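(* Let $\mathsf{T}$ be a big tensor-triangulated category and $\mathcal{D}$ be a definable subcategory of $\mathsf{T}$. Then $\mathcal{D}$ is a $\otimes$-ideal if and only if $\mathcal{D}^{d}$ is a $\otimes$-ideal.
   Context: A big tensor-triangulated category is a compactly generated triangulated category $\mathsf{T}$ with a compatible closed symmetric monoidal structure (product $\otimes$, unit $\mathbb{1}$, internal hom $F$) whose compact objects $\mathsf{T}^{\mathrm{c}}$ coincide with its rigid objects ($X$ is rigid if $F(X,\mathbb{1})\otimes Y\to F(X,Y)$ is an isomorphism for all $Y$). A class $\mathcal{D}$ is a $\otimes$-ideal if $X\otimes A\in\mathcal{D}$ for all $A\in\mathcal{D}$, $X\in\mathsf{T}$. A class $\mathcal{D}\subseteq\mathsf{T}$ is definable if there is a set of maps $f_i$ in $\mathsf{T}^{\mathrm{c}}$ with $\mathcal{D}=\{X:\mathrm{Hom}_{\mathsf{T}}(f_i,X)\text{ is surjective for all }i\}$. $(\mathsf{T}^{\mathrm{c}},\mathbf{Ab})^{\mathrm{fp}}$ is the category of finitely presented functors $G=\mathrm{coker}(\mathrm{Hom}_{\mathsf{T}}(f,-)|_{\mathsf{T}^{\mathrm{c}}})$, $f$ a map in $\mathsf{T}^{\mathrm{c}}$; $\widetilde{G}\colon\mathsf{T}\to\mathbf{Ab}$ is the same cokernel computed on $\mathsf{T}$. With $D=F(-,\mathbb{1})$, put $\mathcal{S}_{\mathcal{D}}=\{G:\widetilde{G}(X)=0\ \forall X\in\mathcal{D}\}$ and $(\delta G)(Y)=\mathrm{Hom}_{(\mathsf{T}^{\mathrm{c}},\mathbf{Ab})}(G,\mathrm{Hom}_{\mathsf{T}}(DY,-))$,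 an exact contravariant autoequivalence of $(\mathsf{T}^{\mathrm{c}},\mathbf{Ab})^{\mathrm{fp}}$. The dual definable category of $\mathcal{D}$ is $\mathcal{D}^{d}=\{Y\in\mathsf{T}:\widetilde{H}(Y)=0\ \forall H\in\delta\mathcal{S}_{\mathcal{D}}\}$. *)

theory Defs
  imports "HOL-Algebra.Free_Abelian_Groups"
begin

unbundle cardinal_syntax

section \<open>Small sets\<close>

text \<open>
  The word ``set'', as opposed to ``class'', is read relative to a cardinal \<open>\<kappa>\<close>: a set is small if its
  cardinality is less than \<open>\<kappa>\<close>.  A strongly inaccessible \<open>\<kappa>\<close> gives the small sets of a Grothendieck
  universe; only regularity and uncountability are needed below.  HOL cannot quantify over the
  types of index sets, so small index sets are taken in the type \<open>'u\<close> that carries \<open>\<kappa>\<close>, in which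
  every small cardinality is represented.
\<close>

definition small :: "'u rel \<Rightarrow> 'a set \<Rightarrow> bool"
  where "small \<kappa> A \<longleftrightarrow> |A| <o \<kappa>"

definition regular_uncountable :: "'u rel \<Rightarrow> bool"
  where "regular_uncountable \<kappa> \<longleftrightarrow> Card_order \<kappa> \<and> regularCard \<kappa> \<and> natLeq <o \<kappa>"


section \<open>Categories\<close>

record ('o, 'm) category =
  Obj :: "'o set"
  Arr :: "'m set"
  Dom :: "'m \<Rightarrow> 'o"
  Cod :: "'m \<Rightarrow> 'o"
  Idn :: "'o \<Rightarrow> 'm"
  Comp :: "'m \<Rightarrow> 'm \<Rightarrow> 'm"  (infixl "\<cdot>\<index>" 70)

definition Hom :: "('o, 'm, 'z) category_scheme \<Rightarrow> 'o \<Rightarrow> 'o \<Rightarrow> 'm set"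
  where "Hom C X Y = {f \<in> Arr C. Dom C f = X \<and> Cod C f = Y}"

locale category =
  fixes C :: "('o, 'm, 'z) category_scheme" (structure)
  assumes Dom_Obj: "f \<in> Arr C \<Longrightarrow> Dom C f \<in> Obj C"
    and Cod_Obj: "f \<in> Arr C \<Longrightarrow> Cod C f \<in> Obj C"
    and Idn_Hom: "X \<in> Obj C \<Longrightarrow> Idn C X \<in> Hom C X X"
    and Comp_Hom: "\<lbrakk>f \<in> Hom C X Y; g \<in> Hom C Y Z\<rbrakk> \<Longrightarrow> g \<cdot> f \<in> Hom C X Z"
    and Idn_left: "f \<in> Hom C X Y \<Longrightarrow> Idn C Y \<cdot> f = f"
    and Idn_right: "f \<in> Hom C X Y \<Longrightarrow> f \<cdot> Idn C X = f"
    and Comp_assoc: "\<lbrakk>f \<in> Hom C W X; g \<in> Hom C X Y; h \<in> Hom C Y Z\<rbrakk> \<Longrightarrow> h \<cdot> (g \<cdot> f) = (h \<cdot> g) \<cdot> f"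

context
  fixes C :: "('o, 'm, 'z) category_scheme" (structure)
begin

definition inverse_arrows :: "'m \<Rightarrow> 'm \<Rightarrow> bool"
  where "inverse_arrows f g \<longleftrightarrow>
    f \<in> Hom C (Dom C f) (Cod C f) \<and> g \<in> Hom C (Cod C f) (Dom C f) \<and>
    g \<cdot> f = Idn C (Dom C f) \<and> f \<cdot> g = Idn C (Cod C f)"

definition iso_arrow :: "'m \<Rightarrow> bool"
  where "iso_arrow f \<longleftrightarrow> (\<exists>g. inverse_arrows f g)"

definition inv_arrow :: "'m \<Rightarrow> 'm"
  where "inv_arrow f = (THE g. inverse_arrows f g)"

definition isomorphic :: "'o \<Rightarrow> 'o \<Rightarrow> bool"
  where "isomorphic X Y \<longleftrightarrow> (\<exists>f \<in> Hom C X Y. iso_arrow f)"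

definition zero_object :: "'o \<Rightarrow> bool"
  where "zero_object Z \<longleftrightarrow>
    Z \<in> Obj C \<and> (\<forall>X \<in> Obj C. (\<exists>!f. f \<in> Hom C Z X) \<and> (\<exists>!f. f \<in> Hom C X Z))"

definition is_coproduct :: "'i set \<Rightarrow> ('i \<Rightarrow> 'o) \<Rightarrow> 'o \<Rightarrow> ('i \<Rightarrow> 'm) \<Rightarrow> bool"
  where "is_coproduct I X P \<iota> \<longleftrightarrow>
    P \<in> Obj C \<and> (\<forall>i \<in> I. \<iota> i \<in> Hom C (X i) P) \<and>
    (\<forall>Y \<in> Obj C. \<forall>f. (\<forall>i \<in> I. f i \<in> Hom C (X i) Y) \<longrightarrow>
       (\<exists>!h. h \<in> Hom C P Y \<and> (\<forall>i \<in> I. h \<cdot> \<iota> i = f i)))"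

end


section \<open>Additive categories\<close>

record ('o, 'm) preadditive_category = "('o, 'm) category" +
  Add :: "'m \<Rightarrow> 'm \<Rightarrow> 'm"
  Zero :: "'o \<Rightarrow> 'o \<Rightarrow> 'm"

definition HomGrp :: "('o, 'm, 'z) preadditive_category_scheme \<Rightarrow> 'o \<Rightarrow> 'o \<Rightarrow> 'm monoid"
  where "HomGrp C X Y = \<lparr>carrier = Hom C X Y, mult = Add C, one = Zero C X Y\<rparr>"

locale additive_category = category C
  for C :: "('o, 'm, 'z) preadditive_category_scheme" (structure) +
  assumes HomGrp_comm_group: "\<lbrakk>X \<in> Obj C; Y \<in> Obj C\<rbrakk> \<Longrightarrow> comm_group (HomGrp C X Y)"
    and Comp_Add_left: "\<lbrakk>f \<in> Hom C X Y; g \<in> Hom C Y Z; h \<in> Hom C Y Z\<rbrakk>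
      \<Longrightarrow> Add C g h \<cdot> f = Add C (g \<cdot> f) (h \<cdot> f)"
    and Comp_Add_right: "\<lbrakk>f \<in> Hom C X Y; g \<in> Hom C X Y; h \<in> Hom C Y Z\<rbrakk>
      \<Longrightarrow> h \<cdot> Add C f g = Add C (h \<cdot> f) (h \<cdot> g)"
    and zero_object_exists: "\<exists>Z. zero_object C Z"
    and biproduct_exists: "\<lbrakk>X \<in> Obj C; Y \<in> Obj C\<rbrakk> \<Longrightarrow>
      \<exists>P \<in> Obj C. \<exists>i \<in> Hom C X P. \<exists>j \<in> Hom C Y P. \<exists>p \<in> Hom C P X. \<exists>q \<in> Hom C P Y.
        p \<cdot> i = Idn C X \<and> q \<cdot> j = Idn C Y \<and> q \<cdot> i = Zero C X Y \<and> p \<cdot> j = Zero C Y X \<and>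
        Add C (i \<cdot> p) (j \<cdot> q) = Idn C P"


section \<open>Triangulated categories\<close>

record ('o, 'm) triangulated_category = "('o, 'm) preadditive_category" +
  Susp :: "'o \<Rightarrow> 'o"
  SuspM :: "'m \<Rightarrow> 'm"
  Dist :: "('m \<times> 'm \<times> 'm) set"

context
  fixes T :: "('o, 'm, 'z) triangulated_category_scheme" (structure)
begin

definition triangle :: "'m \<Rightarrow> 'm \<Rightarrow> 'm \<Rightarrow> bool"
  where "triangle f g h \<longleftrightarrow>
    f \<in> Arr T \<and> g \<in> Arr T \<and> h \<in> Arr T \<and>
    Cod T f = Dom T g \<and> Cod T g = Dom T h \<and> Cod T h = Susp T (Dom T f)"

definition triangle_morphism ::
    "'m \<times> 'm \<times> 'm \<Rightarrow> 'm \<times> 'm \<times> 'm \<Rightarrow> 'm \<Rightarrow> 'm \<Rightarrow> 'm \<Rightarrow> bool"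
  where "triangle_morphism t t' a b c \<longleftrightarrow>
    (case (t, t') of ((f, g, h), (f', g', h')) \<Rightarrow>
      a \<in> Hom T (Dom T f) (Dom T f') \<and> b \<in> Hom T (Dom T g) (Dom T g') \<and>
      c \<in> Hom T (Dom T h) (Dom T h') \<and>
      b \<cdot> f = f' \<cdot> a \<and> c \<cdot> g = g' \<cdot> b \<and> SuspM T a \<cdot> h = h' \<cdot> c)"

definition Neg :: "'m \<Rightarrow> 'm"
  where "Neg f = inv\<^bsub>HomGrp T (Dom T f) (Cod T f)\<^esub> f"

end

text \<open>Verdier's axioms; the suspension is an additive autoequivalence, not necessarily an automorphism.\<close>

locale triangulated_category = additive_category T
  for T :: "('o, 'm, 'z) triangulated_category_scheme" (structure) +
  assumes Susp_Obj: "X \<in> Obj T \<Longrightarrow> Susp T X \<in> Obj T"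
    and SuspM_Idn: "X \<in> Obj T \<Longrightarrow> SuspM T (Idn T X) = Idn T (Susp T X)"
    and SuspM_Comp: "\<lbrakk>f \<in> Hom T X Y; g \<in> Hom T Y Z\<rbrakk> \<Longrightarrow> SuspM T (g \<cdot> f) = SuspM T g \<cdot> SuspM T f"
    and SuspM_Add: "\<lbrakk>f \<in> Hom T X Y; g \<in> Hom T X Y\<rbrakk> \<Longrightarrow>
      SuspM T (Add T f g) = Add T (SuspM T f) (SuspM T g)"
    and Susp_fully_faithful: "\<lbrakk>X \<in> Obj T; Y \<in> Obj T\<rbrakk> \<Longrightarrow>
      bij_betw (SuspM T) (Hom T X Y) (Hom T (Susp T X) (Susp T Y))"
    and Susp_ess_surj: "Y \<in> Obj T \<Longrightarrow> \<exists>X \<in> Obj T. isomorphic T (Susp T X) Y"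
    and Dist_triangle: "(f, g, h) \<in> Dist T \<Longrightarrow> triangle T f g h"
    and Dist_iso: "\<lbrakk>(f, g, h) \<in> Dist T; triangle T f' g' h';
      triangle_morphism T (f, g, h) (f', g', h') a b c;
      iso_arrow T a; iso_arrow T b; iso_arrow T c\<rbrakk> \<Longrightarrow> (f', g', h') \<in> Dist T"
    and Dist_Idn: "\<lbrakk>X \<in> Obj T; zero_object T Z\<rbrakk> \<Longrightarrow>
      (Idn T X, Zero T X Z, Zero T Z (Susp T X)) \<in> Dist T"
    and Dist_cone: "f \<in> Arr T \<Longrightarrow> \<exists>g h. (f, g, h) \<in> Dist T"
    and Dist_rotate: "triangle T f g h \<Longrightarrow>
      (f, g, h) \<in> Dist T \<longleftrightarrow> (g, h, Neg T (SuspM T f)) \<in> Dist T"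
    and Dist_fill: "\<lbrakk>(f, g, h) \<in> Dist T; (f', g', h') \<in> Dist T;
      a \<in> Hom T (Dom T f) (Dom T f'); b \<in> Hom T (Dom T g) (Dom T g'); b \<cdot> f = f' \<cdot> a\<rbrakk> \<Longrightarrow>
      \<exists>c. triangle_morphism T (f, g, h) (f', g', h') a b c"
    and octahedral: "\<lbrakk>f \<in> Hom T X Y; g \<in> Hom T Y Z; (f, f\<^sub>1, f\<^sub>2) \<in> Dist T; (g, g\<^sub>1, g\<^sub>2) \<in> Dist T;
      (g \<cdot> f, h\<^sub>1, h\<^sub>2) \<in> Dist T\<rbrakk> \<Longrightarrow>
      \<exists>u \<in> Hom T (Cod T f\<^sub>1) (Cod T h\<^sub>1). \<exists>v \<in> Hom T (Cod T h\<^sub>1) (Cod T g\<^sub>1).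
        (u, v, SuspM T f\<^sub>1 \<cdot> g\<^sub>2) \<in> Dist T \<and> u \<cdot> f\<^sub>1 = h\<^sub>1 \<cdot> g \<and> h\<^sub>2 \<cdot> u = f\<^sub>2 \<and>
        v \<cdot> h\<^sub>1 = g\<^sub>1 \<and> g\<^sub>2 \<cdot> v = SuspM T f \<cdot> h\<^sub>2"


section \<open>Closed symmetric monoidal structures\<close>

text \<open>
  \<open>Assoc T X Y Z\<close> is the map $(X \otimes Y) \otimes Z \to X \otimes (Y \otimes Z)$; \<open>LUnit\<close>, \<open>RUnit\<close> and \<open>Braid\<close> are the
  unitors and the symmetry; \<open>IHom T X Y\<close> is $F(X,Y)$, with counit \<open>Eval T X Y\<close> from $F(X,Y) \otimes X$
  to $Y$; \<open>TenSusp T X Y\<close> is the comparison map from $\Sigma X \otimes Y$ to $\Sigma (X \otimes Y)$.  The product is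
  written \<open>\<odot>\<close> on objects and \<open>\<boxtimes>\<close> on maps.
\<close>

record ('o, 'm) tt_category = "('o, 'm) triangulated_category" +
  TenO :: "'o \<Rightarrow> 'o \<Rightarrow> 'o"  (infixl "\<odot>\<index>" 75)
  TenM :: "'m \<Rightarrow> 'm \<Rightarrow> 'm"  (infixl "\<boxtimes>\<index>" 75)
  Unit :: "'o"
  Assoc :: "'o \<Rightarrow> 'o \<Rightarrow> 'o \<Rightarrow> 'm"
  LUnit :: "'o \<Rightarrow> 'm"
  RUnit :: "'o \<Rightarrow> 'm"
  Braid :: "'o \<Rightarrow> 'o \<Rightarrow> 'm"
  IHom :: "'o \<Rightarrow> 'o \<Rightarrow> 'o"
  Eval :: "'o \<Rightarrow> 'o \<Rightarrow> 'm"
  TenSusp :: "'o \<Rightarrow> 'o \<Rightarrow> 'm"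

locale symmetric_monoidal_category = category T
  for T :: "('o, 'm, 'z) tt_category_scheme" (structure) +
  assumes TenO_Obj: "\<lbrakk>X \<in> Obj T; Y \<in> Obj T\<rbrakk> \<Longrightarrow> X \<odot> Y \<in> Obj T"
    and TenM_Hom: "\<lbrakk>f \<in> Hom T X X'; g \<in> Hom T Y Y'\<rbrakk> \<Longrightarrow> f \<boxtimes> g \<in> Hom T (X \<odot> Y) (X' \<odot> Y')"
    and TenM_Idn: "\<lbrakk>X \<in> Obj T; Y \<in> Obj T\<rbrakk> \<Longrightarrow> Idn T X \<boxtimes> Idn T Y = Idn T (X \<odot> Y)"
    and TenM_Comp: "\<lbrakk>f \<in> Hom T X X'; f' \<in> Hom T X' X''; g \<in> Hom T Y Y'; g' \<in> Hom T Y' Y''\<rbrakk> \<Longrightarrow>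
      (f' \<cdot> f) \<boxtimes> (g' \<cdot> g) = (f' \<boxtimes> g') \<cdot> (f \<boxtimes> g)"
    and Unit_Obj: "Unit T \<in> Obj T"
    and Assoc_Hom: "\<lbrakk>X \<in> Obj T; Y \<in> Obj T; Z \<in> Obj T\<rbrakk> \<Longrightarrow>
      Assoc T X Y Z \<in> Hom T (X \<odot> Y \<odot> Z) (X \<odot> (Y \<odot> Z))"
    and Assoc_iso: "\<lbrakk>X \<in> Obj T; Y \<in> Obj T; Z \<in> Obj T\<rbrakk> \<Longrightarrow> iso_arrow T (Assoc T X Y Z)"
    and Assoc_natural: "\<lbrakk>f \<in> Hom T X X'; g \<in> Hom T Y Y'; h \<in> Hom T Z Z'\<rbrakk> \<Longrightarrow>
      Assoc T X' Y' Z' \<cdot> (f \<boxtimes> g \<boxtimes> h) = (f \<boxtimes> (g \<boxtimes> h)) \<cdot> Assoc T X Y Z"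
    and LUnit_Hom: "X \<in> Obj T \<Longrightarrow> LUnit T X \<in> Hom T (Unit T \<odot> X) X"
    and LUnit_iso: "X \<in> Obj T \<Longrightarrow> iso_arrow T (LUnit T X)"
    and LUnit_natural: "f \<in> Hom T X Y \<Longrightarrow> LUnit T Y \<cdot> (Idn T (Unit T) \<boxtimes> f) = f \<cdot> LUnit T X"
    and RUnit_Hom: "X \<in> Obj T \<Longrightarrow> RUnit T X \<in> Hom T (X \<odot> Unit T) X"
    and RUnit_iso: "X \<in> Obj T \<Longrightarrow> iso_arrow T (RUnit T X)"
    and RUnit_natural: "f \<in> Hom T X Y \<Longrightarrow> RUnit T Y \<cdot> (f \<boxtimes> Idn T (Unit T)) = f \<cdot> RUnit T X"
    and Braid_Hom: "\<lbrakk>X \<in> Obj T; Y \<in> Obj T\<rbrakk> \<Longrightarrow> Braid T X Y \<in> Hom T (X \<odot> Y) (Y \<odot> X)"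
    and Braid_natural: "\<lbrakk>f \<in> Hom T X X'; g \<in> Hom T Y Y'\<rbrakk> \<Longrightarrow>
      Braid T X' Y' \<cdot> (f \<boxtimes> g) = (g \<boxtimes> f) \<cdot> Braid T X Y"
    and Braid_symmetric: "\<lbrakk>X \<in> Obj T; Y \<in> Obj T\<rbrakk> \<Longrightarrow> Braid T Y X \<cdot> Braid T X Y = Idn T (X \<odot> Y)"
    and pentagon_law: "\<lbrakk>W \<in> Obj T; X \<in> Obj T; Y \<in> Obj T; Z \<in> Obj T\<rbrakk> \<Longrightarrow>
      (Idn T W \<boxtimes> Assoc T X Y Z) \<cdot> Assoc T W (X \<odot> Y) Z \<cdot> (Assoc T W X Y \<boxtimes> Idn T Z)
        = Assoc T W X (Y \<odot> Z) \<cdot> Assoc T (W \<odot> X) Y Z"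
    and triangle_law: "\<lbrakk>X \<in> Obj T; Y \<in> Obj T\<rbrakk> \<Longrightarrow>
      (Idn T X \<boxtimes> LUnit T Y) \<cdot> Assoc T X (Unit T) Y = RUnit T X \<boxtimes> Idn T Y"
    and hexagon_law: "\<lbrakk>X \<in> Obj T; Y \<in> Obj T; Z \<in> Obj T\<rbrakk> \<Longrightarrow>
      Assoc T Y Z X \<cdot> Braid T X (Y \<odot> Z) \<cdot> Assoc T X Y Z
        = (Idn T Y \<boxtimes> Braid T X Z) \<cdot> Assoc T Y X Z \<cdot> (Braid T X Y \<boxtimes> Idn T Z)"

locale closed_symmetric_monoidal_category = symmetric_monoidal_category T
  for T :: "('o, 'm, 'z) tt_category_scheme" (structure) +
  assumes IHom_Obj: "\<lbrakk>X \<in> Obj T; Y \<in> Obj T\<rbrakk> \<Longrightarrow> IHom T X Y \<in> Obj T"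
    and Eval_Hom: "\<lbrakk>X \<in> Obj T; Y \<in> Obj T\<rbrakk> \<Longrightarrow> Eval T X Y \<in> Hom T (IHom T X Y \<odot> X) Y"
    and Eval_universal: "\<lbrakk>W \<in> Obj T; X \<in> Obj T; Y \<in> Obj T; f \<in> Hom T (W \<odot> X) Y\<rbrakk> \<Longrightarrow>
      \<exists>!g. g \<in> Hom T W (IHom T X Y) \<and> Eval T X Y \<cdot> (g \<boxtimes> Idn T X) = f"

text \<open>
  Compatibility with the triangulation: the tensor product is additive and exact in each variable.
  Only the first variable is mentioned; the symmetry transports the condition to the second one.
\<close>

locale closed_tt_category = triangulated_category T + closed_symmetric_monoidal_category T
  for T :: "('o, 'm, 'z) tt_category_scheme" (structure) +
  assumes TenM_Add: "\<lbrakk>f \<in> Hom T X Y; g \<in> Hom T X Y; W \<in> Obj T\<rbrakk> \<Longrightarrow>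
      Add T f g \<boxtimes> Idn T W = Add T (f \<boxtimes> Idn T W) (g \<boxtimes> Idn T W)"
    and TenSusp_Hom: "\<lbrakk>X \<in> Obj T; Y \<in> Obj T\<rbrakk> \<Longrightarrow>
      TenSusp T X Y \<in> Hom T (Susp T X \<odot> Y) (Susp T (X \<odot> Y))"
    and TenSusp_iso: "\<lbrakk>X \<in> Obj T; Y \<in> Obj T\<rbrakk> \<Longrightarrow> iso_arrow T (TenSusp T X Y)"
    and TenSusp_natural: "\<lbrakk>f \<in> Hom T X X'; g \<in> Hom T Y Y'\<rbrakk> \<Longrightarrow>
      TenSusp T X' Y' \<cdot> (SuspM T f \<boxtimes> g) = SuspM T (f \<boxtimes> g) \<cdot> TenSusp T X Y"
    and TenM_exact: "\<lbrakk>(f, g, h) \<in> Dist T; W \<in> Obj T\<rbrakk> \<Longrightarrow>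
      (f \<boxtimes> Idn T W, g \<boxtimes> Idn T W, TenSusp T (Dom T f) W \<cdot> (h \<boxtimes> Idn T W)) \<in> Dist T"


section \<open>Compact and rigid objects\<close>

text \<open>
  \<open>C\<close> is compact if the canonical map $\bigoplus_i \mathrm{Hom}(C, X_i) \to \mathrm{Hom}(C, \coprod_i X_i)$ is an
  isomorphism for all small families $X$.
\<close>

definition compact_object ::
    "('o, 'm, 'z) preadditive_category_scheme \<Rightarrow> 'u rel \<Rightarrow> 'o \<Rightarrow> bool"
  where "compact_object T \<kappa> C \<longleftrightarrow> C \<in> Obj T \<and>
    (\<forall>(I :: 'u set) X P \<iota>. small \<kappa> I \<and> (\<forall>i \<in> I. X i \<in> Obj T) \<and> is_coproduct T I X P \<iota> \<longrightarrow>
       (\<lambda>\<phi>. gfinprod (HomGrp T C P) (\<lambda>i. \<iota> i \<cdot>\<^bsub>T\<^esub> \<phi> i) I)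
         \<in> iso (sum_group I (\<lambda>i. HomGrp T C (X i))) (HomGrp T C P))"

context
  fixes T :: "('o, 'm, 'z) tt_category_scheme" (structure)
begin

definition curry_arrow :: "'o \<Rightarrow> 'o \<Rightarrow> 'o \<Rightarrow> 'm \<Rightarrow> 'm"
  where "curry_arrow W X Y f =
    (THE g. g \<in> Hom T W (IHom T X Y) \<and> Eval T X Y \<cdot> (g \<boxtimes> Idn T X) = f)"

text \<open>
  The canonical map $F(X,1) \otimes Y \to F(X,Y)$, adjoint to
  $(F(X,1) \otimes Y) \otimes X \cong (F(X,1) \otimes X) \otimes Y \to 1 \otimes Y \cong Y$.
\<close>

definition rigidity_map :: "'o \<Rightarrow> 'o \<Rightarrow> 'm"
  where "rigidity_map X Y = (let X' = IHom T X (Unit T) in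
    curry_arrow (X' \<odot> Y) X Y
      (LUnit T Y \<cdot> (Eval T X (Unit T) \<boxtimes> Idn T Y) \<cdot> inv_arrow T (Assoc T X' X Y)
        \<cdot> (Idn T X' \<boxtimes> Braid T Y X) \<cdot> Assoc T X' Y X))"

definition rigid_object :: "'o \<Rightarrow> bool"
  where "rigid_object X \<longleftrightarrow> X \<in> Obj T \<and> (\<forall>Y \<in> Obj T. iso_arrow T (rigidity_map X Y))"

definition dual :: "'o \<Rightarrow> 'o"
  where "dual X = IHom T X (Unit T)"

text \<open>For $g \colon Y \to Y'$, the map $Dg \colon DY' \to DY$.\<close>

definition dualM :: "'m \<Rightarrow> 'm"
  where "dualM g = curry_arrow (dual (Cod T g)) (Dom T g) (Unit T)
    (Eval T (Cod T g) (Unit T) \<cdot> (Idn T (dual (Cod T g)) \<boxtimes> g))"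

definition tensor_ideal :: "'o set \<Rightarrow> bool"
  where "tensor_ideal D \<longleftrightarrow> (\<forall>A \<in> D. \<forall>X \<in> Obj T. X \<odot> A \<in> D)"

end

locale big_tt_category = closed_tt_category T
  for T :: "('o, 'm, 'z) tt_category_scheme" (structure) and \<kappa> :: "'u rel" +
  assumes regular_uncountable: "regular_uncountable \<kappa>"
    and Hom_small: "\<lbrakk>X \<in> Obj T; Y \<in> Obj T\<rbrakk> \<Longrightarrow> small \<kappa> (Hom T X Y)"
    and coproduct_exists: "\<lbrakk>small \<kappa> (I :: 'u set); \<And>i. i \<in> I \<Longrightarrow> E i \<in> Obj T\<rbrakk> \<Longrightarrow>
      \<exists>P \<iota>. is_coproduct T I E P \<iota>"
    and compactly_generated: "\<exists>S. small \<kappa> S \<and> (\<forall>C \<in> S. compact_object T \<kappa> C) \<and>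
      (\<forall>X \<in> Obj T. (\<forall>C \<in> S. Hom T C X = {Zero T C X}) \<longrightarrow> zero_object T X)"
    and compact_iff_rigid: "compact_object T \<kappa> X \<longleftrightarrow> rigid_object T X"


section \<open>Functors to abelian groups\<close>

text \<open>
  A functor from a full subcategory of $\mathsf{T}$ to abelian groups, with values in groups carried by
  the type \<open>'g\<close>.  The object class \<open>K\<close> of the subcategory is an argument of the predicates below, so
  that a functor on $\mathsf{T}$ and its restriction to the compact objects are the same record.
\<close>

record ('o, 'm, 'g) ab_functor =
  FObj :: "'o \<Rightarrow> 'g monoid"
  FArr :: "'m \<Rightarrow> 'g \<Rightarrow> 'g"

context
  fixes T :: "('o, 'm, 'z) preadditive_category_scheme" (structure)
begin

definition additive_functor :: "'o set \<Rightarrow> ('o, 'm, 'g) ab_functor \<Rightarrow> bool"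
  where "additive_functor K G \<longleftrightarrow>
    (\<forall>X \<in> K. comm_group (FObj G X)) \<and>
    (\<forall>X \<in> K. \<forall>Y \<in> K. \<forall>f \<in> Hom T X Y. FArr G f \<in> hom (FObj G X) (FObj G Y)) \<and>
    (\<forall>X \<in> K. \<forall>x \<in> carrier (FObj G X). FArr G (Idn T X) x = x) \<and>
    (\<forall>X \<in> K. \<forall>Y \<in> K. \<forall>Z \<in> K. \<forall>f \<in> Hom T X Y. \<forall>g \<in> Hom T Y Z. \<forall>x \<in> carrier (FObj G X).
       FArr G (g \<cdot> f) x = FArr G g (FArr G f x)) \<and>
    (\<forall>X \<in> K. \<forall>Y \<in> K. \<forall>f \<in> Hom T X Y. \<forall>g \<in> Hom T X Y. \<forall>x \<in> carrier (FObj G X).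
       FArr G (Add T f g) x = FArr G f x \<otimes>\<^bsub>FObj G Y\<^esub> FArr G g x)"

definition corepresentable :: "'o \<Rightarrow> ('o, 'm, 'm) ab_functor"
  where "corepresentable A = \<lparr>FObj = HomGrp T A, FArr = (\<lambda>g f. g \<cdot> f)\<rparr>"

text \<open>
  Natural transformations, as extensional functions, so that they are determined by their
  components on \<open>K\<close>.
\<close>

definition nat_trans ::
    "'o set \<Rightarrow> ('o, 'm, 'g) ab_functor \<Rightarrow> ('o, 'm, 'h) ab_functor \<Rightarrow> ('o \<Rightarrow> 'g \<Rightarrow> 'h) set"
  where "nat_trans K G H =
    {N \<in> (\<Pi>\<^sub>E X \<in> K. hom (FObj G X) (FObj H X) \<inter> extensional (carrier (FObj G X))).
       \<forall>X \<in> K. \<forall>Y \<in> K. \<forall>f \<in> Hom T X Y. \<forall>x \<in> carrier (FObj G X).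
         N Y (FArr G f x) = FArr H f (N X x)}"

definition nat_iso ::
    "'o set \<Rightarrow> ('o, 'm, 'g) ab_functor \<Rightarrow> ('o, 'm, 'h) ab_functor \<Rightarrow> bool"
  where "nat_iso K G H \<longleftrightarrow>
    (\<exists>N \<in> nat_trans K G H. \<forall>X \<in> K. N X \<in> iso (FObj G X) (FObj H X))"

text \<open>
  The image of $\mathrm{Hom}(f,X) \colon \mathrm{Hom}(B,X) \to \mathrm{Hom}(A,X)$ for $f \colon A \to B$, and the cokernel of
  $\mathrm{Hom}(f,-)$.  The latter sends $g \colon X \to Y$ to the map which takes the coset of $u$ to the
  coset of $gu$.
\<close>

definition Hom_image :: "'m \<Rightarrow> 'o \<Rightarrow> 'm set"
  where "Hom_image f X = (\<lambda>h. h \<cdot> f) ` Hom T (Cod T f) X"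

definition coker_functor :: "'m \<Rightarrow> ('o, 'm, 'm set) ab_functor"
  where "coker_functor f =
    \<lparr>FObj = (\<lambda>X. HomGrp T (Dom T f) X Mod Hom_image f X),
     FArr = (\<lambda>g U. \<Union>u\<in>U. Hom_image f (Cod T g) #>\<^bsub>HomGrp T (Dom T f) (Cod T g)\<^esub> (g \<cdot> u))\<rparr>"

end


section \<open>Definable subcategories and their duals\<close>

context
  fixes T :: "('o, 'm, 'z) tt_category_scheme" (structure) and \<kappa> :: "'u rel"
begin

definition compacts :: "'o set"
  where "compacts = {C. compact_object T \<kappa> C}"

definition compact_arrows :: "'m set"
  where "compact_arrows = {f \<in> Arr T. Dom T f \<in> compacts \<and> Cod T f \<in> compacts}"

definition definable :: "'o set \<Rightarrow> bool"
  where "definable D \<longleftrightarrow> (\<exists>\<Phi>. small \<kappa> \<Phi> \<and> \<Phi> \<subseteq> compact_arrows \<and>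
    D = {X \<in> Obj T. \<forall>f \<in> \<Phi>. (\<lambda>h. h \<cdot> f) ` Hom T (Cod T f) X = Hom T (Dom T f) X})"

definition presents :: "'m \<Rightarrow> ('o, 'm, 'g) ab_functor \<Rightarrow> bool"
  where "presents f G \<longleftrightarrow> f \<in> compact_arrows \<and> nat_iso T compacts (coker_functor T f) G"

definition finitely_presented :: "('o, 'm, 'g) ab_functor \<Rightarrow> bool"
  where "finitely_presented G \<longleftrightarrow> additive_functor T compacts G \<and> (\<exists>f. presents f G)"

text \<open>
  $\widetilde{G} \colon \mathsf{T} \to \mathbf{Ab}$ for a finitely presented $G$; up to isomorphism it does not depend on
  the chosen presentation.
\<close>

definition extension :: "('o, 'm, 'g) ab_functor \<Rightarrow> ('o, 'm, 'm set) ab_functor"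
  where "extension G = coker_functor T (SOME f. presents f G)"

text \<open>
  The class $\mathcal{S}_{\mathcal{D}}$.  Its members take values in groups carried by \<open>'m set\<close>, the type of the cokernels
  \<open>coker_functor\<close>; thus every finitely presented functor is represented up to isomorphism.
\<close>

definition annihilator :: "'o set \<Rightarrow> ('o, 'm, 'm set) ab_functor set"
  where "annihilator D =
    {G. finitely_presented G \<and> (\<forall>X \<in> D. trivial_group (FObj (extension G) X))}"

text \<open>
  $(\delta G)(Y)$ is the group of natural transformations from $G$ to $\mathrm{Hom}(DY,-)$ on compact objects, and
  $g \colon Y \to Y'$ acts by precomposition with $Dg$ in $\mathrm{Hom}(DY,-) \to \mathrm{Hom}(DY',-)$.
\<close>

definition delta :: "('o, 'm, 'g) ab_functor \<Rightarrow> ('o, 'm, 'o \<Rightarrow> 'g \<Rightarrow> 'm) ab_functor"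
  where "delta G =
    \<lparr>FObj = (\<lambda>Y.
       \<lparr>carrier = nat_trans T compacts G (corepresentable T (dual T Y)),
        mult = (\<lambda>M N. \<lambda>X\<in>compacts. \<lambda>x\<in>carrier (FObj G X). Add T (M X x) (N X x)),
        one = (\<lambda>X\<in>compacts. \<lambda>x\<in>carrier (FObj G X). Zero T (dual T Y) X)\<rparr>),
     FArr = (\<lambda>g N. \<lambda>X\<in>compacts. \<lambda>x\<in>carrier (FObj G X). N X x \<cdot> dualM T g)\<rparr>"

definition dual_definable :: "'o set \<Rightarrow> 'o set"
  where "dual_definable D =
    {Y \<in> Obj T. \<forall>H \<in> delta ` annihilator D. trivial_group (FObj (extension H) Y)}"

end

end

theory Submission
  imports Defs
begin

text \<open>
  Let \<open>I\<close> be the class of maps \<open>t\<close> between compact objects with \<open>Hom(t, X) = 0\<close> for all \<open>X \<in> D\<close>.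
  Passing from a map \<open>f\<close> to its fiber \<open>t\<close> turns surjectivity of \<open>Hom(f, X)\<close> into \<open>Hom(t, X) = 0\<close>, so \<open>D\<close>
  consists of the objects annihilated by \<open>I\<close>.  The functor \<open>\<delta>(coker Hom(f, -))\<close> is presented by the cone
  of \<open>Dt\<close>, so \<open>D\<^sup>d\<close> consists of the objects annihilated by all \<open>Dt\<close>, equivalently of the \<open>Y\<close> with
  \<open>Hom(1, t \<otimes> Y) = 0\<close> for all \<open>t \<in> I\<close>.  A small object argument shows that a map \<open>g\<close> between compact
  objects with \<open>Hom(1, g \<otimes> Y) = 0\<close> for all \<open>Y \<in> D\<^sup>d\<close> lies in \<open>I\<close>.  By adjunction, each of \<open>D\<close> and \<open>D\<^sup>d\<close>
  is closed under products with compact objects if and only if \<open>K \<otimes> t \<in> I\<close> for all \<open>t \<in> I\<close> and compact \<open>K\<close>.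
  Closure under products with compact objects suffices, since every map from a compact
  object to \<open>Z \<otimes> X\<close> factors through \<open>K \<otimes> X\<close> for some map \<open>K \<rightarrow> Z\<close> from a compact object.
\<close>

section \<open>Categories and additive categories\<close>

text \<open>The symmetry of the statement reflects biduality of definable classes. The proof
  extracts from biduality one implication: a map null on the dual class annihilates
  \<open>D\<close>. The small object argument supplies it by building, from the dual of the source
  of \<open>g\<close>, a map \<open>a\<close> to an object of the dual class that is injective on
  \<open>Hom(1, - \<otimes> X)\<close> for every \<open>X\<close> in \<open>D\<close>; if
  \<open>a\<close> kills \<open>Dg\<close>, then \<open>Dg\<close> is null on \<open>D\<close>. Two
  obstacles shape the rest. The compact objects are not given as a small set, whereas each killing
  step needs a small supply of test maps; hence the small class of cells, closed under cones,
  desuspensions and biproducts. The factorization through \<open>K \<otimes> X\<close> comes from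
  describing the fiber of a killing tower as an iterated extension of coproducts of cells, and
  octahedra control these extensions. Secondly, rigidity provides only the isomorphisms
  \<open>F(C,1) \<otimes> Y \<rightarrow> F(C,Y)\<close>; the adjunctions between
  \<open>C \<otimes> -\<close> and \<open>DC \<otimes> -\<close> in both directions, with all
  naturality, must be derived from them, and this accounts for the monoidal calculations.\<close>

context category
begin

lemma comp_arr [simp]: "\<lbrakk>f \<in> Arr C; g \<in> Arr C; Cod C f = Dom C g\<rbrakk> \<Longrightarrow> g \<cdot> f \<in> Arr C"
  and dom_comp [simp]: "\<lbrakk>f \<in> Arr C; g \<in> Arr C; Cod C f = Dom C g\<rbrakk> \<Longrightarrow> Dom C (g \<cdot> f) = Dom C f"
  and cod_comp [simp]: "\<lbrakk>f \<in> Arr C; g \<in> Arr C; Cod C f = Dom C g\<rbrakk> \<Longrightarrow> Cod C (g \<cdot> f) = Cod C g"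
  using Comp_Hom[of f "Dom C f" "Cod C f" g "Cod C g"] by (auto simp: Hom_def)

lemma comp_assoc: "\<lbrakk>f \<in> Arr C; g \<in> Arr C; h \<in> Arr C; Cod C f = Dom C g; Cod C g = Dom C h\<rbrakk>
    \<Longrightarrow> (h \<cdot> g) \<cdot> f = h \<cdot> (g \<cdot> f)"
  using Comp_assoc[of f "Dom C f" "Cod C f" g "Cod C g" h "Cod C h"] by (auto simp: Hom_def)

lemma idn_arr [simp]: "X \<in> Obj C \<Longrightarrow> Idn C X \<in> Arr C"
  and dom_idn [simp]: "X \<in> Obj C \<Longrightarrow> Dom C (Idn C X) = X"
  and cod_idn [simp]: "X \<in> Obj C \<Longrightarrow> Cod C (Idn C X) = X"
  using Idn_Hom[of X] by (auto simp: Hom_def)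

lemma comp_idl [simp]: "\<lbrakk>f \<in> Arr C; Cod C f = Y\<rbrakk> \<Longrightarrow> Idn C Y \<cdot> f = f"
  and comp_idr [simp]: "\<lbrakk>f \<in> Arr C; Dom C f = X\<rbrakk> \<Longrightarrow> f \<cdot> Idn C X = f"
  using Idn_left[of f "Dom C f" "Cod C f"] Idn_right[of f "Dom C f" "Cod C f"] by (auto simp: Hom_def)

lemma dom_obj [simp]: "f \<in> Arr C \<Longrightarrow> Dom C f \<in> Obj C"
  and cod_obj [simp]: "f \<in> Arr C \<Longrightarrow> Cod C f \<in> Obj C"
  by (auto intro: Dom_Obj Cod_Obj)

text \<open>Composites are kept bracketed to the right, so an equation between two composites does
  not match when a further map \<open>x\<close> comes first. This form applies it to the head of
  such a composite; the diagram chases below use it throughout.\<close>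

lemma comp_rewrite: "\<lbrakk>a \<cdot> b = c; x \<in> Arr C; b \<in> Arr C; a \<in> Arr C; Cod C x = Dom C b; Cod C b = Dom C a\<rbrakk>
    \<Longrightarrow> a \<cdot> (b \<cdot> x) = c \<cdot> x"
  using comp_assoc[of x b a] by simp

lemma Hom_obj: "f \<in> Hom C X Y \<Longrightarrow> X \<in> Obj C" "f \<in> Hom C X Y \<Longrightarrow> Y \<in> Obj C"
  by (auto simp: Hom_def)

lemma inverse_arrows_unique: "\<lbrakk>inverse_arrows C f g; inverse_arrows C f h\<rbrakk> \<Longrightarrow> g = h"
proof -
  assume "inverse_arrows C f g" "inverse_arrows C f h"
  note * = this[unfolded inverse_arrows_def Hom_def, simplified]
  have "g = g \<cdot> (f \<cdot> h)" using * by simp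
  also have "\<dots> = (g \<cdot> f) \<cdot> h" using * by (subst comp_assoc) auto
  also have "\<dots> = h" using * by simp
  finally show ?thesis .
qed

lemma inverse_arrows_inv: "iso_arrow C f \<Longrightarrow> inverse_arrows C f (inv_arrow C f)"
  unfolding iso_arrow_def inv_arrow_def
  by (rule theI') (use inverse_arrows_unique in blast)

lemma iso_arr: "iso_arrow C f \<Longrightarrow> f \<in> Arr C"
  by (auto simp: iso_arrow_def inverse_arrows_def Hom_def)

lemma inv_arr [simp]: "iso_arrow C f \<Longrightarrow> inv_arrow C f \<in> Arr C"
  and dom_inv [simp]: "iso_arrow C f \<Longrightarrow> Dom C (inv_arrow C f) = Cod C f"
  and cod_inv [simp]: "iso_arrow C f \<Longrightarrow> Cod C (inv_arrow C f) = Dom C f"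
  and inv_comp [simp]: "iso_arrow C f \<Longrightarrow> inv_arrow C f \<cdot> f = Idn C (Dom C f)"
  and comp_inv [simp]: "iso_arrow C f \<Longrightarrow> f \<cdot> inv_arrow C f = Idn C (Cod C f)"
  using inverse_arrows_inv[of f] by (auto simp: inverse_arrows_def Hom_def)

lemma inv_comp_cancel [simp]: "\<lbrakk>iso_arrow C f; x \<in> Arr C; Cod C x = Dom C f\<rbrakk> \<Longrightarrow> inv_arrow C f \<cdot> (f \<cdot> x) = x"
  by (simp add: iso_arr flip: comp_assoc)

lemma comp_inv_cancel [simp]: "\<lbrakk>iso_arrow C f; x \<in> Arr C; Cod C x = Cod C f\<rbrakk> \<Longrightarrow> f \<cdot> (inv_arrow C f \<cdot> x) = x"
  by (simp add: iso_arr flip: comp_assoc)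

lemma iso_arrowI: "\<lbrakk>f \<in> Hom C X Y; g \<in> Hom C Y X; g \<cdot> f = Idn C X; f \<cdot> g = Idn C Y\<rbrakk> \<Longrightarrow> iso_arrow C f"
  unfolding iso_arrow_def inverse_arrows_def by (rule exI[of _ g]) (auto simp: Hom_def)

lemma iso_idn [simp]: "X \<in> Obj C \<Longrightarrow> iso_arrow C (Idn C X)"
  by (rule iso_arrowI[where X=X and Y=X and g="Idn C X"]) (auto simp: Hom_def)

lemma iso_inv [simp]: "iso_arrow C f \<Longrightarrow> iso_arrow C (inv_arrow C f)"
  by (rule iso_arrowI[where g=f and X="Cod C f" and Y="Dom C f"]) (auto simp: Hom_def iso_arr)

lemma iso_monic: "\<lbrakk>iso_arrow C f; x \<in> Hom C X (Dom C f); y \<in> Hom C X (Dom C f); f \<cdot> x = f \<cdot> y\<rbrakk> \<Longrightarrow> x = y"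
proof -
  assume *: "iso_arrow C f" "x \<in> Hom C X (Dom C f)" "y \<in> Hom C X (Dom C f)" "f \<cdot> x = f \<cdot> y"
  have "inv_arrow C f \<cdot> (f \<cdot> z) = z" if "z \<in> Hom C X (Dom C f)" for z
    using that *(1) by (simp add: Hom_def)
  then show ?thesis using * by metis
qed

lemma iso_epic: "\<lbrakk>iso_arrow C f; x \<in> Hom C (Cod C f) X; y \<in> Hom C (Cod C f) X; x \<cdot> f = y \<cdot> f\<rbrakk> \<Longrightarrow> x = y"
proof -
  assume *: "iso_arrow C f" "x \<in> Hom C (Cod C f) X" "y \<in> Hom C (Cod C f) X" "x \<cdot> f = y \<cdot> f"
  have "(z \<cdot> f) \<cdot> inv_arrow C f = z" if "z \<in> Hom C (Cod C f) X" for z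
    using that *(1) by (simp add: Hom_def comp_assoc iso_arr)
  then show ?thesis using * by metis
qed

lemma iso_comp: "\<lbrakk>iso_arrow C f; iso_arrow C g; Cod C f = Dom C g\<rbrakk> \<Longrightarrow> iso_arrow C (g \<cdot> f)"
  by (rule iso_arrowI[where g="inv_arrow C f \<cdot> inv_arrow C g" and X="Dom C f" and Y="Cod C g"])
    (auto simp: Hom_def iso_arr comp_assoc)

lemma coproduct_arr:
  assumes "is_coproduct C I X P \<iota>"
  shows "P \<in> Obj C" "i \<in> I \<Longrightarrow> \<iota> i \<in> Arr C" "i \<in> I \<Longrightarrow> Dom C (\<iota> i) = X i" "i \<in> I \<Longrightarrow> Cod C (\<iota> i) = P"
    "i \<in> I \<Longrightarrow> X i \<in> Obj C"
proof -
  have *: "P \<in> Obj C" "\<And>i. i \<in> I \<Longrightarrow> \<iota> i \<in> Hom C (X i) P" using assms by (auto simp: is_coproduct_def)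
  then show "P \<in> Obj C" "i \<in> I \<Longrightarrow> \<iota> i \<in> Arr C" "i \<in> I \<Longrightarrow> Dom C (\<iota> i) = X i" "i \<in> I \<Longrightarrow> Cod C (\<iota> i) = P"
    by (auto simp: Hom_def)
  show "i \<in> I \<Longrightarrow> X i \<in> Obj C" using * Hom_obj(1) by blast
qed

lemma ex1_eq: "\<lbrakk>\<exists>!x. P x; P a; P b\<rbrakk> \<Longrightarrow> a = b"
  by blast

lemma coproduct_ex1:
  assumes "is_coproduct C I X P \<iota>" "Y \<in> Obj C" "\<And>i. i \<in> I \<Longrightarrow> f i \<in> Hom C (X i) Y"
  shows "\<exists>!h. h \<in> Hom C P Y \<and> (\<forall>i \<in> I. h \<cdot> \<iota> i = f i)"
  using assms by (simp add: is_coproduct_def)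

lemma coproduct_eqI:
  assumes "is_coproduct C I X P \<iota>" "f \<in> Hom C P Y" "g \<in> Hom C P Y" "\<And>i. i \<in> I \<Longrightarrow> f \<cdot> \<iota> i = g \<cdot> \<iota> i"
  shows "f = g"
proof -
  have "f \<cdot> \<iota> i \<in> Hom C (X i) Y" if "i \<in> I" for i
    using assms(2) coproduct_arr[OF assms(1)] that by (auto simp: Hom_def)
  then have *: "\<exists>!h. h \<in> Hom C P Y \<and> (\<forall>i \<in> I. h \<cdot> \<iota> i = f \<cdot> \<iota> i)"
    by (rule coproduct_ex1[OF assms(1) Hom_obj(2)[OF assms(2)]])
  show ?thesis
    by (rule ex1_eq[OF *]) (auto simp: assms)
qed

lemma coproduct_desc:
  assumes "is_coproduct C I X P \<iota>" "Y \<in> Obj C" "\<And>i. i \<in> I \<Longrightarrow> f i \<in> Hom C (X i) Y"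
  obtains h where "h \<in> Hom C P Y" "\<And>i. i \<in> I \<Longrightarrow> h \<cdot> \<iota> i = f i"
  using coproduct_ex1[OF assms(1-3)] by blast

lemma is_coproductI:
  assumes "P \<in> Obj C" "\<And>i. i \<in> I \<Longrightarrow> \<iota> i \<in> Hom C (X i) P"
    and "\<And>Y f. Y \<in> Obj C \<Longrightarrow> (\<And>i. i \<in> I \<Longrightarrow> f i \<in> Hom C (X i) Y) \<Longrightarrow> \<exists>h \<in> Hom C P Y. \<forall>i \<in> I. h \<cdot> \<iota> i = f i"
    and "\<And>Y f g. Y \<in> Obj C \<Longrightarrow> f \<in> Hom C P Y \<Longrightarrow> g \<in> Hom C P Y \<Longrightarrow> (\<And>i. i \<in> I \<Longrightarrow> f \<cdot> \<iota> i = g \<cdot> \<iota> i) \<Longrightarrow> f = g"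
  shows "is_coproduct C I X P \<iota>"
  unfolding is_coproduct_def
proof (intro conjI ballI allI impI)
  fix Y f assume Y: "Y \<in> Obj C" "\<forall>i \<in> I. f i \<in> Hom C (X i) Y"
  then obtain h where "h \<in> Hom C P Y" "\<forall>i \<in> I. h \<cdot> \<iota> i = f i" using assms(3)[of Y f] by blast
  then show "\<exists>!h. h \<in> Hom C P Y \<and> (\<forall>i \<in> I. h \<cdot> \<iota> i = f i)"
    using assms(4)[OF Y(1)] by (intro ex1I[of _ h]) auto
qed (use assms in auto)

end

text \<open>Existence of coproducts and compactness are stated for index sets in the type of
  \<open>\<kappa>\<close>; reindexing along a bijection carries them to index sets of other types,
  such as sets of maps.\<close>

lemma reindex_coproduct:
  assumes "bij_betw b I J" "is_coproduct C I (X \<circ> b) P (\<iota> \<circ> b)"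
  shows "is_coproduct C J X P \<iota>"
proof -
  have J: "J = b ` I" using assms(1) by (auto simp: bij_betw_def)
  have "\<exists>!h. h \<in> Hom C P Y \<and> (\<forall>i \<in> J. Comp C h (\<iota> i) = f i)"
    if "Y \<in> Obj C" "\<forall>i \<in> J. f i \<in> Hom C (X i) Y" for Y f
  proof -
    have "\<forall>i \<in> I. (f \<circ> b) i \<in> Hom C ((X \<circ> b) i) Y" using that J by auto
    then have "\<exists>!h. h \<in> Hom C P Y \<and> (\<forall>i \<in> I. Comp C h ((\<iota> \<circ> b) i) = (f \<circ> b) i)"
      using assms(2) that(1) unfolding is_coproduct_def by blast
    then show ?thesis by (simp add: J)
  qed
  then show ?thesis using assms(2) by (auto simp: is_coproduct_def J)
qed

section \<open>Additive categories: zero maps, negatives and differences\<close>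

context additive_category
begin

lemma HomGrp_group: "\<lbrakk>X \<in> Obj C; Y \<in> Obj C\<rbrakk> \<Longrightarrow> group (HomGrp C X Y)"
  using HomGrp_comm_group comm_group.axioms by blast

lemma HomGrp_simps [simp]: "carrier (HomGrp C X Y) = Hom C X Y" "mult (HomGrp C X Y) = Add C"
    "one (HomGrp C X Y) = Zero C X Y"
  by (auto simp: HomGrp_def)

lemma add_Hom: "\<lbrakk>f \<in> Hom C X Y; g \<in> Hom C X Y\<rbrakk> \<Longrightarrow> Add C f g \<in> Hom C X Y"
  using group.subgroup_self[OF HomGrp_group, of X Y, THEN subgroup.m_closed, of f g] Hom_obj by force

lemma zero_Hom: "\<lbrakk>X \<in> Obj C; Y \<in> Obj C\<rbrakk> \<Longrightarrow> Zero C X Y \<in> Hom C X Y"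
  using group.subgroup_self[OF HomGrp_group, of X Y, THEN subgroup.one_closed] by force

lemma add_arr [simp]:
  assumes "f \<in> Arr C" "g \<in> Arr C" "Dom C f = Dom C g" "Cod C f = Cod C g"
  shows "Add C f g \<in> Arr C" "Dom C (Add C f g) = Dom C g" "Cod C (Add C f g) = Cod C g"
  using add_Hom[of f "Dom C g" "Cod C g" g] assms by (auto simp: Hom_def)

lemma zero_arr [simp]:
  assumes "X \<in> Obj C" "Y \<in> Obj C"
  shows "Zero C X Y \<in> Arr C" "Dom C (Zero C X Y) = X" "Cod C (Zero C X Y) = Y"
  using zero_Hom[OF assms] by (auto simp: Hom_def)

lemma add_assoc:
  assumes "f \<in> Hom C X Y" "g \<in> Hom C X Y" "h \<in> Hom C X Y"
  shows "Add C (Add C f g) h = Add C f (Add C g h)"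
proof -
  interpret comm_group "HomGrp C X Y" using HomGrp_comm_group assms Hom_obj by blast
  show ?thesis using m_assoc assms by simp
qed

lemma add_commute:
  assumes "f \<in> Hom C X Y" "g \<in> Hom C X Y"
  shows "Add C f g = Add C g f"
proof -
  interpret comm_group "HomGrp C X Y" using HomGrp_comm_group assms Hom_obj by blast
  show ?thesis using m_comm assms by simp
qed

lemma add_zero [simp]:
  assumes "f \<in> Arr C" "Dom C f = X" "Cod C f = Y"
  shows "Add C (Zero C X Y) f = f" "Add C f (Zero C X Y) = f"
proof -
  interpret comm_group "HomGrp C X Y" using HomGrp_comm_group assms by auto
  show "Add C (Zero C X Y) f = f" "Add C f (Zero C X Y) = f"
    using r_one[of f] l_one[of f] assms by (simp_all add: Hom_def)
qed

text \<open>Additive operations are shown to preserve zero by this criterion: the image of zero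
  equals its own double.\<close>

lemma add_self_zero: "\<lbrakk>f \<in> Hom C X Y; Add C f f = f\<rbrakk> \<Longrightarrow> f = Zero C X Y"
proof -
  assume a: "f \<in> Hom C X Y" "Add C f f = f"
  interpret comm_group "HomGrp C X Y" using HomGrp_comm_group a Hom_obj by blast
  show ?thesis using r_cancel_one[of f f] a by simp
qed

lemma comp_add:
  assumes "f \<in> Arr C" "g \<in> Arr C" "Dom C f = Dom C g" "Cod C f = Cod C g" "h \<in> Arr C"
  shows "Dom C h = Cod C g \<Longrightarrow> h \<cdot> Add C f g = Add C (h \<cdot> f) (h \<cdot> g)"
    "Cod C h = Dom C g \<Longrightarrow> Add C f g \<cdot> h = Add C (f \<cdot> h) (g \<cdot> h)"
  using Comp_Add_right[of f "Dom C g" "Cod C g" g h "Cod C h"]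
    Comp_Add_left[of h "Dom C h" "Cod C h" f "Cod C g" g] assms by (auto simp: Hom_def)

lemma comp_zero [simp]:
  "\<lbrakk>h \<in> Arr C; Dom C h = Y; X \<in> Obj C\<rbrakk> \<Longrightarrow> h \<cdot> Zero C X Y = Zero C X (Cod C h)"
  "\<lbrakk>h \<in> Arr C; Cod C h = X; Y \<in> Obj C\<rbrakk> \<Longrightarrow> Zero C X Y \<cdot> h = Zero C (Dom C h) Y"
proof -
  assume a: "h \<in> Arr C" "Dom C h = Y" "X \<in> Obj C"
  show "h \<cdot> Zero C X Y = Zero C X (Cod C h)"
    by (rule add_self_zero, use a in \<open>auto simp: Hom_def simp flip: comp_add(1)\<close>)
next
  assume a: "h \<in> Arr C" "Cod C h = X" "Y \<in> Obj C"
  show "Zero C X Y \<cdot> h = Zero C (Dom C h) Y"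
    by (rule add_self_zero, use a in \<open>auto simp: Hom_def simp flip: comp_add(2)\<close>)
qed

text \<open>The formula agrees with \<open>Neg\<close> for triangulated categories, but is already
  available for additive ones.\<close>

definition Minus :: "'m \<Rightarrow> 'm"
  where "Minus f = inv\<^bsub>HomGrp C (Dom C f) (Cod C f)\<^esub> f"

lemma minus_arr [simp]: assumes "f \<in> Arr C"
  shows "Minus f \<in> Arr C" "Dom C (Minus f) = Dom C f" "Cod C (Minus f) = Cod C f"
proof -
  interpret comm_group "HomGrp C (Dom C f) (Cod C f)" using HomGrp_comm_group assms by auto
  have "Minus f \<in> Hom C (Dom C f) (Cod C f)"
    unfolding Minus_def using assms by (metis (mono_tags, lifting) HomGrp_simps(1) Hom_def inv_closed mem_Collect_eq)
  then show "Minus f \<in> Arr C" "Dom C (Minus f) = Dom C f" "Cod C (Minus f) = Cod C f"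
    by (auto simp: Hom_def)
qed

lemma add_minus [simp]: assumes "f \<in> Arr C"
  shows "Add C f (Minus f) = Zero C (Dom C f) (Cod C f)" "Add C (Minus f) f = Zero C (Dom C f) (Cod C f)"
proof -
  interpret comm_group "HomGrp C (Dom C f) (Cod C f)" using HomGrp_comm_group assms by auto
  show "Add C f (Minus f) = Zero C (Dom C f) (Cod C f)" "Add C (Minus f) f = Zero C (Dom C f) (Cod C f)"
    unfolding Minus_def using assms r_inv[of f] l_inv[of f] by (auto simp: Hom_def)
qed

lemma minus_unique: "\<lbrakk>f \<in> Hom C X Y; g \<in> Hom C X Y; Add C f g = Zero C X Y\<rbrakk> \<Longrightarrow> g = Minus f"
proof -
  assume a: "f \<in> Hom C X Y" "g \<in> Hom C X Y" "Add C f g = Zero C X Y"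
  interpret comm_group "HomGrp C X Y" using HomGrp_comm_group a Hom_obj by blast
  show ?thesis unfolding Minus_def using a inv_equality[of g f] add_commute[of f X Y g] by (auto simp: Hom_def)
qed

lemma comp_minus:
  "\<lbrakk>f \<in> Arr C; h \<in> Arr C; Dom C h = Cod C f\<rbrakk> \<Longrightarrow> h \<cdot> Minus f = Minus (h \<cdot> f)"
  "\<lbrakk>f \<in> Arr C; h \<in> Arr C; Cod C h = Dom C f\<rbrakk> \<Longrightarrow> Minus f \<cdot> h = Minus (f \<cdot> h)"
  by (rule minus_unique[where X="Dom C f" and Y="Cod C h"], auto simp: Hom_def simp flip: comp_add(1))
   (rule minus_unique[where X="Dom C h" and Y="Cod C f"], auto simp: Hom_def simp flip: comp_add(2))

lemma minus_minus [simp]: "f \<in> Arr C \<Longrightarrow> Minus (Minus f) = f"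
  by (rule minus_unique[symmetric, where X="Dom C f" and Y="Cod C f"]) (auto simp: Hom_def)

lemma minus_zero [simp]: "\<lbrakk>X \<in> Obj C; Y \<in> Obj C\<rbrakk> \<Longrightarrow> Minus (Zero C X Y) = Zero C X Y"
  by (rule minus_unique[symmetric, where X=X and Y=Y]) (auto simp: Hom_def)

lemma minus_eq_zero_iff: "\<lbrakk>f \<in> Arr C; Dom C f = X; Cod C f = Y\<rbrakk> \<Longrightarrow> Minus f = Zero C X Y \<longleftrightarrow> f = Zero C X Y"
  by (metis minus_minus minus_zero dom_obj cod_obj)

definition Sub :: "'m \<Rightarrow> 'm \<Rightarrow> 'm"
  where "Sub f g = Add C f (Minus g)"

lemma sub_arr [simp]:
  assumes "f \<in> Arr C" "g \<in> Arr C" "Dom C f = Dom C g" "Cod C f = Cod C g"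
  shows "Sub f g \<in> Arr C" "Dom C (Sub f g) = Dom C g" "Cod C (Sub f g) = Cod C g"
  using assms by (auto simp: Sub_def)

lemma comp_sub:
  assumes "f \<in> Arr C" "g \<in> Arr C" "Dom C f = Dom C g" "Cod C f = Cod C g" "h \<in> Arr C"
  shows "Dom C h = Cod C g \<Longrightarrow> h \<cdot> Sub f g = Sub (h \<cdot> f) (h \<cdot> g)"
    "Cod C h = Dom C g \<Longrightarrow> Sub f g \<cdot> h = Sub (f \<cdot> h) (g \<cdot> h)"
  using assms by (auto simp: Sub_def comp_add comp_minus)

lemma sub_add:
  assumes "f \<in> Arr C" "g \<in> Arr C" "Dom C f = Dom C g" "Cod C f = Cod C g"
  shows "Add C (Sub f g) g = f" "Add C g (Sub f g) = f"
proof -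
  have H: "f \<in> Hom C (Dom C g) (Cod C g)" "g \<in> Hom C (Dom C g) (Cod C g)"
    "Minus g \<in> Hom C (Dom C g) (Cod C g)" "Sub f g \<in> Hom C (Dom C g) (Cod C g)" using assms by (auto simp: Hom_def)
  show 1: "Add C (Sub f g) g = f" unfolding Sub_def add_assoc[OF H(1,3,2)] using assms by simp
  show "Add C g (Sub f g) = f" using 1 add_commute[OF H(2,4)] by simp
qed

lemma sub_eq_zero_iff:
  assumes "f \<in> Arr C" "g \<in> Arr C" "Dom C f = Dom C g" "Cod C f = Cod C g" "Dom C g = X" "Cod C g = Y"
  shows "Sub f g = Zero C X Y \<longleftrightarrow> f = g"
proof
  assume "Sub f g = Zero C X Y" then show "f = g" using sub_add(1)[of f g] assms by simp
qed (use assms in \<open>auto simp: Sub_def\<close>)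

lemma sub_self [simp]: "f \<in> Arr C \<Longrightarrow> Sub f f = Zero C (Dom C f) (Cod C f)"
  by (simp add: Sub_def)

lemma zero_object_Hom: "\<lbrakk>zero_object C Z; f \<in> Hom C X Z\<rbrakk> \<Longrightarrow> f = Zero C X Z"
    "\<lbrakk>zero_object C Z; f \<in> Hom C Z X\<rbrakk> \<Longrightarrow> f = Zero C Z X"
proof -
  assume Z: "zero_object C Z"
  then have 0: "Z \<in> Obj C" by (simp add: zero_object_def)
  show "f = Zero C X Z" if "f \<in> Hom C X Z"
    by (rule ex1_eq[of "\<lambda>f. f \<in> Hom C X Z"])
      (use Z 0 that Hom_obj[OF that] zero_Hom in \<open>auto simp: zero_object_def\<close>)
  show "f = Zero C Z X" if "f \<in> Hom C Z X"
    by (rule ex1_eq[of "\<lambda>f. f \<in> Hom C Z X"])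
      (use Z 0 that Hom_obj[OF that] zero_Hom in \<open>auto simp: zero_object_def\<close>)
qed

lemma zero_objectI: "\<lbrakk>Z \<in> Obj C; Idn C Z = Zero C Z Z\<rbrakk> \<Longrightarrow> zero_object C Z"
  unfolding zero_object_def
proof (intro conjI ballI)
  fix X assume a: "Z \<in> Obj C" "Idn C Z = Zero C Z Z" "X \<in> Obj C"
  have "f = Zero C Z X" if "f \<in> Hom C Z X" for f
  proof -
    have "f \<cdot> Idn C Z = f" "f \<cdot> Zero C Z Z = Zero C Z X" using a(1,3) that by (auto simp: Hom_def)
    then show ?thesis using a(2) by metis
  qed
  then show "\<exists>!f. f \<in> Hom C Z X" using zero_Hom a(1,3) by blast
  have "f = Zero C X Z" if "f \<in> Hom C X Z" for f
  proof -
    have "Idn C Z \<cdot> f = f" "Zero C Z Z \<cdot> f = Zero C X Z" using a(1,3) that by (auto simp: Hom_def)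
    then show ?thesis using a(2) by metis
  qed
  then show "\<exists>!f. f \<in> Hom C X Z" using zero_Hom a(1,3) by blast
qed

end

section \<open>Triangulated categories\<close>

context triangulated_category
begin

lemma Neg_eq: "Neg T f = Minus f"
  by (simp add: Neg_def Minus_def)

lemma susp_Hom: "f \<in> Hom T X Y \<Longrightarrow> SuspM T f \<in> Hom T (Susp T X) (Susp T Y)"
  using Susp_fully_faithful[of X Y] Hom_obj[of f X Y] by (auto simp: bij_betw_def)

lemma susp_arr [simp]:
  assumes "f \<in> Arr T"
  shows "SuspM T f \<in> Arr T" "Dom T (SuspM T f) = Susp T (Dom T f)" "Cod T (SuspM T f) = Susp T (Cod T f)"
  using susp_Hom[of f "Dom T f" "Cod T f"] assms by (auto simp: Hom_def)

lemma susp_obj [simp]: "X \<in> Obj T \<Longrightarrow> Susp T X \<in> Obj T"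
  by (rule Susp_Obj)

lemma susp_comp: "\<lbrakk>f \<in> Arr T; g \<in> Arr T; Cod T f = Dom T g\<rbrakk> \<Longrightarrow> SuspM T (g \<cdot> f) = SuspM T g \<cdot> SuspM T f"
  using SuspM_Comp[of f "Dom T f" "Cod T f" g "Cod T g"] by (simp add: Hom_def)

lemma susp_inj: "\<lbrakk>f \<in> Hom T X Y; g \<in> Hom T X Y; SuspM T f = SuspM T g\<rbrakk> \<Longrightarrow> f = g"
  using Susp_fully_faithful[of X Y] Hom_obj[of f X Y] unfolding bij_betw_def inj_on_def by blast

lemma susp_full:
  assumes "h \<in> Hom T (Susp T X) (Susp T Y)" "X \<in> Obj T" "Y \<in> Obj T"
  obtains f where "f \<in> Hom T X Y" "SuspM T f = h"
proof -
  have "h \<in> SuspM T ` Hom T X Y"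
    using bij_betw_imp_surj_on[OF Susp_fully_faithful[OF assms(2,3)]] assms(1) by simp
  then show thesis using that by blast
qed

lemma susp_zero [simp]:
  assumes "X \<in> Obj T" "Y \<in> Obj T"
  shows "SuspM T (Zero T X Y) = Zero T (Susp T X) (Susp T Y)"
proof (rule add_self_zero)
  show "SuspM T (Zero T X Y) \<in> Hom T (Susp T X) (Susp T Y)" by (rule susp_Hom[OF zero_Hom[OF assms]])
  show "Add T (SuspM T (Zero T X Y)) (SuspM T (Zero T X Y)) = SuspM T (Zero T X Y)"
    using SuspM_Add[OF zero_Hom[OF assms] zero_Hom[OF assms]] assms by simp
qed

lemma susp_minus: "f \<in> Arr T \<Longrightarrow> SuspM T (Minus f) = Minus (SuspM T f)"
proof (rule minus_unique[where X="Susp T (Dom T f)" and Y="Susp T (Cod T f)"])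
  assume f: "f \<in> Arr T"
  then show "Add T (SuspM T f) (SuspM T (Minus f)) = Zero T (Susp T (Dom T f)) (Susp T (Cod T f))"
    using SuspM_Add[of f "Dom T f" "Cod T f" "Minus f"] by (simp add: Hom_def)
qed (auto simp: Hom_def)

lemma susp_eq_zero: "\<lbrakk>f \<in> Hom T X Y; SuspM T f = Zero T (Susp T X) (Susp T Y)\<rbrakk> \<Longrightarrow> f = Zero T X Y"
  by (rule susp_inj[where X=X and Y=Y]) (auto simp: Hom_obj[of f X Y] zero_Hom)

lemma zero_object_susp: "zero_object T Z \<Longrightarrow> zero_object T (Susp T Z)"
proof (rule zero_objectI)
  assume Z: "zero_object T Z"
  then have "Z \<in> Obj T" by (simp add: zero_object_def)
  then show "Idn T (Susp T Z) = Zero T (Susp T Z) (Susp T Z)"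
    using zero_object_Hom(1)[OF Z, of "Idn T Z" Z] Idn_Hom[of Z] SuspM_Idn[of Z] by simp
qed (auto simp: zero_object_def)

lemma Dist_arr:
  assumes "(f, g, h) \<in> Dist T"
  shows "f \<in> Arr T" "g \<in> Arr T" "h \<in> Arr T" "Dom T g = Cod T f" "Dom T h = Cod T g" "Cod T h = Susp T (Dom T f)"
  using Dist_triangle[OF assms] by (auto simp: triangle_def)

lemma Dist_rot: "(f, g, h) \<in> Dist T \<Longrightarrow> (g, h, Minus (SuspM T f)) \<in> Dist T"
  using Dist_rotate[OF Dist_triangle] by (simp add: Neg_eq)

lemma Dist_unrot:
  assumes "(g, h, Minus (SuspM T f)) \<in> Dist T" "f \<in> Arr T" "Dom T g = Cod T f" "Cod T h = Susp T (Dom T f)"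
  shows "(f, g, h) \<in> Dist T"
proof -
  have "triangle T f g h" using Dist_arr[OF assms(1)] assms(2-) by (simp add: triangle_def)
  then show ?thesis using Dist_rotate assms(1) by (simp add: Neg_eq)
qed

text \<open>The identity and \<open>f\<close> extend to a morphism from the triangle of an identity
  map, whose third object is zero; hence \<open>g \<cdot> f\<close> factors through a zero
  object.\<close>

lemma Dist_comp_zero:
  assumes "(f, g, h) \<in> Dist T"
  shows "g \<cdot> f = Zero T (Dom T f) (Cod T g)"
proof -
  obtain Z where Z: "zero_object T Z" using zero_object_exists by blast
  then have ZO: "Z \<in> Obj T" by (simp add: zero_object_def)
  note a = Dist_arr[OF assms]
  obtain c where "triangle_morphism T (Idn T (Dom T f), Zero T (Dom T f) Z, Zero T Z (Susp T (Dom T f))) (f, g, h)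
      (Idn T (Dom T f)) f c"
    using Dist_fill[OF Dist_Idn[OF dom_obj[OF a(1)] Z] assms, of "Idn T (Dom T f)" f] a ZO
    by (auto simp: Hom_def)
  then have c: "c \<in> Hom T Z (Cod T g)" "c \<cdot> Zero T (Dom T f) Z = g \<cdot> f"
    using a ZO by (auto simp: triangle_morphism_def Hom_def)
  have "c \<cdot> Zero T (Dom T f) Z = Zero T (Dom T f) (Cod T g)" using c(1) a ZO by (auto simp: Hom_def)
  then show ?thesis using c(2) by simp
qed

text \<open>The vanishing of \<open>g \<cdot> x\<close> lets \<open>x\<close> and a zero map start a
  morphism from the rotated triangle of the identity of \<open>C\<close> to the rotated given
  triangle. Its third component is a map between suspensions, and the desuspension of that component
  is the lift.\<close>

lemma Dist_exact:
  assumes D: "(f, g, h) \<in> Dist T" and x: "x \<in> Hom T C (Dom T g)" "g \<cdot> x = Zero T C (Cod T g)"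
  obtains y where "y \<in> Hom T C (Dom T f)" "f \<cdot> y = x"
proof -
  obtain Z where Z: "zero_object T Z" using zero_object_exists by blast
  then have ZO: "Z \<in> Obj T" by (simp add: zero_object_def)
  note a = Dist_arr[OF D]
  have C: "C \<in> Obj T" "x \<in> Arr T" "Dom T x = C" "Cod T x = Dom T g" using x Hom_obj by (auto simp: Hom_def)
  have "\<exists>c. triangle_morphism T (Zero T C Z, Zero T Z (Susp T C), Minus (SuspM T (Idn T C))) (g, h, Minus (SuspM T f))
      x (Zero T Z (Dom T h)) c"
    by (rule Dist_fill[OF Dist_rot[OF Dist_Idn[OF C(1) Z]] Dist_rot[OF D]]) (use a C ZO x in \<open>auto simp: Hom_def\<close>)
  then obtain c where c: "c \<in> Hom T (Susp T C) (Susp T (Dom T f))"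
      "SuspM T x \<cdot> Minus (SuspM T (Idn T C)) = Minus (SuspM T f) \<cdot> c"
    using a C ZO by (auto simp: triangle_morphism_def Hom_def)
  from susp_full[OF c(1) C(1) dom_obj[OF a(1)]] obtain y where y: "y \<in> Hom T C (Dom T f)" "SuspM T y = c" by blast
  then have y': "y \<in> Arr T" "Dom T y = C" "Cod T y = Dom T f" by (auto simp: Hom_def)
  \<comment> \<open>Rotation puts the same sign on both sides, so it cancels after
    desuspension.\<close>
  have "SuspM T (Minus x) = SuspM T (Minus (f \<cdot> y))"
    using c(2) a C y' y(2)[symmetric] by (simp add: comp_minus susp_comp susp_minus SuspM_Idn)
  then have "Minus x = Minus (f \<cdot> y)"
    by (rule susp_inj[rotated 2, where X=C and Y="Cod T f"]) (use a C y' in \<open>auto simp: Hom_def\<close>)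
  then have "Minus (Minus x) = Minus (Minus (f \<cdot> y))" by simp
  then have "f \<cdot> y = x" using a y' C by simp
  then show ?thesis using that y(1) by blast
qed

text \<open>Extend \<open>x\<close> to a morphism into the triangle on the zero map to
  \<open>X\<close> and the identity of \<open>X\<close>; its third component is the required
  factor.\<close>

lemma Dist_coexact:
  assumes D: "(f, g, h) \<in> Dist T" and x: "x \<in> Hom T (Cod T f) X" "x \<cdot> f = Zero T (Dom T f) X"
  obtains y where "y \<in> Hom T (Cod T g) X" "y \<cdot> g = x"
proof -
  obtain Z where Z: "zero_object T Z" using zero_object_exists by blast
  then have ZO: "Z \<in> Obj T" by (simp add: zero_object_def)
  note a = Dist_arr[OF D]
  have X: "X \<in> Obj T" "x \<in> Arr T" "Dom T x = Cod T f" "Cod T x = X" using x Hom_obj by (auto simp: Hom_def)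
  have 1: "(Zero T Z X, Idn T X, Zero T X (Susp T Z)) \<in> Dist T"
    by (rule Dist_unrot) (use Dist_Idn[OF X(1) zero_object_susp[OF Z]] X ZO in auto)
  have "\<exists>c. triangle_morphism T (f, g, h) (Zero T Z X, Idn T X, Zero T X (Susp T Z)) (Zero T (Dom T f) Z) x c"
    by (rule Dist_fill[OF D 1]) (use a X ZO x in \<open>auto simp: Hom_def\<close>)
  then obtain c where c: "triangle_morphism T (f, g, h) (Zero T Z X, Idn T X, Zero T X (Susp T Z)) (Zero T (Dom T f) Z) x c" ..
  then have "c \<in> Hom T (Dom T h) X" "c \<cdot> g = Idn T X \<cdot> x"
    using X(1) ZO by (simp_all add: triangle_morphism_def)
  then show ?thesis using that[of c] X a by simp
qed

lemma desusp:
  assumes "X \<in> Obj T"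
  obtains Y \<theta> where "Y \<in> Obj T" "\<theta> \<in> Hom T (Susp T Y) X" "iso_arrow T \<theta>"
  using Susp_ess_surj[OF assms] by (auto simp: isomorphic_def)

text \<open>The triangle is the rotated cone of a map \<open>k\<close> whose suspension is the
  negative of \<open>\<gamma>\<close>. The map \<open>k\<close> is returned as well because it
  exhibits the middle object as the cone of a map out of \<open>K\<close>, the form in which
  \<open>stably_cell_generated\<close> can be applied.\<close>

lemma Dist_third:
  assumes "\<gamma> \<in> Hom T (Susp T K) (Susp T Z)" "K \<in> Obj T" "Z \<in> Obj T"
  obtains k \<phi> p where "k \<in> Hom T K Z" "(k, \<phi>, p) \<in> Dist T" "(\<phi>, p, \<gamma>) \<in> Dist T"
    "\<phi> \<in> Hom T Z (Cod T \<phi>)" "p \<in> Hom T (Cod T \<phi>) (Susp T K)"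
proof -
  have \<gamma>: "\<gamma> \<in> Arr T" "Dom T \<gamma> = Susp T K" "Cod T \<gamma> = Susp T Z" using assms by (auto simp: Hom_def)
  have "Minus \<gamma> \<in> Hom T (Susp T K) (Susp T Z)" using \<gamma> by (simp add: Hom_def)
  from susp_full[OF this assms(2,3)] obtain k where k: "k \<in> Hom T K Z" "SuspM T k = Minus \<gamma>" by blast
  obtain \<phi> p where D: "(k, \<phi>, p) \<in> Dist T" using Dist_cone[of k] k(1) by (auto simp: Hom_def)
  have "(\<phi>, p, \<gamma>) \<in> Dist T" using Dist_rot[OF D] k \<gamma> by simp
  then show ?thesis using that[OF k(1) D] Dist_arr[OF D] k(1) by (auto simp: Hom_def)
qed

text \<open>The suspension is only essentially surjective: the third object of a triangle on
  \<open>s\<close> is replaced along \<open>\<theta>\<close> by an actual suspension before the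
  triangle is rotated back.\<close>

lemma Dist_fiber:
  assumes s: "s \<in> Arr T"
  obtains b q where "(b, s, q) \<in> Dist T"
proof -
  obtain g h where D: "(s, g, h) \<in> Dist T" using Dist_cone s by blast
  note a = Dist_arr[OF D]
  obtain Y \<theta> where \<theta>: "Y \<in> Obj T" "\<theta> \<in> Hom T (Susp T Y) (Cod T g)" "iso_arrow T \<theta>"
    using desusp[of "Cod T g"] a by auto
  then have t: "\<theta> \<in> Arr T" "Dom T \<theta> = Susp T Y" "Cod T \<theta> = Cod T g" by (auto simp: Hom_def)
  have "Minus (h \<cdot> \<theta>) \<in> Hom T (Susp T Y) (Susp T (Dom T s))" using a t by (simp add: Hom_def)
  from susp_full[OF this \<theta>(1)] a obtain b where b: "b \<in> Hom T Y (Dom T s)" "SuspM T b = Minus (h \<cdot> \<theta>)" by auto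
  have "(s, inv_arrow T \<theta> \<cdot> g, h \<cdot> \<theta>) \<in> Dist T"
    by (rule Dist_iso[OF D, where a="Idn T (Dom T s)" and b="Idn T (Cod T s)" and c="inv_arrow T \<theta>"])
      (use a t \<theta>(3) in \<open>auto simp: triangle_def triangle_morphism_def Hom_def SuspM_Idn comp_assoc\<close>)
  then have "(s, inv_arrow T \<theta> \<cdot> g, Minus (SuspM T b)) \<in> Dist T" using b a t by simp
  then have "(b, s, inv_arrow T \<theta> \<cdot> g) \<in> Dist T"
    by (rule Dist_unrot) (use a t \<theta>(3) b in \<open>auto simp: Hom_def\<close>)
  then show ?thesis using that by blast
qed

end

section \<open>Coproducts and compact objects\<close>

context additive_category
begin

lemma coproduct_proj:
  assumes P: "is_coproduct C I X P \<iota>" and i: "i \<in> I"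
  obtains p where "p \<in> Hom C P (X i)" "\<And>j. j \<in> I \<Longrightarrow> p \<cdot> \<iota> j = (if j = i then Idn C (X i) else Zero C (X j) (X i))"
proof (rule coproduct_desc[OF P, where Y="X i" and f="\<lambda>j. if j = i then Idn C (X i) else Zero C (X j) (X i)"])
  show "X i \<in> Obj C" using coproduct_arr[OF P] i by blast
  show "(if j = i then Idn C (X i) else Zero C (X j) (X i)) \<in> Hom C (X j) (X i)" if "j \<in> I" for j
    using coproduct_arr(5)[OF P] i that zero_Hom Idn_Hom by auto
qed (use that in blast)

lemma coproduct_projs:
  assumes P: "is_coproduct C I X P \<iota>"
  obtains p where "\<forall>i \<in> I. p i \<in> Hom C P (X i)"
    "\<forall>i \<in> I. \<forall>j \<in> I. p i \<cdot> \<iota> j = (if j = i then Idn C (X i) else Zero C (X j) (X i))"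
proof -
  define R where "R i q \<longleftrightarrow> q \<in> Hom C P (X i) \<and>
    (\<forall>j \<in> I. q \<cdot> \<iota> j = (if j = i then Idn C (X i) else Zero C (X j) (X i)))" for i q
  have "\<forall>i \<in> I. \<exists>q. R i q"
  proof
    fix i assume i: "i \<in> I"
    show "\<exists>q. R i q" by (rule coproduct_proj[OF P i]) (auto simp: R_def)
  qed
  then obtain p where "\<forall>i \<in> I. R i (p i)" by (rule bchoice[THEN exE])
  then show thesis by (intro that[of p]) (simp_all add: R_def)
qed

text \<open>
  Finite sums of maps into a coproduct are encoded by the idempotents which project to the summands
  with index in \<open>F\<close>: a map into the coproduct is a finite sum if and only if some such idempotent fixes it.
\<close>

definition is_trunc :: "'i set \<Rightarrow> 'o \<Rightarrow> ('i \<Rightarrow> 'm) \<Rightarrow> 'i set \<Rightarrow> 'm \<Rightarrow> bool"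
  where "is_trunc I P \<iota> F e \<longleftrightarrow> e \<in> Hom C P P \<and>
    (\<forall>i \<in> I. e \<cdot> \<iota> i = (if i \<in> F then \<iota> i else Zero C (Dom C (\<iota> i)) P))"

definition finitely_supported :: "'i set \<Rightarrow> 'o \<Rightarrow> ('i \<Rightarrow> 'm) \<Rightarrow> 'm \<Rightarrow> bool"
  where "finitely_supported I P \<iota> h \<longleftrightarrow> (\<exists>F e. finite F \<and> F \<subseteq> I \<and> is_trunc I P \<iota> F e \<and> e \<cdot> h = h)"

lemma trunc_ex:
  assumes P: "is_coproduct C I X P \<iota>"
  obtains e where "is_trunc I P \<iota> F e"
proof (rule coproduct_desc[OF P, where Y=P and f="\<lambda>i. if i \<in> F then \<iota> i else Zero C (X i) P"])
  show "P \<in> Obj C" using coproduct_arr[OF P] by blast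
  show "(if i \<in> F then \<iota> i else Zero C (X i) P) \<in> Hom C (X i) P" if "i \<in> I" for i
    using coproduct_arr[OF P] that by (auto simp: Hom_def)
  show thesis if "h \<in> Hom C P P" "\<And>i. i \<in> I \<Longrightarrow> h \<cdot> \<iota> i = (if i \<in> F then \<iota> i else Zero C (X i) P)" for h
    using that(1) that(2) coproduct_arr[OF P] \<open>\<And>e. is_trunc I P \<iota> F e \<Longrightarrow> thesis\<close>[of h] by (simp add: is_trunc_def)
qed

lemma trunc_arr:
  assumes "is_trunc I P \<iota> F e"
  shows "e \<in> Arr C" "Dom C e = P" "Cod C e = P"
  using assms by (auto simp: is_trunc_def Hom_def)

lemma trunc_comp:
  assumes "is_coproduct C I X P \<iota>" "is_trunc I P \<iota> F e" "is_trunc I P \<iota> G g" "F \<subseteq> G"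
  shows "g \<cdot> e = e"
proof (rule coproduct_eqI[OF assms(1)])
  note a = coproduct_arr[OF assms(1)] trunc_arr[OF assms(2)] trunc_arr[OF assms(3)]
  show "g \<cdot> e \<in> Hom C P P" "e \<in> Hom C P P" using a by (auto simp: Hom_def)
  fix i assume i: "i \<in> I"
  then have "e \<cdot> \<iota> i = (if i \<in> F then \<iota> i else Zero C (X i) P)" "g \<cdot> \<iota> i = (if i \<in> G then \<iota> i else Zero C (X i) P)"
    using assms(2,3) a by (auto simp: is_trunc_def)
  then show "g \<cdot> e \<cdot> \<iota> i = e \<cdot> \<iota> i" using a i assms(4) by (auto simp: comp_assoc)
qed

text \<open>For \<open>F = G\<close> this replaces one truncation to \<open>F\<close> by another, so
  it is immaterial which of them witnesses finite support.\<close>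

lemma trunc_fixes_mono:
  assumes "is_coproduct C I X P \<iota>" "is_trunc I P \<iota> F e" "is_trunc I P \<iota> G g" "F \<subseteq> G"
    "h \<in> Arr C" "Cod C h = P" "e \<cdot> h = h"
  shows "g \<cdot> h = h"
proof -
  have "g \<cdot> h = g \<cdot> (e \<cdot> h)" using assms by simp
  also have "\<dots> = e \<cdot> h" using comp_rewrite[OF trunc_comp[OF assms(1-4)], of h] assms trunc_arr[OF assms(2)] trunc_arr[OF assms(3)] by simp
  finally show ?thesis using assms by simp
qed

lemma finitely_supportedI:
  assumes P: "is_coproduct C I X P \<iota>" and "finite F" "F \<subseteq> I" "\<And>e. is_trunc I P \<iota> F e \<Longrightarrow> e \<cdot> h = h"
  shows "finitely_supported I P \<iota> h"
  using assms trunc_ex[OF P, of F] unfolding finitely_supported_def by metis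

text \<open>Both maps are fixed by the truncation to the union of the two supports.\<close>

lemma finitely_supported_add:
  assumes P: "is_coproduct C I X P \<iota>" and f: "finitely_supported I P \<iota> f" "f \<in> Hom C A P"
    and g: "finitely_supported I P \<iota> g" "g \<in> Hom C A P"
  shows "finitely_supported I P \<iota> (Add C f g)"
proof -
  obtain F e where F: "finite F" "F \<subseteq> I" "is_trunc I P \<iota> F e" "e \<cdot> f = f" using f by (auto simp: finitely_supported_def)
  obtain G d where G: "finite G" "G \<subseteq> I" "is_trunc I P \<iota> G d" "d \<cdot> g = g" using g by (auto simp: finitely_supported_def)
  show ?thesis
  proof (rule finitely_supportedI[OF P, where F="F \<union> G"])
    fix c assume c: "is_trunc I P \<iota> (F \<union> G) c"
    have "c \<cdot> f = f" "c \<cdot> g = g"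
      using trunc_fixes_mono[OF P F(3) c _ _ _ F(4)] trunc_fixes_mono[OF P G(3) c _ _ _ G(4)] f(2) g(2)
      by (auto simp: Hom_def)
    then show "c \<cdot> Add C f g = Add C f g" using trunc_arr[OF c] f(2) g(2) by (auto simp: comp_add Hom_def)
  qed (use F G in auto)
qed

lemma finitely_supported_comp:
  assumes P: "is_coproduct C I X P \<iota>" and f: "finitely_supported I P \<iota> f" "f \<in> Hom C A P" "u \<in> Hom C B A"
  shows "finitely_supported I P \<iota> (f \<cdot> u)"
proof -
  obtain F e where F: "finite F" "F \<subseteq> I" "is_trunc I P \<iota> F e" "e \<cdot> f = f" using f by (auto simp: finitely_supported_def)
  then have "e \<cdot> (f \<cdot> u) = f \<cdot> u"
    using comp_rewrite[OF F(4), of u] trunc_arr[OF F(3)] f(2,3) by (auto simp: Hom_def)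
  then show ?thesis using F by (auto simp: finitely_supported_def)
qed

lemma finitely_supported_trunc:
  assumes P: "is_coproduct C I X P \<iota>" and F: "finite F" "F \<subseteq> I" "is_trunc I P \<iota> F e" and "w \<in> Hom C A P"
  shows "finitely_supported I P \<iota> (e \<cdot> w)"
  using comp_rewrite[OF trunc_comp[OF P F(3) F(3)], of w] F trunc_arr[OF F(3)] assms(5)
  by (auto simp: finitely_supported_def Hom_def intro!: exI[of _ F] exI[of _ e])

text \<open>The idempotent belonging to the single index \<open>i\<close> is
  \<open>\<iota> i \<cdot> p\<close>. Inductions over finite \<open>F\<close> rest on this
  identity.\<close>

lemma trunc_insert:
  assumes P: "is_coproduct C I X P \<iota>" and e: "is_trunc I P \<iota> F e" and d: "is_trunc I P \<iota> (insert i F) d"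
    and i: "i \<in> I" "i \<notin> F"
    and p: "p \<in> Hom C P (X i)" "\<And>j. j \<in> I \<Longrightarrow> p \<cdot> \<iota> j = (if j = i then Idn C (X i) else Zero C (X j) (X i))"
  shows "d = Add C (\<iota> i \<cdot> p) e"
proof (rule coproduct_eqI[OF P])
  note a = coproduct_arr[OF P] trunc_arr[OF e] trunc_arr[OF d]
  have pa: "p \<in> Arr C" "Dom C p = P" "Cod C p = X i" using p by (auto simp: Hom_def)
  show "d \<in> Hom C P P" "Add C (\<iota> i \<cdot> p) e \<in> Hom C P P" using a pa i by (auto simp: Hom_def)
  fix j assume j: "j \<in> I"
  have "e \<cdot> \<iota> j = (if j \<in> F then \<iota> j else Zero C (X j) P)" "d \<cdot> \<iota> j = (if j \<in> insert i F then \<iota> j else Zero C (X j) P)"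
    using e d a j by (auto simp: is_trunc_def)
  moreover have "\<iota> i \<cdot> p \<cdot> \<iota> j = (if j = i then \<iota> j else Zero C (X j) P)"
    using p(2)[OF j] a pa i j by (auto simp: comp_assoc)
  ultimately show "d \<cdot> \<iota> j = Add C (\<iota> i \<cdot> p) e \<cdot> \<iota> j"
    using a pa i j by (auto simp: comp_add)
qed

text \<open>Surjectivity of the canonical map writes \<open>h\<close> as a finite sum of maps into
  summands, and the truncation to their indices fixes every term.\<close>

lemma compact_finitely_supported:
  fixes \<kappa> :: "'u rel" and I :: "'u set"
  assumes A: "compact_object C \<kappa> A" and I: "small \<kappa> I" and P: "is_coproduct C I X P \<iota>" and h: "h \<in> Hom C A P"
  shows "finitely_supported I P \<iota> h"
proof -
  note a = coproduct_arr[OF P]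
  have AO: "A \<in> Obj C" using A by (simp add: compact_object_def)
  interpret G: comm_group "HomGrp C A P" by (rule HomGrp_comm_group[OF AO a(1)])
  have "\<forall>i \<in> I. X i \<in> Obj C" using a by blast
  then have iso: "(\<lambda>\<phi>. gfinprod (HomGrp C A P) (\<lambda>i. \<iota> i \<cdot> \<phi> i) I) \<in> iso (sum_group I (\<lambda>i. HomGrp C A (X i))) (HomGrp C A P)"
    using A I P unfolding compact_object_def by blast
  then obtain \<phi> where \<phi>: "\<phi> \<in> carrier (sum_group I (\<lambda>i. HomGrp C A (X i)))" "h = gfinprod (HomGrp C A P) (\<lambda>i. \<iota> i \<cdot> \<phi> i) I"
    using h unfolding iso_def bij_betw_def by auto
  have "carrier (sum_group I (\<lambda>i. HomGrp C A (X i))) =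
      {x \<in> \<Pi>\<^sub>E i\<in>I. carrier (HomGrp C A (X i)). finite {i \<in> I. x i \<noteq> \<one>\<^bsub>HomGrp C A (X i)\<^esub>}}"
    by (rule carrier_sum_group) (use HomGrp_group a AO in blast)
  then have \<phi>1: "\<And>i. i \<in> I \<Longrightarrow> \<phi> i \<in> Hom C A (X i)" and fin: "finite {i \<in> I. \<phi> i \<noteq> Zero C A (X i)}"
    using \<phi>(1) by (auto simp: PiE_iff)
  \<comment> \<open>\<open>gfinprod\<close> multiplies over the indices whose factor is nontrivial;
    \<open>J\<close> is this set, and it is contained in the finite support of
    \<open>\<phi>\<close>.\<close>
  define J where "J = {i \<in> I. \<iota> i \<cdot> \<phi> i \<noteq> Zero C A P}"
  have "J \<subseteq> {i \<in> I. \<phi> i \<noteq> Zero C A (X i)}" using a AO by (auto simp: J_def)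
  then have finJ: "finite J" using fin finite_subset by blast
  have JI: "J \<subseteq> I" by (auto simp: J_def)
  have h': "h = finprod (HomGrp C A P) (\<lambda>i. \<iota> i \<cdot> \<phi> i) J"
    using \<phi>(2) finJ by (simp add: gfinprod_def J_def)
  show ?thesis
  proof (rule finitely_supportedI[OF P finJ JI])
    fix e assume e: "is_trunc I P \<iota> J e"
    note ea = trunc_arr[OF e]
    have "e \<cdot> finprod (HomGrp C A P) (\<lambda>i. \<iota> i \<cdot> \<phi> i) K = finprod (HomGrp C A P) (\<lambda>i. \<iota> i \<cdot> \<phi> i) K" if "finite K" "K \<subseteq> J" for K
      using that
    proof (induction K)
      case empty
      then show ?case using ea a AO by simp
    next
      case (insert i K)
      have t: "\<iota> j \<cdot> \<phi> j \<in> Hom C A P" if "j \<in> I" for j using a \<phi>1[OF that] that by (auto simp: Hom_def)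
      have Pi: "(\<lambda>i. \<iota> i \<cdot> \<phi> i) \<in> K \<rightarrow> carrier (HomGrp C A P)" using t insert.prems JI by auto
      have 1: "finprod (HomGrp C A P) (\<lambda>i. \<iota> i \<cdot> \<phi> i) K \<in> Hom C A P" using G.finprod_closed[OF Pi] by simp
      have i: "i \<in> I" "i \<in> J" using insert.prems JI by auto
      have "e \<cdot> (\<iota> i \<cdot> \<phi> i) = \<iota> i \<cdot> \<phi> i"
        using comp_rewrite[of e "\<iota> i" "\<iota> i" "\<phi> i"] e i a ea \<phi>1 by (auto simp: is_trunc_def Hom_def)
      then show ?case
        using insert 1 t[OF i(1)] ea Pi G.finprod_insert[OF insert.hyps Pi] by (auto simp: comp_add Hom_def)
    qed
    then show "e \<cdot> h = h" using h' finJ by blast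
  qed
qed

lemma proj_finprod:
  assumes P: "is_coproduct C I X P \<iota>" and \<phi>: "\<And>i. i \<in> I \<Longrightarrow> \<phi> i \<in> Hom C A (X i)"
    and K: "finite K" "K \<subseteq> I" and j: "j \<in> I" and A: "A \<in> Obj C"
    and p: "p \<in> Hom C P (X j)" "\<And>i. i \<in> I \<Longrightarrow> p \<cdot> \<iota> i = (if i = j then Idn C (X j) else Zero C (X i) (X j))"
  shows "p \<cdot> finprod (HomGrp C A P) (\<lambda>i. \<iota> i \<cdot> \<phi> i) K = (if j \<in> K then \<phi> j else Zero C A (X j))"
  using K
proof (induction K)
  case empty
  interpret G: comm_group "HomGrp C A P" by (rule HomGrp_comm_group[OF A coproduct_arr(1)[OF P]])
  show ?case using p coproduct_arr[OF P] A by (auto simp: Hom_def)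
next
  case (insert i K)
  note a = coproduct_arr[OF P]
  interpret G: comm_group "HomGrp C A P" by (rule HomGrp_comm_group[OF A a(1)])
  have t: "\<iota> j \<cdot> \<phi> j \<in> Hom C A P" if "j \<in> I" for j using a \<phi>[OF that] that by (auto simp: Hom_def)
  have Pi: "(\<lambda>i. \<iota> i \<cdot> \<phi> i) \<in> K \<rightarrow> carrier (HomGrp C A P)" using t insert.prems by auto
  have 1: "finprod (HomGrp C A P) (\<lambda>i. \<iota> i \<cdot> \<phi> i) K \<in> Hom C A P" using G.finprod_closed[OF Pi] by simp
  have i: "i \<in> I" using insert.prems by auto
  have "p \<cdot> (\<iota> i \<cdot> \<phi> i) = (if i = j then \<phi> j else Zero C A (X j))"
    using comp_rewrite[OF p(2)[OF i], of "\<phi> i"] i a \<phi>[OF i] p(1) j by (auto simp: Hom_def)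
  moreover have "p \<cdot> finprod (HomGrp C A P) (\<lambda>i. \<iota> i \<cdot> \<phi> i) (insert i K)
      = Add C (p \<cdot> (\<iota> i \<cdot> \<phi> i)) (p \<cdot> finprod (HomGrp C A P) (\<lambda>i. \<iota> i \<cdot> \<phi> i) K)"
    using 1 t[OF i] p(1) Pi G.finprod_insert[OF insert.hyps Pi] by (auto simp: comp_add Hom_def)
  ultimately show ?case using insert \<phi>[OF j] A a(5)[OF j] by (auto simp: Hom_def)
qed

text \<open>In effect a truncation is the sum of the idempotents
  \<open>\<iota> i \<cdot> p i\<close>. This leads back from truncations to the finite sums in the
  definition of compactness.\<close>

lemma trunc_finprod:
  assumes P: "is_coproduct C I X P \<iota>" and h: "h \<in> Hom C A P"
    and p: "\<And>i. i \<in> I \<Longrightarrow> p i \<in> Hom C P (X i)"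
      "\<And>i j. i \<in> I \<Longrightarrow> j \<in> I \<Longrightarrow> p i \<cdot> \<iota> j = (if j = i then Idn C (X i) else Zero C (X j) (X i))"
    and K: "finite K" "K \<subseteq> I" and e: "is_trunc I P \<iota> K e"
  shows "finprod (HomGrp C A P) (\<lambda>i. \<iota> i \<cdot> (p i \<cdot> h)) K = e \<cdot> h"
  using K e
proof (induction K arbitrary: e)
  case empty
  note a = coproduct_arr[OF P]
  have A: "A \<in> Obj C" using h Hom_obj by blast
  interpret G: comm_group "HomGrp C A P" by (rule HomGrp_comm_group[OF A a(1)])
  have "e = Zero C P P"
    by (rule coproduct_eqI[OF P, of _ P]) (use a empty.prems in \<open>auto simp: is_trunc_def zero_Hom\<close>)
  then show ?case using h a by (auto simp: Hom_def)
next
  case (insert i K)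
  note a = coproduct_arr[OF P]
  have A: "A \<in> Obj C" using h Hom_obj by blast
  interpret G: comm_group "HomGrp C A P" by (rule HomGrp_comm_group[OF A a(1)])
  obtain d where d: "is_trunc I P \<iota> K d" using trunc_ex[OF P] .
  have i: "i \<in> I" "K \<subseteq> I" using insert.prems by auto
  have t: "\<iota> j \<cdot> (p j \<cdot> h) \<in> Hom C A P" if "j \<in> I" for j using a p(1)[OF that] h that by (auto simp: Hom_def)
  then have Pi: "(\<lambda>i. \<iota> i \<cdot> (p i \<cdot> h)) \<in> K \<rightarrow> carrier (HomGrp C A P)" using i by auto
  have "e = Add C (\<iota> i \<cdot> p i) d"
    by (rule trunc_insert[OF P d insert.prems(2) i(1) insert.hyps(2) p(1)[OF i(1)] p(2)[OF i(1)]])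
  moreover have "finprod (HomGrp C A P) (\<lambda>i. \<iota> i \<cdot> (p i \<cdot> h)) (insert i K) = Add C (\<iota> i \<cdot> (p i \<cdot> h)) (d \<cdot> h)"
    using G.finprod_insert[OF insert.hyps Pi] t[OF i(1)] insert.IH[OF i(2) d] by simp
  ultimately show ?case using trunc_arr[OF d] p(1)[OF i(1)] h a i by (auto simp: comp_add Hom_def comp_assoc)
qed

text \<open>The canonical map is injective for every object, since the projections recover all
  components. What remains is surjectivity, and finite support provides it.\<close>

lemma compact_objectI:
  fixes \<kappa> :: "'u rel"
  assumes A: "A \<in> Obj C"
    and fs: "\<And>(I :: 'u set) X P \<iota> h. \<lbrakk>small \<kappa> I; is_coproduct C I X P \<iota>; h \<in> Hom C A P\<rbrakk> \<Longrightarrow> finitely_supported I P \<iota> h"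
  shows "compact_object C \<kappa> A"
  unfolding compact_object_def
proof (intro conjI allI impI)
  fix I :: "'u set" and X P \<iota>
  assume *: "small \<kappa> I \<and> (\<forall>i\<in>I. X i \<in> Obj C) \<and> is_coproduct C I X P \<iota>"
  then have P: "is_coproduct C I X P \<iota>" and I: "small \<kappa> I" by auto
  note a = coproduct_arr[OF P]
  interpret G: comm_group "HomGrp C A P" by (rule HomGrp_comm_group[OF A a(1)])
  define \<Phi> where "\<Phi> = (\<lambda>\<phi>. gfinprod (HomGrp C A P) (\<lambda>i. \<iota> i \<cdot> \<phi> i) I)"
  have carr: "carrier (sum_group I (\<lambda>i. HomGrp C A (X i))) =
      {x \<in> \<Pi>\<^sub>E i\<in>I. carrier (HomGrp C A (X i)). finite {i \<in> I. x i \<noteq> \<one>\<^bsub>HomGrp C A (X i)\<^esub>}}"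
    by (rule carrier_sum_group) (use HomGrp_group a A in blast)
  have hom: "\<Phi> \<in> hom (sum_group I (\<lambda>i. HomGrp C A (X i))) (HomGrp C A P)"
    unfolding \<Phi>_def
  proof (rule G.hom_group_sum)
    show "(\<lambda>x. \<iota> i \<cdot> x) \<in> hom (HomGrp C A (X i)) (HomGrp C A P)" if "i \<in> I" for i
      using a that by (auto simp: hom_def Hom_def comp_add)
  qed (use HomGrp_group a A in blast)
  obtain p where p0: "\<forall>i \<in> I. p i \<in> Hom C P (X i)"
    "\<forall>i \<in> I. \<forall>j \<in> I. p i \<cdot> \<iota> j = (if j = i then Idn C (X i) else Zero C (X j) (X i))"
    by (rule coproduct_projs[OF P])
  have p: "\<And>i. i \<in> I \<Longrightarrow> p i \<in> Hom C P (X i)"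
      "\<And>i j. i \<in> I \<Longrightarrow> j \<in> I \<Longrightarrow> p i \<cdot> \<iota> j = (if j = i then Idn C (X i) else Zero C (X j) (X i))"
    using p0 by simp_all
  have proj: "p j \<cdot> \<Phi> \<phi> = \<phi> j" if \<phi>: "\<phi> \<in> carrier (sum_group I (\<lambda>i. HomGrp C A (X i)))" and j: "j \<in> I" for \<phi> j
  proof -
    have \<phi>1: "\<And>i. i \<in> I \<Longrightarrow> \<phi> i \<in> Hom C A (X i)" and fin: "finite {i \<in> I. \<phi> i \<noteq> Zero C A (X i)}"
      using \<phi> carr by (auto simp: PiE_iff)
    define J where "J = {i \<in> I. \<iota> i \<cdot> \<phi> i \<noteq> Zero C A P}"
    have "J \<subseteq> {i \<in> I. \<phi> i \<noteq> Zero C A (X i)}" using a A by (auto simp: J_def)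
    then have finJ: "finite J" using fin finite_subset by blast
    have JI: "J \<subseteq> I" by (auto simp: J_def)
    have "\<Phi> \<phi> = finprod (HomGrp C A P) (\<lambda>i. \<iota> i \<cdot> \<phi> i) J"
      using finJ by (simp add: gfinprod_def J_def \<Phi>_def)
    then have 1: "p j \<cdot> \<Phi> \<phi> = (if j \<in> J then \<phi> j else Zero C A (X j))"
      using proj_finprod[OF P \<phi>1 finJ JI j A p(1)[OF j]] p(2)[OF j] by simp
    show ?thesis
    proof (cases "j \<in> J")
      case False
      \<comment> \<open>An index outside \<open>J\<close> could a priori carry a nonzero component;
        composing with the projection \<open>p j\<close> shows that it is zero.\<close>
      then have "\<iota> j \<cdot> \<phi> j = Zero C A P" using j by (simp add: J_def)
      then have "p j \<cdot> (\<iota> j \<cdot> \<phi> j) = Zero C A (X j)" using p(1)[OF j] A by (auto simp: Hom_def)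
      moreover have "p j \<cdot> (\<iota> j \<cdot> \<phi> j) = \<phi> j"
        using comp_rewrite[OF p(2)[OF j j], of "\<phi> j"] p(1)[OF j] \<phi>1[OF j] a j by (auto simp: Hom_def)
      ultimately show ?thesis using 1 False by simp
    qed (use 1 in simp)
  qed
  have "inj_on \<Phi> (carrier (sum_group I (\<lambda>i. HomGrp C A (X i))))"
  proof (rule inj_onI)
    fix \<phi> \<psi> assume "\<phi> \<in> carrier (sum_group I (\<lambda>i. HomGrp C A (X i)))" "\<psi> \<in> carrier (sum_group I (\<lambda>i. HomGrp C A (X i)))"
      and eq: "\<Phi> \<phi> = \<Phi> \<psi>"
    note \<phi> = this(1,2)
    have "\<phi> j = \<psi> j" if "j \<in> I" for j using proj[OF \<phi>(1) that] proj[OF \<phi>(2) that] eq by simp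
    moreover have "\<phi> \<in> extensional I" "\<psi> \<in> extensional I" using \<phi> carr by (auto simp: PiE_def)
    ultimately show "\<phi> = \<psi>" by (meson extensionalityI)
  qed
  moreover have "h \<in> \<Phi> ` carrier (sum_group I (\<lambda>i. HomGrp C A (X i)))" if h: "h \<in> Hom C A P" for h
  proof -
    obtain F e where F: "finite F" "F \<subseteq> I" "is_trunc I P \<iota> F e" "e \<cdot> h = h"
      using fs[OF I P h] by (auto simp: finitely_supported_def)
    \<comment> \<open>The preimage of \<open>h\<close> has the components of \<open>h\<close> on
      \<open>F\<close> and zero elsewhere; it is sent to the truncation of \<open>h\<close>, which
      is \<open>h\<close>.\<close>
    define \<phi> where "\<phi> = (\<lambda>i\<in>I. if i \<in> F then p i \<cdot> h else Zero C A (X i))"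
    have \<phi>1: "\<phi> i \<in> Hom C A (X i)" if "i \<in> I" for i
      using that p(1)[OF that] h a A by (auto simp: \<phi>_def Hom_def)
    have "{i \<in> I. \<phi> i \<noteq> Zero C A (X i)} \<subseteq> F" by (auto simp: \<phi>_def)
    then have "finite {i \<in> I. \<phi> i \<noteq> Zero C A (X i)}" using F finite_subset by blast
    then have "\<phi> \<in> carrier (sum_group I (\<lambda>i. HomGrp C A (X i)))"
      unfolding carr using \<phi>1 by (auto simp: \<phi>_def)
    moreover have "\<Phi> \<phi> = h"
    proof -
      have "\<Phi> \<phi> = gfinprod (HomGrp C A P) (\<lambda>i. \<iota> i \<cdot> (p i \<cdot> h)) F"
        unfolding \<Phi>_def
      proof (rule G.gfinprod_mono_neutral_cong_right[OF F(2)])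
        show "\<iota> i \<cdot> \<phi> i = \<one>\<^bsub>HomGrp C A P\<^esub>" if "i \<in> I - F" for i using that a A by (auto simp: \<phi>_def)
        show "(\<lambda>i. \<iota> i \<cdot> \<phi> i) \<in> I \<rightarrow> carrier (HomGrp C A P)" using a \<phi>1 by (auto simp: Hom_def)
        show "\<And>x. x \<in> F \<Longrightarrow> \<iota> x \<cdot> \<phi> x = \<iota> x \<cdot> (p x \<cdot> h)" using F by (auto simp: \<phi>_def)
      qed
      also have "\<dots> = finprod (HomGrp C A P) (\<lambda>i. \<iota> i \<cdot> (p i \<cdot> h)) F"
        by (rule G.gfinprod_eq_finprod) (use F a p(1) h in \<open>auto simp: Hom_def\<close>)
      also have "\<dots> = e \<cdot> h" by (rule trunc_finprod[OF P h p F(1-3)])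
      finally show ?thesis using F by simp
    qed
    ultimately show ?thesis by blast
  qed
  moreover have "\<Phi> ` carrier (sum_group I (\<lambda>i. HomGrp C A (X i))) \<subseteq> Hom C A P" using hom by (auto simp: hom_def)
  ultimately have "\<Phi> \<in> iso (sum_group I (\<lambda>i. HomGrp C A (X i))) (HomGrp C A P)"
    using hom unfolding iso_def bij_betw_def by auto
  then show "(\<lambda>\<phi>. gfinprod (HomGrp C A P) (\<lambda>i. \<iota> i \<cdot> \<phi> i) I) \<in> iso (sum_group I (\<lambda>i. HomGrp C A (X i))) (HomGrp C A P)"
    by (simp add: \<Phi>_def)
qed (rule A)

end

section \<open>Compact objects under suspension, desuspension, cones and biproducts\<close>

context triangulated_category
begin

text \<open>A test object is isomorphic to some suspension, and full faithfulness then desuspends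
  both the maps into it and the equations between them.\<close>

lemma susp_coproduct:
  assumes P: "is_coproduct T I X P \<iota>"
  shows "is_coproduct T I (\<lambda>i. Susp T (X i)) (Susp T P) (\<lambda>i. SuspM T (\<iota> i))"
proof (rule is_coproductI)
  note a = coproduct_arr[OF P]
  show "Susp T P \<in> Obj T" using a by simp
  show "SuspM T (\<iota> i) \<in> Hom T (Susp T (X i)) (Susp T P)" if "i \<in> I" for i using a that by (simp add: Hom_def)
  fix Y assume "Y \<in> Obj T"
  then obtain Y' \<theta> where \<theta>: "Y' \<in> Obj T" "\<theta> \<in> Hom T (Susp T Y') Y" "iso_arrow T \<theta>" using desusp by blast
  then have t: "\<theta> \<in> Arr T" "Dom T \<theta> = Susp T Y'" "Cod T \<theta> = Y" by (auto simp: Hom_def)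
  {
    fix f assume f: "\<And>i. i \<in> I \<Longrightarrow> f i \<in> Hom T (Susp T (X i)) Y"
    have "\<forall>i \<in> I. \<exists>g. g \<in> Hom T (X i) Y' \<and> SuspM T g = inv_arrow T \<theta> \<cdot> f i"
    proof
      fix i assume i: "i \<in> I"
      have "inv_arrow T \<theta> \<cdot> f i \<in> Hom T (Susp T (X i)) (Susp T Y')" using f[OF i] t \<theta>(3) by (auto simp: Hom_def)
      from susp_full[OF this a(5)[OF i] \<theta>(1)] show "\<exists>g. g \<in> Hom T (X i) Y' \<and> SuspM T g = inv_arrow T \<theta> \<cdot> f i" by blast
    qed
    then obtain g where g: "\<forall>i \<in> I. g i \<in> Hom T (X i) Y' \<and> SuspM T (g i) = inv_arrow T \<theta> \<cdot> f i" by (rule bchoice[THEN exE])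
    obtain h where h: "h \<in> Hom T P Y'" "\<And>i. i \<in> I \<Longrightarrow> h \<cdot> \<iota> i = g i"
      by (rule coproduct_desc[OF P \<theta>(1), of g]) (use g in auto)
    have "\<theta> \<cdot> SuspM T h \<cdot> SuspM T (\<iota> i) = f i" if i: "i \<in> I" for i
    proof -
      have "\<theta> \<cdot> SuspM T h \<cdot> SuspM T (\<iota> i) = \<theta> \<cdot> SuspM T (h \<cdot> \<iota> i)"
        using h(1) a i t by (simp add: Hom_def comp_assoc susp_comp)
      then show ?thesis using h(2)[OF i] g i f[OF i] t \<theta>(3) by (auto simp: Hom_def)
    qed
    then show "\<exists>h \<in> Hom T (Susp T P) Y. \<forall>i \<in> I. h \<cdot> SuspM T (\<iota> i) = f i"
      using h(1) t by (intro bexI[of _ "\<theta> \<cdot> SuspM T h"]) (auto simp: Hom_def)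
  }
  fix f g assume fg: "f \<in> Hom T (Susp T P) Y" "g \<in> Hom T (Susp T P) Y" "\<And>i. i \<in> I \<Longrightarrow> f \<cdot> SuspM T (\<iota> i) = g \<cdot> SuspM T (\<iota> i)"
  have "inv_arrow T \<theta> \<cdot> f \<in> Hom T (Susp T P) (Susp T Y')" "inv_arrow T \<theta> \<cdot> g \<in> Hom T (Susp T P) (Susp T Y')"
    using fg t \<theta>(3) by (auto simp: Hom_def)
  from susp_full[OF this(1) a(1) \<theta>(1)] susp_full[OF this(2) a(1) \<theta>(1)] obtain f' g'
    where f': "f' \<in> Hom T P Y'" "SuspM T f' = inv_arrow T \<theta> \<cdot> f" and g': "g' \<in> Hom T P Y'" "SuspM T g' = inv_arrow T \<theta> \<cdot> g" by metis
  have "f' = g'"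
  proof (rule coproduct_eqI[OF P f'(1) g'(1)])
    fix i assume i: "i \<in> I"
    show "f' \<cdot> \<iota> i = g' \<cdot> \<iota> i"
    proof (rule susp_inj)
      show "f' \<cdot> \<iota> i \<in> Hom T (X i) Y'" "g' \<cdot> \<iota> i \<in> Hom T (X i) Y'" using f' g' a i by (auto simp: Hom_def)
      have "SuspM T (f' \<cdot> \<iota> i) = inv_arrow T \<theta> \<cdot> (f \<cdot> SuspM T (\<iota> i))"
        using f' fg(1) a i t \<theta>(3) by (simp add: Hom_def susp_comp comp_assoc)
      also have "\<dots> = SuspM T (g' \<cdot> \<iota> i)" unfolding fg(3)[OF i]
        using g' fg(2) a i t \<theta>(3) by (simp add: Hom_def susp_comp comp_assoc)
      finally show "SuspM T (f' \<cdot> \<iota> i) = SuspM T (g' \<cdot> \<iota> i)" .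
    qed
  qed
  then have "inv_arrow T \<theta> \<cdot> f = inv_arrow T \<theta> \<cdot> g" using f' g' by simp
  then show "f = g" by (rule iso_monic[rotated 3, where X="Susp T P"]) (use fg t \<theta>(3) in \<open>auto simp: Hom_def\<close>)
qed

text \<open>If the truncation \<open>e\<close> fixes \<open>w \<cdot> g\<close>, then the difference
  of \<open>w\<close> and \<open>e \<cdot> w\<close> kills \<open>g\<close> and factors through
  \<open>r\<close>, hence over the compact suspension of \<open>Dom T f\<close>. Thus
  \<open>w\<close> is the sum of two finitely supported maps.\<close>

lemma compact_cone:
  fixes \<kappa> :: "'u rel"
  assumes D: "(f, g, r) \<in> Dist T" and K: "compact_object T \<kappa> (Cod T f)" "compact_object T \<kappa> (Susp T (Dom T f))"
  shows "compact_object T \<kappa> (Cod T g)"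
proof (rule compact_objectI)
  note a = Dist_arr[OF D]
  show "Cod T g \<in> Obj T" using a by simp
  fix I X P \<iota> w assume *: "small \<kappa> (I :: 'u set)" "is_coproduct T I X P \<iota>" "w \<in> Hom T (Cod T g) P"
  have w: "w \<in> Arr T" "Dom T w = Cod T g" "Cod T w = P" using * by (auto simp: Hom_def)
  have "w \<cdot> g \<in> Hom T (Cod T f) P" using a w by (auto simp: Hom_def)
  from compact_finitely_supported[OF K(1) *(1,2) this] obtain F e
    where F: "finite F" "F \<subseteq> I" "is_trunc I P \<iota> F e" "e \<cdot> (w \<cdot> g) = w \<cdot> g" by (auto simp: finitely_supported_def)
  note ea = trunc_arr[OF F(3)]
  have "Sub w (e \<cdot> w) \<cdot> g = Zero T (Dom T g) P" using F(4) a w ea by (simp add: comp_sub comp_assoc)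
  then obtain v where v: "v \<in> Hom T (Susp T (Dom T f)) P" "v \<cdot> r = Sub w (e \<cdot> w)"
    using Dist_coexact[OF Dist_rot[OF D], of "Sub w (e \<cdot> w)" P] a w ea by (auto simp: Hom_def)
  have "finitely_supported I P \<iota> (v \<cdot> r)"
    by (rule finitely_supported_comp[OF *(2) compact_finitely_supported[OF K(2) *(1,2) v(1)] v(1), where B="Cod T g"])
      (use a in \<open>auto simp: Hom_def\<close>)
  moreover have "finitely_supported I P \<iota> (e \<cdot> w)"
    by (rule finitely_supported_trunc[OF *(2) F(1-3) *(3)])
  ultimately have "finitely_supported I P \<iota> (Add T (v \<cdot> r) (e \<cdot> w))"
    using finitely_supported_add[OF *(2), of "v \<cdot> r" "Cod T g" "e \<cdot> w"] v(1) w a ea by (simp add: Hom_def)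
  then show "finitely_supported I P \<iota> w" using v w ea by (simp add: sub_add)
qed

text \<open>A map from \<open>L\<close> into a coproduct is suspended; the resulting map has finite
  support in the suspended coproduct, and faithfulness of the suspension returns this support to the
  original map.\<close>

lemma compact_desusp:
  fixes \<kappa> :: "'u rel"
  assumes K: "compact_object T \<kappa> K" and \<theta>: "\<theta> \<in> Hom T (Susp T L) K" "iso_arrow T \<theta>" and L: "L \<in> Obj T"
  shows "compact_object T \<kappa> L"
proof (rule compact_objectI[OF L])
  fix I X P \<iota> h assume *: "small \<kappa> (I :: 'u set)" "is_coproduct T I X P \<iota>" "h \<in> Hom T L P"
  have t: "\<theta> \<in> Arr T" "Dom T \<theta> = Susp T L" "Cod T \<theta> = K" using \<theta> by (auto simp: Hom_def)
  have h: "h \<in> Arr T" "Dom T h = L" "Cod T h = P" using * by (auto simp: Hom_def)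
  note SP = susp_coproduct[OF *(2)]
  have "SuspM T h \<cdot> inv_arrow T \<theta> \<in> Hom T K (Susp T P)" using t h \<theta>(2) by (auto simp: Hom_def)
  from compact_finitely_supported[OF K *(1) SP this] obtain F e where
    F: "finite F" "F \<subseteq> I" "is_trunc I (Susp T P) (\<lambda>i. SuspM T (\<iota> i)) F e"
      "e \<cdot> (SuspM T h \<cdot> inv_arrow T \<theta>) = SuspM T h \<cdot> inv_arrow T \<theta>" by (auto simp: finitely_supported_def)
  note ea = trunc_arr[OF F(3)]
  show "finitely_supported I P \<iota> h"
  proof (rule finitely_supportedI[OF *(2) F(1,2)])
    fix d assume d: "is_trunc I P \<iota> F d"
    note da = trunc_arr[OF d]
    have "is_trunc I (Susp T P) (\<lambda>i. SuspM T (\<iota> i)) F (SuspM T d)"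
      using d coproduct_arr[OF *(2)] da by (auto simp: is_trunc_def Hom_def simp flip: susp_comp)
    then have "SuspM T d \<cdot> (SuspM T h \<cdot> inv_arrow T \<theta>) = SuspM T h \<cdot> inv_arrow T \<theta>"
      by (rule trunc_fixes_mono[OF SP F(3) _ subset_refl]) (use F(4) h t \<theta>(2) in auto)
    then have "SuspM T (d \<cdot> h) \<cdot> inv_arrow T \<theta> = SuspM T h \<cdot> inv_arrow T \<theta>"
      using h t da \<theta>(2) by (simp add: susp_comp comp_assoc)
    then have "SuspM T (d \<cdot> h) = SuspM T h"
      by (rule iso_epic[rotated 3, where X="Susp T P"]) (use h t da \<theta>(2) in \<open>auto simp: Hom_def\<close>)
    then show "d \<cdot> h = h" by (rule susp_inj[rotated 2, where X=L and Y=P]) (use h da in \<open>auto simp: Hom_def\<close>)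
  qed
qed

text \<open>Compactness of a suspension is tested against arbitrary coproducts. Each of them is
  isomorphic to a suspended coproduct, with structure maps obtained by fullness and a compatible
  isomorphism on every summand.\<close>

lemma desusp_coproduct:
  assumes P: "is_coproduct T I X P \<iota>"
  obtains X' P' \<iota>' \<theta> where "is_coproduct T I X' P' \<iota>'" "\<theta> \<in> Hom T (Susp T P') P" "iso_arrow T \<theta>"
    "\<forall>i \<in> I. \<exists>t. iso_arrow T t \<and> t \<in> Hom T (Susp T (X' i)) (X i) \<and> \<iota> i \<cdot> t = \<theta> \<cdot> SuspM T (\<iota>' i)"
proof -
  note a = coproduct_arr[OF P]
  obtain P' \<theta> where \<theta>: "P' \<in> Obj T" "\<theta> \<in> Hom T (Susp T P') P" "iso_arrow T \<theta>" using desusp[OF a(1)] by blast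
  then have \<theta>a: "\<theta> \<in> Arr T" "Dom T \<theta> = Susp T P'" "Cod T \<theta> = P" by (auto simp: Hom_def)
  define R where "R i q \<longleftrightarrow> (case q of (Y, t, j) \<Rightarrow> Y \<in> Obj T \<and> t \<in> Hom T (Susp T Y) (X i) \<and> iso_arrow T t \<and>
      j \<in> Hom T Y P' \<and> SuspM T j = inv_arrow T \<theta> \<cdot> (\<iota> i \<cdot> t))" for i q
  have "\<forall>i \<in> I. \<exists>q. R i q"
  proof
    fix i assume i: "i \<in> I"
    obtain Y t where t: "Y \<in> Obj T" "t \<in> Hom T (Susp T Y) (X i)" "iso_arrow T t" using desusp[OF a(5)[OF i]] by blast
    have "inv_arrow T \<theta> \<cdot> (\<iota> i \<cdot> t) \<in> Hom T (Susp T Y) (Susp T P')" using t \<theta>a \<theta>(3) a i by (auto simp: Hom_def)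
    from susp_full[OF this t(1) \<theta>(1)] obtain j where "j \<in> Hom T Y P'" "SuspM T j = inv_arrow T \<theta> \<cdot> (\<iota> i \<cdot> t)" .
    then show "\<exists>q. R i q" using t by (intro exI[of _ "(Y, t, j)"]) (simp add: R_def)
  qed
  then obtain q where q: "\<forall>i \<in> I. R i (q i)" by (rule bchoice[THEN exE])
  define X' t j where "X' i = fst (q i)" and "t i = fst (snd (q i))" and "j i = snd (snd (q i))" for i
  have R: "X' i \<in> Obj T" "t i \<in> Hom T (Susp T (X' i)) (X i)" "iso_arrow T (t i)" "j i \<in> Hom T (X' i) P'"
      "SuspM T (j i) = inv_arrow T \<theta> \<cdot> (\<iota> i \<cdot> t i)" if "i \<in> I" for i
    using q that by (simp_all add: R_def X'_def t_def j_def case_prod_unfold)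
  have ja: "j i \<in> Arr T" "Dom T (j i) = X' i" "Cod T (j i) = P'" and ta: "t i \<in> Arr T" "Dom T (t i) = Susp T (X' i)" "Cod T (t i) = X i"
    if "i \<in> I" for i using R(2,4)[OF that] by (auto simp: Hom_def)
  have tj: "\<iota> i \<cdot> t i = \<theta> \<cdot> SuspM T (j i)" if "i \<in> I" for i
    using R[OF that] \<theta>a \<theta>(3) a that ta by simp
  have it: "\<iota> i = \<theta> \<cdot> (SuspM T (j i) \<cdot> inv_arrow T (t i))" if i: "i \<in> I" for i
  proof -
    have "\<iota> i = (\<iota> i \<cdot> t i) \<cdot> inv_arrow T (t i)" using a i R(3)[OF i] ta[OF i] by (simp add: comp_assoc)
    then show ?thesis unfolding tj[OF i] using a i R(3)[OF i] ta[OF i] ja[OF i] \<theta>a by (simp add: comp_assoc)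
  qed
  have "is_coproduct T I X' P' j"
  proof (rule is_coproductI[OF \<theta>(1)])
    show "j i \<in> Hom T (X' i) P'" if "i \<in> I" for i using R that by blast
    fix Y assume Y: "Y \<in> Obj T"
    {
      fix f assume f: "\<And>i. i \<in> I \<Longrightarrow> f i \<in> Hom T (X' i) Y"
      have "SuspM T (f i) \<cdot> inv_arrow T (t i) \<in> Hom T (X i) (Susp T Y)" if i: "i \<in> I" for i
        using f[OF i] R(3)[OF i] ta[OF i] by (auto simp: Hom_def)
      then obtain h where h: "h \<in> Hom T P (Susp T Y)" "\<And>i. i \<in> I \<Longrightarrow> h \<cdot> \<iota> i = SuspM T (f i) \<cdot> inv_arrow T (t i)"
        using coproduct_desc[OF P, of "Susp T Y" "\<lambda>i. SuspM T (f i) \<cdot> inv_arrow T (t i)"] Y by auto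
      have ha: "h \<in> Arr T" "Dom T h = P" "Cod T h = Susp T Y" using h by (auto simp: Hom_def)
      have "h \<cdot> \<theta> \<in> Hom T (Susp T P') (Susp T Y)" using h \<theta>a by (auto simp: Hom_def)
      from susp_full[OF this \<theta>(1) Y] obtain k where k: "k \<in> Hom T P' Y" "SuspM T k = h \<cdot> \<theta>" .
      have "k \<cdot> j i = f i" if i: "i \<in> I" for i
      proof (rule susp_inj)
        show "k \<cdot> j i \<in> Hom T (X' i) Y" "f i \<in> Hom T (X' i) Y" using k ja[OF i] f[OF i] by (auto simp: Hom_def)
        have "SuspM T (k \<cdot> j i) = h \<cdot> (\<theta> \<cdot> SuspM T (j i))"
          using k ja[OF i] ha \<theta>a by (simp add: Hom_def susp_comp comp_assoc)
        also have "\<dots> = (h \<cdot> \<iota> i) \<cdot> t i" using tj[OF i, symmetric] ha a i ta[OF i] by (simp add: comp_assoc)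
        also have "\<dots> = SuspM T (f i)" using h(2)[OF i] f[OF i] ta[OF i] R(3)[OF i] by (simp add: comp_assoc Hom_def)
        finally show "SuspM T (k \<cdot> j i) = SuspM T (f i)" .
      qed
      then show "\<exists>h \<in> Hom T P' Y. \<forall>i \<in> I. h \<cdot> j i = f i" using k(1) by blast
    }
    fix f g assume fg: "f \<in> Hom T P' Y" "g \<in> Hom T P' Y" "\<And>i. i \<in> I \<Longrightarrow> f \<cdot> j i = g \<cdot> j i"
    have fga: "f \<in> Arr T" "Dom T f = P'" "Cod T f = Y" "g \<in> Arr T" "Dom T g = P'" "Cod T g = Y" using fg by (auto simp: Hom_def)
    have s: "SuspM T u \<cdot> inv_arrow T \<theta> \<cdot> \<iota> i = SuspM T (u \<cdot> j i) \<cdot> inv_arrow T (t i)"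
      if i: "i \<in> I" and u: "u \<in> Hom T P' Y" for i u
    proof -
      have u: "u \<in> Arr T" "Dom T u = P'" "Cod T u = Y" using u by (auto simp: Hom_def)
      have "SuspM T u \<cdot> inv_arrow T \<theta> \<cdot> \<iota> i = SuspM T u \<cdot> (inv_arrow T \<theta> \<cdot> (\<theta> \<cdot> (SuspM T (j i) \<cdot> inv_arrow T (t i))))"
        using it[OF i] u a i \<theta>a \<theta>(3) ja[OF i] ta[OF i] R(3)[OF i] by (simp add: comp_assoc)
      then show ?thesis using u \<theta>a \<theta>(3) ja[OF i] ta[OF i] R(3)[OF i] by (simp add: susp_comp comp_assoc)
    qed
    have "SuspM T f \<cdot> inv_arrow T \<theta> = SuspM T g \<cdot> inv_arrow T \<theta>"
      by (rule coproduct_eqI[OF P, where Y="Susp T Y"])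
        (use s fg fga \<theta>a \<theta>(3) in \<open>auto simp: Hom_def\<close>)
    then have "SuspM T f = SuspM T g" by (rule iso_epic[rotated 3, where X="Susp T Y"]) (use fga \<theta>a \<theta>(3) in \<open>auto simp: Hom_def\<close>)
    then show "f = g" by (rule susp_inj[OF fg(1,2)])
  qed
  moreover have "\<forall>i \<in> I. \<exists>t. iso_arrow T t \<and> t \<in> Hom T (Susp T (X' i)) (X i) \<and> \<iota> i \<cdot> t = \<theta> \<cdot> SuspM T (j i)"
    using R tj by blast
  ultimately show thesis using that \<theta>(2,3) by blast
qed

text \<open>Along the desuspended coproduct, a map from the suspension of \<open>K\<close> becomes a
  map from \<open>K\<close>. The isomorphism \<open>\<theta>\<close> intertwines the truncations of
  the two coproducts, so finite support is carried back.\<close>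

lemma compact_susp:
  fixes \<kappa> :: "'u rel"
  assumes K: "compact_object T \<kappa> K"
  shows "compact_object T \<kappa> (Susp T K)"
proof (rule compact_objectI)
  have KO: "K \<in> Obj T" using K by (simp add: compact_object_def)
  then show "Susp T K \<in> Obj T" by simp
  fix I X P \<iota> h assume *: "small \<kappa> (I :: 'u set)" "is_coproduct T I X P \<iota>" "h \<in> Hom T (Susp T K) P"
  note a = coproduct_arr[OF *(2)]
  obtain X' P' \<iota>' \<theta> where P': "is_coproduct T I X' P' \<iota>'" and \<theta>: "\<theta> \<in> Hom T (Susp T P') P" "iso_arrow T \<theta>"
    and t: "\<forall>i \<in> I. \<exists>t. iso_arrow T t \<and> t \<in> Hom T (Susp T (X' i)) (X i) \<and> \<iota> i \<cdot> t = \<theta> \<cdot> SuspM T (\<iota>' i)"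
    by (rule desusp_coproduct[OF *(2)])
  note a' = coproduct_arr[OF P']
  have \<theta>a: "\<theta> \<in> Arr T" "Dom T \<theta> = Susp T P'" "Cod T \<theta> = P" using \<theta> by (auto simp: Hom_def)
  have h: "h \<in> Arr T" "Dom T h = Susp T K" "Cod T h = P" using * by (auto simp: Hom_def)
  have "inv_arrow T \<theta> \<cdot> h \<in> Hom T (Susp T K) (Susp T P')" using h \<theta>a \<theta>(2) by (auto simp: Hom_def)
  from susp_full[OF this KO a'(1)] obtain k where k: "k \<in> Hom T K P'" "SuspM T k = inv_arrow T \<theta> \<cdot> h" .
  have ka: "k \<in> Arr T" "Dom T k = K" "Cod T k = P'" using k by (auto simp: Hom_def)
  obtain F e where F: "finite F" "F \<subseteq> I" "is_trunc I P' \<iota>' F e" "e \<cdot> k = k"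
    using compact_finitely_supported[OF K *(1) P' k(1)] by (auto simp: finitely_supported_def)
  note ea = trunc_arr[OF F(3)]
  show "finitely_supported I P \<iota> h"
  proof (rule finitely_supportedI[OF *(2) F(1,2)])
    fix d assume d: "is_trunc I P \<iota> F d"
    note da = trunc_arr[OF d]
    have "d \<cdot> \<theta> = \<theta> \<cdot> SuspM T e"
    proof (rule coproduct_eqI[OF susp_coproduct[OF P'], where Y=P])
      show "d \<cdot> \<theta> \<in> Hom T (Susp T P') P" "\<theta> \<cdot> SuspM T e \<in> Hom T (Susp T P') P" using da ea \<theta>a by (auto simp: Hom_def)
      fix i assume i: "i \<in> I"
      obtain s where s: "iso_arrow T s" "s \<in> Hom T (Susp T (X' i)) (X i)" "\<iota> i \<cdot> s = \<theta> \<cdot> SuspM T (\<iota>' i)" using t i by blast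
      have sa: "s \<in> Arr T" "Dom T s = Susp T (X' i)" "Cod T s = X i" using s by (auto simp: Hom_def)
      have 1: "e \<cdot> \<iota>' i = (if i \<in> F then \<iota>' i else Zero T (X' i) P')" using F(3) i a' by (auto simp: is_trunc_def)
      have 2: "d \<cdot> \<iota> i = (if i \<in> F then \<iota> i else Zero T (X i) P)" using d i a by (auto simp: is_trunc_def)
      have "d \<cdot> \<theta> \<cdot> SuspM T (\<iota>' i) = d \<cdot> (\<iota> i \<cdot> s)" using s(3) da \<theta>a a' i by (simp add: comp_assoc)
      also have "\<dots> = (d \<cdot> \<iota> i) \<cdot> s" using da a i sa by (simp add: comp_assoc)
      also have "\<dots> = (if i \<in> F then \<theta> \<cdot> SuspM T (\<iota>' i) else Zero T (Susp T (X' i)) P)"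
        using 2 s(3) sa a by simp
      also have "\<dots> = \<theta> \<cdot> SuspM T (e \<cdot> \<iota>' i)" unfolding 1 using \<theta>a a' i by simp
      finally show "d \<cdot> \<theta> \<cdot> SuspM T (\<iota>' i) = \<theta> \<cdot> SuspM T e \<cdot> SuspM T (\<iota>' i)"
        using ea a' i \<theta>a by (simp add: susp_comp comp_assoc)
    qed
    moreover have "h = \<theta> \<cdot> SuspM T k" using k(2) h \<theta>a \<theta>(2) by simp
    ultimately have "d \<cdot> h = \<theta> \<cdot> SuspM T (e \<cdot> k)" using comp_assoc[of "SuspM T k" \<theta> d] ea ka da \<theta>a by (simp add: susp_comp comp_assoc)
    then show "d \<cdot> h = h" using F(4) \<open>h = \<theta> \<cdot> SuspM T k\<close> by simp
  qed
qed

lemma compact_zero: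
  fixes \<kappa> :: "'u rel"
  assumes "zero_object T Z"
  shows "compact_object T \<kappa> Z"
proof (rule compact_objectI)
  show Z: "Z \<in> Obj T" using assms by (simp add: zero_object_def)
  fix I X P \<iota> h assume *: "small \<kappa> (I :: 'u set)" "is_coproduct T I X P \<iota>" "h \<in> Hom T Z P"
  have h: "h = Zero T Z P" using zero_object_Hom(2)[OF assms *(3)] .
  show "finitely_supported I P \<iota> h"
    by (rule finitely_supportedI[OF *(2), where F="{}"]) (use h Z trunc_arr[of I P \<iota> "{}"] in auto)
qed

text \<open>A map out of the biproduct is the sum of its restrictions to the two summands, each
  composed with the projection.\<close>

lemma compact_biproduct:
  fixes \<kappa> :: "'u rel"
  assumes K: "compact_object T \<kappa> X" "compact_object T \<kappa> Y"
    and "i \<in> Hom T X P" "j \<in> Hom T Y P" "p \<in> Hom T P X" "q \<in> Hom T P Y" "Add T (i \<cdot> p) (j \<cdot> q) = Idn T P"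
  shows "compact_object T \<kappa> P"
proof (rule compact_objectI)
  show PO: "P \<in> Obj T" using assms(3) Hom_obj by blast
  fix I Z Q \<iota> h assume *: "small \<kappa> (I :: 'u set)" "is_coproduct T I Z Q \<iota>" "h \<in> Hom T P Q"
  have 1: "h \<cdot> i \<in> Hom T X Q" "h \<cdot> j \<in> Hom T Y Q" using * assms Comp_Hom by blast+
  have "finitely_supported I Q \<iota> (h \<cdot> i \<cdot> p)" "finitely_supported I Q \<iota> (h \<cdot> j \<cdot> q)"
    by (rule finitely_supported_comp[OF *(2) compact_finitely_supported[OF K(1) *(1,2) 1(1)] 1(1) assms(5)],
        rule finitely_supported_comp[OF *(2) compact_finitely_supported[OF K(2) *(1,2) 1(2)] 1(2) assms(6)])
  then have "finitely_supported I Q \<iota> (Add T (h \<cdot> i \<cdot> p) (h \<cdot> j \<cdot> q))"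
    using finitely_supported_add[OF *(2), of "h \<cdot> i \<cdot> p" P "h \<cdot> j \<cdot> q"] 1 assms Comp_Hom by blast
  moreover have "Add T (h \<cdot> i \<cdot> p) (h \<cdot> j \<cdot> q) = h \<cdot> Add T (i \<cdot> p) (j \<cdot> q)"
    using * assms(3-6) by (auto simp: comp_add comp_assoc Hom_def)
  ultimately show "finitely_supported I Q \<iota> h" using assms(7) * PO by (auto simp: Hom_def)
qed

end

section \<open>Cells\<close>

context big_tt_category
begin

section \<open>Arithmetic of small sets, and coproducts over small index sets\<close>

lemma kappa: "Card_order \<kappa>" "regularCard \<kappa>" "natLeq <o \<kappa>" "infinite (Field \<kappa>)" "stable \<kappa>"
proof -
  show 1: "Card_order \<kappa>" "regularCard \<kappa>" "natLeq <o \<kappa>" using regular_uncountable by (auto simp: regular_uncountable_def)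
  then show 2: "infinite (Field \<kappa>)"
    using ordLess_transitive[OF 1(3), of natLeq] card_of_Field_ordIso[OF 1(1)]
      ordIso_ordLess_trans[OF ordIso_symmetric[OF card_of_Field_ordIso[OF 1(1)]], of natLeq] ordLess_irreflexive
    unfolding finite_iff_ordLess_natLeq by blast
  show "stable \<kappa>" by (rule regularCard_stable[OF 1(1) 2 1(2)])
qed

lemma small_subset: "\<lbrakk>small \<kappa> B; A \<subseteq> B\<rbrakk> \<Longrightarrow> small \<kappa> A"
  unfolding small_def by (rule ordLeq_ordLess_trans[OF card_of_mono1])

lemma small_image: "small \<kappa> A \<Longrightarrow> small \<kappa> (f ` A)"
  unfolding small_def by (rule ordLeq_ordLess_trans[OF card_of_image])

lemma small_UN: "\<lbrakk>small \<kappa> A; \<And>a. a \<in> A \<Longrightarrow> small \<kappa> (F a)\<rbrakk> \<Longrightarrow> small \<kappa> (\<Union>a \<in> A. F a)"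
  unfolding small_def by (rule stable_UNION[OF kappa(5)])

lemma small_nat: "small \<kappa> (UNIV :: nat set)"
  unfolding small_def using card_of_nat kappa(3) ordIso_ordLess_trans by blast

lemma small_finite: "finite A \<Longrightarrow> small \<kappa> A"
  unfolding small_def
  by (rule ordLess_transitive[OF _ kappa(3)]) (simp add: finite_iff_ordLess_natLeq)

lemma small_Un: "\<lbrakk>small \<kappa> A; small \<kappa> B\<rbrakk> \<Longrightarrow> small \<kappa> (A \<union> B)"
  using small_UN[of "{A, B}" id] small_finite[of "{A, B}"] by auto

text \<open>A set of cardinality below \<open>\<kappa>\<close> injects into the field of
  \<open>\<kappa>\<close>, so every small set has a copy in the type in which the axioms take their
  index sets.\<close>

lemma small_transport:
  assumes "small \<kappa> A"
  obtains I :: "'u set" and b where "bij_betw b I A" "small \<kappa> I"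
proof -
  have "|A| \<le>o |Field \<kappa>|"
    using assms kappa(1) unfolding small_def
    by (meson card_of_Field_ordIso ordIso_symmetric ordLess_imp_ordLeq ordLeq_ordIso_trans)
  then obtain f where f: "inj_on f A" "f ` A \<subseteq> Field \<kappa>" using card_of_ordLeq[of A "Field \<kappa>"] by blast
  have "bij_betw (inv_into A f) (f ` A) A" by (rule bij_betw_inv_into) (use f in \<open>auto simp: bij_betw_def\<close>)
  then show thesis using that small_image[OF assms] by blast
qed

lemma small_coproduct_exists:
  assumes A: "small \<kappa> A" and E: "\<And>a. a \<in> A \<Longrightarrow> E a \<in> Obj T"
  obtains P \<iota> where "is_coproduct T A E P \<iota>"
proof -
  obtain I :: "'u set" and b where b: "bij_betw b I A" "small \<kappa> I" using small_transport[OF A] .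
  have bI: "b i \<in> A" if "i \<in> I" for i using b(1) that by (auto simp: bij_betw_def)
  obtain P \<iota> where P: "is_coproduct T I (E \<circ> b) P \<iota>"
    using coproduct_exists[OF b(2), of "E \<circ> b"] E bI by auto
  have "is_coproduct T I (E \<circ> b) P ((\<iota> \<circ> inv_into I b) \<circ> b)"
  proof -
    have "((\<iota> \<circ> inv_into I b) \<circ> b) i = \<iota> i" if "i \<in> I" for i
      using that b(1) by (simp add: bij_betw_def)
    then show ?thesis using P unfolding is_coproduct_def by simp
  qed
  from reindex_coproduct[OF b(1) this] that show thesis by blast
qed

lemma compact_small_coproduct:
  assumes K: "compact_object T \<kappa> K" and A: "small \<kappa> A" and P: "is_coproduct T A E P \<iota>" and h: "h \<in> Hom T K P"
  shows "finitely_supported A P \<iota> h"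
proof -
  obtain I :: "'u set" and b where b: "bij_betw b I A" "small \<kappa> I" using small_transport[OF A] .
  have bI: "A = b ` I" "inj_on b I" using b(1) by (auto simp: bij_betw_def)
  note a = coproduct_arr[OF P]
  have "bij_betw (inv_into I b) A I" by (rule bij_betw_inv_into[OF b(1)])
  moreover have "is_coproduct T A ((E \<circ> b) \<circ> inv_into I b) P ((\<iota> \<circ> b) \<circ> inv_into I b)"
  proof -
    have "b (inv_into I b i) = i" if "i \<in> A" for i using that bI by (simp add: f_inv_into_f)
    then show ?thesis using P unfolding is_coproduct_def by simp
  qed
  ultimately have P': "is_coproduct T I (E \<circ> b) P (\<iota> \<circ> b)" by (rule reindex_coproduct)
  from compact_finitely_supported[OF K b(2) P' h] obtain F e where
    F: "finite F" "F \<subseteq> I" "is_trunc I P (\<iota> \<circ> b) F e" "e \<cdot> h = h" by (auto simp: finitely_supported_def)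
  have "is_trunc A P \<iota> (b ` F) e"
    unfolding is_trunc_def
  proof (intro conjI ballI)
    show "e \<in> Hom T P P" using F(3) by (simp add: is_trunc_def)
    fix x assume "x \<in> A"
    then obtain i where i: "i \<in> I" "x = b i" using bI by blast
    then have "x \<in> b ` F \<longleftrightarrow> i \<in> F" using bI(2) F(2) by (auto simp: inj_on_def)
    then show "e \<cdot> \<iota> x = (if x \<in> b ` F then \<iota> x else Zero T (Dom T (\<iota> x)) P)"
      using F(3) i by (simp add: is_trunc_def)
  qed
  then show ?thesis using F bI unfolding finitely_supported_def
    by (intro exI[of _ "b ` F"] exI[of _ e]) auto
qed

definition is_biproduct :: "'o \<Rightarrow> 'o \<Rightarrow> 'o \<Rightarrow> bool"
  where "is_biproduct X Y P \<longleftrightarrow> (\<exists>i \<in> Hom T X P. \<exists>j \<in> Hom T Y P. \<exists>p \<in> Hom T P X. \<exists>q \<in> Hom T P Y.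
    p \<cdot> i = Idn T X \<and> q \<cdot> j = Idn T Y \<and> q \<cdot> i = Zero T X Y \<and> p \<cdot> j = Zero T Y X \<and> Add T (i \<cdot> p) (j \<cdot> q) = Idn T P)"

text \<open>
  A small substitute for the class of compact objects: every compact object will turn out to be a
  retract of a cell.
\<close>

definition cell_class :: "'o set \<Rightarrow> bool"
  where "cell_class K \<longleftrightarrow> small \<kappa> K \<and> (\<forall>C \<in> K. compact_object T \<kappa> C) \<and>
    (\<forall>X \<in> Obj T. (\<forall>C \<in> K. Hom T C X = {Zero T C X}) \<longrightarrow> zero_object T X) \<and>
    (\<exists>Z \<in> K. zero_object T Z) \<and> (\<forall>C \<in> K. \<exists>C' \<in> K. isomorphic T (Susp T C') C) \<and>
    (\<forall>f \<in> Arr T. Dom T f \<in> K \<longrightarrow> Cod T f \<in> K \<longrightarrow> (\<exists>g h. (f, g, h) \<in> Dist T \<and> Cod T g \<in> K)) \<and>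
    (\<forall>C \<in> K. \<forall>C' \<in> K. \<exists>P \<in> K. is_biproduct C C' P)"

text \<open>Start from the generators and a zero object, and adjoin countably often one desuspension
  for each object, one cone for each map and one biproduct for each pair. Since Hom sets are small
  and \<open>\<kappa>\<close> is regular and uncountable, every stage and the union of all stages
  remain small.\<close>

lemma cell_class_exists: "\<exists>K. cell_class K"
proof -
  obtain S :: "'o set" where S: "small \<kappa> S" "\<forall>C \<in> S. compact_object T \<kappa> C"
    "\<forall>X \<in> Obj T. (\<forall>C \<in> S. Hom T C X = {Zero T C X}) \<longrightarrow> zero_object T X"
    using compactly_generated by blast
  obtain Z where Z: "zero_object T Z" using zero_object_exists by blast
  \<comment> \<open>Fixed choices make the objects added at each stage images of small sets.\<close>
  define cone where "cone f = (SOME W. \<exists>g h. (f, g, h) \<in> Dist T \<and> Cod T g = W)" for f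
  define des where "des X = (SOME Y. Y \<in> Obj T \<and> isomorphic T (Susp T Y) X)" for X
  define bip where "bip X Y = (SOME P. is_biproduct X Y P)" for X Y
  have cone: "\<exists>g h. (f, g, h) \<in> Dist T \<and> Cod T g = cone f" if "f \<in> Arr T" for f
    unfolding cone_def by (rule someI_ex) (use Dist_cone[OF that] in blast)
  have des: "des X \<in> Obj T \<and> isomorphic T (Susp T (des X)) X" if "X \<in> Obj T" for X
    unfolding des_def by (rule someI_ex) (use Susp_ess_surj[OF that] in blast)
  have bip: "is_biproduct X Y (bip X Y)" if "X \<in> Obj T" "Y \<in> Obj T" for X Y
    unfolding bip_def by (rule someI_ex) (use biproduct_exists[OF that, folded is_biproduct_def] in blast)
  define step where "step A = A \<union> (des ` A \<union> ((\<Union>X \<in> A. \<Union>Y \<in> A. cone ` Hom T X Y) \<union> (\<Union>X \<in> A. bip X ` A)))" for A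
  define st where "st n = (step ^^ n) (insert Z S)" for n
  have st0: "st 0 = insert Z S" and stS: "\<And>n. st (Suc n) = step (st n)" by (auto simp: st_def)
  define K where "K = (\<Union>n. st n)"
  have comp: "\<forall>C \<in> st n. compact_object T \<kappa> C" for n
  proof (induction n)
    case 0
    then show ?case using S(2) compact_zero[OF Z] st0 by auto
  next
    case (Suc n)
    have O: "X \<in> Obj T" if "X \<in> st n" for X using Suc that by (auto simp: compact_object_def)
    have 1: "compact_object T \<kappa> (des X)" if X: "X \<in> st n" for X
    proof -
      obtain \<theta> where "\<theta> \<in> Hom T (Susp T (des X)) X" "iso_arrow T \<theta>" using des[OF O[OF X]] by (auto simp: isomorphic_def)
      then show ?thesis using compact_desusp Suc X des[OF O[OF X]] by blast
    qed
    have 2: "compact_object T \<kappa> (cone f)" if f: "f \<in> Hom T X Y" "X \<in> st n" "Y \<in> st n" for f X Y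
    proof -
      have fa: "f \<in> Arr T" "Dom T f = X" "Cod T f = Y" using f by (auto simp: Hom_def)
      obtain g h where "(f, g, h) \<in> Dist T" "Cod T g = cone f" using cone[OF fa(1)] by blast
      then show ?thesis using compact_cone[of f g h \<kappa>] compact_susp[of \<kappa> X] Suc f fa by auto
    qed
    have 3: "compact_object T \<kappa> (bip X Y)" if XY: "X \<in> st n" "Y \<in> st n" for X Y
    proof -
      obtain i j p q where "i \<in> Hom T X (bip X Y)" "j \<in> Hom T Y (bip X Y)" "p \<in> Hom T (bip X Y) X" "q \<in> Hom T (bip X Y) Y"
        "Add T (i \<cdot> p) (j \<cdot> q) = Idn T (bip X Y)"
        using bip[OF O[OF XY(1)] O[OF XY(2)]] by (auto simp: is_biproduct_def)
      then show ?thesis using compact_biproduct Suc XY by blast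
    qed
    show ?case unfolding stS step_def using Suc 1 2 3 by blast
  qed
  have KO: "X \<in> Obj T" if "X \<in> st n" for X n using comp that by (auto simp: compact_object_def)
  have "small \<kappa> (st n)" for n
  proof (induction n)
    case 0
    then show ?case using small_Un[OF small_finite[of "{Z}"] S(1)] st0 by simp
  next
    case (Suc n)
    show ?case unfolding stS step_def
      by (intro small_Un small_image Suc small_UN Hom_small KO[of _ n])
  qed
  then have smallK: "small \<kappa> K" unfolding K_def by (intro small_UN small_nat)
  have mono: "st m \<subseteq> st n" if "m \<le> n" for m n
    by (rule lift_Suc_mono_le[of st, OF _ that]) (auto simp: stS step_def)
  \<comment> \<open>Two members of the union share a stage, so the next stage contains the cones of
    maps between them and their biproduct.\<close>
  have KK: "\<exists>n. X \<in> st n \<and> Y \<in> st n" if XY: "X \<in> K" "Y \<in> K" for X Y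
  proof -
    obtain m n where "X \<in> st m" "Y \<in> st n" using XY unfolding K_def by blast
    then have "X \<in> st (max m n)" "Y \<in> st (max m n)" using mono[of m "max m n"] mono[of n "max m n"] by auto
    then show ?thesis by blast
  qed
  have stK: "st n \<subseteq> K" "step (st n) \<subseteq> K" for n using stS[of n] by (auto simp: K_def)
  have "cell_class K"
    unfolding cell_class_def
  proof (intro conjI ballI impI)
    show "small \<kappa> K" by (rule smallK)
    show "compact_object T \<kappa> C" if "C \<in> K" for C using comp that by (auto simp: K_def)
    show "zero_object T X" if "X \<in> Obj T" "\<forall>C \<in> K. Hom T C X = {Zero T C X}" for X
      using S(3) that st0 stK(1)[of 0] by auto
    show "\<exists>Z \<in> K. zero_object T Z" using Z st0 stK(1)[of 0] by auto
    show "\<exists>C' \<in> K. isomorphic T (Susp T C') C" if C: "C \<in> K" for C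
    proof -
      obtain n where n: "C \<in> st n" using C by (auto simp: K_def)
      then have "des C \<in> K" using stK(2)[of n] by (auto simp: step_def)
      then show ?thesis using des KO[OF n] by blast
    qed
    show "\<exists>g h. (f, g, h) \<in> Dist T \<and> Cod T g \<in> K" if f: "f \<in> Arr T" "Dom T f \<in> K" "Cod T f \<in> K" for f
    proof -
      obtain n where n: "Dom T f \<in> st n" "Cod T f \<in> st n" using KK f by blast
      moreover have "f \<in> Hom T (Dom T f) (Cod T f)" using f(1) by (simp add: Hom_def)
      ultimately have "cone f \<in> step (st n)" unfolding step_def by blast
      then have "cone f \<in> K" using stK(2) by blast
      then show ?thesis using cone[OF f(1)] by auto
    qed
    show "\<exists>P \<in> K. is_biproduct C C' P" if CC: "C \<in> K" "C' \<in> K" for C C'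
    proof -
      obtain n where n: "C \<in> st n" "C' \<in> st n" using KK CC by blast
      then have "bip C C' \<in> K" using stK(2)[of n] unfolding step_def by blast
      then show ?thesis using bip KO n by blast
    qed
  qed
  then show ?thesis by blast
qed

definition cells :: "'o set"
  where "cells = (SOME K. cell_class K)"

lemma cells: "cell_class cells"
  unfolding cells_def by (rule someI_ex[OF cell_class_exists])

lemma cells_small: "small \<kappa> cells"
  and cells_compact: "K \<in> cells \<Longrightarrow> compact_object T \<kappa> K"
  and cells_generate: "\<lbrakk>X \<in> Obj T; \<And>K f. K \<in> cells \<Longrightarrow> f \<in> Hom T K X \<Longrightarrow> f = Zero T K X\<rbrakk> \<Longrightarrow> zero_object T X"
  and cells_zero: "\<exists>Z \<in> cells. zero_object T Z"
  and cells_desusp: "K \<in> cells \<Longrightarrow> \<exists>K' \<in> cells. isomorphic T (Susp T K') K"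
  and cells_cone: "\<lbrakk>f \<in> Arr T; Dom T f \<in> cells; Cod T f \<in> cells\<rbrakk> \<Longrightarrow> \<exists>g h. (f, g, h) \<in> Dist T \<and> Cod T g \<in> cells"
  and cells_biproduct: "\<lbrakk>K \<in> cells; K' \<in> cells\<rbrakk> \<Longrightarrow> \<exists>P \<in> cells. is_biproduct K K' P"
proof -
  show "small \<kappa> cells" "K \<in> cells \<Longrightarrow> compact_object T \<kappa> K"
    "\<exists>Z \<in> cells. zero_object T Z" "K \<in> cells \<Longrightarrow> \<exists>K' \<in> cells. isomorphic T (Susp T K') K"
    "\<lbrakk>f \<in> Arr T; Dom T f \<in> cells; Cod T f \<in> cells\<rbrakk> \<Longrightarrow> \<exists>g h. (f, g, h) \<in> Dist T \<and> Cod T g \<in> cells"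
    "\<lbrakk>K \<in> cells; K' \<in> cells\<rbrakk> \<Longrightarrow> \<exists>P \<in> cells. is_biproduct K K' P"
    using cells unfolding cell_class_def by blast+
  show "zero_object T X" if "X \<in> Obj T" "\<And>K f. K \<in> cells \<Longrightarrow> f \<in> Hom T K X \<Longrightarrow> f = Zero T K X"
  proof -
    have "Hom T C X = {Zero T C X}" if C: "C \<in> cells" for C
    proof -
      have "C \<in> Obj T" using cells C by (auto simp: cell_class_def compact_object_def)
      then show ?thesis using zero_Hom[of C X] \<open>X \<in> Obj T\<close> \<open>\<And>K f. K \<in> cells \<Longrightarrow> f \<in> Hom T K X \<Longrightarrow> f = Zero T K X\<close>[OF C] by blast
    qed
    then show ?thesis using cells that(1) unfolding cell_class_def by blast
  qed
qed

lemma compact_obj: "compact_object T \<kappa> K \<Longrightarrow> K \<in> Obj T"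
  by (simp add: compact_object_def)

lemma cells_obj: "K \<in> cells \<Longrightarrow> K \<in> Obj T"
  using cells_compact compact_obj by blast

end

section \<open>Telescopes\<close>

context triangulated_category
begin

lemma Dist_zero:
  assumes "X \<in> Obj T" "zero_object T Z"
  shows "(Zero T Z X, Idn T X, Zero T X (Susp T Z)) \<in> Dist T"
  by (rule Dist_unrot)
    (use Dist_Idn[OF assms(1) zero_object_susp[OF assms(2)]] assms in \<open>auto simp: zero_object_def\<close>)

end

context big_tt_category
begin

text \<open>The homotopy colimit of a sequence as the cone of identity minus shift. Since cones are
  determined only up to isomorphism, this is a predicate on the data, and the colimit is read off as
  \<open>Cod T \<pi>\<close>.\<close>

definition telescope :: "(nat \<Rightarrow> 'm) \<Rightarrow> 'o \<Rightarrow> (nat \<Rightarrow> 'm) \<Rightarrow> 'm \<Rightarrow> 'm \<Rightarrow> bool"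
  where "telescope \<phi> W \<iota> d \<pi> \<longleftrightarrow>
    (\<forall>n. \<phi> n \<in> Arr T \<and> Dom T (\<phi> (Suc n)) = Cod T (\<phi> n)) \<and>
    is_coproduct T UNIV (\<lambda>n. Dom T (\<phi> n)) W \<iota> \<and> d \<in> Hom T W W \<and>
    (\<forall>n. d \<cdot> \<iota> n = Sub (\<iota> n) (\<iota> (Suc n) \<cdot> \<phi> n)) \<and> (\<exists>\<delta>. (d, \<pi>, \<delta>) \<in> Dist T)"

lemma telescope_exists:
  assumes \<phi>: "\<And>n. \<phi> n \<in> Arr T" "\<And>n. Dom T (\<phi> (Suc n)) = Cod T (\<phi> n)"
  obtains W \<iota> d \<pi> where "telescope \<phi> W \<iota> d \<pi>"
proof -
  obtain W \<iota> where W: "is_coproduct T (UNIV :: nat set) (\<lambda>n. Dom T (\<phi> n)) W \<iota>"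
    using small_coproduct_exists[OF small_nat, of "\<lambda>n. Dom T (\<phi> n)"] \<phi> by auto
  note a = coproduct_arr[OF W]
  obtain d where d: "d \<in> Hom T W W" "\<And>n. n \<in> UNIV \<Longrightarrow> d \<cdot> \<iota> n = Sub (\<iota> n) (\<iota> (Suc n) \<cdot> \<phi> n)"
    by (rule coproduct_desc[OF W a(1), of "\<lambda>n. Sub (\<iota> n) (\<iota> (Suc n) \<cdot> \<phi> n)"]) (use a \<phi> in \<open>auto simp: Hom_def\<close>)
  then obtain \<pi> \<delta> where "(d, \<pi>, \<delta>) \<in> Dist T" using Dist_cone[of d] by (auto simp: Hom_def)
  then have "telescope \<phi> W \<iota> d \<pi>" using W d \<phi> by (auto simp: telescope_def)
  then show thesis using that by blast
qed

lemma telescope_arr: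
  assumes t: "telescope \<phi> W \<iota> d \<pi>"
  shows "\<phi> n \<in> Arr T" "Dom T (\<phi> (Suc n)) = Cod T (\<phi> n)" "W \<in> Obj T" "\<iota> n \<in> Arr T" "Dom T (\<iota> n) = Dom T (\<phi> n)"
    "Cod T (\<iota> n) = W" "d \<in> Arr T" "Dom T d = W" "Cod T d = W" "\<pi> \<in> Arr T" "Dom T \<pi> = W"
    "d \<cdot> \<iota> n = Sub (\<iota> n) (\<iota> (Suc n) \<cdot> \<phi> n)" "is_coproduct T UNIV (\<lambda>n. Dom T (\<phi> n)) W \<iota>"
proof -
  show W: "is_coproduct T UNIV (\<lambda>n. Dom T (\<phi> n)) W \<iota>" using t by (simp add: telescope_def)
  show "\<phi> n \<in> Arr T" "Dom T (\<phi> (Suc n)) = Cod T (\<phi> n)" "d \<in> Arr T" "Dom T d = W" "Cod T d = W"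
    "d \<cdot> \<iota> n = Sub (\<iota> n) (\<iota> (Suc n) \<cdot> \<phi> n)" using t by (auto simp: telescope_def Hom_def)
  show "W \<in> Obj T" "\<iota> n \<in> Arr T" "Dom T (\<iota> n) = Dom T (\<phi> n)" "Cod T (\<iota> n) = W" using coproduct_arr[OF W] by auto
  obtain \<delta> where D: "(d, \<pi>, \<delta>) \<in> Dist T" using t by (auto simp: telescope_def)
  show "\<pi> \<in> Arr T" "Dom T \<pi> = W" using Dist_arr[OF D] \<open>Cod T d = W\<close> by auto
qed

lemma telescope_step:
  assumes t: "telescope \<phi> W \<iota> d \<pi>"
  shows "\<pi> \<cdot> \<iota> (Suc n) \<cdot> \<phi> n = \<pi> \<cdot> \<iota> n"
proof -
  note a = telescope_arr[OF t]
  obtain \<delta> where D: "(d, \<pi>, \<delta>) \<in> Dist T" using t by (auto simp: telescope_def)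
  have "\<pi> \<cdot> Sub (\<iota> n) (\<iota> (Suc n) \<cdot> \<phi> n) = \<pi> \<cdot> d \<cdot> \<iota> n" using a by (simp add: comp_assoc)
  also have "\<dots> = Zero T (Dom T (\<phi> n)) (Cod T \<pi>)" using Dist_comp_zero[OF D] a by simp
  finally have "Sub (\<pi> \<cdot> \<iota> n) (\<pi> \<cdot> \<iota> (Suc n) \<cdot> \<phi> n) = Zero T (Dom T (\<phi> n)) (Cod T \<pi>)"
    using a by (simp add: comp_sub comp_assoc)
  then show ?thesis using a by (subst (asm) sub_eq_zero_iff) (auto simp: comp_assoc)
qed

primrec trans_map :: "(nat \<Rightarrow> 'm) \<Rightarrow> nat \<Rightarrow> nat \<Rightarrow> 'm"
  where "trans_map \<phi> m 0 = Idn T (Dom T (\<phi> m))"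
  | "trans_map \<phi> m (Suc k) = \<phi> (m + k) \<cdot> trans_map \<phi> m k"

lemma trans_map_arr:
  assumes t: "telescope \<phi> W \<iota> d \<pi>"
  shows "trans_map \<phi> m k \<in> Arr T" "Dom T (trans_map \<phi> m k) = Dom T (\<phi> m)" "Cod T (trans_map \<phi> m k) = Dom T (\<phi> (m + k))"
  by (induction k) (use telescope_arr[OF t] in auto)

lemma telescope_trans:
  assumes t: "telescope \<phi> W \<iota> d \<pi>"
  shows "\<pi> \<cdot> \<iota> (m + k) \<cdot> trans_map \<phi> m k = \<pi> \<cdot> \<iota> m"
proof (induction k)
  case 0
  then show ?case using telescope_arr[OF t] by simp
next
  case (Suc k)
  note a = telescope_arr[OF t] trans_map_arr[OF t]
  have "\<pi> \<cdot> \<iota> (m + Suc k) \<cdot> trans_map \<phi> m (Suc k) = (\<pi> \<cdot> \<iota> (Suc (m + k)) \<cdot> \<phi> (m + k)) \<cdot> trans_map \<phi> m k"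
    using a by (simp add: comp_assoc)
  then show ?case unfolding telescope_step[OF t] using Suc by simp
qed

text \<open>The relations express each component of \<open>d \<cdot> v\<close> through at most two
  consecutive components of \<open>v\<close>, so equations involving \<open>d\<close> can be solved
  one component at a time.\<close>

lemma telescope_proj:
  assumes t: "telescope \<phi> W \<iota> d \<pi>"
  obtains p where "\<forall>m. p m \<in> Hom T W (Dom T (\<phi> m))"
    "\<forall>m n. p m \<cdot> \<iota> n = (if n = m then Idn T (Dom T (\<phi> m)) else Zero T (Dom T (\<phi> n)) (Dom T (\<phi> m)))"
    "p 0 \<cdot> d = p 0" "\<forall>m. p (Suc m) \<cdot> d = Sub (p (Suc m)) (\<phi> m \<cdot> p m)"
proof -
  note a = telescope_arr[OF t]
  obtain p where p0: "\<forall>i \<in> UNIV. p i \<in> Hom T W (Dom T (\<phi> i))"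
    "\<forall>i \<in> UNIV. \<forall>j \<in> UNIV. p i \<cdot> \<iota> j = (if j = i then Idn T (Dom T (\<phi> i)) else Zero T (Dom T (\<phi> j)) (Dom T (\<phi> i)))"
    by (rule coproduct_projs[OF a(13)])
  have pa: "p m \<in> Arr T" "Dom T (p m) = W" "Cod T (p m) = Dom T (\<phi> m)" for m using p0(1) by (auto simp: Hom_def)
  have p: "p m \<cdot> \<iota> n = (if n = m then Idn T (Dom T (\<phi> m)) else Zero T (Dom T (\<phi> n)) (Dom T (\<phi> m)))" for m n using p0(2) by simp
  have pd: "p m \<cdot> d \<cdot> \<iota> n = Sub (p m \<cdot> \<iota> n) ((p m \<cdot> \<iota> (Suc n)) \<cdot> \<phi> n)" for m n
    using a pa by (simp add: comp_assoc comp_sub)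
  have 1: "p 0 \<cdot> d = p 0"
  proof (rule coproduct_eqI[OF a(13), where Y="Dom T (\<phi> 0)"])
    show "p 0 \<cdot> d \<cdot> \<iota> n = p 0 \<cdot> \<iota> n" for n unfolding pd p using a by (simp add: Sub_def)
  qed (use a pa in \<open>auto simp: Hom_def\<close>)
  have 2: "p (Suc m) \<cdot> d = Sub (p (Suc m)) (\<phi> m \<cdot> p m)" for m
  proof (rule coproduct_eqI[OF a(13), where Y="Dom T (\<phi> (Suc m))"])
    fix n
    have "p (Suc m) \<cdot> d \<cdot> \<iota> n = Sub (p (Suc m) \<cdot> \<iota> n) (\<phi> m \<cdot> (p m \<cdot> \<iota> n))"
      unfolding pd p using a by (auto simp: Sub_def)
    then show "p (Suc m) \<cdot> d \<cdot> \<iota> n = Sub (p (Suc m)) (\<phi> m \<cdot> p m) \<cdot> \<iota> n"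
      using a pa by (simp add: comp_sub comp_assoc)
  qed (use a pa in \<open>auto simp: Hom_def\<close>)
  show thesis by (rule that[of p]) (use p0 1 2 in simp_all)
qed

lemma trunc_proj_zero:
  assumes W: "is_coproduct T I X W \<iota>" and e: "is_trunc I W \<iota> F e" and m: "m \<in> I" "m \<notin> F"
    and p: "p \<in> Hom T W (X m)" "\<forall>n \<in> I. p \<cdot> \<iota> n = (if n = m then Idn T (X m) else Zero T (X n) (X m))"
  shows "p \<cdot> e = Zero T W (X m)"
proof (rule coproduct_eqI[OF W])
  note a = coproduct_arr[OF W] trunc_arr[OF e]
  have pa: "p \<in> Arr T" "Dom T p = W" "Cod T p = X m" using p by (auto simp: Hom_def)
  show "p \<cdot> e \<in> Hom T W (X m)" "Zero T W (X m) \<in> Hom T W (X m)" using a pa m by (auto simp: Hom_def)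
  fix n assume n: "n \<in> I"
  have "e \<cdot> \<iota> n = (if n \<in> F then \<iota> n else Zero T (X n) W)" using e n a by (simp add: is_trunc_def)
  then show "p \<cdot> e \<cdot> \<iota> n = Zero T W (X m) \<cdot> \<iota> n" using a pa n m p(2) by (auto simp: comp_assoc)
qed

text \<open>The obstruction \<open>\<delta> \<cdot> c\<close> to lifting \<open>c\<close> to the
  coproduct desuspends to a map \<open>v\<close> with \<open>d \<cdot> v\<close> zero, and such a
  \<open>v\<close> vanishes because composition with \<open>d\<close> is injective on maps from
  compact objects. The resulting lift has finite support and is pushed forward to a single
  stage.\<close>

lemma telescope_compact:
  assumes t: "telescope \<phi> W \<iota> d \<pi>" and C: "compact_object T \<kappa> C" and c: "c \<in> Hom T C (Cod T \<pi>)"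
  obtains n w where "w \<in> Hom T C (Dom T (\<phi> n))" "c = \<pi> \<cdot> \<iota> n \<cdot> w"
proof -
  note a = telescope_arr[OF t]
  obtain \<delta> where D: "(d, \<pi>, \<delta>) \<in> Dist T" using t by (auto simp: telescope_def)
  note da = Dist_arr[OF D]
  have ca: "c \<in> Arr T" "Dom T c = C" "Cod T c = Cod T \<pi>" using c by (auto simp: Hom_def)
  have CO: "C \<in> Obj T" using ca by auto
  obtain p where p: "\<forall>m. p m \<in> Hom T W (Dom T (\<phi> m))"
    "\<forall>m n. p m \<cdot> \<iota> n = (if n = m then Idn T (Dom T (\<phi> m)) else Zero T (Dom T (\<phi> n)) (Dom T (\<phi> m)))"
    "p 0 \<cdot> d = p 0" "\<forall>m. p (Suc m) \<cdot> d = Sub (p (Suc m)) (\<phi> m \<cdot> p m)" by (rule telescope_proj[OF t])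
  have pa: "p m \<in> Arr T" "Dom T (p m) = W" "Cod T (p m) = Dom T (\<phi> m)" for m using p(1) by (auto simp: Hom_def)
  obtain C' \<theta> where \<theta>: "C' \<in> Obj T" "\<theta> \<in> Hom T (Susp T C') C" "iso_arrow T \<theta>" using desusp[OF CO] by blast
  then have \<theta>a: "\<theta> \<in> Arr T" "Dom T \<theta> = Susp T C'" "Cod T \<theta> = C" by (auto simp: Hom_def)
  have C': "compact_object T \<kappa> C'" by (rule compact_desusp[OF C \<theta>(2,3,1)])
  have "\<delta> \<cdot> (c \<cdot> \<theta>) \<in> Hom T (Susp T C') (Susp T W)" using da ca \<theta>a a by (auto simp: Hom_def)
  from susp_full[OF this \<theta>(1) a(3)] obtain v where v: "v \<in> Hom T C' W" "SuspM T v = \<delta> \<cdot> (c \<cdot> \<theta>)" .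
  then have va: "v \<in> Arr T" "Dom T v = C'" "Cod T v = W" by (auto simp: Hom_def)
  have "SuspM T (d \<cdot> v) = Zero T (Susp T C') (Susp T W)"
  proof -
    have "Minus (SuspM T d) \<cdot> \<delta> = Zero T (Cod T \<pi>) (Susp T W)" using Dist_comp_zero[OF Dist_rot[OF Dist_rot[OF D]]] da a by simp
    then have "SuspM T d \<cdot> \<delta> = Zero T (Cod T \<pi>) (Susp T W)"
      using da a by (simp add: comp_minus minus_eq_zero_iff)
    then have "SuspM T d \<cdot> (\<delta> \<cdot> (c \<cdot> \<theta>)) = Zero T (Cod T \<pi>) (Susp T W) \<cdot> (c \<cdot> \<theta>)"
      by (rule comp_rewrite) (use da a ca \<theta>a in auto)
    then show ?thesis using v va a ca \<theta>a da by (simp add: susp_comp)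
  qed
  then have dv: "d \<cdot> v = Zero T C' W" by (rule susp_eq_zero[rotated]) (use va a in \<open>auto simp: Hom_def\<close>)
  \<comment> \<open>Component \<open>0\<close> vanishes because \<open>p 0 \<cdot> d = p 0\<close>;
    every later component is the image of the preceding one.\<close>
  have pv: "p m \<cdot> v = Zero T C' (Dom T (\<phi> m))" for m
  proof (induction m)
    case 0
    have "p 0 \<cdot> v = p 0 \<cdot> (d \<cdot> v)" using comp_rewrite[OF p(3), of v] pa va a by simp
    then show ?case using dv pa \<theta>(1) by simp
  next
    case (Suc m)
    have "p (Suc m) \<cdot> (d \<cdot> v) = Sub (p (Suc m)) (\<phi> m \<cdot> p m) \<cdot> v"
      by (rule comp_rewrite[OF p(4)[rule_format]]) (use pa va a in auto)
    also have "\<dots> = Sub (p (Suc m) \<cdot> v) (\<phi> m \<cdot> (p m \<cdot> v))" using pa va a by (simp add: comp_sub comp_assoc)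
    finally have "Zero T C' (Dom T (\<phi> (Suc m))) = Sub (p (Suc m) \<cdot> v) (Zero T C' (Dom T (\<phi> (Suc m))))"
      using Suc dv pa va a \<theta>(1) by simp
    then show ?case using sub_eq_zero_iff[of "p (Suc m) \<cdot> v" "Zero T C' (Dom T (\<phi> (Suc m)))" C' "Dom T (\<phi> (Suc m))"] pa va a \<theta>(1) by simp
  qed
  have "v = Zero T C' W"
  proof -
    \<comment> \<open>A finitely supported map is the sum of finitely many of its components, and
      all of them are zero.\<close>
    obtain F e where F: "finite F" "is_trunc UNIV W \<iota> F e" "e \<cdot> v = v"
      using compact_small_coproduct[OF C' small_nat a(13) v(1)] by (auto simp: finitely_supported_def)
    have "finprod (HomGrp T C' W) (\<lambda>i. \<iota> i \<cdot> (p i \<cdot> v)) F = e \<cdot> v"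
      by (rule trunc_finprod[OF a(13) v(1)]) (use p F in auto)
    moreover have "\<iota> i \<cdot> (p i \<cdot> v) = \<one>\<^bsub>HomGrp T C' W\<^esub>" for i unfolding pv using a \<theta>(1) by simp
    moreover have "finprod (HomGrp T C' W) (\<lambda>i. \<one>\<^bsub>HomGrp T C' W\<^esub>) F = \<one>\<^bsub>HomGrp T C' W\<^esub>"
      using comm_monoid.finprod_one_eqI[OF comm_group.axioms(1)[OF HomGrp_comm_group[OF \<theta>(1) a(3)]], of F "\<lambda>i. \<one>\<^bsub>HomGrp T C' W\<^esub>"] by simp
    ultimately show ?thesis using F by simp
  qed
  then have "\<delta> \<cdot> (c \<cdot> \<theta>) = Zero T (Susp T C') (Susp T W)" using v(2) \<theta>(1) a by simp
  then have "(\<delta> \<cdot> c) \<cdot> \<theta> = Zero T C (Susp T W) \<cdot> \<theta>" using da ca \<theta>a a by (simp add: comp_assoc)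
  then have "\<delta> \<cdot> c = Zero T C (Susp T W)"
    by (rule iso_epic[OF \<theta>(3), rotated 2, where X="Susp T W"]) (use da ca \<theta>a a CO in \<open>auto simp: Hom_def\<close>)
  then obtain w where w: "w \<in> Hom T C W" "c = \<pi> \<cdot> w"
    using Dist_exact[OF Dist_rot[OF D], of c C] ca da a CO by (auto simp: Hom_def)
  have wa: "w \<in> Arr T" "Dom T w = C" "Cod T w = W" using w by (auto simp: Hom_def)
  obtain F e where F: "finite F" "is_trunc UNIV W \<iota> F e" "e \<cdot> w = w"
    using compact_small_coproduct[OF C small_nat a(13) w(1)] by (auto simp: finitely_supported_def)
  note ea = trunc_arr[OF F(2)]
  obtain N where N: "\<And>n. n \<in> F \<Longrightarrow> n \<le> N"
    using F(1)[unfolded finite_nat_set_iff_bounded_le] by blast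
  note ta = trans_map_arr[OF t]
  \<comment> \<open>On a summand with index in \<open>F\<close> the map \<open>u\<close> follows the
    transition maps to the common stage \<open>N\<close>; outside \<open>F\<close> it is zero, as
    \<open>e\<close> is.\<close>
  define g where "g n = (if n \<in> F then trans_map \<phi> n (N - n) else Zero T (Dom T (\<phi> n)) (Dom T (\<phi> N)))" for n
  have "g n \<in> Hom T (Dom T (\<phi> n)) (Dom T (\<phi> N))" for n
  proof (cases "n \<in> F")
    case True
    then show ?thesis using ta[of n "N - n"] N[OF True] by (simp add: g_def Hom_def)
  qed (use a zero_Hom in \<open>simp add: g_def\<close>)
  then obtain u where u: "u \<in> Hom T W (Dom T (\<phi> N))" "\<forall>n. u \<cdot> \<iota> n = g n"
    using coproduct_ex1[OF a(13), of "Dom T (\<phi> N)" g] a by auto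
  have ua: "u \<in> Arr T" "Dom T u = W" "Cod T u = Dom T (\<phi> N)" using u by (auto simp: Hom_def)
  have "\<pi> \<cdot> e = \<pi> \<cdot> \<iota> N \<cdot> u"
  proof (rule coproduct_eqI[OF a(13), where Y="Cod T \<pi>"])
    show "\<pi> \<cdot> e \<in> Hom T W (Cod T \<pi>)" "\<pi> \<cdot> \<iota> N \<cdot> u \<in> Hom T W (Cod T \<pi>)" using a ea ua by (auto simp: Hom_def)
    fix n
    have e: "e \<cdot> \<iota> n = (if n \<in> F then \<iota> n else Zero T (Dom T (\<phi> n)) W)" using F(2) a by (simp add: is_trunc_def)
    have "\<pi> \<cdot> \<iota> N \<cdot> trans_map \<phi> n (N - n) = \<pi> \<cdot> \<iota> n" if "n \<in> F" using telescope_trans[OF t, of n "N - n"] N[OF that] by simp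
    then have "\<pi> \<cdot> \<iota> N \<cdot> (u \<cdot> \<iota> n) = \<pi> \<cdot> (e \<cdot> \<iota> n)" unfolding u(2)[rule_format] e g_def using a by simp
    then show "\<pi> \<cdot> e \<cdot> \<iota> n = \<pi> \<cdot> \<iota> N \<cdot> u \<cdot> \<iota> n" using a ea ua by (simp add: comp_assoc)
  qed
  then have "\<pi> \<cdot> e \<cdot> w = \<pi> \<cdot> \<iota> N \<cdot> (u \<cdot> w)" using a ea ua wa by (simp add: comp_assoc)
  then have "c = \<pi> \<cdot> \<iota> N \<cdot> (u \<cdot> w)" using F(3) w(2) a ea wa by (simp add: comp_assoc)
  moreover have "u \<cdot> w \<in> Hom T C (Dom T (\<phi> N))" using ua wa by (simp add: Hom_def)
  ultimately show thesis using that by blast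
qed

end

text \<open>This isolates what the identity and tensoring with a fixed object have in common:
  additivity, preservation of small coproducts, and exactness after applying any
  \<open>Hom(P, -)\<close>. The elements to be factored through cells are maps from a compact
  \<open>P\<close> to \<open>FO Z\<close>.\<close>

locale homological_endofunctor = big_tt_category T \<kappa>
  for T :: "('o, 'm, 'z) tt_category_scheme" (structure) and \<kappa> :: "'u rel" +
  fixes FO :: "'o \<Rightarrow> 'o" and FM :: "'m \<Rightarrow> 'm"
  assumes F_obj: "X \<in> Obj T \<Longrightarrow> FO X \<in> Obj T"
    and F_Hom: "f \<in> Hom T X Y \<Longrightarrow> FM f \<in> Hom T (FO X) (FO Y)"
    and F_Comp: "\<lbrakk>f \<in> Hom T X Y; g \<in> Hom T Y Z\<rbrakk> \<Longrightarrow> FM (g \<cdot> f) = FM g \<cdot> FM f"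
    and F_idn: "X \<in> Obj T \<Longrightarrow> FM (Idn T X) = Idn T (FO X)"
    and F_Add: "\<lbrakk>f \<in> Hom T X Y; g \<in> Hom T X Y\<rbrakk> \<Longrightarrow> FM (Add T f g) = Add T (FM f) (FM g)"
    and F_exact: "\<lbrakk>(f, g, h) \<in> Dist T; x \<in> Hom T P (FO (Dom T g)); FM g \<cdot> x = Zero T P (FO (Cod T g))\<rbrakk>
      \<Longrightarrow> \<exists>y \<in> Hom T P (FO (Dom T f)). FM f \<cdot> y = x"
    and F_Coproduct: "\<lbrakk>small \<kappa> (I :: 'u set); is_coproduct T I E W \<iota>\<rbrakk>
      \<Longrightarrow> is_coproduct T I (\<lambda>i. FO (E i)) (FO W) (\<lambda>i. FM (\<iota> i))"
begin

declare F_obj [simp]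

lemma F_arr [simp]:
  assumes "f \<in> Arr T"
  shows "FM f \<in> Arr T" "Dom T (FM f) = FO (Dom T f)" "Cod T (FM f) = FO (Cod T f)"
  using F_Hom[of f "Dom T f" "Cod T f"] assms by (auto simp: Hom_def)

lemma F_comp: "\<lbrakk>f \<in> Arr T; g \<in> Arr T; Cod T f = Dom T g\<rbrakk> \<Longrightarrow> FM (g \<cdot> f) = FM g \<cdot> FM f"
  using F_Comp[of f "Dom T f" "Cod T f" g "Cod T g"] by (simp add: Hom_def)

lemma F_add: "\<lbrakk>f \<in> Arr T; g \<in> Arr T; Dom T f = Dom T g; Cod T f = Cod T g\<rbrakk> \<Longrightarrow> FM (Add T f g) = Add T (FM f) (FM g)"
  using F_Add[of f "Dom T f" "Cod T f" g] by (simp add: Hom_def)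

lemma F_zero [simp]: "\<lbrakk>X \<in> Obj T; Y \<in> Obj T\<rbrakk> \<Longrightarrow> FM (Zero T X Y) = Zero T (FO X) (FO Y)"
  by (rule add_self_zero) (auto simp: Hom_def simp flip: F_add)

lemma F_minus: "f \<in> Arr T \<Longrightarrow> FM (Minus f) = Minus (FM f)"
  by (rule minus_unique[where X="FO (Dom T f)" and Y="FO (Cod T f)"]) (auto simp: Hom_def simp flip: F_add)

lemma F_sub: "\<lbrakk>f \<in> Arr T; g \<in> Arr T; Dom T f = Dom T g; Cod T f = Cod T g\<rbrakk> \<Longrightarrow> FM (Sub f g) = Sub (FM f) (FM g)"
  by (simp add: Sub_def F_add F_minus)

lemma F_coproduct:
  assumes A: "small \<kappa> A" and P: "is_coproduct T A X W \<iota>"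
  shows "is_coproduct T A (\<lambda>i. FO (X i)) (FO W) (\<lambda>i. FM (\<iota> i))"
proof -
  obtain I :: "'u set" and b where b: "bij_betw b I A" "small \<kappa> I" using small_transport[OF A] .
  have bI: "A = b ` I" "inj_on b I" using b(1) by (auto simp: bij_betw_def)
  have "bij_betw (inv_into I b) A I" by (rule bij_betw_inv_into[OF b(1)])
  moreover have "is_coproduct T A ((X \<circ> b) \<circ> inv_into I b) W ((\<iota> \<circ> b) \<circ> inv_into I b)"
  proof -
    have "b (inv_into I b i) = i" if "i \<in> A" for i using that bI by (simp add: f_inv_into_f)
    then show ?thesis using P unfolding is_coproduct_def by simp
  qed
  ultimately have "is_coproduct T I (X \<circ> b) W (\<iota> \<circ> b)" by (rule reindex_coproduct)
  from F_Coproduct[OF b(2) this]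
  have "is_coproduct T I ((\<lambda>i. FO (X i)) \<circ> b) (FO W) ((\<lambda>i. FM (\<iota> i)) \<circ> b)" by (simp add: comp_def)
  with b(1) show ?thesis by (rule reindex_coproduct)
qed

lemma F_trunc:
  assumes P: "is_coproduct T A X W \<iota>" and e: "is_trunc A W \<iota> F e"
  shows "is_trunc A (FO W) (\<lambda>i. FM (\<iota> i)) F (FM e)"
  unfolding is_trunc_def
proof (intro conjI ballI)
  note a = coproduct_arr[OF P] trunc_arr[OF e]
  show "FM e \<in> Hom T (FO W) (FO W)" using a by (simp add: Hom_def)
  fix i assume i: "i \<in> A"
  have "FM (e \<cdot> \<iota> i) = FM e \<cdot> FM (\<iota> i)" using a i by (simp add: F_comp)
  moreover have "e \<cdot> \<iota> i = (if i \<in> F then \<iota> i else Zero T (X i) W)" using e i a by (simp add: is_trunc_def)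
  ultimately show "FM e \<cdot> FM (\<iota> i) = (if i \<in> F then FM (\<iota> i) else Zero T (Dom T (FM (\<iota> i))) (FO W))"
    using a i by (auto split: if_splits)
qed

text \<open>The truncation on \<open>FO W\<close> is replaced by the image of a truncation on
  \<open>W\<close>. The latter is a map of the original coproduct and can therefore be factored
  through a cell before the functor is applied.\<close>

lemma F_finitely_supported:
  assumes A: "small \<kappa> A" and W: "is_coproduct T A X W \<iota>" and P: "compact_object T \<kappa> P" and w: "w \<in> Hom T P (FO W)"
  obtains F e where "finite F" "F \<subseteq> A" "is_trunc A W \<iota> F e" "FM e \<cdot> w = w"
proof -
  note FW = F_coproduct[OF A W]
  obtain F e' where F: "finite F" "F \<subseteq> A" "is_trunc A (FO W) (\<lambda>i. FM (\<iota> i)) F e'" "e' \<cdot> w = w"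
    using compact_small_coproduct[OF P A FW w] by (auto simp: finitely_supported_def)
  obtain e where e: "is_trunc A W \<iota> F e" by (rule trunc_ex[OF W])
  have "FM e \<cdot> w = w"
    by (rule trunc_fixes_mono[OF FW F(3) F_trunc[OF W e] subset_refl]) (use w F(4) in \<open>auto simp: Hom_def\<close>)
  then show thesis using that F e by blast
qed

text \<open>By exactness the image of \<open>x\<close> in the coproduct equals
  \<open>FM d \<cdot> w\<close> for some \<open>w\<close>. Recursively, component \<open>m\<close>
  of \<open>w\<close> is the image of \<open>x\<close> at stage \<open>m\<close>; since
  \<open>w\<close> has finite support, some component is zero.\<close>

lemma telescope_dies:
  assumes t: "telescope \<phi> W \<iota> d \<pi>" and P: "compact_object T \<kappa> P" and x: "x \<in> Hom T P (FO (Dom T (\<phi> 0)))"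
    and 0: "FM (\<pi> \<cdot> \<iota> 0) \<cdot> x = Zero T P (FO (Cod T \<pi>))"
  obtains n where "FM (trans_map \<phi> 0 n) \<cdot> x = Zero T P (FO (Dom T (\<phi> n)))"
proof -
  note a = telescope_arr[OF t]
  note ta = trans_map_arr[OF t]
  obtain \<delta> where D: "(d, \<pi>, \<delta>) \<in> Dist T" using t by (auto simp: telescope_def)
  have xa: "x \<in> Arr T" "Dom T x = P" "Cod T x = FO (Dom T (\<phi> 0))" using x by (auto simp: Hom_def)
  have PO: "P \<in> Obj T" using xa by auto
  obtain p where p: "\<forall>m. p m \<in> Hom T W (Dom T (\<phi> m))"
    "\<forall>m n. p m \<cdot> \<iota> n = (if n = m then Idn T (Dom T (\<phi> m)) else Zero T (Dom T (\<phi> n)) (Dom T (\<phi> m)))"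
    "p 0 \<cdot> d = p 0" "\<forall>m. p (Suc m) \<cdot> d = Sub (p (Suc m)) (\<phi> m \<cdot> p m)" by (rule telescope_proj[OF t])
  have pa: "p m \<in> Arr T" "Dom T (p m) = W" "Cod T (p m) = Dom T (\<phi> m)" for m using p(1) by (auto simp: Hom_def)
  have "FM \<pi> \<cdot> (FM (\<iota> 0) \<cdot> x) = Zero T P (FO (Cod T \<pi>))" using 0 a xa by (simp add: F_comp comp_assoc)
  then have "\<exists>y \<in> Hom T P (FO (Dom T d)). FM d \<cdot> y = FM (\<iota> 0) \<cdot> x"
    by (intro F_exact[OF D]) (use a xa in \<open>auto simp: Hom_def\<close>)
  then obtain w where w: "w \<in> Hom T P (FO W)" "FM d \<cdot> w = FM (\<iota> 0) \<cdot> x" using a by auto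
  have wa: "w \<in> Arr T" "Dom T w = P" "Cod T w = FO W" using w by (auto simp: Hom_def)
  obtain F e where F: "finite F" "F \<subseteq> UNIV" "is_trunc UNIV W \<iota> F e" "FM e \<cdot> w = w"
    by (rule F_finitely_supported[OF small_nat a(13) P w(1)])
  note ea = trunc_arr[OF F(3)]
  have pdw: "FM (p m \<cdot> d) \<cdot> w = FM (p m \<cdot> \<iota> 0) \<cdot> x" for m
    using w(2) a pa wa xa by (simp add: F_comp comp_assoc)
  have pw: "FM (p m) \<cdot> w = FM (trans_map \<phi> 0 m) \<cdot> x" for m
  proof (induction m)
    case 0
    have "FM (p 0) \<cdot> w = FM (p 0 \<cdot> \<iota> 0) \<cdot> x" using pdw[of 0] p(3) by simp
    then show ?case using p(2) a by (simp add: F_idn)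
  next
    case (Suc m)
    have "Sub (FM (p (Suc m)) \<cdot> w) (FM (\<phi> m) \<cdot> (FM (p m) \<cdot> w)) = FM (p (Suc m) \<cdot> d) \<cdot> w"
      using p(4) a pa wa by (simp add: F_sub F_comp comp_sub comp_assoc)
    also have "\<dots> = Zero T P (FO (Dom T (\<phi> (Suc m))))" unfolding pdw using p(2) a xa by simp
    finally have "FM (p (Suc m)) \<cdot> w = FM (\<phi> m) \<cdot> (FM (p m) \<cdot> w)"
      by (subst (asm) sub_eq_zero_iff) (use a pa wa in auto)
    then show ?case unfolding Suc using a ta[of 0 m] xa by (simp add: F_comp comp_assoc)
  qed
  obtain N where N: "N \<notin> F" using F(1) ex_new_if_finite infinite_UNIV_nat by blast
  have "FM (p N) \<cdot> w = FM (p N \<cdot> e) \<cdot> w" using F(4) pa ea wa by (simp add: F_comp comp_assoc)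
  moreover have "p N \<cdot> e = Zero T W (Dom T (\<phi> N))"
    by (rule trunc_proj_zero[OF a(13) F(3)]) (use N p in auto)
  ultimately have "FM (p N) \<cdot> w = Zero T P (FO (Dom T (\<phi> N)))" using a wa F_obj by simp
  then show thesis using that pw by metis
qed

end

section \<open>Factorization through cells\<close>

context big_tt_category
begin

text \<open>One stage of attaching cells. Killing every map from a cell with property
  \<open>N\<close> makes such maps vanish in the colimit, while the condition on the components of
  \<open>\<gamma>\<close> limits what else is lost. The property \<open>N\<close> is either always
  true or nullity on a class of objects.\<close>

definition kill_step :: "('m \<Rightarrow> bool) \<Rightarrow> 'm \<Rightarrow> bool"
  where "kill_step N \<phi> \<longleftrightarrow> (\<exists>(A :: 'm set) E G \<iota> \<gamma> \<delta>. small \<kappa> A \<and> (\<forall>a \<in> A. E a \<in> cells) \<and> is_coproduct T A E G \<iota> \<and>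
    (\<gamma>, \<phi>, \<delta>) \<in> Dist T \<and> Dom T \<gamma> = G \<and> (\<forall>a \<in> A. N (\<gamma> \<cdot> \<iota> a)) \<and>
    (\<forall>u \<in> Arr T. N u \<longrightarrow> Dom T u \<in> cells \<longrightarrow> Cod T u = Dom T \<phi> \<longrightarrow> \<phi> \<cdot> u = Zero T (Dom T u) (Cod T \<phi>)))"

text \<open>The attached coproduct is indexed by the maps that are to be killed. They form a small
  set because there are few cells and Hom sets are small.\<close>

lemma kill_step_exists:
  assumes Y: "Y \<in> Obj T"
  obtains \<phi> where "kill_step N \<phi>" "\<phi> \<in> Arr T" "Dom T \<phi> = Y"
proof -
  define A where "A = {u \<in> Arr T. Dom T u \<in> cells \<and> Cod T u = Y \<and> N u}"
  have "A \<subseteq> (\<Union>K \<in> cells. Hom T K Y)" by (auto simp: A_def Hom_def)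
  moreover have "small \<kappa> (\<Union>K \<in> cells. Hom T K Y)" by (intro small_UN cells_small Hom_small cells_obj Y)
  ultimately have A: "small \<kappa> A" by (rule small_subset[rotated])
  have O: "Dom T a \<in> Obj T" if "a \<in> A" for a using that by (auto simp: A_def)
  obtain G \<iota> where G: "is_coproduct T A (Dom T) G \<iota>" by (rule small_coproduct_exists[OF A O])
  note ga = coproduct_arr[OF G]
  have "a \<in> Hom T (Dom T a) Y" if "a \<in> A" for a using that by (auto simp: A_def Hom_def)
  then have "\<exists>!h. h \<in> Hom T G Y \<and> (\<forall>i \<in> A. h \<cdot> \<iota> i = i)" by (rule coproduct_ex1[OF G Y])
  then obtain \<gamma> where \<gamma>: "\<gamma> \<in> Hom T G Y" "\<forall>a \<in> A. \<gamma> \<cdot> \<iota> a = a" by (auto dest: ex1_implies_ex)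
  obtain \<phi> \<delta> where D: "(\<gamma>, \<phi>, \<delta>) \<in> Dist T" using Dist_cone[of \<gamma>] \<gamma> by (auto simp: Hom_def)
  note a = Dist_arr[OF D]
  have \<gamma>a: "Dom T \<gamma> = G" "Cod T \<gamma> = Y" using \<gamma> by (auto simp: Hom_def)
  have "\<phi> \<cdot> u = Zero T (Dom T u) (Cod T \<phi>)" if u: "u \<in> Arr T" "N u" "Dom T u \<in> cells" "Cod T u = Y" for u
  proof -
    have uA: "u \<in> A" using u by (simp add: A_def)
    have "\<phi> \<cdot> u = \<phi> \<cdot> (\<gamma> \<cdot> \<iota> u)" using \<gamma>(2) uA by simp
    also have "\<dots> = Zero T G (Cod T \<phi>) \<cdot> \<iota> u" by (rule comp_rewrite) (use Dist_comp_zero[OF D] a \<gamma>a ga uA in auto)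
    also have "\<dots> = Zero T (Dom T u) (Cod T \<phi>)" using ga uA a by simp
    finally show ?thesis .
  qed
  then have "kill_step N \<phi>" unfolding kill_step_def using A G D \<gamma>a \<gamma>(2) a
    by (intro exI[of _ A] exI[of _ "Dom T"] exI[of _ G] exI[of _ \<iota>] exI[of _ \<gamma>] exI[of _ \<delta>]) (auto simp: A_def)
  then show thesis using that a \<gamma>a by simp
qed

lemma kill_tower_exists:
  assumes Z: "Z \<in> Obj T"
  obtains \<phi> :: "nat \<Rightarrow> 'm" where "Dom T (\<phi> 0) = Z" "\<And>n. \<phi> n \<in> Arr T" "\<And>n. Dom T (\<phi> (Suc n)) = Cod T (\<phi> n)"
    "\<And>n. kill_step N (\<phi> n)"
proof -
  \<comment> \<open>The source \<open>Z\<close> is imposed at index \<open>0\<close> only; all later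
    sources are determined by the chain condition.\<close>
  have "\<exists>\<phi>. \<forall>n. (kill_step N (\<phi> n) \<and> \<phi> n \<in> Arr T \<and> (n = 0 \<longrightarrow> Dom T (\<phi> n) = Z)) \<and> Dom T (\<phi> (Suc n)) = Cod T (\<phi> n)"
  proof (rule dependent_nat_choice)
    show "\<exists>x. kill_step N x \<and> x \<in> Arr T \<and> ((0::nat) = 0 \<longrightarrow> Dom T x = Z)" using kill_step_exists[OF Z] by metis
    show "\<exists>y. (kill_step N y \<and> y \<in> Arr T \<and> (Suc n = 0 \<longrightarrow> Dom T y = Z)) \<and> Dom T y = Cod T x"
      if "kill_step N x \<and> x \<in> Arr T \<and> (n = 0 \<longrightarrow> Dom T x = Z)" for x n
      using kill_step_exists[of "Cod T x" N] that by (metis cod_obj nat.distinct(1))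
  qed
  then show thesis using that by metis
qed

end

section \<open>Elements that factor through cells, and their behavior under extensions\<close>

context homological_endofunctor
begin

definition factors :: "'o \<Rightarrow> 'o \<Rightarrow> 'm \<Rightarrow> bool"
  where "factors P Z x \<longleftrightarrow> (\<exists>K \<in> cells. \<exists>c \<in> Hom T K Z. \<exists>y \<in> Hom T P (FO K). x = FM c \<cdot> y)"

definition cell_generated :: "'o \<Rightarrow> bool"
  where "cell_generated Z \<longleftrightarrow> Z \<in> Obj T \<and> (\<forall>P x. compact_object T \<kappa> P \<longrightarrow> x \<in> Hom T P (FO Z) \<longrightarrow> factors P Z x)"

text \<open>Unlike \<open>cell_generated\<close> itself, this strengthening is inherited by extensions.\<close>

definition stably_cell_generated :: "'o \<Rightarrow> bool"
  where "stably_cell_generated Z \<longleftrightarrow> Z \<in> Obj T \<and>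
    (\<forall>k m r. (k, m, r) \<in> Dist T \<longrightarrow> Dom T k \<in> cells \<longrightarrow> Cod T k = Z \<longrightarrow> cell_generated (Cod T m))"

lemma factors_push:
  assumes "factors P Z x" "d \<in> Hom T Z Z'"
  shows "factors P Z' (FM d \<cdot> x)"
proof -
  obtain K c y where K: "K \<in> cells" "c \<in> Hom T K Z" "y \<in> Hom T P (FO K)" "x = FM c \<cdot> y"
    using assms(1) by (auto simp: factors_def)
  have "FM d \<cdot> x = FM (d \<cdot> c) \<cdot> y" using K assms(2) by (auto simp: Hom_def F_comp comp_assoc)
  moreover have "d \<cdot> c \<in> Hom T K Z'" using K assms(2) Comp_Hom by blast
  ultimately show ?thesis using K by (auto simp: factors_def)
qed

text \<open>The two cells are joined to a biproduct; the sum factors through it by the copairing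
  \<open>u\<close> of the maps from the cells and the pairing \<open>v\<close> of the
  elements.\<close>

lemma factors_add:
  assumes "factors P Z x" "factors P Z x'"
  shows "factors P Z (Add T x x')"
proof -
  obtain K c y where K: "K \<in> cells" "c \<in> Hom T K Z" "y \<in> Hom T P (FO K)" "x = FM c \<cdot> y"
    using assms(1) by (auto simp: factors_def)
  obtain K' c' y' where K': "K' \<in> cells" "c' \<in> Hom T K' Z" "y' \<in> Hom T P (FO K')" "x' = FM c' \<cdot> y'"
    using assms(2) by (auto simp: factors_def)
  obtain B where B: "B \<in> cells" "is_biproduct K K' B" using cells_biproduct[OF K(1) K'(1)] by blast
  obtain i j p q where b: "i \<in> Hom T K B" "j \<in> Hom T K' B" "p \<in> Hom T B K" "q \<in> Hom T B K'"
    "p \<cdot> i = Idn T K" "q \<cdot> j = Idn T K'" "q \<cdot> i = Zero T K K'" "p \<cdot> j = Zero T K' K"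
    using B(2) by (auto simp: is_biproduct_def)
  have ar: "i \<in> Arr T" "Dom T i = K" "Cod T i = B" "j \<in> Arr T" "Dom T j = K'" "Cod T j = B"
    "p \<in> Arr T" "Dom T p = B" "Cod T p = K" "q \<in> Arr T" "Dom T q = B" "Cod T q = K'"
    "c \<in> Arr T" "Dom T c = K" "Cod T c = Z" "c' \<in> Arr T" "Dom T c' = K'" "Cod T c' = Z"
    "y \<in> Arr T" "Dom T y = P" "Cod T y = FO K" "y' \<in> Arr T" "Dom T y' = P" "Cod T y' = FO K'"
    using b K K' by (auto simp: Hom_def)
  define u where "u = Add T (c \<cdot> p) (c' \<cdot> q)"
  have u: "u \<in> Arr T" "Dom T u = B" "Cod T u = Z" using ar by (auto simp: u_def)
  have "Z \<in> Obj T" "K \<in> Obj T" "K' \<in> Obj T" using ar by auto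
  then have ui: "u \<cdot> i = c" "u \<cdot> j = c'" unfolding u_def using ar b(5-8) by (simp_all add: comp_add comp_assoc)
  define v where "v = Add T (FM i \<cdot> y) (FM j \<cdot> y')"
  have "FM u \<cdot> v = Add T (FM (u \<cdot> i) \<cdot> y) (FM (u \<cdot> j) \<cdot> y')"
    unfolding v_def using u ar by (simp add: comp_add F_comp comp_assoc)
  then have "Add T x x' = FM u \<cdot> v" using ui K(4) K'(4) by simp
  moreover have "u \<in> Hom T B Z" "v \<in> Hom T P (FO B)" using u ar by (auto simp: Hom_def v_def)
  ultimately show ?thesis using B(1) by (auto simp: factors_def)
qed

lemma cell_is_generated: "K \<in> cells \<Longrightarrow> cell_generated K"
  unfolding cell_generated_def factors_def
proof (intro conjI allI impI cells_obj)
  fix P x assume K: "K \<in> cells" and x: "x \<in> Hom T P (FO K)"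
  then have "x = FM (Idn T K) \<cdot> x" using cells_obj[OF K] by (auto simp: Hom_def F_idn)
  then show "\<exists>K' \<in> cells. \<exists>c \<in> Hom T K' K. \<exists>y \<in> Hom T P (FO K'). x = FM c \<cdot> y"
    using K x Idn_Hom[OF cells_obj[OF K]] by blast
qed

text \<open>The object \<open>Z\<close> is itself the cone of the map to \<open>Z\<close> from a
  zero cell.\<close>

lemma stably_cell_generated_imp:
  assumes "stably_cell_generated Z"
  shows "cell_generated Z"
proof -
  obtain C where C: "C \<in> cells" "zero_object T C" using cells_zero by blast
  have Z: "Z \<in> Obj T" "C \<in> Obj T" using assms C by (auto simp: stably_cell_generated_def zero_object_def)
  show ?thesis using assms Dist_zero[OF Z(1) C(2)] C(1) Z unfolding stably_cell_generated_def by (metis cod_idn zero_arr(2,3))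
qed

text \<open>
  An element of \<open>FO Z\<close> is represented in \<open>FO Z''\<close> by some cell; pulling the triangle back along this
  cell gives an extension of a cell by \<open>Z'\<close>, which is the cone of a map from a cell to \<open>Z'\<close>.
\<close>

lemma cell_generated_extension:
  assumes D: "(f, g, h) \<in> Dist T" and Z': "stably_cell_generated (Dom T f)" and Z'': "cell_generated (Cod T g)"
  shows "cell_generated (Cod T f)"
  unfolding cell_generated_def
proof (intro conjI allI impI)
  note a = Dist_arr[OF D]
  show "Cod T f \<in> Obj T" using a by simp
  fix P x assume P: "compact_object T \<kappa> P" and x: "x \<in> Hom T P (FO (Cod T f))"
  have xa: "x \<in> Arr T" "Dom T x = P" "Cod T x = FO (Cod T f)" using x by (auto simp: Hom_def)
  have PO: "P \<in> Obj T" using xa by auto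
  have "FM g \<cdot> x \<in> Hom T P (FO (Cod T g))" using xa a by (auto simp: Hom_def)
  then have "factors P (Cod T g) (FM g \<cdot> x)" using Z'' P by (auto simp: cell_generated_def)
  then obtain K0 c0 y0 where K0: "K0 \<in> cells" "c0 \<in> Hom T K0 (Cod T g)" "y0 \<in> Hom T P (FO K0)" "FM g \<cdot> x = FM c0 \<cdot> y0"
    by (auto simp: factors_def)
  \<comment> \<open>Writing the cell as a suspension makes \<open>h \<cdot> c\<close> the last map
    of a triangle that begins with the suspended cell's desuspension \<open>K\<close>, again a
    cell.\<close>
  obtain K \<theta> where K: "K \<in> cells" "\<theta> \<in> Hom T (Susp T K) K0" "iso_arrow T \<theta>"
    using cells_desusp[OF K0(1)] by (auto simp: isomorphic_def)
  have K0a: "c0 \<in> Arr T" "Dom T c0 = K0" "Cod T c0 = Cod T g" "y0 \<in> Arr T" "Dom T y0 = P" "Cod T y0 = FO K0"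
    "\<theta> \<in> Arr T" "Dom T \<theta> = Susp T K" "Cod T \<theta> = K0" using K0 K by (auto simp: Hom_def)
  define c where "c = c0 \<cdot> \<theta>"
  define y where "y = FM (inv_arrow T \<theta>) \<cdot> y0"
  have ca: "c \<in> Arr T" "Dom T c = Susp T K" "Cod T c = Cod T g" using K0a by (auto simp: c_def)
  have ya: "y \<in> Arr T" "Dom T y = P" "Cod T y = FO (Susp T K)" using K0a K(3) by (auto simp: y_def)
  have "FM c \<cdot> y = FM (c0 \<cdot> (\<theta> \<cdot> inv_arrow T \<theta>)) \<cdot> y0"
    unfolding c_def y_def using K0a K(3) by (simp add: F_comp comp_assoc del: comp_inv)
  then have cy: "FM c \<cdot> y = FM g \<cdot> x" using K0(4) K0a K(3) by simp
  have KO: "K \<in> Obj T" using cells_obj[OF K(1)] .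
  have "h \<cdot> c \<in> Hom T (Susp T K) (Susp T (Dom T f))" using ca a by (auto simp: Hom_def)
  from Dist_third[OF this KO dom_obj[OF a(1)]] obtain k i q where
    k: "k \<in> Hom T K (Dom T f)" "(k, i, q) \<in> Dist T" "(i, q, h \<cdot> c) \<in> Dist T"
      "i \<in> Hom T (Dom T f) (Cod T i)" "q \<in> Hom T (Cod T i) (Susp T K)" .
  define W where "W = Cod T i"
  have ia: "i \<in> Arr T" "Dom T i = Dom T f" "Cod T i = W" "q \<in> Arr T" "Dom T q = W" "Cod T q = Susp T K"
    using k W_def by (auto simp: Hom_def)
  \<comment> \<open>\<open>W\<close> is the cone of \<open>k\<close>, a map from the cell
    \<open>K\<close> to \<open>Dom T f\<close>; cones of this kind are what the stable condition
    speaks about.\<close>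
  have W: "cell_generated W" using Z' k K unfolding stably_cell_generated_def W_def Hom_def by blast
  have "FM (h \<cdot> c) \<cdot> y = FM (h \<cdot> g) \<cdot> x"
    using cy ca ya a xa by (simp add: F_comp comp_assoc)
  also have "\<dots> = Zero T P (FO (Susp T (Dom T f)))"
    using Dist_comp_zero[OF Dist_rot[OF D]] a xa by simp
  finally have "\<exists>y' \<in> Hom T P (FO (Dom T q)). FM q \<cdot> y' = y"
    by (intro F_exact[OF Dist_rot[OF k(3)]]) (use ca ya a in \<open>auto simp: Hom_def\<close>)
  then obtain y' where y': "y' \<in> Hom T P (FO W)" "FM q \<cdot> y' = y" using ia by auto
  have y'a: "y' \<in> Arr T" "Dom T y' = P" "Cod T y' = FO W" using y' by (auto simp: Hom_def)
  have "h \<cdot> (c \<cdot> q) = Zero T W (Cod T h)" using Dist_comp_zero[OF Dist_rot[OF k(3)]] ia ca a by (simp add: comp_assoc)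
  then obtain d where d: "d \<in> Hom T W (Cod T f)" "g \<cdot> d = c \<cdot> q"
    using Dist_exact[OF Dist_rot[OF D], of "c \<cdot> q" W] ia ca a by (auto simp: Hom_def)
  have da: "d \<in> Arr T" "Dom T d = W" "Cod T d = Cod T f" using d by (auto simp: Hom_def)
  have "FM g \<cdot> (FM d \<cdot> y') = FM (c \<cdot> q) \<cdot> y'" using d(2)[symmetric] da a y'a by (simp add: F_comp comp_assoc)
  also have "\<dots> = FM g \<cdot> x" using cy y' ca ia y'a by (simp add: F_comp comp_assoc)
  \<comment> \<open>The image of \<open>x\<close> over the third object is now realized through
    \<open>d\<close>, so the remaining difference comes from the first object.\<close>
  finally have "FM g \<cdot> Sub x (FM d \<cdot> y') = Zero T P (FO (Cod T g))"
    using xa da y'a a PO by (simp add: comp_sub)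
  then have "\<exists>z \<in> Hom T P (FO (Dom T f)). FM f \<cdot> z = Sub x (FM d \<cdot> y')"
    by (intro F_exact[OF D]) (use xa da y'a a in \<open>auto simp: Hom_def\<close>)
  then obtain z where z: "z \<in> Hom T P (FO (Dom T f))" "FM f \<cdot> z = Sub x (FM d \<cdot> y')" by blast
  have "factors P (Dom T f) z" using stably_cell_generated_imp[OF Z'] P z by (auto simp: cell_generated_def)
  then have 1: "factors P (Cod T f) (FM f \<cdot> z)" by (rule factors_push) (use a in \<open>auto simp: Hom_def\<close>)
  have "factors P W y'" using W P y' by (auto simp: cell_generated_def)
  then have 2: "factors P (Cod T f) (FM d \<cdot> y')" by (rule factors_push) (use d in auto)
  have "Add T (FM f \<cdot> z) (FM d \<cdot> y') = x" unfolding z(2) using xa da y'a by (simp add: sub_add)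
  then show "factors P (Cod T f) x" using factors_add[OF 1 2] by simp
qed

text \<open>Let \<open>k\<close> be a map from a cell to the middle object. The octahedron on
  \<open>f\<close> followed by \<open>m\<close> identifies the cone of \<open>m \<cdot> f\<close>
  with the cone of \<open>g \<cdot> k\<close>. Hence the cone of \<open>k\<close> is an extension of
  the cone of \<open>g \<cdot> k\<close> by \<open>Dom T f\<close>, and
  \<open>cell_generated_extension\<close> applies.\<close>

lemma stably_cell_generated_extension:
  assumes D: "(f, g, h) \<in> Dist T" and Z': "stably_cell_generated (Dom T f)" and Z'': "stably_cell_generated (Cod T g)"
  shows "stably_cell_generated (Cod T f)"
  unfolding stably_cell_generated_def
proof (intro conjI allI impI)
  note a = Dist_arr[OF D]
  show "Cod T f \<in> Obj T" using a by simp
  fix k m r assume M: "(k, m, r) \<in> Dist T" and K: "Dom T k \<in> cells" "Cod T k = Cod T f"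
  note b = Dist_arr[OF M]
  obtain h1 h2 where H: "(m \<cdot> f, h1, h2) \<in> Dist T" using Dist_cone[of "m \<cdot> f"] a b K by auto
  have "\<exists>u \<in> Hom T (Cod T g) (Cod T h1). \<exists>v \<in> Hom T (Cod T h1) (Cod T r).
        (u, v, SuspM T g \<cdot> Minus (SuspM T k)) \<in> Dist T \<and> u \<cdot> g = h1 \<cdot> m \<and> h2 \<cdot> u = h \<and>
        v \<cdot> h1 = r \<and> Minus (SuspM T k) \<cdot> v = SuspM T f \<cdot> h2"
    by (rule octahedral[OF _ _ D Dist_rot[OF M] H, of "Dom T f" "Cod T f" "Cod T m"])
      (use a b K in \<open>auto simp: Hom_def\<close>)
  then obtain u v where uv: "u \<in> Hom T (Cod T g) (Cod T h1)" "v \<in> Hom T (Cod T h1) (Cod T r)"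
    "(u, v, SuspM T g \<cdot> Minus (SuspM T k)) \<in> Dist T" by blast
  have uva: "u \<in> Arr T" "Dom T u = Cod T g" "Cod T u = Cod T h1" "v \<in> Arr T" "Dom T v = Cod T h1" "Cod T v = Cod T r"
    using uv by (auto simp: Hom_def)
  have "(u, v, Minus (SuspM T (g \<cdot> k))) \<in> Dist T" using uv(3) a b K by (simp add: comp_minus susp_comp)
  then have "(g \<cdot> k, u, v) \<in> Dist T" by (rule Dist_unrot) (use a b K uva in auto)
  then have "cell_generated (Cod T h1)" using Z'' a b K uva unfolding stably_cell_generated_def
    by (metis dom_comp cod_comp)
  then have "cell_generated (Cod T (m \<cdot> f))"
    by (intro cell_generated_extension[OF H]) (use Z' a b K in auto)
  then show "cell_generated (Cod T m)" using a b K by simp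
qed

text \<open>Cells are closed under biproducts, so the part of the coproduct selected by
  \<open>F\<close> is realized by a single cell, built by induction on \<open>F\<close> from a zero
  cell.\<close>

lemma trunc_through_cell:
  assumes A: "\<And>a. a \<in> A \<Longrightarrow> E a \<in> cells" and G: "is_coproduct T A E G \<iota>" and F: "finite F" "F \<subseteq> A" and e: "is_trunc A G \<iota> F e"
  shows "\<exists>K \<in> cells. \<exists>m \<in> Hom T K G. \<exists>\<rho> \<in> Hom T G K. m \<cdot> \<rho> = e"
  using F e
proof (induction F arbitrary: e)
  case empty
  note a = coproduct_arr[OF G]
  obtain C where C: "C \<in> cells" "zero_object T C" using cells_zero by blast
  have CO: "C \<in> Obj T" using cells_obj[OF C(1)] .
  have "e = Zero T G G"
    by (rule coproduct_eqI[OF G, of _ G]) (use a empty.prems in \<open>auto simp: is_trunc_def zero_Hom\<close>)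
  then have "Zero T C G \<cdot> Zero T G C = e" using a CO by simp
  then show ?case using C zero_Hom a CO by blast
next
  case (insert i F)
  note a = coproduct_arr[OF G]
  obtain d where d: "is_trunc A G \<iota> F d" by (rule trunc_ex[OF G])
  have i: "i \<in> A" "F \<subseteq> A" using insert.prems by auto
  obtain K m \<rho> where K: "K \<in> cells" "m \<in> Hom T K G" "\<rho> \<in> Hom T G K" "m \<cdot> \<rho> = d" using insert.IH[OF i(2) d] by blast
  obtain p where p0: "\<forall>i \<in> A. p i \<in> Hom T G (E i)"
    "\<forall>i \<in> A. \<forall>j \<in> A. p i \<cdot> \<iota> j = (if j = i then Idn T (E i) else Zero T (E j) (E i))" by (rule coproduct_projs[OF G])
  have e: "e = Add T (\<iota> i \<cdot> p i) d"
    by (rule trunc_insert[OF G d insert.prems(2) i(1) insert.hyps(2)]) (use p0 i in auto)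
  obtain B where B: "B \<in> cells" "is_biproduct K (E i) B" using cells_biproduct[OF K(1) A[OF i(1)]] by blast
  obtain s j t q where b: "s \<in> Hom T K B" "j \<in> Hom T (E i) B" "t \<in> Hom T B K" "q \<in> Hom T B (E i)"
    "t \<cdot> s = Idn T K" "q \<cdot> j = Idn T (E i)" "q \<cdot> s = Zero T K (E i)" "t \<cdot> j = Zero T (E i) K"
    using B(2) by (auto simp: is_biproduct_def)
  have ar: "s \<in> Arr T" "Dom T s = K" "Cod T s = B" "j \<in> Arr T" "Dom T j = E i" "Cod T j = B"
    "t \<in> Arr T" "Dom T t = B" "Cod T t = K" "q \<in> Arr T" "Dom T q = B" "Cod T q = E i"
    "m \<in> Arr T" "Dom T m = K" "Cod T m = G" "\<rho> \<in> Arr T" "Dom T \<rho> = G" "Cod T \<rho> = K"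
    "p i \<in> Arr T" "Dom T (p i) = G" "Cod T (p i) = E i"
    using b K p0 i by (auto simp: Hom_def)
  have O: "K \<in> Obj T" "E i \<in> Obj T" "G \<in> Obj T" using cells_obj[OF K(1)] a i by auto
  define m' where "m' = Add T (m \<cdot> t) (\<iota> i \<cdot> q)"
  define \<rho>' where "\<rho>' = Add T (s \<cdot> \<rho>) (j \<cdot> p i)"
  have m': "m' \<in> Arr T" "Dom T m' = B" "Cod T m' = G" using ar a i by (auto simp: m'_def)
  have "m' \<cdot> s = m" "m' \<cdot> j = \<iota> i" unfolding m'_def using ar b(5-8) a i O by (simp_all add: comp_add comp_assoc)
  moreover have "m' \<cdot> \<rho>' = Add T ((m' \<cdot> s) \<cdot> \<rho>) ((m' \<cdot> j) \<cdot> p i)" unfolding \<rho>'_def using m' ar by (simp add: comp_add comp_assoc)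
  ultimately have "m' \<cdot> \<rho>' = Add T d (\<iota> i \<cdot> p i)" using K(4) by simp
  also have "\<dots> = e" unfolding e by (rule add_commute[where X=G and Y=G]) (use trunc_arr[OF d] ar a i in \<open>auto simp: Hom_def\<close>)
  finally show ?case using B(1) m' ar by (intro bexI[of _ B] bexI[of _ m'] bexI[of _ \<rho>']) (auto simp: Hom_def \<rho>'_def)
qed

text \<open>A map \<open>k\<close> from a cell factors as \<open>n \<cdot> k'\<close> through a cell
  \<open>C\<close>, and the cone of \<open>k'\<close> can be taken to be a cell. An element over the
  cone of \<open>k\<close> has the same image under \<open>r\<close> as one coming from this cell;
  the difference comes from \<open>G\<close>, where finite support again leads to a cell.\<close>

lemma stably_cell_generated_coproduct:
  assumes small: "small \<kappa> A" and A: "\<And>a. a \<in> A \<Longrightarrow> E a \<in> cells" and G: "is_coproduct T A E G \<iota>"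
  shows "stably_cell_generated G"
  unfolding stably_cell_generated_def
proof (intro conjI allI impI)
  show GO: "G \<in> Obj T" by (rule coproduct_arr(1)[OF G])
  fix k m r assume M: "(k, m, r) \<in> Dist T" and K: "Dom T k \<in> cells" "Cod T k = G"
  note a = Dist_arr[OF M]
  have "k \<in> Hom T (Dom T k) G" using a K by (simp add: Hom_def)
  from compact_small_coproduct[OF cells_compact[OF K(1)] small G this] obtain F e where
    F: "finite F" "F \<subseteq> A" "is_trunc A G \<iota> F e" "e \<cdot> k = k" by (auto simp: finitely_supported_def)
  obtain C n \<rho> where C: "C \<in> cells" "n \<in> Hom T C G" "\<rho> \<in> Hom T G C" "n \<cdot> \<rho> = e"
    using trunc_through_cell[OF A G F(1-3)] by blast
  have Ca: "n \<in> Arr T" "Dom T n = C" "Cod T n = G" "\<rho> \<in> Arr T" "Dom T \<rho> = G" "Cod T \<rho> = C" using C by (auto simp: Hom_def)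
  define k' where "k' = \<rho> \<cdot> k"
  have k': "k' \<in> Arr T" "Dom T k' = Dom T k" "Cod T k' = C" using Ca a K by (auto simp: k'_def)
  have nk: "n \<cdot> k' = k" unfolding k'_def using comp_rewrite[OF C(4), of k] F(4) Ca a K by simp
  obtain m' r' where M': "(k', m', r') \<in> Dist T" "Cod T m' \<in> cells" using cells_cone[OF k'(1)] k' K C by auto
  note b = Dist_arr[OF M'(1)]
  have "\<exists>d. triangle_morphism T (k', m', r') (k, m, r) (Idn T (Dom T k)) n d"
    by (rule Dist_fill[OF M'(1) M]) (use a b K Ca k' nk in \<open>auto simp: Hom_def\<close>)
  then obtain d where "d \<in> Hom T (Cod T m') (Cod T m)" "SuspM T (Idn T (Dom T k)) \<cdot> r' = r \<cdot> d"
    using a b by (auto simp: triangle_morphism_def)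
  then have d: "d \<in> Arr T" "Dom T d = Cod T m'" "Cod T d = Cod T m" "r \<cdot> d = r'"
    using a b k' by (auto simp: Hom_def SuspM_Idn)
  show "cell_generated (Cod T m)"
    unfolding cell_generated_def
  proof (intro conjI allI impI)
    show "Cod T m \<in> Obj T" using a by simp
    fix P x assume P: "compact_object T \<kappa> P" and x: "x \<in> Hom T P (FO (Cod T m))"
    have xa: "x \<in> Arr T" "Dom T x = P" "Cod T x = FO (Cod T m)" using x by (auto simp: Hom_def)
    have PO: "P \<in> Obj T" using xa by auto
    have "FM (Minus (SuspM T k)) \<cdot> (FM r \<cdot> x) = FM (Minus (SuspM T k) \<cdot> r) \<cdot> x" using a xa K by (simp add: F_comp comp_assoc)
    also have "\<dots> = Zero T P (FO (Susp T G))"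
      using Dist_comp_zero[OF Dist_rot[OF Dist_rot[OF M]]] a xa K GO by simp
    finally have 0: "FM (Minus (SuspM T k)) \<cdot> (FM r \<cdot> x) = Zero T P (FO (Susp T G))" .
    \<comment> \<open>Because \<open>k'\<close> is \<open>\<rho> \<cdot> k\<close>, an element
      killed by the suspension of \<open>k\<close> is killed by that of \<open>k'\<close> too, and
      so it lifts along \<open>r'\<close>.\<close>
    have "Minus (SuspM T k') = SuspM T \<rho> \<cdot> Minus (SuspM T k)" unfolding k'_def using Ca a K by (simp add: susp_comp comp_minus)
    then have "FM (Minus (SuspM T k')) \<cdot> (FM r \<cdot> x) = FM (SuspM T \<rho>) \<cdot> (FM (Minus (SuspM T k)) \<cdot> (FM r \<cdot> x))"
      using Ca a K xa by (simp add: F_comp comp_assoc)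
    also have "\<dots> = Zero T P (FO (Susp T C))" unfolding 0 using Ca GO PO by simp
    finally have "\<exists>y \<in> Hom T P (FO (Dom T r')). FM r' \<cdot> y = FM r \<cdot> x"
      by (intro F_exact[OF Dist_rot[OF Dist_rot[OF M'(1)]]]) (use a b xa K k' in \<open>auto simp: Hom_def\<close>)
    then obtain y where y: "y \<in> Hom T P (FO (Cod T m'))" "FM r' \<cdot> y = FM r \<cdot> x" using b by auto
    have ya: "y \<in> Arr T" "Dom T y = P" "Cod T y = FO (Cod T m')" using y by (auto simp: Hom_def)
    have "FM r \<cdot> (FM d \<cdot> y) = FM (r \<cdot> d) \<cdot> y"
      using d(1-3) a ya by (simp add: F_comp comp_assoc)
    then have "FM r \<cdot> (FM d \<cdot> y) = FM r \<cdot> x" unfolding d(4) y(2) .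
    then have "FM r \<cdot> Sub x (FM d \<cdot> y) = Zero T P (FO (Cod T r))"
      using xa ya d a PO by (simp add: comp_sub)
    then have "\<exists>z \<in> Hom T P (FO (Dom T m)). FM m \<cdot> z = Sub x (FM d \<cdot> y)"
      by (intro F_exact[OF Dist_rot[OF M]]) (use a xa ya d in \<open>auto simp: Hom_def\<close>)
    then obtain z where z: "z \<in> Hom T P (FO G)" "FM m \<cdot> z = Sub x (FM d \<cdot> y)" using a K by auto
    have za: "z \<in> Arr T" "Dom T z = P" "Cod T z = FO G" using z by (auto simp: Hom_def)
    obtain H f where H: "finite H" "H \<subseteq> A" "is_trunc A G \<iota> H f" "FM f \<cdot> z = z"
      by (rule F_finitely_supported[OF small G P z(1)])
    obtain C1 n1 \<rho>1 where C1: "C1 \<in> cells" "n1 \<in> Hom T C1 G" "\<rho>1 \<in> Hom T G C1" "n1 \<cdot> \<rho>1 = f"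
      using trunc_through_cell[OF A G H(1-3)] by blast
    have "z = FM n1 \<cdot> (FM \<rho>1 \<cdot> z)" using H(4) C1 za by (auto simp: Hom_def F_comp comp_assoc)
    moreover have "FM \<rho>1 \<cdot> z \<in> Hom T P (FO C1)" using C1 za by (auto simp: Hom_def)
    ultimately have "factors P G z" unfolding factors_def using C1 by blast
    then have 1: "factors P (Cod T m) (FM m \<cdot> z)" by (rule factors_push) (use a K in \<open>auto simp: Hom_def\<close>)
    have "factors P (Cod T m') y" using cell_is_generated[OF M'(2)] P y by (auto simp: cell_generated_def)
    then have 2: "factors P (Cod T m) (FM d \<cdot> y)" by (rule factors_push) (use d in \<open>auto simp: Hom_def\<close>)
    have "Add T (FM m \<cdot> z) (FM d \<cdot> y) = x" unfolding z(2) using xa ya d by (simp add: sub_add)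
    then show "factors P (Cod T m) x" using factors_add[OF 1 2] by simp
  qed
qed

end

section \<open>Triangles with a prescribed last map, and fibers of composites\<close>

context triangulated_category
begin

text \<open>The source of \<open>\<gamma>\<close> is replaced by a suspension along
  \<open>\<theta>\<close>, and the isomorphism is then absorbed into the second map.\<close>

lemma Dist_third_general:
  assumes \<gamma>: "\<gamma> \<in> Hom T G (Susp T Z)" and Z: "Z \<in> Obj T"
  obtains \<phi> p where "(\<phi>, p, \<gamma>) \<in> Dist T" "Dom T \<phi> = Z"
proof -
  have \<gamma>a: "\<gamma> \<in> Arr T" "Dom T \<gamma> = G" "Cod T \<gamma> = Susp T Z" using \<gamma> by (auto simp: Hom_def)
  obtain K \<theta> where \<theta>: "K \<in> Obj T" "\<theta> \<in> Hom T (Susp T K) G" "iso_arrow T \<theta>" using desusp[of G] \<gamma>a dom_obj[of \<gamma>] by metis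
  have \<theta>a: "\<theta> \<in> Arr T" "Dom T \<theta> = Susp T K" "Cod T \<theta> = G" using \<theta> by (auto simp: Hom_def)
  have "\<gamma> \<cdot> \<theta> \<in> Hom T (Susp T K) (Susp T Z)" using \<gamma>a \<theta>a by (simp add: Hom_def)
  from Dist_third[OF this \<theta>(1) Z] obtain k \<phi> p where D: "(\<phi>, p, \<gamma> \<cdot> \<theta>) \<in> Dist T" "\<phi> \<in> Hom T Z (Cod T \<phi>)"
    "p \<in> Hom T (Cod T \<phi>) (Susp T K)" .
  note a = Dist_arr[OF D(1)]
  have pa: "Dom T \<phi> = Z" "Cod T p = Susp T K" using D by (auto simp: Hom_def)
  have "(\<phi>, \<theta> \<cdot> p, \<gamma>) \<in> Dist T"
    by (rule Dist_iso[OF D(1), where a="Idn T Z" and b="Idn T (Cod T \<phi>)" and c=\<theta>])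
      (use a pa \<theta>a \<theta>(3) \<gamma>a Z in \<open>auto simp: triangle_def triangle_morphism_def Hom_def SuspM_Idn\<close>)
  then show thesis using that pa by blast
qed

text \<open>The octahedron is taken over \<open>q \<cdot> \<gamma>\<close>, where \<open>q\<close>
  and \<open>\<gamma>\<close> are neighbors of \<open>s\<close> and \<open>\<phi>\<close> in their
  triangles, and its new triangle is rotated back twice. It exhibits the fiber of
  \<open>\<phi> \<cdot> s\<close> as an extension of \<open>Dom T \<gamma>\<close> by the fiber of
  \<open>s\<close>.\<close>

lemma octahedral_fiber:
  assumes D: "(b, s, q) \<in> Dist T" and G: "(\<gamma>, \<phi>, \<delta>) \<in> Dist T" and c: "Cod T s = Dom T \<phi>"
  obtains b' u \<beta> p where "(b', \<phi> \<cdot> s, u) \<in> Dist T" "(\<beta>, p, q \<cdot> \<gamma>) \<in> Dist T" "Dom T \<beta> = Dom T b" "Cod T \<beta> = Dom T b'"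
proof -
  note a = Dist_arr[OF D] and g = Dist_arr[OF G]
  have "q \<cdot> \<gamma> \<in> Hom T (Dom T \<gamma>) (Susp T (Dom T b))" using a g c by (simp add: Hom_def)
  from Dist_third_general[OF this] a obtain \<beta> p where B: "(\<beta>, p, q \<cdot> \<gamma>) \<in> Dist T" "Dom T \<beta> = Dom T b" by auto
  note ba = Dist_arr[OF B(1)]
  have "\<exists>u \<in> Hom T (Cod T \<phi>) (Cod T (Minus (SuspM T \<beta>))). \<exists>v \<in> Hom T (Cod T (Minus (SuspM T \<beta>))) (Cod T (Minus (SuspM T b))).
        (u, v, SuspM T \<phi> \<cdot> Minus (SuspM T s)) \<in> Dist T \<and> u \<cdot> \<phi> = Minus (SuspM T \<beta>) \<cdot> q \<and> Minus (SuspM T p) \<cdot> u = \<delta> \<and>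
        v \<cdot> Minus (SuspM T \<beta>) = Minus (SuspM T b) \<and> Minus (SuspM T s) \<cdot> v = SuspM T \<gamma> \<cdot> Minus (SuspM T p)"
    by (rule octahedral[OF _ _ G Dist_rot[OF Dist_rot[OF D]] Dist_rot[OF Dist_rot[OF B(1)]], of "Dom T \<gamma>" "Cod T \<gamma>" "Cod T q"])
      (use a g c in \<open>auto simp: Hom_def\<close>)
  then obtain u v where uv: "u \<in> Hom T (Cod T \<phi>) (Susp T (Cod T \<beta>))" "v \<in> Hom T (Susp T (Cod T \<beta>)) (Susp T (Cod T b))"
    "(u, v, SuspM T \<phi> \<cdot> Minus (SuspM T s)) \<in> Dist T" using a ba by auto
  have uva: "u \<in> Arr T" "Dom T u = Cod T \<phi>" "Cod T u = Susp T (Cod T \<beta>)" "v \<in> Arr T" "Dom T v = Susp T (Cod T \<beta>)"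
    "Cod T v = Susp T (Cod T b)" using uv by (auto simp: Hom_def)
  have "(u, v, Minus (SuspM T (\<phi> \<cdot> s))) \<in> Dist T" using uv(3) a g c by (simp add: comp_minus susp_comp)
  then have E: "(\<phi> \<cdot> s, u, v) \<in> Dist T" by (rule Dist_unrot) (use a g c uva in auto)
  have "Minus v \<in> Hom T (Susp T (Cod T \<beta>)) (Susp T (Cod T b))" using uva by (simp add: Hom_def)
  from susp_full[OF this] obtain b' where b': "b' \<in> Hom T (Cod T \<beta>) (Cod T b)" "SuspM T b' = Minus v" using a ba by auto
  have ba': "b' \<in> Arr T" "Dom T b' = Cod T \<beta>" "Cod T b' = Cod T b" using b' by (auto simp: Hom_def)
  have "(\<phi> \<cdot> s, u, Minus (SuspM T b')) \<in> Dist T" using E b'(2) uva by simp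
  then have "(b', \<phi> \<cdot> s, u) \<in> Dist T" by (rule Dist_unrot) (use ba' a g c uva in auto)
  then show thesis using that B ba' by auto
qed

end

section \<open>Fibers of killing towers, and factorization through cells in general\<close>

context homological_endofunctor
begin

text \<open>A zero object is the coproduct of the empty family of cells.\<close>

lemma stably_cell_generated_zero:
  assumes Z: "zero_object T Z"
  shows "stably_cell_generated Z"
proof (rule stably_cell_generated_coproduct)
  show "small \<kappa> ({} :: 'm set)" by (rule small_finite) simp
  show "is_coproduct T ({} :: 'm set) (\<lambda>_. Z) Z (\<lambda>_. undefined)"
    using Z by (auto simp: is_coproduct_def zero_object_def)
qed simp

text \<open>Each killing step contributes one coproduct of cells, so the fiber of a composite of
  \<open>n\<close> steps is built by extensions from \<open>n\<close> such coproducts.\<close>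

lemma kill_tower_fiber:
  assumes \<phi>: "\<And>n. \<phi> n \<in> Arr T" "\<And>n. Dom T (\<phi> (Suc n)) = Cod T (\<phi> n)" "\<And>n. kill_step N (\<phi> n)"
  shows "\<exists>b q. (b, trans_map \<phi> 0 n, q) \<in> Dist T \<and> stably_cell_generated (Dom T b)"
proof -
  obtain W \<iota> d \<pi> where t: "telescope \<phi> W \<iota> d \<pi>" by (rule telescope_exists[of \<phi>]) (use \<phi> in auto)
  note ta = trans_map_arr[OF t]
  show ?thesis
  proof (induction n)
    case 0
    obtain Z where Z: "zero_object T Z" using zero_object_exists by blast
    then have "Z \<in> Obj T" by (simp add: zero_object_def)
    then show ?case using Dist_zero[of "Dom T (\<phi> 0)" Z] Z stably_cell_generated_zero[OF Z] \<phi>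
      by (intro exI[of _ "Zero T Z (Dom T (\<phi> 0))"] exI[of _ "Zero T (Dom T (\<phi> 0)) (Susp T Z)"]) auto
  next
    case (Suc n)
    obtain b q where b: "(b, trans_map \<phi> 0 n, q) \<in> Dist T" "stably_cell_generated (Dom T b)" using Suc by blast
    obtain A :: "'m set" and E G \<iota> \<gamma> \<delta> where G: "small \<kappa> A" "\<forall>a \<in> A. E a \<in> cells" "is_coproduct T A E G \<iota>"
      "(\<gamma>, \<phi> n, \<delta>) \<in> Dist T" "Dom T \<gamma> = G" using \<phi>(3)[of n] unfolding kill_step_def by blast
    obtain b' u \<beta> p where B: "(b', \<phi> n \<cdot> trans_map \<phi> 0 n, u) \<in> Dist T" "(\<beta>, p, q \<cdot> \<gamma>) \<in> Dist T"
        "Dom T \<beta> = Dom T b" "Cod T \<beta> = Dom T b'"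
      by (rule octahedral_fiber[OF b(1) G(4)]) (use ta[of 0 n] in auto)
    have "Cod T p = G"
    proof -
      have "Dom T (q \<cdot> \<gamma>) = G"
        using Dist_arr[OF b(1)] Dist_arr[OF G(4)] G(5) ta[of 0 n] by simp
      then show ?thesis using Dist_arr[OF B(2)] by simp
    qed
    moreover have "stably_cell_generated G" by (rule stably_cell_generated_coproduct[OF G(1) _ G(3)]) (use G in blast)
    ultimately have "stably_cell_generated (Dom T b')"
      using stably_cell_generated_extension[OF B(2)] B(3,4) b(2) by simp
    then show ?case using B(1) by auto
  qed
qed

text \<open>
  Killing all maps from cells repeatedly leads to a telescope with vanishing colimit, hence every
  element dies at a finite stage.
\<close>

theorem cell_generated_all:
  assumes Z: "Z \<in> Obj T"
  shows "cell_generated Z"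
  unfolding cell_generated_def
proof (intro conjI allI impI)
  fix P x assume P: "compact_object T \<kappa> P" and x: "x \<in> Hom T P (FO Z)"
  have xa: "x \<in> Arr T" "Dom T x = P" "Cod T x = FO Z" using x by (auto simp: Hom_def)
  have PO: "P \<in> Obj T" using xa by auto
  obtain \<phi> :: "nat \<Rightarrow> 'm" where \<phi>: "Dom T (\<phi> 0) = Z" "\<And>n. \<phi> n \<in> Arr T" "\<And>n. Dom T (\<phi> (Suc n)) = Cod T (\<phi> n)"
    "\<And>n. kill_step (\<lambda>_. True) (\<phi> n)" using kill_tower_exists[OF Z] by metis
  obtain W \<iota> d \<pi> where t: "telescope \<phi> W \<iota> d \<pi>" by (rule telescope_exists[of \<phi>]) (use \<phi> in auto)
  note a = telescope_arr[OF t]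
  note ta = trans_map_arr[OF t]
  \<comment> \<open>A map from a cell to the colimit comes from a finite stage and is killed by the
    next step; since cells generate, the colimit is zero.\<close>
  have L: "zero_object T (Cod T \<pi>)"
  proof (rule cells_generate)
    show "Cod T \<pi> \<in> Obj T" using a by simp
    fix K f assume K: "K \<in> cells" and f: "f \<in> Hom T K (Cod T \<pi>)"
    obtain n w where w: "w \<in> Hom T K (Dom T (\<phi> n))" "f = \<pi> \<cdot> \<iota> n \<cdot> w" by (rule telescope_compact[OF t cells_compact[OF K] f])
    have wa: "w \<in> Arr T" "Dom T w = K" "Cod T w = Dom T (\<phi> n)" using w by (auto simp: Hom_def)
    have "\<phi> n \<cdot> w = Zero T K (Cod T (\<phi> n))" using \<phi>(4)[of n] wa K unfolding kill_step_def by blast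
    moreover have "f = (\<pi> \<cdot> \<iota> (Suc n)) \<cdot> (\<phi> n \<cdot> w)"
      unfolding w(2) telescope_step[OF t, of n, symmetric] using a wa by (simp add: comp_assoc)
    ultimately show "f = Zero T K (Cod T \<pi>)" using a cells_obj[OF K] by simp
  qed
  have "\<pi> \<cdot> \<iota> 0 = Zero T Z (Cod T \<pi>)" by (rule zero_object_Hom(1)[OF L]) (use a \<phi>(1) in \<open>auto simp: Hom_def\<close>)
  then have "FM (\<pi> \<cdot> \<iota> 0) \<cdot> x = Zero T P (FO (Cod T \<pi>))" using xa a Z by simp
  then obtain n where n: "FM (trans_map \<phi> 0 n) \<cdot> x = Zero T P (FO (Dom T (\<phi> n)))"
    by (rule telescope_dies[OF t P, rotated 1]) (use x \<phi>(1) in auto)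
  \<comment> \<open>Having died at stage \<open>n\<close>, the element lifts to the fiber of the
    composite of the first \<open>n\<close> maps.\<close>
  obtain b q where b: "(b, trans_map \<phi> 0 n, q) \<in> Dist T" "stably_cell_generated (Dom T b)"
    using kill_tower_fiber[of \<phi> "\<lambda>_. True" n] \<phi> by blast
  note ba = Dist_arr[OF b(1)]
  have "\<exists>y \<in> Hom T P (FO (Dom T b)). FM b \<cdot> y = x"
    by (rule F_exact[OF b(1)]) (use n x \<phi>(1) ta[of 0 n] in auto)
  then obtain y where y: "y \<in> Hom T P (FO (Dom T b))" "FM b \<cdot> y = x" by blast
  have "factors P (Dom T b) y" using stably_cell_generated_imp[OF b(2)] P y by (auto simp: cell_generated_def)
  then have "factors P Z (FM b \<cdot> y)" by (rule factors_push) (use ba ta[of 0 n] \<phi>(1) in \<open>auto simp: Hom_def\<close>)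
  then show "factors P Z x" using y by simp
qed (rule Z)

end

context big_tt_category
begin

lemma homological_endofunctor_id: "homological_endofunctor T \<kappa> (\<lambda>X. X) (\<lambda>f. f)"
proof unfold_locales
  fix f g h x P
  assume "(f, g, h) \<in> Dist T" "x \<in> Hom T P (Dom T g)" "g \<cdot> x = Zero T P (Cod T g)"
  then show "\<exists>y \<in> Hom T P (Dom T f). f \<cdot> y = x" by (metis Dist_exact)
qed (assumption | rule refl)+

text \<open>Apply the factorization theorem for the identity functor to the identity map of
  \<open>C\<close>. Tests on all compact objects are thereby reduced to a small set of
  cells.\<close>

lemma compact_retract_of_cell:
  assumes C: "compact_object T \<kappa> C"
  obtains K i r where "K \<in> cells" "i \<in> Hom T C K" "r \<in> Hom T K C" "r \<cdot> i = Idn T C"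
proof -
  interpret H: homological_endofunctor T \<kappa> "\<lambda>X. X" "\<lambda>f. f" by (rule homological_endofunctor_id)
  have CO: "C \<in> Obj T" using compact_obj[OF C] .
  have "H.factors C C (Idn T C)"
    using H.cell_generated_all[OF CO] C Idn_Hom[OF CO] unfolding H.cell_generated_def by blast
  then show thesis using that unfolding H.factors_def by metis
qed

end

section \<open>Tensoring with a fixed object as a homological endofunctor\<close>

context symmetric_monoidal_category
begin

lemma ten_arr [simp]:
  assumes "f \<in> Arr T" "g \<in> Arr T"
  shows "f \<boxtimes> g \<in> Arr T" "Dom T (f \<boxtimes> g) = Dom T f \<odot> Dom T g" "Cod T (f \<boxtimes> g) = Cod T f \<odot> Cod T g"
  using TenM_Hom[of f "Dom T f" "Cod T f" g "Dom T g" "Cod T g"] assms by (auto simp: Hom_def)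

lemma ten_obj [simp]: "\<lbrakk>X \<in> Obj T; Y \<in> Obj T\<rbrakk> \<Longrightarrow> X \<odot> Y \<in> Obj T"
  by (rule TenO_Obj)

lemma ten_comp: "\<lbrakk>f \<in> Arr T; f' \<in> Arr T; Cod T f = Dom T f'; g \<in> Arr T; g' \<in> Arr T; Cod T g = Dom T g'\<rbrakk>
    \<Longrightarrow> (f' \<boxtimes> g') \<cdot> (f \<boxtimes> g) = (f' \<cdot> f) \<boxtimes> (g' \<cdot> g)"
  using TenM_Comp[of f "Dom T f" "Cod T f" f' "Cod T f'" g "Dom T g" "Cod T g" g' "Cod T g'"] by (simp add: Hom_def)

end

context closed_symmetric_monoidal_category
begin

lemma ihom_obj [simp]: "\<lbrakk>X \<in> Obj T; Y \<in> Obj T\<rbrakk> \<Longrightarrow> IHom T X Y \<in> Obj T"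
  by (rule IHom_Obj)

lemma eval_arr [simp]:
  assumes "X \<in> Obj T" "Y \<in> Obj T"
  shows "Eval T X Y \<in> Arr T" "Dom T (Eval T X Y) = IHom T X Y \<odot> X" "Cod T (Eval T X Y) = Y"
  using Eval_Hom[OF assms] by (auto simp: Hom_def)

lemma curry_unique:
  assumes "X \<in> Obj T" "Y \<in> Obj T" "f \<in> Hom T W (IHom T X Y)" "g \<in> Hom T W (IHom T X Y)"
    and "Eval T X Y \<cdot> (f \<boxtimes> Idn T X) = Eval T X Y \<cdot> (g \<boxtimes> Idn T X)"
  shows "f = g"
proof -
  have "Eval T X Y \<cdot> (f \<boxtimes> Idn T X) \<in> Hom T (W \<odot> X) Y" using assms by (auto simp: Hom_def)
  then have "\<exists>!h. h \<in> Hom T W (IHom T X Y) \<and> Eval T X Y \<cdot> (h \<boxtimes> Idn T X) = Eval T X Y \<cdot> (f \<boxtimes> Idn T X)"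
    using Eval_universal[of W X Y] assms(1-3) Hom_obj by blast
  then show ?thesis by (rule ex1_eq) (use assms in auto)
qed

lemma curry_exists:
  assumes "X \<in> Obj T" "W \<in> Obj T" "f \<in> Hom T (W \<odot> X) Y"
  obtains g where "g \<in> Hom T W (IHom T X Y)" "Eval T X Y \<cdot> (g \<boxtimes> Idn T X) = f"
proof -
  have "Y \<in> Obj T" using assms Hom_obj by blast
  from Eval_universal[OF assms(2,1) this assms(3)] show thesis using that by blast
qed

text \<open>Tensoring with \<open>X\<close> is left adjoint to the internal hom: currying turns the
  universal property to be shown into that of \<open>P\<close>.\<close>

lemma ten_coproduct:
  assumes P: "is_coproduct T I E P \<iota>" and X: "X \<in> Obj T"
  shows "is_coproduct T I (\<lambda>i. E i \<odot> X) (P \<odot> X) (\<lambda>i. \<iota> i \<boxtimes> Idn T X)"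
proof (rule is_coproductI)
  note a = coproduct_arr[OF P]
  show "P \<odot> X \<in> Obj T" using a X by simp
  show "\<iota> i \<boxtimes> Idn T X \<in> Hom T (E i \<odot> X) (P \<odot> X)" if "i \<in> I" for i using a that X by (simp add: Hom_def)
  fix Y assume Y: "Y \<in> Obj T"
  have ev: "Eval T X Y \<cdot> (h \<boxtimes> Idn T X) \<cdot> (\<iota> i \<boxtimes> Idn T X) = Eval T X Y \<cdot> ((h \<cdot> \<iota> i) \<boxtimes> Idn T X)"
    if "h \<in> Hom T P (IHom T X Y)" "i \<in> I" for h i
    using that a X Y by (simp add: Hom_def comp_assoc ten_comp)
  {
    fix f assume f: "\<And>i. i \<in> I \<Longrightarrow> f i \<in> Hom T (E i \<odot> X) Y"
    have "\<forall>i \<in> I. \<exists>g. g \<in> Hom T (E i) (IHom T X Y) \<and> Eval T X Y \<cdot> (g \<boxtimes> Idn T X) = f i"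
    proof
      fix i assume "i \<in> I"
      then show "\<exists>g. g \<in> Hom T (E i) (IHom T X Y) \<and> Eval T X Y \<cdot> (g \<boxtimes> Idn T X) = f i"
        using curry_exists[OF X a(5) f] by metis
    qed
    then obtain g where g: "\<forall>i \<in> I. g i \<in> Hom T (E i) (IHom T X Y) \<and> Eval T X Y \<cdot> (g i \<boxtimes> Idn T X) = f i"
      by (rule bchoice[THEN exE])
    then have "\<exists>!h. h \<in> Hom T P (IHom T X Y) \<and> (\<forall>i \<in> I. h \<cdot> \<iota> i = g i)"
      by (intro coproduct_ex1[OF P]) (use X Y in auto)
    then obtain h where h: "h \<in> Hom T P (IHom T X Y)" "\<forall>i \<in> I. h \<cdot> \<iota> i = g i" by (auto dest: ex1_implies_ex)
    then have "\<forall>i \<in> I. Eval T X Y \<cdot> (h \<boxtimes> Idn T X) \<cdot> (\<iota> i \<boxtimes> Idn T X) = f i" using ev g by simp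
    moreover have "Eval T X Y \<cdot> (h \<boxtimes> Idn T X) \<in> Hom T (P \<odot> X) Y" using h X Y by (auto simp: Hom_def)
    ultimately show "\<exists>h \<in> Hom T (P \<odot> X) Y. \<forall>i \<in> I. h \<cdot> (\<iota> i \<boxtimes> Idn T X) = f i" by blast
  }
  fix f g assume fg: "f \<in> Hom T (P \<odot> X) Y" "g \<in> Hom T (P \<odot> X) Y"
    "\<And>i. i \<in> I \<Longrightarrow> f \<cdot> (\<iota> i \<boxtimes> Idn T X) = g \<cdot> (\<iota> i \<boxtimes> Idn T X)"
  obtain f' where f': "f' \<in> Hom T P (IHom T X Y)" "Eval T X Y \<cdot> (f' \<boxtimes> Idn T X) = f" by (rule curry_exists[OF X a(1) fg(1)])
  obtain g' where g': "g' \<in> Hom T P (IHom T X Y)" "Eval T X Y \<cdot> (g' \<boxtimes> Idn T X) = g" by (rule curry_exists[OF X a(1) fg(2)])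
  have "f' = g'"
  proof (rule coproduct_eqI[OF P f'(1) g'(1)])
    fix i assume i: "i \<in> I"
    show "f' \<cdot> \<iota> i = g' \<cdot> \<iota> i"
    proof (rule curry_unique[OF X Y])
      show "f' \<cdot> \<iota> i \<in> Hom T (E i) (IHom T X Y)" "g' \<cdot> \<iota> i \<in> Hom T (E i) (IHom T X Y)"
        using f' g' a i by (auto simp: Hom_def)
      show "Eval T X Y \<cdot> ((f' \<cdot> \<iota> i) \<boxtimes> Idn T X) = Eval T X Y \<cdot> ((g' \<cdot> \<iota> i) \<boxtimes> Idn T X)"
        using ev[OF f'(1) i] ev[OF g'(1) i] f'(2) g'(2) fg(3)[OF i] by simp
    qed
  qed
  then show "f = g" using f' g' by simp
qed

end

context big_tt_category
begin

lemma homological_endofunctor_ten: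
  assumes X: "X \<in> Obj T"
  shows "homological_endofunctor T \<kappa> (\<lambda>Z. Z \<odot> X) (\<lambda>f. f \<boxtimes> Idn T X)"
proof unfold_locales
  show "\<And>Z. Z \<in> Obj T \<Longrightarrow> Z \<odot> X \<in> Obj T" using X by simp
  show "\<And>f Y Z. f \<in> Hom T Y Z \<Longrightarrow> f \<boxtimes> Idn T X \<in> Hom T (Y \<odot> X) (Z \<odot> X)" using TenM_Hom Idn_Hom[OF X] by blast
  show "\<And>f U Y g Z. f \<in> Hom T U Y \<Longrightarrow> g \<in> Hom T Y Z \<Longrightarrow> (g \<cdot> f) \<boxtimes> Idn T X = (g \<boxtimes> Idn T X) \<cdot> (f \<boxtimes> Idn T X)"
    using X by (auto simp: Hom_def ten_comp)
  show "\<And>Y. Y \<in> Obj T \<Longrightarrow> Idn T Y \<boxtimes> Idn T X = Idn T (Y \<odot> X)" using TenM_Idn X by blast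
  show "\<And>f Y Z g. f \<in> Hom T Y Z \<Longrightarrow> g \<in> Hom T Y Z \<Longrightarrow> Add T f g \<boxtimes> Idn T X = Add T (f \<boxtimes> Idn T X) (g \<boxtimes> Idn T X)"
    using TenM_Add X by blast
  show "\<exists>y \<in> Hom T P (Dom T f \<odot> X). (f \<boxtimes> Idn T X) \<cdot> y = x"
    if "(f, g, h) \<in> Dist T" "x \<in> Hom T P (Dom T g \<odot> X)" "(g \<boxtimes> Idn T X) \<cdot> x = Zero T P (Cod T g \<odot> X)" for f g h x P
    using Dist_exact[OF TenM_exact[OF that(1) X], of x P] that Dist_arr[OF that(1)] X by (metis cod_idn dom_idn idn_arr ten_arr(2,3))
  show "\<And>(I :: 'u set) E W \<iota>. small \<kappa> I \<Longrightarrow> is_coproduct T I E W \<iota> \<Longrightarrow>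
      is_coproduct T I (\<lambda>i. E i \<odot> X) (W \<odot> X) (\<lambda>i. \<iota> i \<boxtimes> Idn T X)"
    using ten_coproduct X by blast
qed

lemma compact_factors_ten:
  assumes "Z \<in> Obj T" "X \<in> Obj T" and P: "compact_object T \<kappa> P" "x \<in> Hom T P (Z \<odot> X)"
  obtains K c y where "compact_object T \<kappa> K" "c \<in> Hom T K Z" "y \<in> Hom T P (K \<odot> X)" "x = (c \<boxtimes> Idn T X) \<cdot> y"
proof -
  interpret H: homological_endofunctor T \<kappa> "\<lambda>Z. Z \<odot> X" "\<lambda>f. f \<boxtimes> Idn T X" by (rule homological_endofunctor_ten[OF assms(2)])
  have "H.factors P Z x" using H.cell_generated_all[OF assms(1)] P unfolding H.cell_generated_def by blast
  then show thesis using that cells_compact unfolding H.factors_def by metis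
qed

end

section \<open>Coherence of the symmetric monoidal structure\<close>

context symmetric_monoidal_category
begin

lemma assoc_arr [simp]:
  assumes "X \<in> Obj T" "Y \<in> Obj T" "Z \<in> Obj T"
  shows "Assoc T X Y Z \<in> Arr T" "Dom T (Assoc T X Y Z) = X \<odot> Y \<odot> Z" "Cod T (Assoc T X Y Z) = X \<odot> (Y \<odot> Z)"
    "iso_arrow T (Assoc T X Y Z)"
  using Assoc_Hom[OF assms] Assoc_iso[OF assms] by (auto simp: Hom_def)

lemma lunit_arr [simp]:
  assumes "X \<in> Obj T"
  shows "LUnit T X \<in> Arr T" "Dom T (LUnit T X) = Unit T \<odot> X" "Cod T (LUnit T X) = X" "iso_arrow T (LUnit T X)"
  using LUnit_Hom[OF assms] LUnit_iso[OF assms] by (auto simp: Hom_def)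

lemma runit_arr [simp]:
  assumes "X \<in> Obj T"
  shows "RUnit T X \<in> Arr T" "Dom T (RUnit T X) = X \<odot> Unit T" "Cod T (RUnit T X) = X" "iso_arrow T (RUnit T X)"
  using RUnit_Hom[OF assms] RUnit_iso[OF assms] by (auto simp: Hom_def)

lemma unit_obj [simp]: "Unit T \<in> Obj T"
  by (rule Unit_Obj)

lemma braid_arr [simp]:
  assumes "X \<in> Obj T" "Y \<in> Obj T"
  shows "Braid T X Y \<in> Arr T" "Dom T (Braid T X Y) = X \<odot> Y" "Cod T (Braid T X Y) = Y \<odot> X" "iso_arrow T (Braid T X Y)"
proof -
  show "Braid T X Y \<in> Arr T" "Dom T (Braid T X Y) = X \<odot> Y" "Cod T (Braid T X Y) = Y \<odot> X"
    using Braid_Hom[OF assms] by (auto simp: Hom_def)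
  show "iso_arrow T (Braid T X Y)"
    by (rule iso_arrowI[OF Braid_Hom[OF assms] Braid_Hom[OF assms(2,1)]]) (use Braid_symmetric assms in auto)
qed

lemma braid_braid [simp]: "\<lbrakk>X \<in> Obj T; Y \<in> Obj T\<rbrakk> \<Longrightarrow> Braid T Y X \<cdot> Braid T X Y = Idn T (X \<odot> Y)"
  by (rule Braid_symmetric)

lemma ten_idn [simp]: "\<lbrakk>X \<in> Obj T; Y \<in> Obj T\<rbrakk> \<Longrightarrow> Idn T X \<boxtimes> Idn T Y = Idn T (X \<odot> Y)"
  by (rule TenM_Idn)

lemma ten_comp_tail: "\<lbrakk>f \<in> Arr T; f' \<in> Arr T; Cod T f = Dom T f'; g \<in> Arr T; g' \<in> Arr T; Cod T g = Dom T g';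
    x \<in> Arr T; Cod T x = Dom T f \<odot> Dom T g\<rbrakk>
    \<Longrightarrow> (f' \<boxtimes> g') \<cdot> ((f \<boxtimes> g) \<cdot> x) = ((f' \<cdot> f) \<boxtimes> (g' \<cdot> g)) \<cdot> x"
  by (rule comp_rewrite[OF ten_comp]) auto

lemma ten_iso [simp]:
  assumes "iso_arrow T f" "iso_arrow T g"
  shows "iso_arrow T (f \<boxtimes> g)"
  by (rule iso_arrowI[where X="Dom T f \<odot> Dom T g" and Y="Cod T f \<odot> Cod T g" and g="inv_arrow T f \<boxtimes> inv_arrow T g"])
    (use assms iso_arr in \<open>auto simp: Hom_def ten_comp\<close>)

lemma assoc_nat:
  assumes "f \<in> Arr T" "g \<in> Arr T" "h \<in> Arr T"
    "X = Cod T f" "Y = Cod T g" "Z = Cod T h"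
  shows "Assoc T X Y Z \<cdot> (f \<boxtimes> g \<boxtimes> h) = (f \<boxtimes> (g \<boxtimes> h)) \<cdot> Assoc T (Dom T f) (Dom T g) (Dom T h)"
  using Assoc_natural[of f "Dom T f" X g "Dom T g" Y h "Dom T h" Z] assms by (simp add: Hom_def)

lemma lunit_nat: "f \<in> Arr T \<Longrightarrow> LUnit T (Cod T f) \<cdot> (Idn T (Unit T) \<boxtimes> f) = f \<cdot> LUnit T (Dom T f)"
  using LUnit_natural[of f "Dom T f" "Cod T f"] by (simp add: Hom_def)

lemma runit_nat: "f \<in> Arr T \<Longrightarrow> RUnit T (Cod T f) \<cdot> (f \<boxtimes> Idn T (Unit T)) = f \<cdot> RUnit T (Dom T f)"
  using RUnit_natural[of f "Dom T f" "Cod T f"] by (simp add: Hom_def)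

lemma braid_nat: "\<lbrakk>f \<in> Arr T; g \<in> Arr T\<rbrakk> \<Longrightarrow> Braid T (Cod T f) (Cod T g) \<cdot> (f \<boxtimes> g) = (g \<boxtimes> f) \<cdot> Braid T (Dom T f) (Dom T g)"
  using Braid_natural[of f "Dom T f" "Cod T f" g "Dom T g" "Cod T g"] by (simp add: Hom_def)

text \<open>The left unitor identifies tensoring with the unit with the identity functor, so
  equations may be tested after tensoring with the unit, where the coherence laws become
  applicable.\<close>

lemma unit_ten_faithful:
  assumes "f \<in> Hom T X Y" "g \<in> Hom T X Y" "Idn T (Unit T) \<boxtimes> f = Idn T (Unit T) \<boxtimes> g"
  shows "f = g"
proof (rule iso_epic[of "LUnit T X"])
  have o: "X \<in> Obj T" "Y \<in> Obj T" using assms Hom_obj by auto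
  then show "iso_arrow T (LUnit T X)" "f \<in> Hom T (Cod T (LUnit T X)) Y" "g \<in> Hom T (Cod T (LUnit T X)) Y" using assms by auto
  show "f \<cdot> LUnit T X = g \<cdot> LUnit T X" using LUnit_natural[OF assms(1)] LUnit_natural[OF assms(2)] assms(3) by simp
qed

lemma ten_unit_faithful:
  assumes "f \<in> Hom T X Y" "g \<in> Hom T X Y" "f \<boxtimes> Idn T (Unit T) = g \<boxtimes> Idn T (Unit T)"
  shows "f = g"
proof (rule iso_epic[of "RUnit T X"])
  have o: "X \<in> Obj T" "Y \<in> Obj T" using assms Hom_obj by auto
  then show "iso_arrow T (RUnit T X)" "f \<in> Hom T (Cod T (RUnit T X)) Y" "g \<in> Hom T (Cod T (RUnit T X)) Y" using assms by auto
  show "f \<cdot> RUnit T X = g \<cdot> RUnit T X" using RUnit_natural[OF assms(1)] RUnit_natural[OF assms(2)] assms(3) by simp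
qed

lemma pentagon:
  assumes "W \<in> Obj T" "X \<in> Obj T" "Y \<in> Obj T" "Z \<in> Obj T"
  shows "Assoc T W X (Y \<odot> Z) \<cdot> Assoc T (W \<odot> X) Y Z
     = (Idn T W \<boxtimes> Assoc T X Y Z) \<cdot> (Assoc T W (X \<odot> Y) Z \<cdot> (Assoc T W X Y \<boxtimes> Idn T Z))"
  using pentagon_law[OF assms] assms by (simp add: comp_assoc)

lemma hexagon:
  assumes "X \<in> Obj T" "Y \<in> Obj T" "Z \<in> Obj T"
  shows "Assoc T Y Z X \<cdot> (Braid T X (Y \<odot> Z) \<cdot> Assoc T X Y Z)
        = (Idn T Y \<boxtimes> Braid T X Z) \<cdot> (Assoc T Y X Z \<cdot> (Braid T X Y \<boxtimes> Idn T Z))"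
  using hexagon_law[OF assms] assms by (simp add: comp_assoc)

text \<open>Kelly's argument: after tensoring on the left with the unit and composing with the
  isomorphism \<open>p\<close>, the pentagon and two instances of the triangle law rewrite one side
  into the other.\<close>

lemma lunit_assoc:
  assumes X: "X \<in> Obj T" and Y: "Y \<in> Obj T"
  shows "LUnit T (X \<odot> Y) \<cdot> Assoc T (Unit T) X Y = LUnit T X \<boxtimes> Idn T Y"
proof (rule unit_ten_faithful)
  let ?I = "Unit T"
  define p where "p = Assoc T ?I (?I \<odot> X) Y \<cdot> (Assoc T ?I ?I X \<boxtimes> Idn T Y)"
  have p: "iso_arrow T p" "p \<in> Arr T" "Dom T p = ?I \<odot> ?I \<odot> X \<odot> Y" "Cod T p = ?I \<odot> (?I \<odot> X \<odot> Y)"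
    using X Y by (auto simp: p_def intro!: iso_comp)
  show H: "LUnit T (X \<odot> Y) \<cdot> Assoc T ?I X Y \<in> Hom T (?I \<odot> X \<odot> Y) (X \<odot> Y)" "LUnit T X \<boxtimes> Idn T Y \<in> Hom T (?I \<odot> X \<odot> Y) (X \<odot> Y)"
    using X Y by (auto simp: Hom_def)
  have "(Idn T ?I \<boxtimes> (LUnit T (X \<odot> Y) \<cdot> Assoc T ?I X Y)) \<cdot> p
      = (Idn T ?I \<boxtimes> LUnit T (X \<odot> Y)) \<cdot> ((Idn T ?I \<boxtimes> Assoc T ?I X Y) \<cdot> p)"
    using X Y p by (simp add: ten_comp_tail)
  also have "(Idn T ?I \<boxtimes> Assoc T ?I X Y) \<cdot> p = Assoc T ?I ?I (X \<odot> Y) \<cdot> Assoc T (?I \<odot> ?I) X Y"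
    unfolding p_def by (rule pentagon[symmetric]) (use X Y in auto)
  also have "(Idn T ?I \<boxtimes> LUnit T (X \<odot> Y)) \<cdot> (Assoc T ?I ?I (X \<odot> Y) \<cdot> Assoc T (?I \<odot> ?I) X Y)
      = (RUnit T ?I \<boxtimes> Idn T (X \<odot> Y)) \<cdot> Assoc T (?I \<odot> ?I) X Y"
    by (rule comp_rewrite[OF triangle_law]) (use X Y in auto)
  also have "\<dots> = Assoc T ?I X Y \<cdot> ((RUnit T ?I \<boxtimes> Idn T X) \<boxtimes> Idn T Y)"
    using X Y by (simp add: assoc_nat)
  also have "RUnit T ?I \<boxtimes> Idn T X = (Idn T ?I \<boxtimes> LUnit T X) \<cdot> Assoc T ?I ?I X"
    by (rule triangle_law[symmetric]) (use X in auto)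
  also have "Assoc T ?I X Y \<cdot> (((Idn T ?I \<boxtimes> LUnit T X) \<cdot> Assoc T ?I ?I X) \<boxtimes> Idn T Y)
      = (Assoc T ?I X Y \<cdot> ((Idn T ?I \<boxtimes> LUnit T X) \<boxtimes> Idn T Y)) \<cdot> (Assoc T ?I ?I X \<boxtimes> Idn T Y)"
    using X Y by (simp add: comp_assoc ten_comp)
  also have "\<dots> = (Idn T ?I \<boxtimes> (LUnit T X \<boxtimes> Idn T Y)) \<cdot> p"
    unfolding p_def using X Y by (simp add: assoc_nat comp_assoc)
  finally show "Idn T ?I \<boxtimes> (LUnit T (X \<odot> Y) \<cdot> Assoc T ?I X Y) = Idn T ?I \<boxtimes> (LUnit T X \<boxtimes> Idn T Y)"
    by (rule iso_epic[rotated 3, where X="?I \<odot> (X \<odot> Y)"]) (use p X Y in \<open>auto simp: Hom_def\<close>)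
qed

text \<open>The hexagon for \<open>X\<close> and two copies of the unit, followed by a left unitor,
  becomes this identity tensored with the unit, up to an invertible braiding.\<close>

lemma lunit_braid:
  assumes X: "X \<in> Obj T"
  shows "LUnit T X \<cdot> Braid T X (Unit T) = RUnit T X"
proof (rule ten_unit_faithful)
  let ?I = "Unit T"
  show H: "LUnit T X \<cdot> Braid T X ?I \<in> Hom T (X \<odot> ?I) X" "RUnit T X \<in> Hom T (X \<odot> ?I) X" using X by (auto simp: Hom_def)
  have "LUnit T (?I \<odot> X) \<cdot> (Assoc T ?I ?I X \<cdot> (Braid T X (?I \<odot> ?I) \<cdot> Assoc T X ?I ?I))
     = (LUnit T ?I \<boxtimes> Idn T X) \<cdot> (Braid T X (?I \<odot> ?I) \<cdot> Assoc T X ?I ?I)"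
    by (rule comp_rewrite[OF lunit_assoc]) (use X in auto)
  also have "\<dots> = (Braid T X ?I \<cdot> (Idn T X \<boxtimes> LUnit T ?I)) \<cdot> Assoc T X ?I ?I"
    using X braid_nat[of "Idn T X" "LUnit T ?I"] by (simp add: comp_assoc)
  also have "\<dots> = Braid T X ?I \<cdot> (RUnit T X \<boxtimes> Idn T ?I)"
    using X by (simp add: comp_assoc triangle_law)
  finally have 1: "LUnit T (?I \<odot> X) \<cdot> (Assoc T ?I ?I X \<cdot> (Braid T X (?I \<odot> ?I) \<cdot> Assoc T X ?I ?I)) = Braid T X ?I \<cdot> (RUnit T X \<boxtimes> Idn T ?I)" .
  have "LUnit T (?I \<odot> X) \<cdot> ((Idn T ?I \<boxtimes> Braid T X ?I) \<cdot> (Assoc T ?I X ?I \<cdot> (Braid T X ?I \<boxtimes> Idn T ?I)))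
     = (Braid T X ?I \<cdot> LUnit T (X \<odot> ?I)) \<cdot> (Assoc T ?I X ?I \<cdot> (Braid T X ?I \<boxtimes> Idn T ?I))"
    by (rule comp_rewrite) (use X lunit_nat[of "Braid T X ?I"] in auto)
  also have "\<dots> = Braid T X ?I \<cdot> ((LUnit T (X \<odot> ?I) \<cdot> Assoc T ?I X ?I) \<cdot> (Braid T X ?I \<boxtimes> Idn T ?I))"
    using X by (simp add: comp_assoc)
  also have "\<dots> = Braid T X ?I \<cdot> ((LUnit T X \<cdot> Braid T X ?I) \<boxtimes> Idn T ?I)"
    using X by (simp add: lunit_assoc ten_comp)
  finally have "Braid T X ?I \<cdot> ((LUnit T X \<cdot> Braid T X ?I) \<boxtimes> Idn T ?I) = Braid T X ?I \<cdot> (RUnit T X \<boxtimes> Idn T ?I)"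
    using 1 hexagon[of X ?I ?I] X by simp
  then show "(LUnit T X \<cdot> Braid T X ?I) \<boxtimes> Idn T ?I = RUnit T X \<boxtimes> Idn T ?I"
    by (rule iso_monic[rotated 3, where X="X \<odot> ?I \<odot> ?I"]) (use X in \<open>auto simp: Hom_def\<close>)
qed

text \<open>The commutation of the functors \<open>A \<odot> -\<close> and
  \<open>B \<odot> -\<close>. Regarding iterated products as such functors applied to
  \<open>Y\<close> keeps most associators out of the duality calculations.\<close>

definition swap :: "'o \<Rightarrow> 'o \<Rightarrow> 'o \<Rightarrow> 'm"
  where "swap A B Y = Assoc T B A Y \<cdot> ((Braid T A B \<boxtimes> Idn T Y) \<cdot> inv_arrow T (Assoc T A B Y))"

lemma swap_arr [simp]:
  assumes "A \<in> Obj T" "B \<in> Obj T" "Y \<in> Obj T"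
  shows "swap A B Y \<in> Arr T" "Dom T (swap A B Y) = A \<odot> (B \<odot> Y)" "Cod T (swap A B Y) = B \<odot> (A \<odot> Y)"
  using assms by (auto simp: swap_def)

lemma swap_assoc:
  assumes "A \<in> Obj T" "B \<in> Obj T" "Y \<in> Obj T"
  shows "swap A B Y \<cdot> Assoc T A B Y = Assoc T B A Y \<cdot> (Braid T A B \<boxtimes> Idn T Y)"
  using assms by (simp add: swap_def comp_assoc)

lemma swap_swap:
  assumes "A \<in> Obj T" "B \<in> Obj T" "Y \<in> Obj T"
  shows "swap B A Y \<cdot> swap A B Y = Idn T (A \<odot> (B \<odot> Y))"
  using assms by (simp add: swap_def comp_assoc ten_comp_tail)

lemma swap_nat:
  assumes f: "f \<in> Hom T A A'" and g: "g \<in> Hom T B B'" and h: "h \<in> Hom T Y Y'"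
  shows "swap A' B' Y' \<cdot> (f \<boxtimes> (g \<boxtimes> h)) = (g \<boxtimes> (f \<boxtimes> h)) \<cdot> swap A B Y"
proof -
  have ar: "f \<in> Arr T" "Dom T f = A" "Cod T f = A'" "g \<in> Arr T" "Dom T g = B" "Cod T g = B'" "h \<in> Arr T" "Dom T h = Y" "Cod T h = Y'"
    using assms by (auto simp: Hom_def)
  have o: "A \<in> Obj T" "B \<in> Obj T" "Y \<in> Obj T" "A' \<in> Obj T" "B' \<in> Obj T" "Y' \<in> Obj T" using assms Hom_obj by auto
  have "(swap A' B' Y' \<cdot> (f \<boxtimes> (g \<boxtimes> h))) \<cdot> Assoc T A B Y = swap A' B' Y' \<cdot> (Assoc T A' B' Y' \<cdot> (f \<boxtimes> g \<boxtimes> h))"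
    using ar o by (simp add: assoc_nat comp_assoc)
  also have "\<dots> = (Assoc T B' A' Y' \<cdot> (Braid T A' B' \<boxtimes> Idn T Y')) \<cdot> (f \<boxtimes> g \<boxtimes> h)"
    by (rule comp_rewrite[OF swap_assoc]) (use ar o in auto)
  also have "\<dots> = Assoc T B' A' Y' \<cdot> (((g \<boxtimes> f) \<cdot> Braid T A B) \<boxtimes> h)"
    using ar o braid_nat[of f g] by (simp add: comp_assoc ten_comp)
  also have "\<dots> = Assoc T B' A' Y' \<cdot> (((g \<boxtimes> f) \<boxtimes> h) \<cdot> (Braid T A B \<boxtimes> Idn T Y))"
    using ar o by (simp add: ten_comp)
  also have "\<dots> = ((g \<boxtimes> (f \<boxtimes> h)) \<cdot> Assoc T B A Y) \<cdot> (Braid T A B \<boxtimes> Idn T Y)"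
    by (rule comp_rewrite) (use ar o assoc_nat[of g f h] in auto)
  also have "\<dots> = ((g \<boxtimes> (f \<boxtimes> h)) \<cdot> swap A B Y) \<cdot> Assoc T A B Y"
    using ar o by (simp add: comp_assoc swap_assoc)
  finally show ?thesis
    by (rule iso_epic[rotated 3, where X="B' \<odot> (A' \<odot> Y')"]) (use ar o in \<open>auto simp: Hom_def\<close>)
qed

text \<open>The hexagon law in terms of \<open>swap\<close>: moving \<open>M\<close> past
  \<open>A \<odot> B\<close> amounts to moving it past the factors in turn. After composition with
  the isomorphism \<open>p\<close> the pentagon can be used on either side.\<close>

lemma swap_ten:
  assumes o: "A \<in> Obj T" "B \<in> Obj T" "M \<in> Obj T" "Y \<in> Obj T"
  shows "Assoc T A B (M \<odot> Y) \<cdot> swap M (A \<odot> B) Y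
    = (Idn T A \<boxtimes> swap M B Y) \<cdot> (swap M A (B \<odot> Y) \<cdot> (Idn T M \<boxtimes> Assoc T A B Y))"
proof -
  define p where "p = Assoc T M (A \<odot> B) Y \<cdot> (Assoc T M A B \<boxtimes> Idn T Y)"
  have p: "iso_arrow T p" "p \<in> Arr T" "Dom T p = M \<odot> A \<odot> B \<odot> Y" "Cod T p = M \<odot> (A \<odot> B \<odot> Y)"
    using o by (auto simp: p_def intro!: iso_comp)
  define q where "q = Assoc T A (M \<odot> B) Y \<cdot> ((Assoc T A M B \<cdot> (Braid T M A \<boxtimes> Idn T B)) \<boxtimes> Idn T Y)"
  have "(Assoc T A B (M \<odot> Y) \<cdot> swap M (A \<odot> B) Y) \<cdot> p
      = Assoc T A B (M \<odot> Y) \<cdot> ((swap M (A \<odot> B) Y \<cdot> Assoc T M (A \<odot> B) Y) \<cdot> (Assoc T M A B \<boxtimes> Idn T Y))"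
    using o by (simp add: p_def comp_assoc)
  also have "\<dots> = (Assoc T A B (M \<odot> Y) \<cdot> Assoc T (A \<odot> B) M Y) \<cdot> ((Braid T M (A \<odot> B) \<cdot> Assoc T M A B) \<boxtimes> Idn T Y)"
    using o by (simp add: swap_assoc comp_assoc ten_comp)
  also have "\<dots> = (Idn T A \<boxtimes> Assoc T B M Y) \<cdot> (Assoc T A (B \<odot> M) Y \<cdot>
      ((Assoc T A B M \<cdot> (Braid T M (A \<odot> B) \<cdot> Assoc T M A B)) \<boxtimes> Idn T Y))"
    using o by (simp add: pentagon comp_assoc ten_comp)
  also have "Assoc T A B M \<cdot> (Braid T M (A \<odot> B) \<cdot> Assoc T M A B)
      = (Idn T A \<boxtimes> Braid T M B) \<cdot> (Assoc T A M B \<cdot> (Braid T M A \<boxtimes> Idn T B))"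
    by (rule hexagon) (use o in auto)
  also have "Assoc T A (B \<odot> M) Y \<cdot> (((Idn T A \<boxtimes> Braid T M B) \<cdot> (Assoc T A M B \<cdot> (Braid T M A \<boxtimes> Idn T B))) \<boxtimes> Idn T Y)
      = (Assoc T A (B \<odot> M) Y \<cdot> ((Idn T A \<boxtimes> Braid T M B) \<boxtimes> Idn T Y)) \<cdot> ((Assoc T A M B \<cdot> (Braid T M A \<boxtimes> Idn T B)) \<boxtimes> Idn T Y)"
    using o by (simp add: comp_assoc ten_comp)
  also have "\<dots> = (Idn T A \<boxtimes> (Braid T M B \<boxtimes> Idn T Y)) \<cdot> q"
    unfolding q_def using o by (simp add: assoc_nat comp_assoc)
  finally have 1: "(Assoc T A B (M \<odot> Y) \<cdot> swap M (A \<odot> B) Y) \<cdot> p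
      = (Idn T A \<boxtimes> Assoc T B M Y) \<cdot> ((Idn T A \<boxtimes> (Braid T M B \<boxtimes> Idn T Y)) \<cdot> q)" .
  have q: "q \<in> Arr T" "Dom T q = M \<odot> A \<odot> B \<odot> Y" "Cod T q = A \<odot> (M \<odot> B \<odot> Y)" using o by (auto simp: q_def)
  have "((Idn T A \<boxtimes> swap M B Y) \<cdot> (swap M A (B \<odot> Y) \<cdot> (Idn T M \<boxtimes> Assoc T A B Y))) \<cdot> p
     = (Idn T A \<boxtimes> swap M B Y) \<cdot> (swap M A (B \<odot> Y) \<cdot> ((Idn T M \<boxtimes> Assoc T A B Y) \<cdot> p))"
    using o p by (simp add: comp_assoc)
  also have "(Idn T M \<boxtimes> Assoc T A B Y) \<cdot> p = Assoc T M A (B \<odot> Y) \<cdot> Assoc T (M \<odot> A) B Y"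
    unfolding p_def by (rule pentagon[symmetric]) (use o in auto)
  also have "swap M A (B \<odot> Y) \<cdot> (Assoc T M A (B \<odot> Y) \<cdot> Assoc T (M \<odot> A) B Y)
      = (Assoc T A M (B \<odot> Y) \<cdot> (Braid T M A \<boxtimes> Idn T (B \<odot> Y))) \<cdot> Assoc T (M \<odot> A) B Y"
    by (rule comp_rewrite[OF swap_assoc]) (use o in auto)
  also have "\<dots> = Assoc T A M (B \<odot> Y) \<cdot> (Assoc T (A \<odot> M) B Y \<cdot> ((Braid T M A \<boxtimes> Idn T B) \<boxtimes> Idn T Y))"
    using o by (simp add: assoc_nat comp_assoc)
  also have "\<dots> = ((Idn T A \<boxtimes> Assoc T M B Y) \<cdot> (Assoc T A (M \<odot> B) Y \<cdot> (Assoc T A M B \<boxtimes> Idn T Y))) \<cdot> ((Braid T M A \<boxtimes> Idn T B) \<boxtimes> Idn T Y)"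
    by (rule comp_rewrite[OF pentagon]) (use o in auto)
  also have "\<dots> = (Idn T A \<boxtimes> Assoc T M B Y) \<cdot> q" unfolding q_def using o by (simp add: comp_assoc ten_comp)
  also have "(Idn T A \<boxtimes> swap M B Y) \<cdot> ((Idn T A \<boxtimes> Assoc T M B Y) \<cdot> q) = (Idn T A \<boxtimes> (swap M B Y \<cdot> Assoc T M B Y)) \<cdot> q"
    using o q by (simp add: ten_comp_tail)
  also have "\<dots> = (Idn T A \<boxtimes> Assoc T B M Y) \<cdot> ((Idn T A \<boxtimes> (Braid T M B \<boxtimes> Idn T Y)) \<cdot> q)"
    using o q by (simp add: swap_assoc ten_comp_tail)
  finally have "(Assoc T A B (M \<odot> Y) \<cdot> swap M (A \<odot> B) Y) \<cdot> p
     = ((Idn T A \<boxtimes> swap M B Y) \<cdot> (swap M A (B \<odot> Y) \<cdot> (Idn T M \<boxtimes> Assoc T A B Y))) \<cdot> p" using 1 by simp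
  then show ?thesis
    by (rule iso_epic[rotated 3, where X="A \<odot> (B \<odot> (M \<odot> Y))"]) (use p o in \<open>auto simp: Hom_def\<close>)
qed

lemma swap_unit:
  assumes o: "M \<in> Obj T" "Y \<in> Obj T"
  shows "LUnit T (M \<odot> Y) \<cdot> swap M (Unit T) Y = Idn T M \<boxtimes> LUnit T Y"
proof -
  have "(LUnit T (M \<odot> Y) \<cdot> swap M (Unit T) Y) \<cdot> Assoc T M (Unit T) Y
     = LUnit T (M \<odot> Y) \<cdot> (Assoc T (Unit T) M Y \<cdot> (Braid T M (Unit T) \<boxtimes> Idn T Y))"
    using o by (simp add: comp_assoc swap_assoc)
  also have "\<dots> = (LUnit T M \<boxtimes> Idn T Y) \<cdot> (Braid T M (Unit T) \<boxtimes> Idn T Y)"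
    by (rule comp_rewrite[OF lunit_assoc]) (use o in auto)
  also have "\<dots> = RUnit T M \<boxtimes> Idn T Y" using o by (simp add: ten_comp lunit_braid)
  also have "\<dots> = (Idn T M \<boxtimes> LUnit T Y) \<cdot> Assoc T M (Unit T) Y" using o triangle_law by simp
  finally show ?thesis
    by (rule iso_epic[rotated 3, where X="M \<odot> Y"]) (use o in \<open>auto simp: Hom_def\<close>)
qed

text \<open>By naturality, moving \<open>A\<close> past \<open>B \<odot> C\<close> as a whole
  commutes with braiding \<open>B\<close> and \<open>C\<close>; expanding this with
  \<open>swap_ten\<close> gives the braid relation.\<close>

lemma swap_yang_baxter:
  assumes o: "A \<in> Obj T" "B \<in> Obj T" "C \<in> Obj T" "Y \<in> Obj T"
  shows "swap B C (A \<odot> Y) \<cdot> ((Idn T B \<boxtimes> swap A C Y) \<cdot> swap A B (C \<odot> Y))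
    = (Idn T C \<boxtimes> swap A B Y) \<cdot> (swap A C (B \<odot> Y) \<cdot> (Idn T A \<boxtimes> swap B C Y))"
proof -
  define p where "p = Idn T A \<boxtimes> Assoc T B C Y"
  have p: "iso_arrow T p" "p \<in> Arr T" "Dom T p = A \<odot> (B \<odot> C \<odot> Y)" "Cod T p = A \<odot> (B \<odot> (C \<odot> Y))"
    using o by (auto simp: p_def)
  have "(swap B C (A \<odot> Y) \<cdot> ((Idn T B \<boxtimes> swap A C Y) \<cdot> swap A B (C \<odot> Y))) \<cdot> p
     = swap B C (A \<odot> Y) \<cdot> (Assoc T B C (A \<odot> Y) \<cdot> swap A (B \<odot> C) Y)"
    unfolding swap_ten[OF o(2,3,1,4)] using o by (simp add: p_def comp_assoc)
  also have "\<dots> = (Assoc T C B (A \<odot> Y) \<cdot> (Braid T B C \<boxtimes> Idn T (A \<odot> Y))) \<cdot> swap A (B \<odot> C) Y"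
    by (rule comp_rewrite[OF swap_assoc]) (use o in auto)
  also have "\<dots> = Assoc T C B (A \<odot> Y) \<cdot> (swap A (C \<odot> B) Y \<cdot> (Idn T A \<boxtimes> (Braid T B C \<boxtimes> Idn T Y)))"
    using o swap_nat[OF Idn_Hom[OF o(1)] Braid_Hom[OF o(2,3)] Idn_Hom[OF o(4)]] by (simp add: comp_assoc)
  also have "\<dots> = ((Idn T C \<boxtimes> swap A B Y) \<cdot> (swap A C (B \<odot> Y) \<cdot> (Idn T A \<boxtimes> Assoc T C B Y))) \<cdot> (Idn T A \<boxtimes> (Braid T B C \<boxtimes> Idn T Y))"
    by (rule comp_rewrite[OF swap_ten]) (use o in auto)
  also have "\<dots> = (Idn T C \<boxtimes> swap A B Y) \<cdot> (swap A C (B \<odot> Y) \<cdot> (Idn T A \<boxtimes> (swap B C Y \<cdot> Assoc T B C Y)))"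
    using o by (simp add: comp_assoc ten_comp swap_assoc)
  also have "\<dots> = ((Idn T C \<boxtimes> swap A B Y) \<cdot> (swap A C (B \<odot> Y) \<cdot> (Idn T A \<boxtimes> swap B C Y))) \<cdot> p"
    using o by (simp add: comp_assoc ten_comp p_def)
  finally show ?thesis
    by (rule iso_epic[rotated 3, where X="C \<odot> (B \<odot> (A \<odot> Y))"]) (use p o in \<open>auto simp: Hom_def\<close>)
qed

end

section \<open>Rigid objects and duality\<close>

context closed_symmetric_monoidal_category
begin

lemma dual_obj [simp]: "X \<in> Obj T \<Longrightarrow> dual T X \<in> Obj T"
  by (simp add: dual_def)

lemma curry_arrow:
  assumes "X \<in> Obj T" "W \<in> Obj T" "f \<in> Hom T (W \<odot> X) Y"
  shows "curry_arrow T W X Y f \<in> Hom T W (IHom T X Y)" "Eval T X Y \<cdot> (curry_arrow T W X Y f \<boxtimes> Idn T X) = f"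
proof -
  have "Y \<in> Obj T" using assms Hom_obj by blast
  from theI'[OF Eval_universal[OF assms(2,1) this assms(3)]]
  show "curry_arrow T W X Y f \<in> Hom T W (IHom T X Y)" "Eval T X Y \<cdot> (curry_arrow T W X Y f \<boxtimes> Idn T X) = f"
    by (simp_all add: curry_arrow_def)
qed

lemma dual_map_arr [simp]:
  assumes "g \<in> Arr T"
  shows "dualM T g \<in> Arr T" "Dom T (dualM T g) = dual T (Cod T g)" "Cod T (dualM T g) = dual T (Dom T g)"
proof -
  have "Eval T (Cod T g) (Unit T) \<cdot> (Idn T (dual T (Cod T g)) \<boxtimes> g) \<in> Hom T (dual T (Cod T g) \<odot> Dom T g) (Unit T)"
    using assms by (simp add: Hom_def dual_def)
  then have "dualM T g \<in> Hom T (dual T (Cod T g)) (IHom T (Dom T g) (Unit T))"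
    unfolding dualM_def by (rule curry_arrow(1)[rotated 2]) (use assms in auto)
  then show "dualM T g \<in> Arr T" "Dom T (dualM T g) = dual T (Cod T g)" "Cod T (dualM T g) = dual T (Dom T g)"
    by (auto simp: Hom_def dual_def)
qed

lemma eval_dual_map:
  assumes "g \<in> Arr T"
  shows "Eval T (Dom T g) (Unit T) \<cdot> (dualM T g \<boxtimes> Idn T (Dom T g))
    = Eval T (Cod T g) (Unit T) \<cdot> (Idn T (dual T (Cod T g)) \<boxtimes> g)"
  unfolding dualM_def by (rule curry_arrow(2)) (use assms in \<open>auto simp: Hom_def dual_def\<close>)

text \<open>Evaluation with its arguments exchanged, so that \<open>C\<close> acts from the left as
  in \<open>contract\<close>.\<close>

definition pairing :: "'o \<Rightarrow> 'm"
  where "pairing C = Eval T C (Unit T) \<cdot> Braid T C (dual T C)"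

text \<open>For rigid \<open>C\<close> this is the counit of the adjunction between
  \<open>C \<odot> -\<close> and \<open>dual T C \<odot> -\<close>.\<close>

definition contract :: "'o \<Rightarrow> 'o \<Rightarrow> 'm"
  where "contract C Y = LUnit T Y \<cdot> ((pairing C \<boxtimes> Idn T Y) \<cdot> inv_arrow T (Assoc T C (dual T C) Y))"

lemma pairing_arr [simp]:
  assumes "C \<in> Obj T"
  shows "pairing C \<in> Arr T" "Dom T (pairing C) = C \<odot> dual T C" "Cod T (pairing C) = Unit T"
  using assms dual_obj[OF assms] by (auto simp: pairing_def dual_def)

lemma contract_arr [simp]:
  assumes "C \<in> Obj T" "Y \<in> Obj T"
  shows "contract C Y \<in> Arr T" "Dom T (contract C Y) = C \<odot> (dual T C \<odot> Y)" "Cod T (contract C Y) = Y"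
  using assms by (auto simp: contract_def)

lemma contract_assoc:
  assumes "C \<in> Obj T" "Y \<in> Obj T"
  shows "contract C Y \<cdot> Assoc T C (dual T C) Y = LUnit T Y \<cdot> (pairing C \<boxtimes> Idn T Y)"
  using assms by (simp add: contract_def comp_assoc)

lemma contract_nat:
  assumes C: "C \<in> Obj T" and f: "f \<in> Hom T Y Y'"
  shows "contract C Y' \<cdot> (Idn T C \<boxtimes> (Idn T (dual T C) \<boxtimes> f)) = f \<cdot> contract C Y"
proof -
  have ar: "f \<in> Arr T" "Dom T f = Y" "Cod T f = Y'" "Y \<in> Obj T" "Y' \<in> Obj T" using f Hom_obj[OF f] by (auto simp: Hom_def)
  have "(contract C Y' \<cdot> (Idn T C \<boxtimes> (Idn T (dual T C) \<boxtimes> f))) \<cdot> Assoc T C (dual T C) Y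
     = contract C Y' \<cdot> (Assoc T C (dual T C) Y' \<cdot> (Idn T C \<boxtimes> Idn T (dual T C) \<boxtimes> f))"
    using ar C assoc_nat[of "Idn T C" "Idn T (dual T C)" f] by (simp add: comp_assoc)
  also have "\<dots> = (LUnit T Y' \<cdot> (pairing C \<boxtimes> Idn T Y')) \<cdot> (Idn T C \<boxtimes> Idn T (dual T C) \<boxtimes> f)"
    by (rule comp_rewrite[OF contract_assoc]) (use ar C in auto)
  also have "\<dots> = LUnit T Y' \<cdot> ((Idn T (Unit T) \<boxtimes> f) \<cdot> (pairing C \<boxtimes> Idn T Y))"
    using ar C by (simp add: comp_assoc ten_comp)
  also have "\<dots> = (f \<cdot> LUnit T Y) \<cdot> (pairing C \<boxtimes> Idn T Y)"
    by (rule comp_rewrite) (use ar C lunit_nat[of f] in auto)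
  also have "\<dots> = (f \<cdot> contract C Y) \<cdot> Assoc T C (dual T C) Y"
    using ar C by (simp add: comp_assoc contract_assoc)
  finally show ?thesis by (rule iso_epic[rotated 3, where X=Y']) (use ar C in \<open>auto simp: Hom_def\<close>)
qed

text \<open>Naturality of the braiding turns this into the equation by which \<open>dualM\<close> is
  characterized.\<close>

lemma pairing_dinat:
  assumes t: "t \<in> Hom T C A"
  shows "pairing C \<cdot> (Idn T C \<boxtimes> dualM T t) = pairing A \<cdot> (t \<boxtimes> Idn T (dual T A))"
proof -
  have ar: "t \<in> Arr T" "Dom T t = C" "Cod T t = A" "C \<in> Obj T" "A \<in> Obj T" using t Hom_obj[OF t] by (auto simp: Hom_def)
  have D: "dual T C \<in> Obj T" "dual T A \<in> Obj T" using ar by auto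
  have ev: "Eval T X (Unit T) \<in> Arr T" "Dom T (Eval T X (Unit T)) = dual T X \<odot> X" "Cod T (Eval T X (Unit T)) = Unit T" if "X \<in> Obj T" for X
    using that by (auto simp: dual_def)
  have "pairing C \<cdot> (Idn T C \<boxtimes> dualM T t) = Eval T C (Unit T) \<cdot> ((dualM T t \<boxtimes> Idn T C) \<cdot> Braid T C (dual T A))"
    using ar D ev braid_nat[of "Idn T C" "dualM T t"] by (simp add: pairing_def comp_assoc)
  also have "\<dots> = (Eval T A (Unit T) \<cdot> (Idn T (dual T A) \<boxtimes> t)) \<cdot> Braid T C (dual T A)"
    by (rule comp_rewrite) (use ar D ev eval_dual_map[of t] in auto)
  also have "\<dots> = pairing A \<cdot> (t \<boxtimes> Idn T (dual T A))"
    using ar D ev braid_nat[of t "Idn T (dual T A)"] by (simp add: pairing_def comp_assoc)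
  finally show ?thesis .
qed

lemma contract_dinat:
  assumes t: "t \<in> Hom T C A" and Y: "Y \<in> Obj T"
  shows "contract C Y \<cdot> (Idn T C \<boxtimes> (dualM T t \<boxtimes> Idn T Y)) = contract A Y \<cdot> (t \<boxtimes> Idn T (dual T A \<odot> Y))"
proof -
  have ar: "t \<in> Arr T" "Dom T t = C" "Cod T t = A" "C \<in> Obj T" "A \<in> Obj T" using t Hom_obj[OF t] by (auto simp: Hom_def)
  have "(contract C Y \<cdot> (Idn T C \<boxtimes> (dualM T t \<boxtimes> Idn T Y))) \<cdot> Assoc T C (dual T A) Y
     = contract C Y \<cdot> (Assoc T C (dual T C) Y \<cdot> (Idn T C \<boxtimes> dualM T t \<boxtimes> Idn T Y))"
    using ar Y assoc_nat[of "Idn T C" "dualM T t" "Idn T Y"] by (simp add: comp_assoc)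
  also have "\<dots> = (LUnit T Y \<cdot> (pairing C \<boxtimes> Idn T Y)) \<cdot> (Idn T C \<boxtimes> dualM T t \<boxtimes> Idn T Y)"
    by (rule comp_rewrite[OF contract_assoc]) (use ar Y in auto)
  also have "\<dots> = LUnit T Y \<cdot> ((pairing A \<cdot> (t \<boxtimes> Idn T (dual T A))) \<boxtimes> Idn T Y)"
    using ar Y by (simp add: comp_assoc ten_comp pairing_dinat[OF t])
  also have "\<dots> = (LUnit T Y \<cdot> (pairing A \<boxtimes> Idn T Y)) \<cdot> (t \<boxtimes> Idn T (dual T A) \<boxtimes> Idn T Y)"
    using ar Y by (simp add: comp_assoc ten_comp)
  also have "\<dots> = contract A Y \<cdot> (Assoc T A (dual T A) Y \<cdot> (t \<boxtimes> Idn T (dual T A) \<boxtimes> Idn T Y))"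
    using comp_rewrite[OF contract_assoc[of A Y], of "t \<boxtimes> Idn T (dual T A) \<boxtimes> Idn T Y"] ar Y by simp
  also have "\<dots> = (contract A Y \<cdot> (t \<boxtimes> Idn T (dual T A \<odot> Y))) \<cdot> Assoc T C (dual T A) Y"
    using ar Y assoc_nat[of t "Idn T (dual T A)" "Idn T Y"] by (simp add: comp_assoc)
  finally show ?thesis by (rule iso_epic[rotated 3, where X=Y]) (use ar Y in \<open>auto simp: Hom_def\<close>)
qed

text \<open>Contraction is compatible with a further factor \<open>M\<close>. Pushing
  \<open>M\<close> past \<open>C\<close> and its dual together is \<open>swap_ten\<close>; the
  pairing then leaves the unit, which \<open>swap_unit\<close> handles.\<close>

lemma contract_module:
  assumes o: "C \<in> Obj T" "M \<in> Obj T" "Y \<in> Obj T"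
  shows "contract C (M \<odot> Y) \<cdot> ((Idn T C \<boxtimes> swap M (dual T C) Y) \<cdot> swap M C (dual T C \<odot> Y)) = Idn T M \<boxtimes> contract C Y"
proof -
  let ?L = "dual T C"
  have L: "?L \<in> Obj T" using o by simp
  have "(contract C (M \<odot> Y) \<cdot> ((Idn T C \<boxtimes> swap M ?L Y) \<cdot> swap M C (?L \<odot> Y))) \<cdot> (Idn T M \<boxtimes> Assoc T C ?L Y)
     = contract C (M \<odot> Y) \<cdot> (Assoc T C ?L (M \<odot> Y) \<cdot> swap M (C \<odot> ?L) Y)"
    unfolding swap_ten[OF o(1) L o(2,3)] using o L by (simp add: comp_assoc)
  also have "\<dots> = (LUnit T (M \<odot> Y) \<cdot> (pairing C \<boxtimes> Idn T (M \<odot> Y))) \<cdot> swap M (C \<odot> ?L) Y"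
    by (rule comp_rewrite[OF contract_assoc]) (use o L in auto)
  also have "\<dots> = LUnit T (M \<odot> Y) \<cdot> (swap M (Unit T) Y \<cdot> (Idn T M \<boxtimes> (pairing C \<boxtimes> Idn T Y)))"
    using o L swap_nat[of "Idn T M" M M "pairing C" "C \<odot> ?L" "Unit T" "Idn T Y" Y Y] by (simp add: Hom_def comp_assoc)
  also have "\<dots> = (Idn T M \<boxtimes> LUnit T Y) \<cdot> (Idn T M \<boxtimes> (pairing C \<boxtimes> Idn T Y))"
    by (rule comp_rewrite[OF swap_unit]) (use o L in auto)
  also have "\<dots> = (Idn T M \<boxtimes> contract C Y) \<cdot> (Idn T M \<boxtimes> Assoc T C ?L Y)"
    using o L by (simp add: ten_comp contract_assoc)
  finally show ?thesis
    by (rule iso_epic[rotated 3, where X="M \<odot> Y"]) (use o L in \<open>auto simp: Hom_def\<close>)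
qed

text \<open>The uncurried form of \<open>rigidity_map\<close>, isolated so that it can be compared
  with \<open>contract\<close>.\<close>

definition rigidity_flat :: "'o \<Rightarrow> 'o \<Rightarrow> 'm"
  where "rigidity_flat C Y = LUnit T Y \<cdot> (Eval T C (Unit T) \<boxtimes> Idn T Y) \<cdot> inv_arrow T (Assoc T (dual T C) C Y)
        \<cdot> (Idn T (dual T C) \<boxtimes> Braid T Y C) \<cdot> Assoc T (dual T C) Y C"

lemma rigidity_flat_arr [simp]:
  assumes "C \<in> Obj T" "Y \<in> Obj T"
  shows "rigidity_flat C Y \<in> Arr T" "Dom T (rigidity_flat C Y) = dual T C \<odot> Y \<odot> C" "Cod T (rigidity_flat C Y) = Y"
proof -
  have ev: "Eval T C (Unit T) \<in> Arr T" "Dom T (Eval T C (Unit T)) = dual T C \<odot> C" "Cod T (Eval T C (Unit T)) = Unit T"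
    using assms by (auto simp: dual_def)
  show "rigidity_flat C Y \<in> Arr T" "Dom T (rigidity_flat C Y) = dual T C \<odot> Y \<odot> C" "Cod T (rigidity_flat C Y) = Y"
    unfolding rigidity_flat_def using assms ev dual_obj[OF assms(1)] by auto
qed

lemma rigidity_map:
  assumes "C \<in> Obj T" "Y \<in> Obj T"
  shows "rigidity_map T C Y \<in> Hom T (dual T C \<odot> Y) (IHom T C Y)"
    "Eval T C Y \<cdot> (rigidity_map T C Y \<boxtimes> Idn T C) = rigidity_flat C Y"
proof -
  have "rigidity_map T C Y = curry_arrow T (dual T C \<odot> Y) C Y (rigidity_flat C Y)"
    by (simp add: rigidity_map_def rigidity_flat_def dual_def Let_def)
  moreover have "rigidity_flat C Y \<in> Hom T (dual T C \<odot> Y \<odot> C) Y" using assms by (simp add: Hom_def)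
  ultimately show "rigidity_map T C Y \<in> Hom T (dual T C \<odot> Y) (IHom T C Y)"
    "Eval T C Y \<cdot> (rigidity_map T C Y \<boxtimes> Idn T C) = rigidity_flat C Y"
    using curry_arrow[of C "dual T C \<odot> Y" "rigidity_flat C Y" Y] assms by simp_all
qed

text \<open>The hexagon lets the braiding of \<open>Y\<close> with \<open>C\<close> cancel, leaving
  the one inside \<open>pairing\<close>. This ties the definition of rigid objects to the adjunction
  expressed by \<open>contract\<close>.\<close>

lemma rigidity_flat_braid:
  assumes o: "C \<in> Obj T" "Y \<in> Obj T"
  shows "rigidity_flat C Y \<cdot> Braid T C (dual T C \<odot> Y) = contract C Y"
proof -
  let ?L = "dual T C"
  have L: "?L \<in> Obj T" using o by simp
  have ev: "Eval T C (Unit T) \<in> Arr T" "Dom T (Eval T C (Unit T)) = ?L \<odot> C" "Cod T (Eval T C (Unit T)) = Unit T"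
    using o by (auto simp: dual_def)
  define k where "k = LUnit T Y \<cdot> ((Eval T C (Unit T) \<boxtimes> Idn T Y) \<cdot> inv_arrow T (Assoc T ?L C Y))"
  have k: "k \<in> Arr T" "Dom T k = ?L \<odot> (C \<odot> Y)" "Cod T k = Y" using o L ev by (auto simp: k_def)
  have "(rigidity_flat C Y \<cdot> Braid T C (?L \<odot> Y)) \<cdot> Assoc T C ?L Y
     = k \<cdot> ((Idn T ?L \<boxtimes> Braid T Y C) \<cdot> (Assoc T ?L Y C \<cdot> (Braid T C (?L \<odot> Y) \<cdot> Assoc T C ?L Y)))"
    using o L ev by (simp add: rigidity_flat_def k_def comp_assoc)
  also have "\<dots> = k \<cdot> ((Idn T ?L \<boxtimes> Braid T Y C) \<cdot> ((Idn T ?L \<boxtimes> Braid T C Y) \<cdot> (Assoc T ?L C Y \<cdot> (Braid T C ?L \<boxtimes> Idn T Y))))"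
    using hexagon[OF o(1) L o(2)] by simp
  also have "\<dots> = k \<cdot> (Assoc T ?L C Y \<cdot> (Braid T C ?L \<boxtimes> Idn T Y))"
    using o L by (simp add: ten_comp_tail)
  also have "\<dots> = LUnit T Y \<cdot> ((Eval T C (Unit T) \<boxtimes> Idn T Y) \<cdot> (Braid T C ?L \<boxtimes> Idn T Y))"
    using o L ev by (simp add: k_def comp_assoc)
  also have "\<dots> = contract C Y \<cdot> Assoc T C ?L Y"
    using o L ev by (simp add: contract_assoc pairing_def ten_comp)
  finally show ?thesis by (rule iso_epic[rotated 3, where X=Y]) (use o L in \<open>auto simp: Hom_def\<close>)
qed

lemma contract_eq_flat:
  assumes o: "C \<in> Obj T" "Y \<in> Obj T" and h: "h \<in> Hom T W (dual T C \<odot> Y)"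
  shows "contract C Y \<cdot> (Idn T C \<boxtimes> h) = rigidity_flat C Y \<cdot> (h \<boxtimes> Idn T C) \<cdot> Braid T C W"
proof -
  have h: "h \<in> Arr T" "Dom T h = W" "Cod T h = dual T C \<odot> Y" "W \<in> Obj T" using h Hom_obj[OF h] by (auto simp: Hom_def)
  show ?thesis unfolding rigidity_flat_braid[OF o, symmetric]
    using h o braid_nat[of "Idn T C" h] by (simp add: comp_assoc)
qed

lemma rigid_obj: "rigid_object T C \<Longrightarrow> C \<in> Obj T"
  by (simp add: rigid_object_def)

text \<open>Curry \<open>f\<close> and apply the inverse of the rigidity map. Together with
  \<open>rigid_unique\<close> this makes \<open>contract C Y\<close> universal:
  \<open>C \<odot> -\<close> is left adjoint to \<open>dual T C \<odot> -\<close>.\<close>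

lemma rigid_exists:
  assumes C: "rigid_object T C" and f: "f \<in> Hom T (C \<odot> W) Y" and W: "W \<in> Obj T"
  obtains h where "h \<in> Hom T W (dual T C \<odot> Y)" "contract C Y \<cdot> (Idn T C \<boxtimes> h) = f"
proof -
  have o: "C \<in> Obj T" "Y \<in> Obj T" using rigid_obj[OF C] Hom_obj[OF f] by auto
  have fa: "f \<in> Arr T" "Dom T f = C \<odot> W" "Cod T f = Y" using f by (auto simp: Hom_def)
  let ?R = "rigidity_map T C Y"
  have R: "?R \<in> Arr T" "Dom T ?R = dual T C \<odot> Y" "Cod T ?R = IHom T C Y" "iso_arrow T ?R"
    using rigidity_map(1)[OF o] C o by (auto simp: Hom_def rigid_object_def)
  have "f \<cdot> Braid T W C \<in> Hom T (W \<odot> C) Y" using fa o W by (auto simp: Hom_def)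
  then obtain g where g: "g \<in> Hom T W (IHom T C Y)" "Eval T C Y \<cdot> (g \<boxtimes> Idn T C) = f \<cdot> Braid T W C"
    by (rule curry_exists[OF o(1) W])
  have ga: "g \<in> Arr T" "Dom T g = W" "Cod T g = IHom T C Y" using g by (auto simp: Hom_def)
  define h where "h = inv_arrow T ?R \<cdot> g"
  have h: "h \<in> Arr T" "Dom T h = W" "Cod T h = dual T C \<odot> Y" "?R \<cdot> h = g" using R ga by (auto simp: h_def)
  have "rigidity_flat C Y \<cdot> (h \<boxtimes> Idn T C) = Eval T C Y \<cdot> ((?R \<cdot> h) \<boxtimes> Idn T C)"
    using rigidity_map(2)[OF o, symmetric] R(1-3) h(1-3) o by (simp add: comp_assoc ten_comp)
  then have "rigidity_flat C Y \<cdot> (h \<boxtimes> Idn T C) = f \<cdot> Braid T W C" using g h by simp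
  then have "contract C Y \<cdot> (Idn T C \<boxtimes> h) = f \<cdot> Braid T W C \<cdot> Braid T C W"
    using contract_eq_flat[OF o, of h W] h by (simp add: Hom_def)
  also have "\<dots> = f" using fa o W by (simp add: comp_assoc)
  finally show thesis using that h by (auto simp: Hom_def)
qed

lemma rigid_unique:
  assumes C: "rigid_object T C" and h: "h \<in> Hom T W (dual T C \<odot> Y)" and h': "h' \<in> Hom T W (dual T C \<odot> Y)" and Y: "Y \<in> Obj T"
    and eq: "contract C Y \<cdot> (Idn T C \<boxtimes> h) = contract C Y \<cdot> (Idn T C \<boxtimes> h')"
  shows "h = h'"
proof -
  have o: "C \<in> Obj T" "Y \<in> Obj T" using rigid_obj[OF C] Y by auto
  have W: "W \<in> Obj T" using Hom_obj[OF h] by simp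
  let ?R = "rigidity_map T C Y"
  have R: "?R \<in> Arr T" "Dom T ?R = dual T C \<odot> Y" "Cod T ?R = IHom T C Y" "iso_arrow T ?R"
    using rigidity_map(1)[OF o] C o by (auto simp: Hom_def rigid_object_def)
  have ha: "h \<in> Arr T" "Dom T h = W" "Cod T h = dual T C \<odot> Y" "h' \<in> Arr T" "Dom T h' = W" "Cod T h' = dual T C \<odot> Y"
    using h h' by (auto simp: Hom_def)
  have "(rigidity_flat C Y \<cdot> (h \<boxtimes> Idn T C)) \<cdot> Braid T C W = (rigidity_flat C Y \<cdot> (h' \<boxtimes> Idn T C)) \<cdot> Braid T C W"
    using eq contract_eq_flat[OF o h] contract_eq_flat[OF o h'] by simp
  then have flat: "rigidity_flat C Y \<cdot> (h \<boxtimes> Idn T C) = rigidity_flat C Y \<cdot> (h' \<boxtimes> Idn T C)"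
    by (rule iso_epic[rotated 3, where X=Y]) (use ha o W in \<open>auto simp: Hom_def\<close>)
  have ev: "Eval T C Y \<cdot> ((?R \<cdot> k) \<boxtimes> Idn T C) = rigidity_flat C Y \<cdot> (k \<boxtimes> Idn T C)" if "k \<in> Hom T W (dual T C \<odot> Y)" for k
    using that rigidity_map(2)[OF o, symmetric] R(1-3) o by (simp add: Hom_def comp_assoc ten_comp)
  have "?R \<cdot> h = ?R \<cdot> h'"
    by (rule curry_unique[OF o, of _ W]) (use ha R o ev[OF h] ev[OF h'] flat in \<open>auto simp: Hom_def\<close>)
  then show ?thesis by (rule iso_monic[rotated 3, where X=W]) (use R ha in \<open>auto simp: Hom_def\<close>)
qed

text \<open>Evaluation at the unit is invertible, hence so are the pairing, the contraction and the
  uncurried rigidity map. The lemma makes the unit compact, on which \<open>compact_dual\<close> and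
  the treatment of null maps rely.\<close>

lemma rigid_unit: "rigid_object T (Unit T)"
proof -
  let ?I = "Unit T" and ?L = "dual T (Unit T)" and ?E = "Eval T (Unit T) (Unit T)"
  have L: "?L \<in> Obj T" by simp
  have E: "?E \<in> Arr T" "Dom T ?E = ?L \<odot> ?I" "Cod T ?E = ?I" by (auto simp: dual_def)
  \<comment> \<open>The inverse of evaluation comes from the transpose of the right unitor.\<close>
  obtain g where g: "g \<in> Hom T ?I (IHom T ?I ?I)" "?E \<cdot> (g \<boxtimes> Idn T ?I) = RUnit T ?I"
    by (rule curry_exists[of ?I ?I "RUnit T ?I" ?I]) (auto simp: Hom_def)
  have ga: "g \<in> Arr T" "Dom T g = ?I" "Cod T g = ?L" using g by (auto simp: Hom_def dual_def)
  define j where "j = inv_arrow T (RUnit T ?L) \<cdot> g"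
  have j: "j \<in> Arr T" "Dom T j = ?I" "Cod T j = ?L \<odot> ?I" using ga by (auto simp: j_def)
  have jr: "j \<cdot> RUnit T ?I = g \<boxtimes> Idn T ?I"
  proof -
    have "RUnit T ?L \<cdot> (g \<boxtimes> Idn T ?I) = g \<cdot> RUnit T ?I" using runit_nat[OF ga(1)] ga by simp
    then have "inv_arrow T (RUnit T ?L) \<cdot> (RUnit T ?L \<cdot> (g \<boxtimes> Idn T ?I)) = inv_arrow T (RUnit T ?L) \<cdot> (g \<cdot> RUnit T ?I)" by simp
    then show ?thesis using ga by (simp add: j_def comp_assoc)
  qed
  have 1: "?E \<cdot> j = Idn T ?I"
  proof (rule iso_epic[of "RUnit T ?I"])
    show "?E \<cdot> j \<cdot> RUnit T ?I = Idn T ?I \<cdot> RUnit T ?I" using E j jr g(2) by (simp add: comp_assoc)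
  qed (use E j in \<open>auto simp: Hom_def\<close>)
  have 2: "j \<cdot> ?E = Idn T (?L \<odot> ?I)"
  proof -
    \<comment> \<open>Conjugation with the right unitor is chosen so that \<open>u\<close> tensored
      with the unit is \<open>j \<cdot> ?E\<close>; uniqueness of transposes then forces
      \<open>u\<close> to be the identity.\<close>
    define u where "u = RUnit T ?L \<cdot> (j \<cdot> (?E \<cdot> inv_arrow T (RUnit T ?L)))"
    have u: "u \<in> Arr T" "Dom T u = ?L" "Cod T u = ?L" using E j by (auto simp: u_def)
    have "RUnit T ?L \<cdot> (u \<boxtimes> Idn T ?I) = u \<cdot> RUnit T ?L" using runit_nat[OF u(1)] u by simp
    also have "\<dots> = RUnit T ?L \<cdot> (j \<cdot> ?E)" using E j by (simp add: u_def comp_assoc)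
    finally have uj: "u \<boxtimes> Idn T ?I = j \<cdot> ?E"
      by (rule iso_monic[rotated 3, where X="?L \<odot> ?I"]) (use E j u in \<open>auto simp: Hom_def\<close>)
    have "u = Idn T ?L"
    proof (rule curry_unique[of ?I ?I u ?L])
      have "?E \<cdot> (j \<cdot> ?E) = ?E" using comp_rewrite[OF 1, of ?E] E j by simp
      then show "?E \<cdot> (u \<boxtimes> Idn T ?I) = ?E \<cdot> (Idn T ?L \<boxtimes> Idn T ?I)" using uj E by simp
    qed (use u in \<open>auto simp: Hom_def dual_def\<close>)
    then show ?thesis using uj by simp
  qed
  have Eiso: "iso_arrow T ?E" by (rule iso_arrowI[of ?E "?L \<odot> ?I" ?I j]) (use E j 1 2 in \<open>auto simp: Hom_def\<close>)
  then have pair: "iso_arrow T (pairing ?I)" unfolding pairing_def by (intro iso_comp) (auto simp: E)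
  have "iso_arrow T (rigidity_map T ?I Y)" if Y: "Y \<in> Obj T" for Y
  proof -
    have c: "iso_arrow T (contract ?I Y)"
      unfolding contract_def by (intro iso_comp ten_iso pair) (use Y in auto)
    have flat: "iso_arrow T (rigidity_flat ?I Y)"
    proof -
      have b: "iso_arrow T (Braid T (?L \<odot> Y) ?I)" using Y by simp
      have "rigidity_flat ?I Y = contract ?I Y \<cdot> Braid T (?L \<odot> Y) ?I"
        unfolding rigidity_flat_braid[OF unit_obj Y, symmetric] using Y by (simp add: comp_assoc)
      then show ?thesis using iso_comp[OF b c] Y by simp
    qed
    let ?R = "rigidity_map T ?I Y"
    have R: "?R \<in> Arr T" "Dom T ?R = ?L \<odot> Y" "Cod T ?R = IHom T ?I Y" using rigidity_map(1)[OF unit_obj Y] by (auto simp: Hom_def)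
    let ?F = "IHom T ?I Y"
    \<comment> \<open>The same device: \<open>h\<close> tensored with the unit is evaluation
      followed by the inverse of \<open>rigidity_flat\<close>, which makes \<open>h\<close> inverse
      to \<open>?R\<close>.\<close>
    define h where "h = RUnit T (?L \<odot> Y) \<cdot> (inv_arrow T (rigidity_flat ?I Y) \<cdot> (Eval T ?I Y \<cdot> inv_arrow T (RUnit T ?F)))"
    have h: "h \<in> Arr T" "Dom T h = ?F" "Cod T h = ?L \<odot> Y" using Y flat by (auto simp: h_def)
    have "RUnit T (?L \<odot> Y) \<cdot> (h \<boxtimes> Idn T ?I) = h \<cdot> RUnit T ?F" using runit_nat[OF h(1)] h by simp
    also have "\<dots> = RUnit T (?L \<odot> Y) \<cdot> (inv_arrow T (rigidity_flat ?I Y) \<cdot> Eval T ?I Y)"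
      using Y flat by (simp add: h_def comp_assoc)
    finally have hI: "h \<boxtimes> Idn T ?I = inv_arrow T (rigidity_flat ?I Y) \<cdot> Eval T ?I Y"
      by (rule iso_monic[rotated 3, where X="?F \<odot> ?I"]) (use Y flat h in \<open>auto simp: Hom_def\<close>)
    have ev: "Eval T ?I Y \<cdot> ((?R \<cdot> h) \<boxtimes> Idn T ?I) = Eval T ?I Y"
    proof -
      have "Eval T ?I Y \<cdot> ((?R \<cdot> h) \<boxtimes> Idn T ?I) = (Eval T ?I Y \<cdot> (?R \<boxtimes> Idn T ?I)) \<cdot> (h \<boxtimes> Idn T ?I)"
        using R h Y by (simp add: comp_assoc ten_comp)
      also have "\<dots> = Eval T ?I Y" unfolding rigidity_map(2)[OF unit_obj Y] hI using flat Y by simp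
      finally show ?thesis .
    qed
    have Rh: "?R \<cdot> h = Idn T ?F"
      by (rule curry_unique[OF unit_obj Y, of _ ?F]) (use ev R h Y in \<open>auto simp: Hom_def\<close>)
    have "rigidity_flat ?I Y \<cdot> ((h \<cdot> ?R) \<boxtimes> Idn T ?I) = (rigidity_flat ?I Y \<cdot> (h \<boxtimes> Idn T ?I)) \<cdot> (?R \<boxtimes> Idn T ?I)"
      using R h Y by (simp add: comp_assoc ten_comp)
    also have "\<dots> = Eval T ?I Y \<cdot> (?R \<boxtimes> Idn T ?I)" unfolding hI using flat Y R by (simp add: comp_assoc)
    also have "\<dots> = rigidity_flat ?I Y \<cdot> Idn T (?L \<odot> Y \<odot> ?I)" unfolding rigidity_map(2)[OF unit_obj Y] using Y by simp
    finally have "(h \<cdot> ?R) \<boxtimes> Idn T ?I = Idn T (?L \<odot> Y \<odot> ?I)"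
      by (rule iso_monic[OF flat, rotated 2, where X="?L \<odot> Y \<odot> ?I"]) (use R h Y in \<open>auto simp: Hom_def\<close>)
    then have hRI: "(h \<cdot> ?R) \<boxtimes> Idn T ?I = Idn T (?L \<odot> Y) \<boxtimes> Idn T ?I" using Y by simp
    have "h \<cdot> ?R \<in> Hom T (?L \<odot> Y) (?L \<odot> Y)" "Idn T (?L \<odot> Y) \<in> Hom T (?L \<odot> Y) (?L \<odot> Y)"
      using R h Y by (auto simp: Hom_def)
    then have hR: "h \<cdot> ?R = Idn T (?L \<odot> Y)" by (rule ten_unit_faithful[OF _ _ hRI])
    show ?thesis by (rule iso_arrowI[OF _ _ hR Rh]) (use R h in \<open>simp_all add: Hom_def\<close>)
  qed
  then show ?thesis by (simp add: rigid_object_def)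
qed

text \<open>The unit of the adjunction with counit \<open>contract\<close>, characterized by one
  triangle identity; by \<open>rigid_unique\<close> the choice is unique for rigid
  \<open>C\<close>.\<close>

definition expand :: "'o \<Rightarrow> 'o \<Rightarrow> 'm"
  where "expand C Y = (SOME h. h \<in> Hom T Y (dual T C \<odot> (C \<odot> Y)) \<and> contract C (C \<odot> Y) \<cdot> (Idn T C \<boxtimes> h) = Idn T (C \<odot> Y))"

lemma expand:
  assumes C: "rigid_object T C" and Y: "Y \<in> Obj T"
  shows "expand C Y \<in> Hom T Y (dual T C \<odot> (C \<odot> Y))" "contract C (C \<odot> Y) \<cdot> (Idn T C \<boxtimes> expand C Y) = Idn T (C \<odot> Y)"
proof -
  have "C \<odot> Y \<in> Obj T" using rigid_obj[OF C] Y by simp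
  then have "\<exists>h. h \<in> Hom T Y (dual T C \<odot> (C \<odot> Y)) \<and> contract C (C \<odot> Y) \<cdot> (Idn T C \<boxtimes> h) = Idn T (C \<odot> Y)"
    using rigid_exists[OF C Idn_Hom Y] by metis
  then show "expand C Y \<in> Hom T Y (dual T C \<odot> (C \<odot> Y))" "contract C (C \<odot> Y) \<cdot> (Idn T C \<boxtimes> expand C Y) = Idn T (C \<odot> Y)"
    using someI_ex[of "\<lambda>h. h \<in> Hom T Y (dual T C \<odot> (C \<odot> Y)) \<and> contract C (C \<odot> Y) \<cdot> (Idn T C \<boxtimes> h) = Idn T (C \<odot> Y)"]
    unfolding expand_def by blast+
qed

lemma expand_arr:
  assumes "rigid_object T C" "Y \<in> Obj T"
  shows "expand C Y \<in> Arr T" "Dom T (expand C Y) = Y" "Cod T (expand C Y) = dual T C \<odot> (C \<odot> Y)"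
  using expand(1)[OF assms] by (auto simp: Hom_def)

text \<open>The other triangle identity: by naturality of \<open>contract\<close>, both sides have
  the same transpose.\<close>

lemma contract_expand:
  assumes C: "rigid_object T C" and Y: "Y \<in> Obj T"
  shows "(Idn T (dual T C) \<boxtimes> contract C Y) \<cdot> expand C (dual T C \<odot> Y) = Idn T (dual T C \<odot> Y)"
proof (rule rigid_unique[OF C])
  let ?L = "dual T C"
  have o: "C \<in> Obj T" "?L \<in> Obj T" "?L \<odot> Y \<in> Obj T" "C \<odot> (?L \<odot> Y) \<in> Obj T" using rigid_obj[OF C] Y by auto
  note e = expand_arr[OF C o(3)]
  have "contract C Y \<cdot> (Idn T C \<boxtimes> ((Idn T ?L \<boxtimes> contract C Y) \<cdot> expand C (?L \<odot> Y)))
     = (contract C Y \<cdot> (Idn T C \<boxtimes> (Idn T ?L \<boxtimes> contract C Y))) \<cdot> (Idn T C \<boxtimes> expand C (?L \<odot> Y))"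
    using o Y e by (simp add: comp_assoc ten_comp)
  also have "\<dots> = contract C Y \<cdot> (contract C (C \<odot> (?L \<odot> Y)) \<cdot> (Idn T C \<boxtimes> expand C (?L \<odot> Y)))"
    using contract_nat[OF o(1), of "contract C Y" "C \<odot> (?L \<odot> Y)" Y] o Y e by (simp add: Hom_def comp_assoc)
  also have "\<dots> = contract C Y \<cdot> (Idn T C \<boxtimes> Idn T (?L \<odot> Y))" unfolding expand(2)[OF C o(3)] using o by simp
  finally show "contract C Y \<cdot> (Idn T C \<boxtimes> ((Idn T ?L \<boxtimes> contract C Y) \<cdot> expand C (?L \<odot> Y))) = contract C Y \<cdot> (Idn T C \<boxtimes> Idn T (?L \<odot> Y))" .
  show "(Idn T ?L \<boxtimes> contract C Y) \<cdot> expand C (?L \<odot> Y) \<in> Hom T (?L \<odot> Y) (?L \<odot> Y)" "Idn T (?L \<odot> Y) \<in> Hom T (?L \<odot> Y) (?L \<odot> Y)"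
    using o Y e by (auto simp: Hom_def)
qed (rule Y)

lemma expand_nat:
  assumes C: "rigid_object T C" and f: "f \<in> Hom T Y Y'"
  shows "expand C Y' \<cdot> f = (Idn T (dual T C) \<boxtimes> (Idn T C \<boxtimes> f)) \<cdot> expand C Y"
proof (rule rigid_unique[OF C, where W=Y and Y="C \<odot> Y'"])
  let ?L = "dual T C"
  have o: "C \<in> Obj T" "?L \<in> Obj T" "Y \<in> Obj T" "Y' \<in> Obj T" "f \<in> Arr T" "Dom T f = Y" "Cod T f = Y'"
    using rigid_obj[OF C] f Hom_obj[OF f] by (auto simp: Hom_def)
  note e = expand_arr[OF C o(3)] expand_arr[OF C o(4)]
  show "expand C Y' \<cdot> f \<in> Hom T Y (?L \<odot> (C \<odot> Y'))" "(Idn T ?L \<boxtimes> (Idn T C \<boxtimes> f)) \<cdot> expand C Y \<in> Hom T Y (?L \<odot> (C \<odot> Y'))" "C \<odot> Y' \<in> Obj T"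
    using o e by (auto simp: Hom_def)
  have "contract C (C \<odot> Y') \<cdot> (Idn T C \<boxtimes> (expand C Y' \<cdot> f)) = (contract C (C \<odot> Y') \<cdot> (Idn T C \<boxtimes> expand C Y')) \<cdot> (Idn T C \<boxtimes> f)"
    using o e by (simp add: comp_assoc ten_comp)
  also have "\<dots> = Idn T C \<boxtimes> f" unfolding expand(2)[OF C o(4)] using o by simp
  also have "\<dots> = (Idn T C \<boxtimes> f) \<cdot> (contract C (C \<odot> Y) \<cdot> (Idn T C \<boxtimes> expand C Y))" unfolding expand(2)[OF C o(3)] using o by simp
  also have "\<dots> = (contract C (C \<odot> Y') \<cdot> (Idn T C \<boxtimes> (Idn T ?L \<boxtimes> (Idn T C \<boxtimes> f)))) \<cdot> (Idn T C \<boxtimes> expand C Y)"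
    using contract_nat[OF o(1), of "Idn T C \<boxtimes> f" "C \<odot> Y" "C \<odot> Y'"] o e by (simp add: Hom_def comp_assoc)
  also have "\<dots> = contract C (C \<odot> Y') \<cdot> (Idn T C \<boxtimes> ((Idn T ?L \<boxtimes> (Idn T C \<boxtimes> f)) \<cdot> expand C Y))"
    using o e by (simp add: comp_assoc ten_comp)
  finally show "contract C (C \<odot> Y') \<cdot> (Idn T C \<boxtimes> (expand C Y' \<cdot> f)) = contract C (C \<odot> Y') \<cdot> (Idn T C \<boxtimes> ((Idn T ?L \<boxtimes> (Idn T C \<boxtimes> f)) \<cdot> expand C Y))" .
qed

text \<open>The mate of \<open>contract_module\<close>: transposition along \<open>contract\<close>
  reduces the claim to that identity, once a pair of mutually inverse swaps has been
  inserted.\<close>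

lemma expand_module:
  assumes C: "rigid_object T C" and M: "M \<in> Obj T" and Y: "Y \<in> Obj T"
  shows "expand C (M \<odot> Y) = (Idn T (dual T C) \<boxtimes> swap M C Y) \<cdot> (swap M (dual T C) (C \<odot> Y) \<cdot> (Idn T M \<boxtimes> expand C Y))"
proof (rule rigid_unique[OF C, where W="M \<odot> Y" and Y="C \<odot> (M \<odot> Y)"])
  let ?L = "dual T C"
  have o: "C \<in> Obj T" "?L \<in> Obj T" "M \<in> Obj T" "Y \<in> Obj T" "M \<odot> Y \<in> Obj T" using rigid_obj[OF C] M Y by auto
  note e = expand_arr[OF C o(4)] expand_arr[OF C o(5)]
  let ?r = "(Idn T ?L \<boxtimes> swap M C Y) \<cdot> (swap M ?L (C \<odot> Y) \<cdot> (Idn T M \<boxtimes> expand C Y))"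
  show "expand C (M \<odot> Y) \<in> Hom T (M \<odot> Y) (?L \<odot> (C \<odot> (M \<odot> Y)))" "?r \<in> Hom T (M \<odot> Y) (?L \<odot> (C \<odot> (M \<odot> Y)))" "C \<odot> (M \<odot> Y) \<in> Obj T"
    using o e by (auto simp: Hom_def)
  have "contract C (C \<odot> (M \<odot> Y)) \<cdot> (Idn T C \<boxtimes> ?r)
     = (contract C (C \<odot> (M \<odot> Y)) \<cdot> (Idn T C \<boxtimes> (Idn T ?L \<boxtimes> swap M C Y))) \<cdot> (Idn T C \<boxtimes> (swap M ?L (C \<odot> Y) \<cdot> (Idn T M \<boxtimes> expand C Y)))"
    using o e by (simp add: comp_assoc ten_comp)
  also have "\<dots> = swap M C Y \<cdot> (contract C (M \<odot> (C \<odot> Y)) \<cdot> (Idn T C \<boxtimes> (swap M ?L (C \<odot> Y) \<cdot> (Idn T M \<boxtimes> expand C Y))))"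
    using contract_nat[OF o(1), of "swap M C Y" "M \<odot> (C \<odot> Y)" "C \<odot> (M \<odot> Y)"] o e by (simp add: Hom_def comp_assoc)
  also have "Idn T C \<boxtimes> (swap M ?L (C \<odot> Y) \<cdot> (Idn T M \<boxtimes> expand C Y))
      = (Idn T C \<boxtimes> swap M ?L (C \<odot> Y)) \<cdot> ((swap M C (?L \<odot> (C \<odot> Y)) \<cdot> swap C M (?L \<odot> (C \<odot> Y))) \<cdot> (Idn T C \<boxtimes> (Idn T M \<boxtimes> expand C Y)))"
    using o e by (simp add: swap_swap ten_comp)
  also have "\<dots> = (Idn T C \<boxtimes> swap M ?L (C \<odot> Y)) \<cdot> (swap M C (?L \<odot> (C \<odot> Y)) \<cdot> ((Idn T M \<boxtimes> (Idn T C \<boxtimes> expand C Y)) \<cdot> swap C M Y))"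
    using swap_nat[of "Idn T C" C C "Idn T M" M M "expand C Y" Y "?L \<odot> (C \<odot> Y)"] o e by (simp add: Hom_def comp_assoc)
  also have "contract C (M \<odot> (C \<odot> Y)) \<cdot> \<dots>
      = (contract C (M \<odot> (C \<odot> Y)) \<cdot> ((Idn T C \<boxtimes> swap M ?L (C \<odot> Y)) \<cdot> swap M C (?L \<odot> (C \<odot> Y)))) \<cdot> ((Idn T M \<boxtimes> (Idn T C \<boxtimes> expand C Y)) \<cdot> swap C M Y)"
    using o e by (simp add: comp_assoc)
  also have "\<dots> = (Idn T M \<boxtimes> contract C (C \<odot> Y)) \<cdot> ((Idn T M \<boxtimes> (Idn T C \<boxtimes> expand C Y)) \<cdot> swap C M Y)"
    using contract_module[of C M "C \<odot> Y"] o by simp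
  also have "\<dots> = (Idn T M \<boxtimes> (contract C (C \<odot> Y) \<cdot> (Idn T C \<boxtimes> expand C Y))) \<cdot> swap C M Y"
    using o e by (simp add: ten_comp_tail)
  also have "\<dots> = swap C M Y" unfolding expand(2)[OF C o(4)] using o by simp
  also have "swap M C Y \<cdot> swap C M Y = contract C (C \<odot> (M \<odot> Y)) \<cdot> (Idn T C \<boxtimes> expand C (M \<odot> Y))"
    unfolding expand(2)[OF C o(5)] using o by (simp add: swap_swap)
  finally show "contract C (C \<odot> (M \<odot> Y)) \<cdot> (Idn T C \<boxtimes> expand C (M \<odot> Y)) = contract C (C \<odot> (M \<odot> Y)) \<cdot> (Idn T C \<boxtimes> ?r)" by simp
qed

text \<open>The opposite adjunction, which exhibits \<open>C\<close> as a dual of \<open>dual T C\<close>.\<close>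

definition contract' :: "'o \<Rightarrow> 'o \<Rightarrow> 'm"
  where "contract' C Y = contract C Y \<cdot> swap (dual T C) C Y"

definition expand' :: "'o \<Rightarrow> 'o \<Rightarrow> 'm"
  where "expand' C Y = swap (dual T C) C Y \<cdot> expand C Y"

lemma contract'_arr [simp]:
  assumes "C \<in> Obj T" "Y \<in> Obj T"
  shows "contract' C Y \<in> Arr T" "Dom T (contract' C Y) = dual T C \<odot> (C \<odot> Y)" "Cod T (contract' C Y) = Y"
  using assms by (auto simp: contract'_def)

lemma expand'_arr:
  assumes "rigid_object T C" "Y \<in> Obj T"
  shows "expand' C Y \<in> Arr T" "Dom T (expand' C Y) = Y" "Cod T (expand' C Y) = C \<odot> (dual T C \<odot> Y)"
  using assms expand_arr[OF assms] rigid_obj[OF assms(1)] by (auto simp: expand'_def)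

lemma contract'_nat:
  assumes C: "C \<in> Obj T" and f: "f \<in> Hom T Y Y'"
  shows "contract' C Y' \<cdot> (Idn T (dual T C) \<boxtimes> (Idn T C \<boxtimes> f)) = f \<cdot> contract' C Y"
proof -
  have ar: "f \<in> Arr T" "Dom T f = Y" "Cod T f = Y'" "Y \<in> Obj T" "Y' \<in> Obj T" using f Hom_obj[OF f] by (auto simp: Hom_def)
  have "contract' C Y' \<cdot> (Idn T (dual T C) \<boxtimes> (Idn T C \<boxtimes> f)) = contract C Y' \<cdot> ((Idn T C \<boxtimes> (Idn T (dual T C) \<boxtimes> f)) \<cdot> swap (dual T C) C Y)"
    unfolding contract'_def using ar C swap_nat[OF Idn_Hom Idn_Hom f, of "dual T C" C] by (simp add: comp_assoc)
  also have "\<dots> = (f \<cdot> contract C Y) \<cdot> swap (dual T C) C Y"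
    by (rule comp_rewrite[OF contract_nat[OF C f]]) (use ar C in auto)
  finally show ?thesis unfolding contract'_def using ar C by (simp add: comp_assoc)
qed

lemma expand'_nat:
  assumes C: "rigid_object T C" and f: "f \<in> Hom T Y Y'"
  shows "expand' C Y' \<cdot> f = (Idn T C \<boxtimes> (Idn T (dual T C) \<boxtimes> f)) \<cdot> expand' C Y"
proof -
  have o: "C \<in> Obj T" "dual T C \<in> Obj T" "Y \<in> Obj T" "Y' \<in> Obj T" "f \<in> Arr T" "Dom T f = Y" "Cod T f = Y'"
    using rigid_obj[OF C] f Hom_obj[OF f] by (auto simp: Hom_def)
  note e = expand_arr[OF C o(3)] expand_arr[OF C o(4)]
  have "expand' C Y' \<cdot> f = swap (dual T C) C Y' \<cdot> ((Idn T (dual T C) \<boxtimes> (Idn T C \<boxtimes> f)) \<cdot> expand C Y)"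
    unfolding expand'_def using o e by (simp add: comp_assoc expand_nat[OF C f])
  also have "\<dots> = ((Idn T C \<boxtimes> (Idn T (dual T C) \<boxtimes> f)) \<cdot> swap (dual T C) C Y) \<cdot> expand C Y"
    by (rule comp_rewrite[OF swap_nat[OF Idn_Hom Idn_Hom f]]) (use o e in auto)
  finally show ?thesis unfolding expand'_def using o e by (simp add: comp_assoc)
qed

text \<open>The fact \<open>main\<close> is the dinaturality of \<open>expand\<close>, which
  transposition reduces to \<open>contract_dinat\<close>; naturality of the swaps carries it over to
  \<open>expand'\<close>.\<close>

lemma expand'_dinat:
  assumes C: "rigid_object T C" and A: "rigid_object T A" and t: "t \<in> Hom T C A" and Y: "Y \<in> Obj T"
  shows "(t \<boxtimes> Idn T (dual T C \<odot> Y)) \<cdot> expand' C Y = (Idn T A \<boxtimes> (dualM T t \<boxtimes> Idn T Y)) \<cdot> expand' A Y"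
proof -
  let ?L = "dual T C" and ?M = "dual T A"
  have o: "C \<in> Obj T" "?L \<in> Obj T" "A \<in> Obj T" "?M \<in> Obj T" "Y \<in> Obj T" "t \<in> Arr T" "Dom T t = C" "Cod T t = A"
    using rigid_obj[OF C] rigid_obj[OF A] t Y by (auto simp: Hom_def)
  note e = expand_arr[OF C Y] expand_arr[OF A Y]
  have tY: "t \<boxtimes> Idn T Y \<in> Hom T (C \<odot> Y) (A \<odot> Y)" using o by (simp add: Hom_def)
  have dt: "dualM T t \<in> Arr T" "Dom T (dualM T t) = ?M" "Cod T (dualM T t) = ?L" using o by auto
  have main: "(dualM T t \<boxtimes> Idn T (A \<odot> Y)) \<cdot> expand A Y = (Idn T ?L \<boxtimes> (t \<boxtimes> Idn T Y)) \<cdot> expand C Y"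
  proof (rule rigid_unique[OF C, where W=Y and Y="A \<odot> Y"])
    show "(dualM T t \<boxtimes> Idn T (A \<odot> Y)) \<cdot> expand A Y \<in> Hom T Y (?L \<odot> (A \<odot> Y))" "(Idn T ?L \<boxtimes> (t \<boxtimes> Idn T Y)) \<cdot> expand C Y \<in> Hom T Y (?L \<odot> (A \<odot> Y))"
      "A \<odot> Y \<in> Obj T" using o e dt by (auto simp: Hom_def)
    have "contract C (A \<odot> Y) \<cdot> (Idn T C \<boxtimes> ((dualM T t \<boxtimes> Idn T (A \<odot> Y)) \<cdot> expand A Y))
       = (contract C (A \<odot> Y) \<cdot> (Idn T C \<boxtimes> (dualM T t \<boxtimes> Idn T (A \<odot> Y)))) \<cdot> (Idn T C \<boxtimes> expand A Y)"
      using o e dt by (simp add: comp_assoc ten_comp)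
    also have "\<dots> = contract A (A \<odot> Y) \<cdot> ((t \<boxtimes> Idn T (?M \<odot> (A \<odot> Y))) \<cdot> (Idn T C \<boxtimes> expand A Y))"
      using contract_dinat[OF t, of "A \<odot> Y"] o e by (simp add: comp_assoc)
    also have "\<dots> = (contract A (A \<odot> Y) \<cdot> (Idn T A \<boxtimes> expand A Y)) \<cdot> (t \<boxtimes> Idn T Y)"
      using o e by (simp add: ten_comp comp_assoc)
    also have "\<dots> = (t \<boxtimes> Idn T Y) \<cdot> (contract C (C \<odot> Y) \<cdot> (Idn T C \<boxtimes> expand C Y))"
      unfolding expand(2)[OF C Y] expand(2)[OF A Y] using o by simp
    also have "\<dots> = (contract C (A \<odot> Y) \<cdot> (Idn T C \<boxtimes> (Idn T ?L \<boxtimes> (t \<boxtimes> Idn T Y)))) \<cdot> (Idn T C \<boxtimes> expand C Y)"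
      using contract_nat[OF o(1) tY] o e by (simp add: comp_assoc)
    also have "\<dots> = contract C (A \<odot> Y) \<cdot> (Idn T C \<boxtimes> ((Idn T ?L \<boxtimes> (t \<boxtimes> Idn T Y)) \<cdot> expand C Y))"
      using o e by (simp add: comp_assoc ten_comp)
    finally show "contract C (A \<odot> Y) \<cdot> (Idn T C \<boxtimes> ((dualM T t \<boxtimes> Idn T (A \<odot> Y)) \<cdot> expand A Y))
      = contract C (A \<odot> Y) \<cdot> (Idn T C \<boxtimes> ((Idn T ?L \<boxtimes> (t \<boxtimes> Idn T Y)) \<cdot> expand C Y))" .
  qed
  have "(t \<boxtimes> Idn T (?L \<odot> Y)) \<cdot> expand' C Y = ((t \<boxtimes> (Idn T ?L \<boxtimes> Idn T Y)) \<cdot> swap ?L C Y) \<cdot> expand C Y"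
    unfolding expand'_def using o e by (simp add: comp_assoc)
  also have "\<dots> = (swap ?L A Y \<cdot> (Idn T ?L \<boxtimes> (t \<boxtimes> Idn T Y))) \<cdot> expand C Y"
    using swap_nat[OF Idn_Hom[OF o(2)] t Idn_Hom[OF Y]] by simp
  also have "\<dots> = swap ?L A Y \<cdot> ((dualM T t \<boxtimes> Idn T (A \<odot> Y)) \<cdot> expand A Y)" using o e main by (simp add: comp_assoc)
  also have "\<dots> = ((Idn T A \<boxtimes> (dualM T t \<boxtimes> Idn T Y)) \<cdot> swap ?M A Y) \<cdot> expand A Y"
    using comp_rewrite[OF swap_nat[of "dualM T t" ?M ?L "Idn T A" A A "Idn T Y" Y Y], of "expand A Y"] o e dt by (simp add: Hom_def)
  finally show ?thesis unfolding expand'_def using o e dt by (simp add: comp_assoc)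
qed

text \<open>By \<open>cm\<close> the contraction over \<open>?L \<odot> Y\<close> is moved past the
  outer dual. The braid relation then reorders the two copies of the dual so that
  \<open>expand_module\<close> recognizes an expansion, and \<open>contract_expand\<close>
  finishes.\<close>

lemma contract'_expand':
  assumes C: "rigid_object T C" and Y: "Y \<in> Obj T"
  shows "contract' C (dual T C \<odot> Y) \<cdot> (Idn T (dual T C) \<boxtimes> expand' C Y) = Idn T (dual T C \<odot> Y)"
proof -
  let ?L = "dual T C"
  have o: "C \<in> Obj T" "?L \<in> Obj T" "Y \<in> Obj T" "?L \<odot> Y \<in> Obj T" using rigid_obj[OF C] Y by auto
  note e = expand_arr[OF C Y] expand_arr[OF C o(4)]
  let ?n = "Idn T ?L \<boxtimes> expand C Y"
  have cm: "contract C (?L \<odot> Y) = (Idn T ?L \<boxtimes> contract C Y) \<cdot> (swap C ?L (?L \<odot> Y) \<cdot> (Idn T C \<boxtimes> swap ?L ?L Y))"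
  proof -
    have "(Idn T ?L \<boxtimes> contract C Y) \<cdot> (swap C ?L (?L \<odot> Y) \<cdot> (Idn T C \<boxtimes> swap ?L ?L Y))
       = contract C (?L \<odot> Y) \<cdot> ((Idn T C \<boxtimes> swap ?L ?L Y) \<cdot> ((swap ?L C (?L \<odot> Y) \<cdot> swap C ?L (?L \<odot> Y)) \<cdot> (Idn T C \<boxtimes> swap ?L ?L Y)))"
      using contract_module[of C ?L Y, symmetric] o by (simp add: comp_assoc)
    also have "\<dots> = contract C (?L \<odot> Y)" using o by (simp add: swap_swap ten_comp)
    finally show ?thesis by simp
  qed
  have "contract' C (?L \<odot> Y) \<cdot> (Idn T ?L \<boxtimes> expand' C Y)
     = contract C (?L \<odot> Y) \<cdot> (swap ?L C (?L \<odot> Y) \<cdot> ((Idn T ?L \<boxtimes> swap ?L C Y) \<cdot> ?n))"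
    unfolding contract'_def expand'_def using o e by (simp add: comp_assoc ten_comp)
  also have "\<dots> = (Idn T ?L \<boxtimes> contract C Y) \<cdot> (swap C ?L (?L \<odot> Y) \<cdot>
      (((Idn T C \<boxtimes> swap ?L ?L Y) \<cdot> (swap ?L C (?L \<odot> Y) \<cdot> (Idn T ?L \<boxtimes> swap ?L C Y))) \<cdot> ?n))"
    unfolding cm using o e by (simp add: comp_assoc)
  also have "(Idn T C \<boxtimes> swap ?L ?L Y) \<cdot> (swap ?L C (?L \<odot> Y) \<cdot> (Idn T ?L \<boxtimes> swap ?L C Y))
      = swap ?L C (?L \<odot> Y) \<cdot> ((Idn T ?L \<boxtimes> swap ?L C Y) \<cdot> swap ?L ?L (C \<odot> Y))"
    by (rule swap_yang_baxter[symmetric]) (use o in auto)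
  also have "swap C ?L (?L \<odot> Y) \<cdot> ((swap ?L C (?L \<odot> Y) \<cdot> ((Idn T ?L \<boxtimes> swap ?L C Y) \<cdot> swap ?L ?L (C \<odot> Y))) \<cdot> ?n)
     = (swap C ?L (?L \<odot> Y) \<cdot> swap ?L C (?L \<odot> Y)) \<cdot> ((Idn T ?L \<boxtimes> swap ?L C Y) \<cdot> (swap ?L ?L (C \<odot> Y) \<cdot> ?n))"
    using o e by (simp add: comp_assoc)
  also have "\<dots> = expand C (?L \<odot> Y)" unfolding expand_module[OF C o(2,3)] using o e by (simp add: swap_swap)
  also have "(Idn T ?L \<boxtimes> contract C Y) \<cdot> expand C (?L \<odot> Y) = Idn T (?L \<odot> Y)" by (rule contract_expand[OF C Y])
  finally show ?thesis .
qed

text \<open>The companion triangle identity: here the braid relation reorders two copies of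
  \<open>C\<close>, two inverse swaps cancel, and the defining identity of \<open>expand\<close>
  remains.\<close>

lemma expand'_contract':
  assumes C: "rigid_object T C" and Y: "Y \<in> Obj T"
  shows "(Idn T C \<boxtimes> contract' C Y) \<cdot> expand' C (C \<odot> Y) = Idn T (C \<odot> Y)"
proof -
  let ?L = "dual T C"
  have o: "C \<in> Obj T" "?L \<in> Obj T" "Y \<in> Obj T" "C \<odot> Y \<in> Obj T" using rigid_obj[OF C] Y by auto
  note e = expand_arr[OF C Y] expand_arr[OF C o(4)]
  let ?n = "Idn T C \<boxtimes> expand C Y"
  have cm: "contract C (C \<odot> Y) = (Idn T C \<boxtimes> contract C Y) \<cdot> (swap C C (?L \<odot> Y) \<cdot> (Idn T C \<boxtimes> swap ?L C Y))"
  proof -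
    have "(Idn T C \<boxtimes> contract C Y) \<cdot> (swap C C (?L \<odot> Y) \<cdot> (Idn T C \<boxtimes> swap ?L C Y))
       = contract C (C \<odot> Y) \<cdot> ((Idn T C \<boxtimes> swap C ?L Y) \<cdot> ((swap C C (?L \<odot> Y) \<cdot> swap C C (?L \<odot> Y)) \<cdot> (Idn T C \<boxtimes> swap ?L C Y)))"
      using contract_module[of C C Y, symmetric] o by (simp add: comp_assoc)
    also have "\<dots> = contract C (C \<odot> Y)" using o by (simp add: swap_swap ten_comp)
    finally show ?thesis by simp
  qed
  have "(Idn T C \<boxtimes> contract' C Y) \<cdot> expand' C (C \<odot> Y)
     = (Idn T C \<boxtimes> contract C Y) \<cdot> ((Idn T C \<boxtimes> swap ?L C Y) \<cdot> (swap ?L C (C \<odot> Y) \<cdot> ((Idn T ?L \<boxtimes> swap C C Y) \<cdot> (swap C ?L (C \<odot> Y) \<cdot> ?n))))"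
    unfolding contract'_def expand'_def expand_module[OF C o(1,3)] using o e by (simp add: comp_assoc ten_comp_tail)
  also have "\<dots> = (Idn T C \<boxtimes> contract C Y) \<cdot> (((Idn T C \<boxtimes> swap ?L C Y) \<cdot> (swap ?L C (C \<odot> Y) \<cdot> (Idn T ?L \<boxtimes> swap C C Y))) \<cdot> (swap C ?L (C \<odot> Y) \<cdot> ?n))"
    using o e by (simp add: comp_assoc)
  also have "(Idn T C \<boxtimes> swap ?L C Y) \<cdot> (swap ?L C (C \<odot> Y) \<cdot> (Idn T ?L \<boxtimes> swap C C Y))
      = swap C C (?L \<odot> Y) \<cdot> ((Idn T C \<boxtimes> swap ?L C Y) \<cdot> swap ?L C (C \<odot> Y))"
    by (rule swap_yang_baxter[symmetric]) (use o in auto)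
  also have "(swap C C (?L \<odot> Y) \<cdot> ((Idn T C \<boxtimes> swap ?L C Y) \<cdot> swap ?L C (C \<odot> Y))) \<cdot> (swap C ?L (C \<odot> Y) \<cdot> ?n)
     = swap C C (?L \<odot> Y) \<cdot> ((Idn T C \<boxtimes> swap ?L C Y) \<cdot> ((swap ?L C (C \<odot> Y) \<cdot> swap C ?L (C \<odot> Y)) \<cdot> ?n))"
    using o e by (simp add: comp_assoc)
  also have "\<dots> = swap C C (?L \<odot> Y) \<cdot> ((Idn T C \<boxtimes> swap ?L C Y) \<cdot> ?n)" using o e by (simp add: swap_swap)
  also have "(Idn T C \<boxtimes> contract C Y) \<cdot> (swap C C (?L \<odot> Y) \<cdot> ((Idn T C \<boxtimes> swap ?L C Y) \<cdot> ?n)) = contract C (C \<odot> Y) \<cdot> ?n"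
    unfolding cm using o e by (simp add: comp_assoc)
  also have "\<dots> = Idn T (C \<odot> Y)" by (rule expand(2)[OF C Y])
  finally show ?thesis .
qed

text \<open>Preservation of coproducts in the first variable is transported along the
  braiding.\<close>

lemma ten_coproduct_left:
  assumes P: "is_coproduct T I E P \<iota>" and X: "X \<in> Obj T"
  shows "is_coproduct T I (\<lambda>i. X \<odot> E i) (X \<odot> P) (\<lambda>i. Idn T X \<boxtimes> \<iota> i)"
proof (rule is_coproductI)
  note a = coproduct_arr[OF P]
  note PX = ten_coproduct[OF P X]
  show "X \<odot> P \<in> Obj T" using a X by simp
  show "Idn T X \<boxtimes> \<iota> i \<in> Hom T (X \<odot> E i) (X \<odot> P)" if "i \<in> I" for i using a that X by (simp add: Hom_def)
  fix Y assume Y: "Y \<in> Obj T"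
  have b: "Braid T X P \<cdot> (Idn T X \<boxtimes> \<iota> i) = (\<iota> i \<boxtimes> Idn T X) \<cdot> Braid T X (E i)"
    and b': "Braid T P X \<cdot> (\<iota> i \<boxtimes> Idn T X) = (Idn T X \<boxtimes> \<iota> i) \<cdot> Braid T (E i) X" if "i \<in> I" for i
    using braid_nat[of "Idn T X" "\<iota> i"] braid_nat[of "\<iota> i" "Idn T X"] a that X by simp_all
  {
    fix f assume f: "\<And>i. i \<in> I \<Longrightarrow> f i \<in> Hom T (X \<odot> E i) Y"
    have "f i \<cdot> Braid T (E i) X \<in> Hom T (E i \<odot> X) Y" if "i \<in> I" for i using f[OF that] a that X by (auto simp: Hom_def)
    then have "\<exists>!h. h \<in> Hom T (P \<odot> X) Y \<and> (\<forall>i \<in> I. h \<cdot> (\<iota> i \<boxtimes> Idn T X) = f i \<cdot> Braid T (E i) X)"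
      by (rule coproduct_ex1[OF PX Y])
    then obtain h where h: "h \<in> Hom T (P \<odot> X) Y" "\<forall>i \<in> I. h \<cdot> (\<iota> i \<boxtimes> Idn T X) = f i \<cdot> Braid T (E i) X"
      by (auto dest: ex1_implies_ex)
    have ha: "h \<in> Arr T" "Dom T h = P \<odot> X" "Cod T h = Y" using h by (auto simp: Hom_def)
    have "h \<cdot> Braid T X P \<cdot> (Idn T X \<boxtimes> \<iota> i) = f i" if i: "i \<in> I" for i
    proof -
      have fi: "f i \<in> Arr T" "Dom T (f i) = X \<odot> E i" using f[OF i] by (auto simp: Hom_def)
      have "h \<cdot> Braid T X P \<cdot> (Idn T X \<boxtimes> \<iota> i) = (h \<cdot> (\<iota> i \<boxtimes> Idn T X)) \<cdot> Braid T X (E i)"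
        using ha a i X b[OF i] by (simp add: comp_assoc)
      then show ?thesis using h(2) i fi a X by (simp add: comp_assoc)
    qed
    moreover have "h \<cdot> Braid T X P \<in> Hom T (X \<odot> P) Y" using ha a X by (auto simp: Hom_def)
    ultimately show "\<exists>h \<in> Hom T (X \<odot> P) Y. \<forall>i \<in> I. h \<cdot> (Idn T X \<boxtimes> \<iota> i) = f i" by blast
  }
  fix f g assume fg: "f \<in> Hom T (X \<odot> P) Y" "g \<in> Hom T (X \<odot> P) Y"
    "\<And>i. i \<in> I \<Longrightarrow> f \<cdot> (Idn T X \<boxtimes> \<iota> i) = g \<cdot> (Idn T X \<boxtimes> \<iota> i)"
  have fga: "f \<in> Arr T" "Dom T f = X \<odot> P" "Cod T f = Y" "g \<in> Arr T" "Dom T g = X \<odot> P" "Cod T g = Y" using fg by (auto simp: Hom_def)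
  have "f \<cdot> Braid T P X = g \<cdot> Braid T P X"
  proof (rule coproduct_eqI[OF PX])
    show "f \<cdot> Braid T P X \<in> Hom T (P \<odot> X) Y" "g \<cdot> Braid T P X \<in> Hom T (P \<odot> X) Y" using fga a X by (auto simp: Hom_def)
    fix i assume i: "i \<in> I"
    have "u \<cdot> Braid T P X \<cdot> (\<iota> i \<boxtimes> Idn T X) = (u \<cdot> (Idn T X \<boxtimes> \<iota> i)) \<cdot> Braid T (E i) X" if "u \<in> Hom T (X \<odot> P) Y" for u
      using that b'[OF i] a i X by (simp add: Hom_def comp_assoc)
    then show "f \<cdot> Braid T P X \<cdot> (\<iota> i \<boxtimes> Idn T X) = g \<cdot> Braid T P X \<cdot> (\<iota> i \<boxtimes> Idn T X)" using fg i by simp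
  qed
  then show "f = g" by (rule iso_epic[rotated 3, where X=Y]) (use fga a X in \<open>auto simp: Hom_def\<close>)
qed

text \<open>Coevaluation, obtained as the unit of the opposite adjunction at the tensor
  unit.\<close>

definition coev :: "'o \<Rightarrow> 'm"
  where "coev C = (Idn T C \<boxtimes> RUnit T (dual T C)) \<cdot> expand' C (Unit T)"

lemma coev_arr:
  assumes "rigid_object T C"
  shows "coev C \<in> Arr T" "Dom T (coev C) = Unit T" "Cod T (coev C) = C \<odot> dual T C"
  using expand'_arr[OF assms unit_obj] rigid_obj[OF assms] by (auto simp: coev_def)

lemma coev_dinat:
  assumes C: "rigid_object T C" and A: "rigid_object T A" and t: "t \<in> Hom T C A"
  shows "(t \<boxtimes> Idn T (dual T C)) \<cdot> coev C = (Idn T A \<boxtimes> dualM T t) \<cdot> coev A"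
proof -
  let ?I = "Unit T"
  have o: "C \<in> Obj T" "A \<in> Obj T" "dual T C \<in> Obj T" "dual T A \<in> Obj T" "t \<in> Arr T" "Dom T t = C" "Cod T t = A"
    using rigid_obj[OF C] rigid_obj[OF A] t by (auto simp: Hom_def)
  note e = expand'_arr[OF C unit_obj] expand'_arr[OF A unit_obj]
  have "(t \<boxtimes> Idn T (dual T C)) \<cdot> coev C = (Idn T A \<boxtimes> RUnit T (dual T C)) \<cdot> ((t \<boxtimes> Idn T (dual T C \<odot> ?I)) \<cdot> expand' C ?I)"
    unfolding coev_def using o e by (simp add: ten_comp_tail)
  also have "\<dots> = (Idn T A \<boxtimes> RUnit T (dual T C)) \<cdot> ((Idn T A \<boxtimes> (dualM T t \<boxtimes> Idn T ?I)) \<cdot> expand' A ?I)"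
    using expand'_dinat[OF C A t unit_obj] by simp
  also have "\<dots> = (Idn T A \<boxtimes> (RUnit T (dual T C) \<cdot> (dualM T t \<boxtimes> Idn T ?I))) \<cdot> expand' A ?I"
    using o e by (simp add: ten_comp_tail)
  also have "RUnit T (dual T C) \<cdot> (dualM T t \<boxtimes> Idn T ?I) = dualM T t \<cdot> RUnit T (dual T A)"
    using runit_nat[of "dualM T t"] o by simp
  also have "(Idn T A \<boxtimes> (dualM T t \<cdot> RUnit T (dual T A))) \<cdot> expand' A ?I = (Idn T A \<boxtimes> dualM T t) \<cdot> coev A"
    unfolding coev_def using o e by (simp add: ten_comp_tail)
  finally show ?thesis .
qed

text \<open>The bijection from \<open>Hom T (dual T C) Y\<close> to \<open>Hom T (Unit T) (C \<odot> Y)\<close>.\<close>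

definition name_map :: "'o \<Rightarrow> 'm \<Rightarrow> 'm"
  where "name_map C w = (Idn T C \<boxtimes> w) \<cdot> coev C"

lemma name_map_Hom:
  assumes C: "rigid_object T C" and w: "w \<in> Hom T (dual T C) Y"
  shows "name_map C w \<in> Hom T (Unit T) (C \<odot> Y)"
  using coev_arr[OF C] rigid_obj[OF C] w by (auto simp: name_map_def Hom_def)

lemma name_map_comp:
  assumes C: "rigid_object T C" and w: "w \<in> Hom T (dual T C) Y" and f: "f \<in> Hom T Y Y'"
  shows "name_map C (f \<cdot> w) = (Idn T C \<boxtimes> f) \<cdot> name_map C w"
  using coev_arr[OF C] rigid_obj[OF C] w f by (auto simp: name_map_def Hom_def ten_comp_tail)

text \<open>Dinaturality of the coevaluation turns precomposition with \<open>dualM T t\<close> into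
  the action of \<open>t\<close> on the first factor. This is the bridge between
  \<open>annihilates\<close> and \<open>null_on\<close>.\<close>

lemma name_map_dual:
  assumes C: "rigid_object T C" and A: "rigid_object T A" and t: "t \<in> Hom T C A" and w: "w \<in> Hom T (dual T C) Y"
  shows "name_map A (w \<cdot> dualM T t) = (t \<boxtimes> Idn T Y) \<cdot> name_map C w"
proof -
  have o: "C \<in> Obj T" "A \<in> Obj T" "dual T C \<in> Obj T" "dual T A \<in> Obj T" "t \<in> Arr T" "Dom T t = C" "Cod T t = A"
    "w \<in> Arr T" "Dom T w = dual T C" "Cod T w = Y" "Y \<in> Obj T"
    using rigid_obj[OF C] rigid_obj[OF A] t w Hom_obj[OF w] by (auto simp: Hom_def)
  note e = coev_arr[OF C] coev_arr[OF A]
  have "name_map A (w \<cdot> dualM T t) = (Idn T A \<boxtimes> w) \<cdot> ((Idn T A \<boxtimes> dualM T t) \<cdot> coev A)"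
    unfolding name_map_def using o e by (simp add: ten_comp_tail)
  also have "\<dots> = (Idn T A \<boxtimes> w) \<cdot> ((t \<boxtimes> Idn T (dual T C)) \<cdot> coev C)" using coev_dinat[OF C A t] by simp
  also have "\<dots> = (t \<boxtimes> Idn T Y) \<cdot> name_map C w" unfolding name_map_def using o e by (simp add: ten_comp_tail)
  finally show ?thesis .
qed

text \<open>A snake identity: naturality moves \<open>w\<close> out of the contraction, and
  \<open>contract'_expand'\<close> cancels what is left.\<close>

lemma name_map_inverse:
  assumes C: "rigid_object T C" and w: "w \<in> Hom T (dual T C) Y"
  shows "contract' C Y \<cdot> ((Idn T (dual T C) \<boxtimes> name_map C w) \<cdot> inv_arrow T (RUnit T (dual T C))) = w"
proof -
  let ?L = "dual T C" and ?I = "Unit T"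
  have o: "C \<in> Obj T" "?L \<in> Obj T" "w \<in> Arr T" "Dom T w = ?L" "Cod T w = Y" "Y \<in> Obj T"
    using rigid_obj[OF C] w Hom_obj[OF w] by (auto simp: Hom_def)
  note e = expand'_arr[OF C unit_obj]
  let ?r = "RUnit T ?L"
  have "contract' C Y \<cdot> ((Idn T ?L \<boxtimes> name_map C w) \<cdot> inv_arrow T ?r)
     = (contract' C Y \<cdot> (Idn T ?L \<boxtimes> (Idn T C \<boxtimes> (w \<cdot> ?r)))) \<cdot> ((Idn T ?L \<boxtimes> expand' C ?I) \<cdot> inv_arrow T ?r)"
    unfolding name_map_def coev_def using o e by (simp add: comp_assoc ten_comp ten_comp_tail)
  also have "\<dots> = (w \<cdot> ?r) \<cdot> ((contract' C (?L \<odot> ?I) \<cdot> (Idn T ?L \<boxtimes> expand' C ?I)) \<cdot> inv_arrow T ?r)"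
    using contract'_nat[OF o(1), of "w \<cdot> ?r" "?L \<odot> ?I" Y] o e by (simp add: Hom_def comp_assoc)
  also have "\<dots> = w" unfolding contract'_expand'[OF C unit_obj] using o by (simp add: comp_assoc)
  finally show ?thesis .
qed

lemma name_map_inj:
  assumes C: "rigid_object T C" and w: "w \<in> Hom T (dual T C) Y" "w' \<in> Hom T (dual T C) Y" and eq: "name_map C w = name_map C w'"
  shows "w = w'"
  by (rule trans[OF name_map_inverse[OF C w(1), symmetric, unfolded eq] name_map_inverse[OF C w(2)]])

lemma name_map_surj:
  assumes C: "rigid_object T C" and z: "z \<in> Hom T (Unit T) (C \<odot> Y)" and Y: "Y \<in> Obj T"
  obtains w where "w \<in> Hom T (dual T C) Y" "name_map C w = z"
proof -
  let ?L = "dual T C" and ?I = "Unit T"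
  have o: "C \<in> Obj T" "?L \<in> Obj T" "z \<in> Arr T" "Dom T z = ?I" "Cod T z = C \<odot> Y" "C \<odot> Y \<in> Obj T"
    using rigid_obj[OF C] z Hom_obj[OF z] by (auto simp: Hom_def)
  note e = expand'_arr[OF C unit_obj] expand'_arr[OF C o(6)]
  let ?r = "RUnit T ?L"
  define w where "w = contract' C Y \<cdot> ((Idn T ?L \<boxtimes> z) \<cdot> inv_arrow T ?r)"
  have w: "w \<in> Hom T ?L Y" using o Y by (auto simp: w_def Hom_def)
  have "w \<cdot> ?r = contract' C Y \<cdot> (Idn T ?L \<boxtimes> z)" unfolding w_def using o Y by (simp add: comp_assoc)
  moreover have "name_map C w = (Idn T C \<boxtimes> (w \<cdot> ?r)) \<cdot> expand' C ?I"
    unfolding name_map_def coev_def using o e w by (simp add: Hom_def ten_comp_tail)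
  ultimately have "name_map C w = (Idn T C \<boxtimes> contract' C Y) \<cdot> ((Idn T C \<boxtimes> (Idn T ?L \<boxtimes> z)) \<cdot> expand' C ?I)"
    using o e Y by (simp add: ten_comp_tail)
  also have "\<dots> = ((Idn T C \<boxtimes> contract' C Y) \<cdot> expand' C (C \<odot> Y)) \<cdot> z"
    unfolding expand'_nat[OF C z, symmetric] using o e Y by (simp add: comp_assoc)
  also have "\<dots> = z" unfolding expand'_contract'[OF C Y] using o by simp
  finally show thesis using that w by blast
qed

end

section \<open>Additivity of the tensor product, and two vanishing conditions on maps\<close>

context closed_tt_category
begin

lemma ten_add_left: "\<lbrakk>f \<in> Hom T X Y; g \<in> Hom T X Y; W \<in> Obj T\<rbrakk> \<Longrightarrow> Add T f g \<boxtimes> Idn T W = Add T (f \<boxtimes> Idn T W) (g \<boxtimes> Idn T W)"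
  by (rule TenM_Add)

lemma ten_add_right:
  assumes f: "f \<in> Hom T X Y" and g: "g \<in> Hom T X Y" and W: "W \<in> Obj T"
  shows "Idn T W \<boxtimes> Add T f g = Add T (Idn T W \<boxtimes> f) (Idn T W \<boxtimes> g)"
proof -
  have o: "f \<in> Arr T" "Dom T f = X" "Cod T f = Y" "g \<in> Arr T" "Dom T g = X" "Cod T g = Y" "X \<in> Obj T" "Y \<in> Obj T"
    using f g Hom_obj[OF f] by (auto simp: Hom_def)
  have b: "Idn T W \<boxtimes> h = Braid T Y W \<cdot> ((h \<boxtimes> Idn T W) \<cdot> Braid T W X)" if h: "h \<in> Hom T X Y" for h
  proof -
    have ha: "h \<in> Arr T" "Dom T h = X" "Cod T h = Y" using h by (auto simp: Hom_def)
    have "Braid T Y W \<cdot> ((h \<boxtimes> Idn T W) \<cdot> Braid T W X) = ((Idn T W \<boxtimes> h) \<cdot> Braid T X W) \<cdot> Braid T W X"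
      by (rule comp_rewrite) (use ha o W braid_nat[of h "Idn T W"] in auto)
    also have "\<dots> = Idn T W \<boxtimes> h" using ha o W by (simp add: comp_assoc)
    finally show ?thesis by simp
  qed
  have "Idn T W \<boxtimes> Add T f g = Braid T Y W \<cdot> (Add T (f \<boxtimes> Idn T W) (g \<boxtimes> Idn T W) \<cdot> Braid T W X)"
    unfolding b[OF add_Hom[OF f g]] ten_add_left[OF f g W] ..
  also have "\<dots> = Add T (Braid T Y W \<cdot> ((f \<boxtimes> Idn T W) \<cdot> Braid T W X)) (Braid T Y W \<cdot> ((g \<boxtimes> Idn T W) \<cdot> Braid T W X))"
    using o W by (simp add: comp_add)
  also have "\<dots> = Add T (Idn T W \<boxtimes> f) (Idn T W \<boxtimes> g)" using b[OF f] b[OF g] by simp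
  finally show ?thesis .
qed

lemma ten_zero [simp]:
  assumes "X \<in> Obj T" "Y \<in> Obj T" "W \<in> Obj T"
  shows "Zero T X Y \<boxtimes> Idn T W = Zero T (X \<odot> W) (Y \<odot> W)" "Idn T W \<boxtimes> Zero T X Y = Zero T (W \<odot> X) (W \<odot> Y)"
proof -
  note z = zero_Hom[OF assms(1,2)]
  show "Zero T X Y \<boxtimes> Idn T W = Zero T (X \<odot> W) (Y \<odot> W)"
    by (rule add_self_zero) (use ten_add_left[OF z z assms(3)] assms in \<open>auto simp: Hom_def\<close>)
  show "Idn T W \<boxtimes> Zero T X Y = Zero T (W \<odot> X) (W \<odot> Y)"
    by (rule add_self_zero) (use ten_add_right[OF z z assms(3)] assms in \<open>auto simp: Hom_def\<close>)
qed

lemma ten_trunc_left: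
  assumes P: "is_coproduct T I E P \<iota>" and e: "is_trunc I P \<iota> F e" and X: "X \<in> Obj T"
  shows "is_trunc I (X \<odot> P) (\<lambda>i. Idn T X \<boxtimes> \<iota> i) F (Idn T X \<boxtimes> e)"
  unfolding is_trunc_def
proof (intro conjI ballI)
  note a = coproduct_arr[OF P] trunc_arr[OF e]
  show "Idn T X \<boxtimes> e \<in> Hom T (X \<odot> P) (X \<odot> P)" using a X by (simp add: Hom_def)
  fix i assume i: "i \<in> I"
  have "e \<cdot> \<iota> i = (if i \<in> F then \<iota> i else Zero T (E i) P)" using e i a by (simp add: is_trunc_def)
  then show "(Idn T X \<boxtimes> e) \<cdot> (Idn T X \<boxtimes> \<iota> i) = (if i \<in> F then Idn T X \<boxtimes> \<iota> i else Zero T (Dom T (Idn T X \<boxtimes> \<iota> i)) (X \<odot> P))"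
    using a i X by (simp add: ten_comp)
qed

lemma name_map_add:
  assumes C: "rigid_object T C" and w: "w \<in> Hom T (dual T C) Y" "w' \<in> Hom T (dual T C) Y"
  shows "name_map C (Add T w w') = Add T (name_map C w) (name_map C w')"
  using ten_add_right[OF w rigid_obj[OF C]] coev_arr[OF C] rigid_obj[OF C] w by (auto simp: name_map_def comp_add Hom_def)

lemma name_map_zero:
  assumes C: "rigid_object T C" and Y: "Y \<in> Obj T"
  shows "name_map C (Zero T (dual T C) Y) = Zero T (Unit T) (C \<odot> Y)"
  using coev_arr[OF C] rigid_obj[OF C] Y by (auto simp: name_map_def)

lemma name_map_eq_zero:
  assumes C: "rigid_object T C" and w: "w \<in> Hom T (dual T C) Y"
  shows "name_map C w = Zero T (Unit T) (C \<odot> Y) \<longleftrightarrow> w = Zero T (dual T C) Y"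
proof -
  have o: "Y \<in> Obj T" "dual T C \<in> Obj T" using Hom_obj[OF w] by auto
  then show ?thesis using name_map_inj[OF C w zero_Hom[OF o(2,1)]] name_map_zero[OF C o(1)] by metis
qed

definition annihilates :: "'m \<Rightarrow> 'o \<Rightarrow> bool"
  where "annihilates t X \<longleftrightarrow> (\<forall>x \<in> Hom T (Cod T t) X. x \<cdot> t = Zero T (Dom T t) X)"

text \<open>The vanishing of \<open>Hom(1, t \<otimes> X)\<close>. In this form a tensor factor of
  \<open>t\<close> can be moved over to the object, as in \<open>null_on_ten_iff\<close>.\<close>

definition null_on :: "'m \<Rightarrow> 'o \<Rightarrow> bool"
  where "null_on t X \<longleftrightarrow> (\<forall>z \<in> Hom T (Unit T) (Dom T t \<odot> X). (t \<boxtimes> Idn T X) \<cdot> z = Zero T (Unit T) (Cod T t \<odot> X))"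

text \<open>The names of maps from \<open>dual T C\<close> to \<open>Y\<close> exhaust the maps from
  the unit to \<open>C \<odot> Y\<close>, and on names precomposition with \<open>dualM T t\<close>
  is the action of \<open>t\<close>.\<close>

lemma annihilates_dual_iff:
  assumes C: "rigid_object T C" and A: "rigid_object T A" and t: "t \<in> Hom T C A" and Y: "Y \<in> Obj T"
  shows "annihilates (dualM T t) Y \<longleftrightarrow> null_on t Y"
proof -
  have o: "C \<in> Obj T" "A \<in> Obj T" "dual T C \<in> Obj T" "dual T A \<in> Obj T" "t \<in> Arr T" "Dom T t = C" "Cod T t = A"
    using rigid_obj[OF C] rigid_obj[OF A] t by (auto simp: Hom_def)
  have 1: "w \<cdot> dualM T t = Zero T (dual T A) Y \<longleftrightarrow> (t \<boxtimes> Idn T Y) \<cdot> name_map C w = Zero T (Unit T) (A \<odot> Y)"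
    if w: "w \<in> Hom T (dual T C) Y" for w
  proof -
    have "w \<cdot> dualM T t \<in> Hom T (dual T A) Y" using w o by (auto simp: Hom_def)
    from name_map_eq_zero[OF A this] show ?thesis using name_map_dual[OF C A t w] by simp
  qed
  show ?thesis unfolding annihilates_def null_on_def
  proof (intro iffI ballI)
    fix z assume *: "\<forall>w \<in> Hom T (Cod T (dualM T t)) Y. w \<cdot> dualM T t = Zero T (Dom T (dualM T t)) Y" and "z \<in> Hom T (Unit T) (Dom T t \<odot> Y)"
    then have "z \<in> Hom T (Unit T) (C \<odot> Y)" using o by simp
    then obtain w where w: "w \<in> Hom T (dual T C) Y" "name_map C w = z" by (rule name_map_surj[OF C _ Y])
    then show "(t \<boxtimes> Idn T Y) \<cdot> z = Zero T (Unit T) (Cod T t \<odot> Y)" using * 1[OF w(1)] o by simp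
  next
    fix w assume *: "\<forall>z \<in> Hom T (Unit T) (Dom T t \<odot> Y). (t \<boxtimes> Idn T Y) \<cdot> z = Zero T (Unit T) (Cod T t \<odot> Y)"
      and "w \<in> Hom T (Cod T (dualM T t)) Y"
    then have w: "w \<in> Hom T (dual T C) Y" using o by simp
    then show "w \<cdot> dualM T t = Zero T (Dom T (dualM T t)) Y" using * 1[OF w] name_map_Hom[OF C w] o by simp
  qed
qed

text \<open>Here a map \<open>x\<close> from \<open>A\<close> to \<open>X\<close> corresponds by
  contraction to a map \<open>h\<close> from the unit to \<open>dual T A \<odot> X\<close>, and
  \<open>contract_dinat\<close> matches the two vanishing conditions. With
  \<open>annihilates_dual_iff\<close> both directions of duality are covered.\<close>

lemma annihilates_iff_dual_null:
  assumes C: "rigid_object T C" and A: "rigid_object T A" and t: "t \<in> Hom T C A" and X: "X \<in> Obj T"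
  shows "annihilates t X \<longleftrightarrow> null_on (dualM T t) X"
proof -
  let ?I = "Unit T"
  have o: "C \<in> Obj T" "A \<in> Obj T" "dual T C \<in> Obj T" "dual T A \<in> Obj T" "t \<in> Arr T" "Dom T t = C" "Cod T t = A"
    using rigid_obj[OF C] rigid_obj[OF A] t by (auto simp: Hom_def)
  have d: "dualM T t \<in> Arr T" "Dom T (dualM T t) = dual T A" "Cod T (dualM T t) = dual T C" using o by auto
  have 1: "x \<cdot> t = Zero T C X \<longleftrightarrow> (dualM T t \<boxtimes> Idn T X) \<cdot> h = Zero T ?I (dual T C \<odot> X)"
    if x: "x \<in> Hom T A X" and h: "h \<in> Hom T ?I (dual T A \<odot> X)" and xh: "contract A X \<cdot> (Idn T A \<boxtimes> h) = x \<cdot> RUnit T A" for x h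
  proof -
    have xa: "x \<in> Arr T" "Dom T x = A" "Cod T x = X" and ha: "h \<in> Arr T" "Dom T h = ?I" "Cod T h = dual T A \<odot> X"
      using x h by (auto simp: Hom_def)
    have "contract C X \<cdot> (Idn T C \<boxtimes> ((dualM T t \<boxtimes> Idn T X) \<cdot> h)) = (contract C X \<cdot> (Idn T C \<boxtimes> (dualM T t \<boxtimes> Idn T X))) \<cdot> (Idn T C \<boxtimes> h)"
      using o d ha X by (simp add: comp_assoc ten_comp)
    also have "\<dots> = contract A X \<cdot> ((t \<boxtimes> Idn T (dual T A \<odot> X)) \<cdot> (Idn T C \<boxtimes> h))"
      unfolding contract_dinat[OF t X] using o ha X by (simp add: comp_assoc)
    also have "\<dots> = (contract A X \<cdot> (Idn T A \<boxtimes> h)) \<cdot> (t \<boxtimes> Idn T ?I)" using o ha X by (simp add: comp_assoc ten_comp)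
    also have "\<dots> = x \<cdot> (RUnit T A \<cdot> (t \<boxtimes> Idn T ?I))" unfolding xh using o xa by (simp add: comp_assoc)
    also have "\<dots> = (x \<cdot> t) \<cdot> RUnit T C" using runit_nat[OF o(5)] o xa by (simp add: comp_assoc)
    finally have eq: "contract C X \<cdot> (Idn T C \<boxtimes> ((dualM T t \<boxtimes> Idn T X) \<cdot> h)) = (x \<cdot> t) \<cdot> RUnit T C" .
    show ?thesis
    proof
      assume "x \<cdot> t = Zero T C X"
      then have "contract C X \<cdot> (Idn T C \<boxtimes> ((dualM T t \<boxtimes> Idn T X) \<cdot> h)) = contract C X \<cdot> (Idn T C \<boxtimes> Zero T ?I (dual T C \<odot> X))"
        using eq o X by simp
      then show "(dualM T t \<boxtimes> Idn T X) \<cdot> h = Zero T ?I (dual T C \<odot> X)"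
        by (rule rigid_unique[OF C, rotated 3, where W="?I"]) (use o d ha X in \<open>auto simp: Hom_def\<close>)
    next
      assume "(dualM T t \<boxtimes> Idn T X) \<cdot> h = Zero T ?I (dual T C \<odot> X)"
      then have "(x \<cdot> t) \<cdot> RUnit T C = Zero T C X \<cdot> RUnit T C" using eq o X by simp
      then show "x \<cdot> t = Zero T C X" by (rule iso_epic[rotated 3, where X=X]) (use o xa X in \<open>auto simp: Hom_def\<close>)
    qed
  qed
  show ?thesis unfolding annihilates_def null_on_def
  proof (intro iffI ballI)
    fix h assume *: "\<forall>x \<in> Hom T (Cod T t) X. x \<cdot> t = Zero T (Dom T t) X" and "h \<in> Hom T ?I (Dom T (dualM T t) \<odot> X)"
    then have h: "h \<in> Hom T ?I (dual T A \<odot> X)" using d by simp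
    then have ha: "h \<in> Arr T" "Dom T h = ?I" "Cod T h = dual T A \<odot> X" by (auto simp: Hom_def)
    define x where "x = contract A X \<cdot> ((Idn T A \<boxtimes> h) \<cdot> inv_arrow T (RUnit T A))"
    have x: "x \<in> Hom T A X" "contract A X \<cdot> (Idn T A \<boxtimes> h) = x \<cdot> RUnit T A"
      unfolding x_def using ha o X by (auto simp: Hom_def comp_assoc)
    then show "(dualM T t \<boxtimes> Idn T X) \<cdot> h = Zero T ?I (Cod T (dualM T t) \<odot> X)" using * 1[OF x(1) h x(2)] o d by simp
  next
    fix x assume *: "\<forall>z \<in> Hom T ?I (Dom T (dualM T t) \<odot> X). (dualM T t \<boxtimes> Idn T X) \<cdot> z = Zero T ?I (Cod T (dualM T t) \<odot> X)"
      and "x \<in> Hom T (Cod T t) X"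
    then have x: "x \<in> Hom T A X" using o by simp
    then have "x \<cdot> RUnit T A \<in> Hom T (A \<odot> ?I) X" using o by (auto simp: Hom_def)
    then obtain h where h: "h \<in> Hom T ?I (dual T A \<odot> X)" "contract A X \<cdot> (Idn T A \<boxtimes> h) = x \<cdot> RUnit T A"
      by (rule rigid_exists[OF A _ unit_obj])
    then show "x \<cdot> t = Zero T (Dom T t) X" using * 1[OF x h] o d by simp
  qed
qed

end

section \<open>Duals and tensor products of compact objects\<close>

context big_tt_category
begin

lemma compact_rigid: "compact_object T \<kappa> C \<Longrightarrow> rigid_object T C"
  using compact_iff_rigid by blast

lemma compact_unit: "compact_object T \<kappa> (Unit T)"
  using compact_iff_rigid rigid_unit by blast

text \<open>Maps from the dual of \<open>C\<close> to \<open>P\<close> correspond to maps from the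
  compact unit to \<open>C \<odot> P\<close>, and tensoring with \<open>C\<close> preserves
  coproducts and truncations.\<close>

lemma compact_dual:
  assumes C: "compact_object T \<kappa> C"
  shows "compact_object T \<kappa> (dual T C)"
proof (rule compact_objectI)
  note R = compact_rigid[OF C]
  have CO: "C \<in> Obj T" using rigid_obj[OF R] .
  then show "dual T C \<in> Obj T" by simp
  fix I X P \<iota> h assume *: "small \<kappa> (I :: 'u set)" "is_coproduct T I X P \<iota>" "h \<in> Hom T (dual T C) P"
  note CP = ten_coproduct_left[OF *(2) CO]
  obtain F e' where F: "finite F" "F \<subseteq> I" "is_trunc I (C \<odot> P) (\<lambda>i. Idn T C \<boxtimes> \<iota> i) F e'" "e' \<cdot> name_map C h = name_map C h"
    using compact_finitely_supported[OF compact_unit *(1) CP name_map_Hom[OF R *(3)]] by (auto simp: finitely_supported_def)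
  show "finitely_supported I P \<iota> h"
  proof (rule finitely_supportedI[OF *(2) F(1,2)])
    fix e assume e: "is_trunc I P \<iota> F e"
    have eH: "e \<in> Hom T P P" using e by (simp add: is_trunc_def)
    have "(Idn T C \<boxtimes> e) \<cdot> name_map C h = name_map C h"
      by (rule trunc_fixes_mono[OF CP F(3) ten_trunc_left[OF *(2) e CO] subset_refl])
        (use name_map_Hom[OF R *(3)] F(4) in \<open>auto simp: Hom_def\<close>)
    then have "name_map C (e \<cdot> h) = name_map C h" using name_map_comp[OF R *(3) eH] by simp
    then show "e \<cdot> h = h" by (rule name_map_inj[OF R, rotated 2]) (use eH *(3) Comp_Hom in auto)
  qed
qed

text \<open>The adjunction replaces \<open>f\<close> by a map \<open>h\<close> from \<open>W\<close>
  to \<open>dual T C \<odot> P\<close>. Truncations commute with contraction, so the finite support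
  of \<open>h\<close> passes to \<open>f\<close>.\<close>

lemma compact_ten:
  assumes C: "compact_object T \<kappa> C" and W: "compact_object T \<kappa> W"
  shows "compact_object T \<kappa> (C \<odot> W)"
proof (rule compact_objectI)
  note R = compact_rigid[OF C]
  have CO: "C \<in> Obj T" "W \<in> Obj T" "dual T C \<in> Obj T" using rigid_obj[OF R] compact_obj[OF W] by auto
  then show "C \<odot> W \<in> Obj T" by simp
  fix I X P \<iota> f assume *: "small \<kappa> (I :: 'u set)" "is_coproduct T I X P \<iota>" "f \<in> Hom T (C \<odot> W) P"
  obtain h where h: "h \<in> Hom T W (dual T C \<odot> P)" "contract C P \<cdot> (Idn T C \<boxtimes> h) = f" by (rule rigid_exists[OF R *(3) CO(2)])
  have ha: "h \<in> Arr T" "Dom T h = W" "Cod T h = dual T C \<odot> P" "P \<in> Obj T" using h(1) coproduct_arr[OF *(2)] by (auto simp: Hom_def)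
  note LP = ten_coproduct_left[OF *(2) CO(3)]
  obtain F e' where F: "finite F" "F \<subseteq> I" "is_trunc I (dual T C \<odot> P) (\<lambda>i. Idn T (dual T C) \<boxtimes> \<iota> i) F e'" "e' \<cdot> h = h"
    using compact_finitely_supported[OF W *(1) LP h(1)] by (auto simp: finitely_supported_def)
  show "finitely_supported I P \<iota> f"
  proof (rule finitely_supportedI[OF *(2) F(1,2)])
    fix e assume e: "is_trunc I P \<iota> F e"
    have eH: "e \<in> Hom T P P" using e by (simp add: is_trunc_def)
    note ea = trunc_arr[OF e]
    have 1: "(Idn T (dual T C) \<boxtimes> e) \<cdot> h = h"
      by (rule trunc_fixes_mono[OF LP F(3) ten_trunc_left[OF *(2) e CO(3)] subset_refl]) (use ha F(4) in auto)
    have "e \<cdot> f = (contract C P \<cdot> (Idn T C \<boxtimes> (Idn T (dual T C) \<boxtimes> e))) \<cdot> (Idn T C \<boxtimes> h)"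
      unfolding h(2)[symmetric] contract_nat[OF CO(1) eH] using CO ha ea by (simp add: comp_assoc)
    also have "\<dots> = contract C P \<cdot> (Idn T C \<boxtimes> ((Idn T (dual T C) \<boxtimes> e) \<cdot> h))" using CO ha ea by (simp add: comp_assoc ten_comp)
    finally show "e \<cdot> f = f" unfolding 1 h(2) .
  qed
qed

end

section \<open>Finitely presented functors\<close>

context additive_category
begin

definition hom_surj :: "'m \<Rightarrow> 'o \<Rightarrow> bool"
  where "hom_surj f X \<longleftrightarrow> (\<forall>x \<in> Hom C (Dom C f) X. \<exists>y \<in> Hom C (Cod C f) X. x = y \<cdot> f)"

definition coker_class :: "'m \<Rightarrow> 'o \<Rightarrow> 'm \<Rightarrow> 'm set"
  where "coker_class f X h = Hom_image C f X #>\<^bsub>HomGrp C (Dom C f) X\<^esub> h"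

lemma coker_class_eq: "coker_class f X h = {Add C (k \<cdot> f) h | k. k \<in> Hom C (Cod C f) X}"
  by (auto simp: coker_class_def r_coset_def Hom_image_def)

lemma Hom_image_subgroup:
  assumes f: "f \<in> Arr C" and X: "X \<in> Obj C"
  shows "subgroup (Hom_image C f X) (HomGrp C (Dom C f) X)"
proof -
  have 1: "group (HomGrp C (Cod C f) X)" "group (HomGrp C (Dom C f) X)" using HomGrp_group f X by auto
  have "(\<lambda>h. h \<cdot> f) \<in> hom (HomGrp C (Cod C f) X) (HomGrp C (Dom C f) X)"
    using f by (auto simp: hom_def Hom_def comp_add)
  then have "group_hom (HomGrp C (Cod C f) X) (HomGrp C (Dom C f) X) (\<lambda>h. h \<cdot> f)"
    using 1 by (simp add: group_hom_def group_hom_axioms_def)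
  from group_hom.img_is_subgroup[OF this] show ?thesis by (simp add: Hom_image_def)
qed

lemma Hom_image_normal:
  assumes f: "f \<in> Arr C" and X: "X \<in> Obj C"
  shows "normal (Hom_image C f X) (HomGrp C (Dom C f) X)"
  using comm_group.normal_iff_subgroup[OF HomGrp_comm_group] Hom_image_subgroup[OF assms] f X by auto

lemma coker_class_self: "\<lbrakk>f \<in> Arr C; h \<in> Hom C (Dom C f) X\<rbrakk> \<Longrightarrow> h \<in> coker_class f X h"
  unfolding coker_class_eq using Hom_obj[of h "Dom C f" X]
  by (auto simp: Hom_def intro!: exI[of _ "Zero C (Cod C f) X"])

lemma coker_class_eq_iff:
  assumes f: "f \<in> Arr C" and h: "h \<in> Hom C (Dom C f) X" "h' \<in> Hom C (Dom C f) X"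
  shows "coker_class f X h = coker_class f X h' \<longleftrightarrow> (\<exists>k \<in> Hom C (Cod C f) X. h = Add C (k \<cdot> f) h')"
proof
  assume "coker_class f X h = coker_class f X h'"
  then have "h \<in> coker_class f X h'" using coker_class_self[OF f h(1)] by simp
  then show "\<exists>k \<in> Hom C (Cod C f) X. h = Add C (k \<cdot> f) h'" by (auto simp: coker_class_eq)
next
  have X: "X \<in> Obj C" using Hom_obj h by blast
  assume "\<exists>k \<in> Hom C (Cod C f) X. h = Add C (k \<cdot> f) h'"
  then have "h \<in> Hom_image C f X #>\<^bsub>HomGrp C (Dom C f) X\<^esub> h'" unfolding coker_class_def[symmetric] coker_class_eq by blast
  then show "coker_class f X h = coker_class f X h'"
    unfolding coker_class_def
    using group.repr_independence[OF HomGrp_group _ _ Hom_image_subgroup[OF f X], of h h'] f X h by simp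
qed

lemma coker_carrier: "carrier (FObj (coker_functor C f) X) = coker_class f X ` Hom C (Dom C f) X"
  by (auto simp: coker_functor_def FactGroup_def RCOSETS_def coker_class_def)

lemma coker_mult:
  assumes "f \<in> Arr C" "h \<in> Hom C (Dom C f) X" "h' \<in> Hom C (Dom C f) X"
  shows "coker_class f X h \<otimes>\<^bsub>FObj (coker_functor C f) X\<^esub> coker_class f X h' = coker_class f X (Add C h h')"
  using normal.rcos_sum[OF Hom_image_normal[OF assms(1)], of X h h'] assms Hom_obj[of h "Dom C f" X]
  by (simp add: coker_functor_def FactGroup_def coker_class_def)

lemma coker_one:
  assumes "f \<in> Arr C" "X \<in> Obj C"
  shows "\<one>\<^bsub>FObj (coker_functor C f) X\<^esub> = coker_class f X (Zero C (Dom C f) X)"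
proof -
  have "coker_class f X (Zero C (Dom C f) X) = Hom_image C f X"
    unfolding coker_class_def
    using group.coset_mult_one[OF HomGrp_group[of "Dom C f" X], of "Hom_image C f X"] assms
      subgroup.subset[OF Hom_image_subgroup[OF assms]] by simp
  then show ?thesis by (simp add: coker_functor_def FactGroup_def)
qed

lemma coker_comm_group:
  assumes "f \<in> Arr C" "X \<in> Obj C"
  shows "comm_group (FObj (coker_functor C f) X)"
  using comm_group.abelian_FactGroup[OF HomGrp_comm_group Hom_image_subgroup[OF assms]] assms
  by (simp add: coker_functor_def)

text \<open>All representatives of a coset are sent into one coset, so the union in
  \<open>FArr\<close> collapses.\<close>

lemma coker_FArr:
  assumes f: "f \<in> Arr C" and h: "h \<in> Hom C (Dom C f) X" and g: "g \<in> Hom C X Y"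
  shows "FArr (coker_functor C f) g (coker_class f X h) = coker_class f Y (g \<cdot> h)"
proof -
  have "FArr (coker_functor C f) g (coker_class f X h) = (\<Union>u \<in> coker_class f X h. coker_class f Y (g \<cdot> u))"
    using g by (simp add: coker_functor_def coker_class_def Hom_def)
  also have "\<dots> = coker_class f Y (g \<cdot> h)"
  proof -
    have "coker_class f Y (g \<cdot> u) = coker_class f Y (g \<cdot> h)" if "u \<in> coker_class f X h" for u
    proof -
      obtain k where k: "k \<in> Hom C (Cod C f) X" "u = Add C (k \<cdot> f) h" using \<open>u \<in> coker_class f X h\<close> by (auto simp: coker_class_eq)
      have "g \<cdot> u = Add C ((g \<cdot> k) \<cdot> f) (g \<cdot> h)" using k f g h by (auto simp: Hom_def comp_add comp_assoc)
      moreover have "g \<cdot> k \<in> Hom C (Cod C f) Y" "g \<cdot> h \<in> Hom C (Dom C f) Y" "g \<cdot> u \<in> Hom C (Dom C f) Y"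
        using k g h f by (auto simp: Hom_def)
      ultimately show ?thesis using coker_class_eq_iff[OF f, of "g \<cdot> u" Y "g \<cdot> h"] by blast
    qed
    then show ?thesis using coker_class_self[OF f h] by blast
  qed
  finally show ?thesis .
qed

lemma coker_additive_functor:
  assumes f: "f \<in> Arr C" and K: "K \<subseteq> Obj C"
  shows "additive_functor C K (coker_functor C f)"
  unfolding additive_functor_def
proof (intro conjI ballI)
  fix X assume X: "X \<in> K"
  then have XO: "X \<in> Obj C" using K by blast
  then show "comm_group (FObj (coker_functor C f) X)" by (rule coker_comm_group[OF f])
  show "FArr (coker_functor C f) (Idn C X) x = x" if x: "x \<in> carrier (FObj (coker_functor C f) X)" for x
  proof -
    obtain h where h: "h \<in> Hom C (Dom C f) X" "x = coker_class f X h" using x coker_carrier by blast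
    then show ?thesis using coker_FArr[OF f h(1) Idn_Hom[OF XO]] by (simp add: Hom_def)
  qed
  fix Y g assume Y: "Y \<in> K" and g: "g \<in> Hom C X Y"
  show "FArr (coker_functor C f) g \<in> hom (FObj (coker_functor C f) X) (FObj (coker_functor C f) Y)"
  proof (rule homI)
    fix x assume "x \<in> carrier (FObj (coker_functor C f) X)"
    then obtain h where h: "h \<in> Hom C (Dom C f) X" "x = coker_class f X h" using coker_carrier by blast
    have gh: "g \<cdot> h \<in> Hom C (Dom C f) Y" using Comp_Hom[OF h(1) g] .
    then show "FArr (coker_functor C f) g x \<in> carrier (FObj (coker_functor C f) Y)" using h coker_FArr[OF f h(1) g] coker_carrier by auto
    fix y assume "y \<in> carrier (FObj (coker_functor C f) X)"
    then obtain h' where h': "h' \<in> Hom C (Dom C f) X" "y = coker_class f X h'" using coker_carrier by blast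
    have gh': "g \<cdot> h' \<in> Hom C (Dom C f) Y" using Comp_Hom[OF h'(1) g] .
    have "g \<cdot> Add C h h' = Add C (g \<cdot> h) (g \<cdot> h')" by (rule Comp_Add_right[OF h(1) h'(1) g])
    then show "FArr (coker_functor C f) g (x \<otimes>\<^bsub>FObj (coker_functor C f) X\<^esub> y)
      = FArr (coker_functor C f) g x \<otimes>\<^bsub>FObj (coker_functor C f) Y\<^esub> FArr (coker_functor C f) g y"
      unfolding h(2) h'(2)
      using coker_mult[OF f h(1) h'(1)] coker_mult[OF f gh gh'] coker_FArr[OF f h(1) g] coker_FArr[OF f h'(1) g]
        coker_FArr[OF f add_Hom[OF h(1) h'(1)] g] by simp
  qed
  show "FArr (coker_functor C f) (k \<cdot> g) x = FArr (coker_functor C f) k (FArr (coker_functor C f) g x)"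
    if k: "k \<in> Hom C Y Z" and x: "x \<in> carrier (FObj (coker_functor C f) X)" for Z k x
  proof -
    obtain h where h: "h \<in> Hom C (Dom C f) X" "x = coker_class f X h" using x coker_carrier by blast
    show ?thesis using coker_FArr[OF f h(1) Comp_Hom[OF g k]] coker_FArr[OF f h(1) g]
      coker_FArr[OF f Comp_Hom[OF h(1) g] k] Comp_assoc[OF h(1) g k] h(2) by simp
  qed
  show "FArr (coker_functor C f) (Add C g k) x = FArr (coker_functor C f) g x \<otimes>\<^bsub>FObj (coker_functor C f) Y\<^esub> FArr (coker_functor C f) k x"
    if k: "k \<in> Hom C X Y" and x: "x \<in> carrier (FObj (coker_functor C f) X)" for k x
  proof -
    obtain h where h: "h \<in> Hom C (Dom C f) X" "x = coker_class f X h" using x coker_carrier by blast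
    show ?thesis using coker_FArr[OF f h(1) add_Hom[OF g k]] coker_FArr[OF f h(1) g] coker_FArr[OF f h(1) k]
      coker_mult[OF f Comp_Hom[OF h(1) g] Comp_Hom[OF h(1) k]] Comp_Add_left[OF h(1) g k] h(2) by simp
  qed
qed

lemma coker_trivial_iff:
  assumes f: "f \<in> Arr C" and X: "X \<in> Obj C"
  shows "trivial_group (FObj (coker_functor C f) X) \<longleftrightarrow> hom_surj f X"
proof -
  have z: "Zero C (Dom C f) X \<in> Hom C (Dom C f) X" using zero_Hom f X by simp
  have "trivial_group (FObj (coker_functor C f) X) \<longleftrightarrow> (\<forall>h \<in> Hom C (Dom C f) X. coker_class f X h = coker_class f X (Zero C (Dom C f) X))"
    using coker_comm_group[OF f X] z
    by (auto simp: trivial_group_def coker_carrier coker_one[OF f X] comm_group_def)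
  also have "\<dots> \<longleftrightarrow> hom_surj f X"
    unfolding hom_surj_def
  proof (intro ball_cong refl)
    fix h assume h: "h \<in> Hom C (Dom C f) X"
    have "Add C (k \<cdot> f) (Zero C (Dom C f) X) = k \<cdot> f" if "k \<in> Hom C (Cod C f) X" for k
      using that f by (auto simp: Hom_def)
    then show "coker_class f X h = coker_class f X (Zero C (Dom C f) X) \<longleftrightarrow> (\<exists>y \<in> Hom C (Cod C f) X. h = y \<cdot> f)"
      unfolding coker_class_eq_iff[OF f h z] by (auto intro!: bex_cong)
  qed
  finally show ?thesis .
qed

lemma nat_iso_refl:
  assumes G: "additive_functor C K G"
  shows "nat_iso C K G G"
proof -
  define N where "N = (\<lambda>X \<in> K. \<lambda>x \<in> carrier (FObj G X). x)"
  have g: "comm_group (FObj G X)" if "X \<in> K" for X using G that by (simp add: additive_functor_def)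
  have m: "\<And>x y. x \<in> carrier (FObj G X) \<Longrightarrow> y \<in> carrier (FObj G X) \<Longrightarrow> x \<otimes>\<^bsub>FObj G X\<^esub> y \<in> carrier (FObj G X)" if "X \<in> K" for X
    using monoid.m_closed[OF comm_group.axioms(2)[OF g[OF that], THEN group.is_monoid]] by blast
  have iso: "N X \<in> iso (FObj G X) (FObj G X)" if "X \<in> K" for X
    using that m[OF that] by (auto simp: N_def iso_def hom_def bij_betw_def inj_on_def)
  have c: "FArr G f x \<in> carrier (FObj G Y)" if "X \<in> K" "Y \<in> K" "f \<in> Hom C X Y" "x \<in> carrier (FObj G X)" for X Y f x
    using G that unfolding additive_functor_def hom_def by blast
  have "N \<in> nat_trans C K G G"
    unfolding nat_trans_def
  proof (intro CollectI conjI ballI)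
    show "N \<in> (\<Pi>\<^sub>E X \<in> K. hom (FObj G X) (FObj G X) \<inter> extensional (carrier (FObj G X)))"
      using iso by (auto simp: N_def iso_def)
  qed (use c in \<open>simp add: N_def\<close>)
  then show ?thesis using iso unfolding nat_iso_def by blast
qed

end

section \<open>Presentations, the duality of finitely presented functors, and the dual class\<close>

context big_tt_category
begin

text \<open>Exactness of \<open>Hom(-, X)\<close>: the maps that factor through \<open>f\<close> are
  those killed by \<open>t\<close>.\<close>

lemma hom_surj_iff_annihilates:
  assumes D: "(t, f, r) \<in> Dist T"
  shows "hom_surj f X \<longleftrightarrow> annihilates t X"
proof -
  note a = Dist_arr[OF D]
  show ?thesis unfolding hom_surj_def annihilates_def
  proof (intro iffI ballI)
    fix x assume *: "\<forall>x \<in> Hom T (Dom T f) X. \<exists>y \<in> Hom T (Cod T f) X. x = y \<cdot> f" and "x \<in> Hom T (Cod T t) X"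
    then obtain y where y: "y \<in> Hom T (Cod T f) X" "x = y \<cdot> f" using a by auto
    then show "x \<cdot> t = Zero T (Dom T t) X" using a Dist_comp_zero[OF D] Hom_obj[OF y(1)] by (auto simp: Hom_def comp_assoc)
  next
    fix x assume *: "\<forall>x \<in> Hom T (Cod T t) X. x \<cdot> t = Zero T (Dom T t) X" and x: "x \<in> Hom T (Dom T f) X"
    have "x \<in> Hom T (Cod T t) X" using x a by simp
    then show "\<exists>y \<in> Hom T (Cod T f) X. x = y \<cdot> f" using Dist_coexact[OF D] * by metis
  qed
qed

lemma compacts_iff: "C \<in> compacts T \<kappa> \<longleftrightarrow> compact_object T \<kappa> C"
  by (simp add: compacts_def)

lemma compact_arrows_iff: "f \<in> compact_arrows T \<kappa> \<longleftrightarrow> f \<in> Arr T \<and> compact_object T \<kappa> (Dom T f) \<and> compact_object T \<kappa> (Cod T f)"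
  by (simp add: compact_arrows_def compacts_iff)

lemma compact_arrow_cone:
  assumes D: "(f, g, h) \<in> Dist T" and f: "f \<in> compact_arrows T \<kappa>"
  shows "g \<in> compact_arrows T \<kappa>"
  using compact_cone[OF D, of \<kappa>] compact_susp[of \<kappa> "Dom T f"] f Dist_arr[OF D] by (simp add: compact_arrows_iff)

text \<open>The suspension of \<open>Dom T f\<close> is compact as the target of the last map of the
  triangle, and compactness descends along the suspension.\<close>

lemma compact_arrow_fiber:
  assumes D: "(f, g, h) \<in> Dist T" and g: "g \<in> compact_arrows T \<kappa>"
  shows "f \<in> compact_arrows T \<kappa>"
proof -
  note a = Dist_arr[OF D]
  have "h \<in> compact_arrows T \<kappa>" by (rule compact_arrow_cone[OF Dist_rot[OF D] g])
  then have "compact_object T \<kappa> (Susp T (Dom T f))" using a by (simp add: compact_arrows_iff)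
  then have "compact_object T \<kappa> (Dom T f)"
    by (rule compact_desusp[OF _ Idn_Hom]) (use a in auto)
  then show ?thesis using a g by (simp add: compact_arrows_iff)
qed

text \<open>An isomorphism from the cokernel of \<open>Hom(f, -)\<close> to \<open>G\<close> on
  compact objects, unpacked so that elements of \<open>G\<close> are handled through representing
  maps in place of cosets.\<close>

definition presentation :: "'m \<Rightarrow> ('o, 'm, 'g) ab_functor \<Rightarrow> ('o \<Rightarrow> 'm \<Rightarrow> 'g) \<Rightarrow> bool"
  where "presentation f G m \<longleftrightarrow>
    (\<forall>X. compact_object T \<kappa> X \<longrightarrow> m X ` Hom T (Dom T f) X = carrier (FObj G X) \<and>
      (\<forall>h \<in> Hom T (Dom T f) X. \<forall>h' \<in> Hom T (Dom T f) X.
        (m X h = m X h' \<longleftrightarrow> (\<exists>k \<in> Hom T (Cod T f) X. h = Add T (k \<cdot> f) h')) \<and>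
        m X (Add T h h') = m X h \<otimes>\<^bsub>FObj G X\<^esub> m X h') \<and>
      (\<forall>Y g. compact_object T \<kappa> Y \<longrightarrow> g \<in> Hom T X Y \<longrightarrow> (\<forall>h \<in> Hom T (Dom T f) X. m Y (g \<cdot> h) = FArr G g (m X h))))"

lemma presents_presentation:
  assumes p: "presents T \<kappa> f G"
  obtains m where "presentation f G m"
proof -
  have f: "f \<in> Arr T" using p by (simp add: presents_def compact_arrows_iff)
  obtain M where M: "M \<in> nat_trans T (compacts T \<kappa>) (coker_functor T f) G"
    "\<And>X. compact_object T \<kappa> X \<Longrightarrow> M X \<in> iso (FObj (coker_functor T f) X) (FObj G X)"
    using p unfolding presents_def nat_iso_def compacts_iff[symmetric] by blast
  have nat: "M Y (FArr (coker_functor T f) g x) = FArr G g (M X x)"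
    if "compact_object T \<kappa> X" "compact_object T \<kappa> Y" "g \<in> Hom T X Y" "x \<in> carrier (FObj (coker_functor T f) X)" for X Y g x
    using M(1) that unfolding nat_trans_def compacts_iff[symmetric] by blast
  define m where "m X h = M X (coker_class f X h)" for X h
  have "presentation f G m"
    unfolding presentation_def
  proof (intro allI impI conjI ballI)
    fix X assume X: "compact_object T \<kappa> X"
    note I = M(2)[OF X]
    have bij: "bij_betw (M X) (carrier (FObj (coker_functor T f) X)) (carrier (FObj G X))" using I by (simp add: iso_def)
    show "m X ` Hom T (Dom T f) X = carrier (FObj G X)"
      using bij_betw_imp_surj_on[OF bij] unfolding coker_carrier m_def by (simp add: image_image)
    {
      fix h h' assume h: "h \<in> Hom T (Dom T f) X" "h' \<in> Hom T (Dom T f) X"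
      then have c: "coker_class f X h \<in> carrier (FObj (coker_functor T f) X)" "coker_class f X h' \<in> carrier (FObj (coker_functor T f) X)"
        by (auto simp: coker_carrier)
      have "m X h = m X h' \<longleftrightarrow> coker_class f X h = coker_class f X h'"
        unfolding m_def using inj_on_eq_iff[OF bij_betw_imp_inj_on[OF bij] c] .
      then show "m X h = m X h' \<longleftrightarrow> (\<exists>k \<in> Hom T (Cod T f) X. h = Add T (k \<cdot> f) h')" using coker_class_eq_iff[OF f h] by simp
      show "m X (Add T h h') = m X h \<otimes>\<^bsub>FObj G X\<^esub> m X h'"
        unfolding m_def coker_mult[OF f h, symmetric] using I c by (simp add: iso_def hom_def)
    }
    fix Y g h assume "compact_object T \<kappa> Y" "g \<in> Hom T X Y" "h \<in> Hom T (Dom T f) X"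
    then show "m Y (g \<cdot> h) = FArr G g (m X h)"
      using nat[OF X, of Y g "coker_class f X h"] coker_FArr[OF f] by (simp add: m_def coker_carrier)
  qed
  then show thesis using that by blast
qed

lemma presentationD:
  assumes "presentation f G m" "compact_object T \<kappa> X"
  shows "m X ` Hom T (Dom T f) X = carrier (FObj G X)"
    "\<lbrakk>h \<in> Hom T (Dom T f) X; h' \<in> Hom T (Dom T f) X\<rbrakk> \<Longrightarrow> m X h = m X h' \<longleftrightarrow> (\<exists>k \<in> Hom T (Cod T f) X. h = Add T (k \<cdot> f) h')"
    "\<lbrakk>h \<in> Hom T (Dom T f) X; h' \<in> Hom T (Dom T f) X\<rbrakk> \<Longrightarrow> m X (Add T h h') = m X h \<otimes>\<^bsub>FObj G X\<^esub> m X h'"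
    "\<lbrakk>compact_object T \<kappa> Y; g \<in> Hom T X Y; h \<in> Hom T (Dom T f) X\<rbrakk> \<Longrightarrow> m Y (g \<cdot> h) = FArr G g (m X h)"
  using assms unfolding presentation_def by blast+

text \<open>Two presentations, by \<open>f: A -> B\<close> and \<open>f': A' -> B'\<close>, are
  compared by Yoneda. Their universal elements give \<open>u: A' -> A\<close> and
  \<open>u': A -> A'\<close>, and the kernels give \<open>v\<close> and \<open>w\<close> with
  \<open>f' u' = v f\<close> and \<open>1 = w f + u u'\<close>. If \<open>x u = y f'\<close>, then
  \<open>x = (x w + y v) f\<close>.\<close>

lemma hom_surj_independent:
  assumes p: "presents T \<kappa> f G" and p': "presents T \<kappa> f' G" and s: "hom_surj f' X" and X: "X \<in> Obj T"
  shows "hom_surj f X"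
proof -
  obtain m where m: "presentation f G m" using presents_presentation[OF p] .
  obtain m' where m': "presentation f' G m'" using presents_presentation[OF p'] .
  define A B A' B' where "A = Dom T f" and "B = Cod T f" and "A' = Dom T f'" and "B' = Cod T f'"
  have c: "compact_object T \<kappa> A" "compact_object T \<kappa> B" "compact_object T \<kappa> A'" "compact_object T \<kappa> B'" "f \<in> Hom T A B" "f' \<in> Hom T A' B'"
    using p p' by (auto simp: presents_def compact_arrows_iff A_def B_def A'_def B'_def Hom_def)
  have o: "A \<in> Obj T" "B \<in> Obj T" "A' \<in> Obj T" "B' \<in> Obj T" using c compact_obj by auto
  note D = presentationD[OF m, folded A_def B_def] and D' = presentationD[OF m', folded A'_def B'_def]
  have "m A (Idn T A) \<in> carrier (FObj G A)" using D(1)[OF c(1)] Idn_Hom[OF o(1)] by blast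
  then obtain u where u: "u \<in> Hom T A' A" "m A (Idn T A) = m' A u" using D'(1)[OF c(1)] by blast
  have "m' A' (Idn T A') \<in> carrier (FObj G A')" using D'(1)[OF c(3)] Idn_Hom[OF o(3)] by blast
  then obtain u' where u': "u' \<in> Hom T A A'" "m' A' (Idn T A') = m A' u'" using D(1)[OF c(3)] by blast
  have mx: "m' Y x = m Y (x \<cdot> u')" if "compact_object T \<kappa> Y" "x \<in> Hom T A' Y" for Y x
    using D'(4)[OF c(3) that Idn_Hom[OF o(3)]] D(4)[OF c(3) that u'(1)] u'(2) that(2) by (simp add: Hom_def)
  \<comment> \<open>The map \<open>f'\<close> represents the zero element since it factors through
    itself; transported along \<open>u'\<close>, this says that \<open>f' \<cdot> u'\<close> is zero
    modulo maps through \<open>f\<close>.\<close>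
  have "m B' (f' \<cdot> u') = m B' (Zero T A B')"
  proof -
    have "m' B' f' = m' B' (Zero T A' B')"
      unfolding D'(2)[OF c(4) c(6) zero_Hom[OF o(3,4)]] using Idn_Hom[OF o(4)] c(6) by (intro bexI[of _ "Idn T B'"]) (auto simp: Hom_def)
    then show ?thesis using mx[OF c(4) c(6)] mx[OF c(4) zero_Hom[OF o(3,4)]] u'(1) o by (simp add: Hom_def)
  qed
  then obtain v where v: "v \<in> Hom T B B'" "f' \<cdot> u' = Add T (v \<cdot> f) (Zero T A B')"
    using D(2)[OF c(4) Comp_Hom[OF u'(1) c(6)] zero_Hom[OF o(1,4)]] by blast
  have vf: "f' \<cdot> u' = v \<cdot> f" using v c by (auto simp: Hom_def)
  have "m A (Idn T A) = m A (u \<cdot> u')" using u mx[OF c(1) u(1)] by simp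
  then obtain w where w: "w \<in> Hom T B A" "Idn T A = Add T (w \<cdot> f) (u \<cdot> u')"
    using D(2)[OF c(1) Idn_Hom[OF o(1)] Comp_Hom[OF u'(1) u(1)]] by blast
  have ar: "u \<in> Arr T" "Dom T u = A'" "Cod T u = A" "u' \<in> Arr T" "Dom T u' = A" "Cod T u' = A'" "v \<in> Arr T" "Dom T v = B" "Cod T v = B'"
    "w \<in> Arr T" "Dom T w = B" "Cod T w = A" "f \<in> Arr T" "Dom T f = A" "Cod T f = B" "f' \<in> Arr T" "Dom T f' = A'" "Cod T f' = B'"
    using u u' v w c by (auto simp: Hom_def)
  show ?thesis unfolding hom_surj_def
  proof
    fix x assume "x \<in> Hom T (Dom T f) X"
    then have x: "x \<in> Arr T" "Dom T x = A" "Cod T x = X" by (auto simp: Hom_def A_def)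
    have "x \<cdot> u \<in> Hom T A' X" using x ar by (simp add: Hom_def)
    then obtain y where y: "y \<in> Hom T B' X" "x \<cdot> u = y \<cdot> f'" using s ar unfolding hom_surj_def by auto
    have ya: "y \<in> Arr T" "Dom T y = B'" "Cod T y = X" using y by (auto simp: Hom_def)
    have "(x \<cdot> u) \<cdot> u' = y \<cdot> (f' \<cdot> u')" unfolding y(2) using ar ya by (simp add: comp_assoc)
    then have 1: "x \<cdot> (u \<cdot> u') = (y \<cdot> v) \<cdot> f" unfolding vf using ar ya x by (simp add: comp_assoc)
    have "x = x \<cdot> Idn T A" using x o by simp
    also have "\<dots> = Add T (x \<cdot> (w \<cdot> f)) (x \<cdot> (u \<cdot> u'))" unfolding w(2) using x ar by (simp add: comp_add)
    also have "\<dots> = Add T (x \<cdot> w) (y \<cdot> v) \<cdot> f" unfolding 1 using x ya ar by (simp add: comp_add comp_assoc)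
    finally have "x = Add T (x \<cdot> w) (y \<cdot> v) \<cdot> f" .
    moreover have "Add T (x \<cdot> w) (y \<cdot> v) \<in> Hom T (Cod T f) X" using x ya ar by (auto simp: Hom_def)
    ultimately show "\<exists>y \<in> Hom T (Cod T f) X. x = y \<cdot> f" by blast
  qed
qed

text \<open>A map from \<open>DC\<close> to \<open>Y\<close> and one from \<open>DY\<close> to
  \<open>C\<close> are both named by maps from the unit, into \<open>C \<odot> Y\<close> and
  \<open>Y \<odot> C\<close>, which the braiding exchanges. The flip stands for dualization followed
  by the identification of the double dual of \<open>C\<close> with \<open>C\<close>.\<close>

definition dual_flip :: "'o \<Rightarrow> 'o \<Rightarrow> 'm \<Rightarrow> 'm"
  where "dual_flip C Y w = (SOME a. a \<in> Hom T (dual T Y) C \<and> name_map Y a = Braid T C Y \<cdot> name_map C w)"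

lemma dual_flip:
  assumes C: "rigid_object T C" and Y: "rigid_object T Y" and w: "w \<in> Hom T (dual T C) Y"
  shows "dual_flip C Y w \<in> Hom T (dual T Y) C" "name_map Y (dual_flip C Y w) = Braid T C Y \<cdot> name_map C w"
proof -
  have o: "C \<in> Obj T" "Y \<in> Obj T" using rigid_obj C Y by auto
  have "Braid T C Y \<cdot> name_map C w \<in> Hom T (Unit T) (Y \<odot> C)" using Comp_Hom[OF name_map_Hom[OF C w] Braid_Hom[OF o]] .
  then have "\<exists>a. a \<in> Hom T (dual T Y) C \<and> name_map Y a = Braid T C Y \<cdot> name_map C w" using name_map_surj[OF Y _ o(1)] by metis
  from someI_ex[OF this] show "dual_flip C Y w \<in> Hom T (dual T Y) C" "name_map Y (dual_flip C Y w) = Braid T C Y \<cdot> name_map C w"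
    by (simp_all add: dual_flip_def)
qed

lemma dual_flip_eqI:
  assumes C: "rigid_object T C" and Y: "rigid_object T Y" and w: "w \<in> Hom T (dual T C) Y"
    and a: "a \<in> Hom T (dual T Y) C" "name_map Y a = Braid T C Y \<cdot> name_map C w"
  shows "dual_flip C Y w = a"
  by (rule name_map_inj[OF Y dual_flip(1)[OF C Y w] a(1)]) (simp add: dual_flip(2)[OF C Y w] a(2))

lemma dual_flip_inj:
  assumes C: "rigid_object T C" and Y: "rigid_object T Y" and w: "w \<in> Hom T (dual T C) Y" "w' \<in> Hom T (dual T C) Y"
    and eq: "dual_flip C Y w = dual_flip C Y w'"
  shows "w = w'"
proof (rule name_map_inj[OF C w])
  have o: "C \<in> Obj T" "Y \<in> Obj T" using rigid_obj C Y by auto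
  have "Braid T C Y \<cdot> name_map C w = Braid T C Y \<cdot> name_map C w'"
    using dual_flip(2)[OF C Y w(1)] dual_flip(2)[OF C Y w(2)] eq by metis
  then show "name_map C w = name_map C w'"
    by (rule iso_monic[rotated 3, where X="Unit T"]) (use name_map_Hom[OF C] w o in auto)
qed

lemma dual_flip_surj:
  assumes C: "rigid_object T C" and Y: "rigid_object T Y" and a: "a \<in> Hom T (dual T Y) C"
  obtains w where "w \<in> Hom T (dual T C) Y" "dual_flip C Y w = a"
proof -
  have o: "C \<in> Obj T" "Y \<in> Obj T" using rigid_obj C Y by auto
  note na = name_map_Hom[OF Y a]
  have "Braid T Y C \<cdot> name_map Y a \<in> Hom T (Unit T) (C \<odot> Y)" using Comp_Hom[OF na Braid_Hom[OF o(2,1)]] .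
  then obtain w where w: "w \<in> Hom T (dual T C) Y" "name_map C w = Braid T Y C \<cdot> name_map Y a" by (rule name_map_surj[OF C _ o(2)])
  have "Braid T C Y \<cdot> name_map C w = name_map Y a"
    unfolding w(2) using comp_rewrite[OF braid_braid[OF o(2,1)], of "name_map Y a"] na o by (auto simp: Hom_def)
  then have "dual_flip C Y w = a" by (intro dual_flip_eqI[OF C Y w(1) a]) simp
  then show thesis using that w by blast
qed

lemma dual_flip_comp:
  assumes C: "rigid_object T C" and Y: "rigid_object T Y" and Y': "rigid_object T Y'" and w: "w \<in> Hom T (dual T C) Y" and g: "g \<in> Hom T Y Y'"
  shows "dual_flip C Y' (g \<cdot> w) = dual_flip C Y w \<cdot> dualM T g"
proof (rule dual_flip_eqI[OF C Y' Comp_Hom[OF w g]])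
  have o: "C \<in> Obj T" "Y \<in> Obj T" "Y' \<in> Obj T" "g \<in> Arr T" "Dom T g = Y" "Cod T g = Y'" using rigid_obj C Y Y' g by (auto simp: Hom_def)
  note t = dual_flip[OF C Y w]
  show "dual_flip C Y w \<cdot> dualM T g \<in> Hom T (dual T Y') C" using t o by (auto simp: Hom_def)
  have n: "name_map C w \<in> Arr T" "Cod T (name_map C w) = C \<odot> Y" using name_map_Hom[OF C w] by (auto simp: Hom_def)
  have "name_map Y' (dual_flip C Y w \<cdot> dualM T g) = (g \<boxtimes> Idn T C) \<cdot> (Braid T C Y \<cdot> name_map C w)"
    using name_map_dual[OF Y Y' g t(1)] t(2) by simp
  also have "\<dots> = Braid T C Y' \<cdot> ((Idn T C \<boxtimes> g) \<cdot> name_map C w)"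
    using comp_rewrite[OF braid_nat[of "Idn T C" g], of "name_map C w"] n o by (simp add: comp_assoc)
  finally show "name_map Y' (dual_flip C Y w \<cdot> dualM T g) = Braid T C Y' \<cdot> name_map C (g \<cdot> w)"
    using name_map_comp[OF C w g] by simp
qed

lemma dual_flip_dual:
  assumes C: "rigid_object T C" and A: "rigid_object T A" and Y: "rigid_object T Y" and w: "w \<in> Hom T (dual T C) Y" and t: "t \<in> Hom T C A"
  shows "dual_flip A Y (w \<cdot> dualM T t) = t \<cdot> dual_flip C Y w"
proof (rule dual_flip_eqI[OF A Y])
  have o: "C \<in> Obj T" "A \<in> Obj T" "Y \<in> Obj T" "t \<in> Arr T" "Dom T t = C" "Cod T t = A" using rigid_obj C A Y t by (auto simp: Hom_def)
  note tr = dual_flip[OF C Y w]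
  show "w \<cdot> dualM T t \<in> Hom T (dual T A) Y" using w o by (auto simp: Hom_def)
  show "t \<cdot> dual_flip C Y w \<in> Hom T (dual T Y) A" by (rule Comp_Hom[OF tr(1) t])
  have n: "name_map C w \<in> Arr T" "Cod T (name_map C w) = C \<odot> Y" using name_map_Hom[OF C w] by (auto simp: Hom_def)
  have "name_map Y (t \<cdot> dual_flip C Y w) = (Idn T Y \<boxtimes> t) \<cdot> (Braid T C Y \<cdot> name_map C w)"
    using name_map_comp[OF Y tr(1) t] tr(2) by simp
  also have "\<dots> = Braid T A Y \<cdot> ((t \<boxtimes> Idn T Y) \<cdot> name_map C w)"
    using comp_rewrite[OF braid_nat[of t "Idn T Y"], of "name_map C w"] n o by (simp add: comp_assoc)
  finally show "name_map Y (t \<cdot> dual_flip C Y w) = Braid T A Y \<cdot> name_map A (w \<cdot> dualM T t)"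
    using name_map_dual[OF C A t w] by simp
qed

lemma dual_flip_add:
  assumes C: "rigid_object T C" and Y: "rigid_object T Y" and w: "w \<in> Hom T (dual T C) Y" "w' \<in> Hom T (dual T C) Y"
  shows "dual_flip C Y (Add T w w') = Add T (dual_flip C Y w) (dual_flip C Y w')"
proof (rule dual_flip_eqI[OF C Y add_Hom[OF w]])
  have o: "C \<in> Obj T" "Y \<in> Obj T" using rigid_obj C Y by auto
  note t = dual_flip[OF C Y w(1)] dual_flip[OF C Y w(2)]
  show "Add T (dual_flip C Y w) (dual_flip C Y w') \<in> Hom T (dual T Y) C" by (rule add_Hom[OF t(1,3)])
  show "name_map Y (Add T (dual_flip C Y w) (dual_flip C Y w')) = Braid T C Y \<cdot> name_map C (Add T w w')"
    unfolding name_map_add[OF Y t(1,3)] name_map_add[OF C w] t(2,4)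
    using Comp_Add_right[OF name_map_Hom[OF C w(1)] name_map_Hom[OF C w(2)] Braid_Hom[OF o]] by simp
qed

text \<open>
  The natural transformation \<open>G \<rightarrow> Hom(DY, -)\<close> determined by an element \<open>a\<close> of \<open>Hom(DY, A)\<close>, where \<open>m\<close>
  is a presentation of \<open>G\<close> by a map \<open>f\<close> with source \<open>A\<close>.
\<close>

definition yoneda_map :: "'m \<Rightarrow> ('o, 'm, 'g) ab_functor \<Rightarrow> ('o \<Rightarrow> 'm \<Rightarrow> 'g) \<Rightarrow> 'm \<Rightarrow> 'o \<Rightarrow> 'g \<Rightarrow> 'm"
  where "yoneda_map f G m a = (\<lambda>X \<in> compacts T \<kappa>. \<lambda>x \<in> carrier (FObj G X). (SOME h. h \<in> Hom T (Dom T f) X \<and> m X h = x) \<cdot> a)"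

text \<open>Two representatives of one element differ by a map through \<open>f\<close>, and
  \<open>f\<close> kills \<open>a\<close>; so the choice inside \<open>yoneda_map\<close> is
  harmless.\<close>

lemma yoneda_map_apply:
  assumes m: "presentation f G m" and X: "compact_object T \<kappa> X" and h: "h \<in> Hom T (Dom T f) X" and f: "f \<in> Arr T"
    and a: "a \<in> Hom T Z (Dom T f)" "f \<cdot> a = Zero T Z (Cod T f)"
  shows "yoneda_map f G m a X (m X h) = h \<cdot> a"
proof -
  note D = presentationD[OF m X]
  have c: "m X h \<in> carrier (FObj G X)" using D(1) h by blast
  define h' where "h' = (SOME h'. h' \<in> Hom T (Dom T f) X \<and> m X h' = m X h)"
  have h': "h' \<in> Hom T (Dom T f) X" "m X h' = m X h"
    using someI[of "\<lambda>h'. h' \<in> Hom T (Dom T f) X \<and> m X h' = m X h" h] h by (auto simp: h'_def)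
  then obtain k where k: "k \<in> Hom T (Cod T f) X" "h' = Add T (k \<cdot> f) h" using D(2)[OF h'(1) h] by blast
  have "h' \<cdot> a = Add T (k \<cdot> (f \<cdot> a)) (h \<cdot> a)" unfolding k(2) using k(1) h a(1) f by (auto simp: Hom_def comp_add comp_assoc)
  also have "\<dots> = h \<cdot> a" unfolding a(2) using k(1) h a(1) Hom_obj[OF a(1)] by (auto simp: Hom_def)
  finally show ?thesis using c X by (simp add: yoneda_map_def compacts_iff h'_def)
qed

lemma corepresentable_simps [simp]:
  "FObj (corepresentable T A) X = HomGrp T A X" "FArr (corepresentable T A) g x = g \<cdot> x"
  by (simp_all add: corepresentable_def)

lemma yoneda_map_nat_trans:
  assumes m: "presentation f G m" and f: "f \<in> compact_arrows T \<kappa>"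
    and a: "a \<in> Hom T Z (Dom T f)" "f \<cdot> a = Zero T Z (Cod T f)"
  shows "yoneda_map f G m a \<in> nat_trans T (compacts T \<kappa>) G (corepresentable T Z)"
proof -
  have fa: "f \<in> Arr T" using f by (simp add: compact_arrows_iff)
  note ap = yoneda_map_apply[OF m _ _ fa a]
  show ?thesis unfolding nat_trans_def
  proof (intro CollectI conjI ballI)
    show "yoneda_map f G m a \<in> (\<Pi>\<^sub>E X \<in> compacts T \<kappa>. hom (FObj G X) (FObj (corepresentable T Z) X) \<inter> extensional (carrier (FObj G X)))"
    proof (rule PiE_I)
      fix X assume "X \<in> compacts T \<kappa>"
      then have X: "compact_object T \<kappa> X" by (simp add: compacts_iff)
      note D = presentationD[OF m X]
      have "yoneda_map f G m a X \<in> hom (FObj G X) (HomGrp T Z X)"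
      proof (rule homI)
        fix x assume "x \<in> carrier (FObj G X)"
        then obtain h where h: "h \<in> Hom T (Dom T f) X" "x = m X h" using D(1) by blast
        show "yoneda_map f G m a X x \<in> carrier (HomGrp T Z X)" unfolding h(2) ap[OF X h(1)] using Comp_Hom[OF a(1) h(1)] by simp
        fix y assume "y \<in> carrier (FObj G X)"
        then obtain h' where h': "h' \<in> Hom T (Dom T f) X" "y = m X h'" using D(1) by blast
        show "yoneda_map f G m a X (x \<otimes>\<^bsub>FObj G X\<^esub> y) = yoneda_map f G m a X x \<otimes>\<^bsub>HomGrp T Z X\<^esub> yoneda_map f G m a X y"
          unfolding h(2) h'(2) D(3)[OF h(1) h'(1), symmetric] ap[OF X h(1)] ap[OF X h'(1)] ap[OF X add_Hom[OF h(1) h'(1)]]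
          using Comp_Add_left[OF a(1) h(1) h'(1)] by simp
      qed
      then show "yoneda_map f G m a X \<in> hom (FObj G X) (FObj (corepresentable T Z) X) \<inter> extensional (carrier (FObj G X))"
        using X by (simp add: yoneda_map_def compacts_iff)
    qed (simp add: yoneda_map_def)
    fix X Y g x assume "X \<in> compacts T \<kappa>" "Y \<in> compacts T \<kappa>" and g: "g \<in> Hom T X Y" and x: "x \<in> carrier (FObj G X)"
    then have X: "compact_object T \<kappa> X" and Y: "compact_object T \<kappa> Y" by (simp_all add: compacts_iff)
    note D = presentationD[OF m X]
    obtain h where h: "h \<in> Hom T (Dom T f) X" "x = m X h" using D(1) x by blast
    show "yoneda_map f G m a Y (FArr G g x) = FArr (corepresentable T Z) g (yoneda_map f G m a X x)"
      unfolding h(2) D(4)[OF Y g h(1), symmetric] ap[OF Y Comp_Hom[OF h(1) g]] ap[OF X h(1)]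
      using Comp_assoc[OF a(1) h(1) g] by simp
  qed
qed

lemma yoneda_map_inj:
  assumes m: "presentation f G m" and f: "f \<in> compact_arrows T \<kappa>"
    and a: "a \<in> Hom T Z (Dom T f)" "f \<cdot> a = Zero T Z (Cod T f)"
    and b: "b \<in> Hom T Z (Dom T f)" "f \<cdot> b = Zero T Z (Cod T f)"
    and eq: "yoneda_map f G m a = yoneda_map f G m b"
  shows "a = b"
proof -
  have fa: "f \<in> Arr T" "compact_object T \<kappa> (Dom T f)" using f by (auto simp: compact_arrows_iff)
  have i: "Idn T (Dom T f) \<in> Hom T (Dom T f) (Dom T f)" using Idn_Hom fa by simp
  have "Idn T (Dom T f) \<cdot> a = Idn T (Dom T f) \<cdot> b"
    using yoneda_map_apply[OF m fa(2) i fa(1) a] yoneda_map_apply[OF m fa(2) i fa(1) b] eq by metis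
  then show ?thesis using a(1) b(1) by (auto simp: Hom_def)
qed

lemma nat_trans_eqI:
  assumes M: "M \<in> nat_trans T K G H" and N: "N \<in> nat_trans T K G H"
    and eq: "\<And>X x. X \<in> K \<Longrightarrow> x \<in> carrier (FObj G X) \<Longrightarrow> M X x = N X x"
  shows "M = N"
proof
  fix X
  show "M X = N X"
  proof (cases "X \<in> K")
    case True
    then have "M X \<in> extensional (carrier (FObj G X))" "N X \<in> extensional (carrier (FObj G X))" using M N by (auto simp: nat_trans_def)
    then show ?thesis by (rule extensionalityI) (rule eq[OF True])
  next
    case False
    have "M \<in> extensional K" "N \<in> extensional K" using M N by (simp_all add: nat_trans_def PiE_def)
    then show ?thesis using False by (simp add: extensional_def)
  qed
qed

text \<open>Yoneda: \<open>a\<close> is the value of \<open>N\<close> on the universal element. It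
  is killed by \<open>f\<close> because \<open>f\<close> represents the zero element of
  \<open>G\<close> at \<open>Cod T f\<close>.\<close>

lemma yoneda_map_surj:
  assumes m: "presentation f G m" and f: "f \<in> compact_arrows T \<kappa>" and Z: "Z \<in> Obj T"
    and N: "N \<in> nat_trans T (compacts T \<kappa>) G (corepresentable T Z)"
  obtains a where "a \<in> Hom T Z (Dom T f)" "f \<cdot> a = Zero T Z (Cod T f)" "N = yoneda_map f G m a"
proof -
  define A where "A = Dom T f"
  have c: "f \<in> Hom T A (Cod T f)" "compact_object T \<kappa> A" "compact_object T \<kappa> (Cod T f)" using f by (auto simp: compact_arrows_iff A_def Hom_def)
  have o: "A \<in> Obj T" "Cod T f \<in> Obj T" using c compact_obj by auto
  note D = presentationD[OF m, folded A_def]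
  define a where "a = N A (m A (Idn T A))"
  have i: "Idn T A \<in> Hom T A A" using Idn_Hom o by simp
  have mi: "m A (Idn T A) \<in> carrier (FObj G A)" using D(1)[OF c(2)] i by blast
  have "N A \<in> hom (FObj G A) (HomGrp T Z A)" using N c(2) by (auto simp: nat_trans_def compacts_iff)
  then have a: "a \<in> Hom T Z A" using mi by (auto simp: a_def hom_def)
  have ap: "N X (m X h) = h \<cdot> a" if X: "compact_object T \<kappa> X" and h: "h \<in> Hom T A X" for X h
  proof -
    have "N X (FArr G h (m A (Idn T A))) = h \<cdot> N A (m A (Idn T A))"
      using N X c(2) h mi unfolding nat_trans_def by (simp add: compacts_iff)
    then show ?thesis using D(4)[OF c(2) X h i] h by (simp add: a_def Hom_def)
  qed
  have "m (Cod T f) f = m (Cod T f) (Zero T A (Cod T f))"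
    unfolding D(2)[OF c(3,1) zero_Hom[OF o]] using c(1) o by (intro bexI[of _ "Idn T (Cod T f)"]) (auto simp: Hom_def)
  then have fa: "f \<cdot> a = Zero T Z (Cod T f)" using ap[OF c(3,1)] ap[OF c(3) zero_Hom[OF o]] a o by (auto simp: Hom_def)
  have "N = yoneda_map f G m a"
  proof (rule nat_trans_eqI[OF N yoneda_map_nat_trans[OF m f]])
    show "a \<in> Hom T Z (Dom T f)" "f \<cdot> a = Zero T Z (Cod T f)" using a fa A_def by auto
    fix X x assume X: "X \<in> compacts T \<kappa>" and x: "x \<in> carrier (FObj G X)"
    then have X: "compact_object T \<kappa> X" by (simp add: compacts_iff)
    obtain h where h: "h \<in> Hom T A X" "x = m X h" using D(1)[OF X] x by blast
    have "yoneda_map f G m a X (m X h) = h \<cdot> a"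
      by (rule yoneda_map_apply[OF m X]) (use h a fa c A_def in \<open>auto simp: Hom_def\<close>)
    then show "N X x = yoneda_map f G m a X x" using ap[OF X h(1)] h(2) by simp
  qed
  then show thesis using that a fa A_def by blast
qed

lemma delta_carrier: "carrier (FObj (delta T \<kappa> G) Y) = nat_trans T (compacts T \<kappa>) G (corepresentable T (dual T Y))"
  by (simp add: delta_def)

lemma yoneda_map_add:
  assumes m: "presentation f G m" and f: "f \<in> compact_arrows T \<kappa>"
    and a: "a \<in> Hom T (dual T Y) (Dom T f)" "f \<cdot> a = Zero T (dual T Y) (Cod T f)"
    and b: "b \<in> Hom T (dual T Y) (Dom T f)" "f \<cdot> b = Zero T (dual T Y) (Cod T f)"
  shows "yoneda_map f G m (Add T a b) = yoneda_map f G m a \<otimes>\<^bsub>FObj (delta T \<kappa> G) Y\<^esub> yoneda_map f G m b"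
proof -
  have fa: "f \<in> Arr T" using f by (simp add: compact_arrows_iff)
  have ab: "Add T a b \<in> Hom T (dual T Y) (Dom T f)" "f \<cdot> Add T a b = Zero T (dual T Y) (Cod T f)"
    using add_Hom[OF a(1) b(1)] Comp_Add_right[OF a(1) b(1), of f "Cod T f"] a b fa Hom_obj[OF a(1)]
    by (auto simp: Hom_def)
  have "yoneda_map f G m (Add T a b) X x = Add T (yoneda_map f G m a X x) (yoneda_map f G m b X x)"
    if X: "X \<in> compacts T \<kappa>" and x: "x \<in> carrier (FObj G X)" for X x
  proof -
    have X: "compact_object T \<kappa> X" using X by (simp add: compacts_iff)
    obtain h where h: "h \<in> Hom T (Dom T f) X" "x = m X h" using presentationD(1)[OF m X] x by blast
    show ?thesis unfolding h(2) yoneda_map_apply[OF m X h(1) fa ab] yoneda_map_apply[OF m X h(1) fa a] yoneda_map_apply[OF m X h(1) fa b]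
      by (rule Comp_Add_right[OF a(1) b(1) h(1)])
  qed
  then have "yoneda_map f G m (Add T a b) = (\<lambda>X\<in>compacts T \<kappa>. \<lambda>x\<in>carrier (FObj G X). Add T (yoneda_map f G m a X x) (yoneda_map f G m b X x))"
    unfolding yoneda_map_def[of f G m "Add T a b"]
    by (intro ext) (auto simp: yoneda_map_def restrict_def)
  then show ?thesis by (simp add: delta_def)
qed

lemma yoneda_map_dual:
  assumes m: "presentation f G m" and f: "f \<in> compact_arrows T \<kappa>"
    and a: "a \<in> Hom T (dual T Y) (Dom T f)" "f \<cdot> a = Zero T (dual T Y) (Cod T f)" and g: "g \<in> Hom T Y Y'"
  shows "FArr (delta T \<kappa> G) g (yoneda_map f G m a) = yoneda_map f G m (a \<cdot> dualM T g)"
proof -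
  have fa: "f \<in> Arr T" using f by (simp add: compact_arrows_iff)
  have d: "dualM T g \<in> Hom T (dual T Y') (dual T Y)" using g by (auto simp: Hom_def)
  have ag: "a \<cdot> dualM T g \<in> Hom T (dual T Y') (Dom T f)" "f \<cdot> (a \<cdot> dualM T g) = Zero T (dual T Y') (Cod T f)"
    using Comp_Hom[OF d a(1)] comp_rewrite[OF a(2), of "dualM T g"] a(1) d fa by (auto simp: Hom_def)
  have "yoneda_map f G m (a \<cdot> dualM T g) X x = yoneda_map f G m a X x \<cdot> dualM T g"
    if X: "X \<in> compacts T \<kappa>" and x: "x \<in> carrier (FObj G X)" for X x
  proof -
    have X: "compact_object T \<kappa> X" using X by (simp add: compacts_iff)
    obtain h where h: "h \<in> Hom T (Dom T f) X" "x = m X h" using presentationD(1)[OF m X] x by blast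
    show ?thesis unfolding h(2) yoneda_map_apply[OF m X h(1) fa ag] yoneda_map_apply[OF m X h(1) fa a]
      by (rule Comp_assoc[OF d a(1) h(1)])
  qed
  then have "yoneda_map f G m (a \<cdot> dualM T g) = (\<lambda>X\<in>compacts T \<kappa>. \<lambda>x\<in>carrier (FObj G X). yoneda_map f G m a X x \<cdot> dualM T g)"
    unfolding yoneda_map_def[of f G m "a \<cdot> dualM T g"]
    by (intro ext) (auto simp: yoneda_map_def restrict_def)
  then show ?thesis by (simp add: delta_def)
qed

text \<open>
  An element of \<open>(\<delta>G)(Y)\<close> is a map \<open>DY \<rightarrow> A\<close> annihilated by \<open>f\<close>, hence of the form \<open>t \<circ> c\<close>,
  and \<open>c\<close> is the flip of a map \<open>DC \<rightarrow> Y\<close>.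
\<close>

lemma delta_presents:
  assumes G: "presents T \<kappa> f G" and D: "(t, f, r) \<in> Dist T" and E: "(dualM T t, p, s) \<in> Dist T"
  shows "presents T \<kappa> p (delta T \<kappa> G)"
proof -
  have f: "f \<in> compact_arrows T \<kappa>" using G by (simp add: presents_def)
  have t: "t \<in> compact_arrows T \<kappa>" by (rule compact_arrow_fiber[OF D f])
  define A C where "A = Dom T f" and "C = Dom T t"
  note a = Dist_arr[OF D] and b = Dist_arr[OF E]
  have tH: "t \<in> Hom T C A" using a by (simp add: Hom_def A_def C_def)
  have cA: "compact_object T \<kappa> A" "compact_object T \<kappa> C" using f t by (auto simp: compact_arrows_iff A_def C_def)
  note R = compact_rigid[OF cA(1)] compact_rigid[OF cA(2)]
  have o: "A \<in> Obj T" "C \<in> Obj T" "dual T C \<in> Obj T" "dual T A \<in> Obj T" using rigid_obj R by auto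
  have tA: "t \<in> Arr T" "Dom T t = C" "Cod T t = A" using tH by (auto simp: Hom_def)
  have "dualM T t \<in> compact_arrows T \<kappa>" using tA cA compact_dual by (simp add: compact_arrows_iff)
  then have p: "p \<in> compact_arrows T \<kappa>" by (rule compact_arrow_cone[OF E])
  have pA: "p \<in> Arr T" "Dom T p = dual T C" using b tA by auto
  obtain m where m: "presentation f G m" using presents_presentation[OF G] .
  \<comment> \<open>The map named by \<open>w\<close> is flipped and composed with \<open>t\<close>,
    which yields a map into \<open>A\<close> that \<open>f\<close> kills.\<close>
  define \<tau> where "\<tau> Y w = t \<cdot> dual_flip C Y w" for Y w
  have \<tau>: "\<tau> Y w \<in> Hom T (dual T Y) (Dom T f)" "f \<cdot> \<tau> Y w = Zero T (dual T Y) (Cod T f)"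
    if Y: "compact_object T \<kappa> Y" and w: "w \<in> Hom T (dual T C) Y" for Y w
  proof -
    note tr = dual_flip(1)[OF R(2) compact_rigid[OF Y] w]
    show "\<tau> Y w \<in> Hom T (dual T Y) (Dom T f)" using Comp_Hom[OF tr tH] by (simp add: \<tau>_def A_def)
    show "f \<cdot> \<tau> Y w = Zero T (dual T Y) (Cod T f)"
      unfolding \<tau>_def using comp_rewrite[OF Dist_comp_zero[OF D], of "dual_flip C Y w"] tr a tA by (auto simp: Hom_def)
  qed
  \<comment> \<open>Flipping exchanges composition with \<open>t\<close> after a map and composition
    with \<open>dualM T t\<close> before a map.\<close>
  have \<tau>_eq: "\<tau> Y w = \<tau> Y w' \<longleftrightarrow> w \<cdot> dualM T t = w' \<cdot> dualM T t"
    if Y: "compact_object T \<kappa> Y" and w: "w \<in> Hom T (dual T C) Y" "w' \<in> Hom T (dual T C) Y" for Y w w'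
  proof -
    note RY = compact_rigid[OF Y]
    have H: "w \<cdot> dualM T t \<in> Hom T (dual T A) Y" "w' \<cdot> dualM T t \<in> Hom T (dual T A) Y" using w tA by (auto simp: Hom_def)
    show ?thesis unfolding \<tau>_def dual_flip_dual[OF R(2,1) RY w(1) tH, symmetric] dual_flip_dual[OF R(2,1) RY w(2) tH, symmetric]
      by (rule iffI) (use dual_flip_inj[OF R(1) RY H] in auto)
  qed
  \<comment> \<open>The maps that kill \<open>dualM T t\<close> are those factoring through its cone
    map \<open>p\<close>, so the kernel is exactly the one defining the cokernel of
    \<open>Hom(p, -)\<close>.\<close>
  have wt: "w \<cdot> dualM T t = w' \<cdot> dualM T t \<longleftrightarrow> coker_class p Y w = coker_class p Y w'"
    if w: "w \<in> Hom T (dual T C) Y" "w' \<in> Hom T (dual T C) Y" for Y w w'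
  proof -
    have wA: "w \<in> Arr T" "Dom T w = dual T C" "Cod T w = Y" "w' \<in> Arr T" "Dom T w' = dual T C" "Cod T w' = Y" "Y \<in> Obj T"
      using w Hom_obj[OF w(1)] by (auto simp: Hom_def)
    show ?thesis unfolding coker_class_eq_iff[OF pA(1), unfolded pA(2), OF w]
    proof
      assume "w \<cdot> dualM T t = w' \<cdot> dualM T t"
      then have "Sub w w' \<cdot> dualM T t = Zero T (dual T A) Y" using wA tA o by (simp add: comp_sub)
      then obtain k where k: "k \<in> Hom T (Cod T p) Y" "k \<cdot> p = Sub w w'"
        using Dist_coexact[OF E, of "Sub w w'" Y] wA tA by (auto simp: Hom_def)
      then have "w = Add T (k \<cdot> p) w'" using wA by (simp add: sub_add)
      then show "\<exists>k \<in> Hom T (Cod T p) Y. w = Add T (k \<cdot> p) w'" using k by blast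
    next
      assume "\<exists>k \<in> Hom T (Cod T p) Y. w = Add T (k \<cdot> p) w'"
      then obtain k where k: "k \<in> Hom T (Cod T p) Y" "w = Add T (k \<cdot> p) w'" by blast
      have "w \<cdot> dualM T t = Add T (k \<cdot> (p \<cdot> dualM T t)) (w' \<cdot> dualM T t)"
        unfolding k(2) using k(1) wA tA pA by (auto simp: Hom_def comp_add comp_assoc)
      also have "\<dots> = w' \<cdot> dualM T t" unfolding Dist_comp_zero[OF E] using k(1) wA tA pA by (auto simp: Hom_def)
      finally show "w \<cdot> dualM T t = w' \<cdot> dualM T t" .
    qed
  qed
  define N where "N = (\<lambda>Y \<in> compacts T \<kappa>. \<lambda>U \<in> carrier (FObj (coker_functor T p) Y).
    yoneda_map f G m (\<tau> Y (SOME w. w \<in> Hom T (dual T C) Y \<and> coker_class p Y w = U)))"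
  have carr: "carrier (FObj (coker_functor T p) Y) = coker_class p Y ` Hom T (dual T C) Y" for Y using coker_carrier[of p Y] pA by simp
  have N: "N Y (coker_class p Y w) = yoneda_map f G m (\<tau> Y w)" if Y: "compact_object T \<kappa> Y" and w: "w \<in> Hom T (dual T C) Y" for Y w
  proof -
    define w' where "w' = (SOME w'. w' \<in> Hom T (dual T C) Y \<and> coker_class p Y w' = coker_class p Y w)"
    have w': "w' \<in> Hom T (dual T C) Y" "coker_class p Y w' = coker_class p Y w"
      using someI[of "\<lambda>w'. w' \<in> Hom T (dual T C) Y \<and> coker_class p Y w' = coker_class p Y w" w] w by (auto simp: w'_def)
    then have "\<tau> Y w' = \<tau> Y w" using \<tau>_eq[OF Y w'(1) w] wt[OF w'(1) w] by simp
    moreover have "coker_class p Y w \<in> carrier (FObj (coker_functor T p) Y)" using w carr by blast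
    ultimately show ?thesis using Y by (simp add: N_def compacts_iff w'_def)
  qed
  have iso: "N Y \<in> iso (FObj (coker_functor T p) Y) (FObj (delta T \<kappa> G) Y)" if Y: "compact_object T \<kappa> Y" for Y
  proof -
    note RY = compact_rigid[OF Y]
    have "N Y \<in> hom (FObj (coker_functor T p) Y) (FObj (delta T \<kappa> G) Y)"
    proof (rule homI)
      fix x assume "x \<in> carrier (FObj (coker_functor T p) Y)"
      then obtain w where w: "w \<in> Hom T (dual T C) Y" "x = coker_class p Y w" using carr by blast
      show "N Y x \<in> carrier (FObj (delta T \<kappa> G) Y)"
        unfolding w(2) N[OF Y w(1)] delta_carrier by (rule yoneda_map_nat_trans[OF m f \<tau>[OF Y w(1)]])
      fix y assume "y \<in> carrier (FObj (coker_functor T p) Y)"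
      then obtain w' where w': "w' \<in> Hom T (dual T C) Y" "y = coker_class p Y w'" using carr by blast
      have "\<tau> Y (Add T w w') = Add T (\<tau> Y w) (\<tau> Y w')"
        unfolding \<tau>_def dual_flip_add[OF R(2) RY w(1) w'(1)]
        by (rule Comp_Add_right[OF dual_flip(1)[OF R(2) RY w(1)] dual_flip(1)[OF R(2) RY w'(1)] tH])
      then show "N Y (x \<otimes>\<^bsub>FObj (coker_functor T p) Y\<^esub> y) = N Y x \<otimes>\<^bsub>FObj (delta T \<kappa> G) Y\<^esub> N Y y"
        unfolding w(2) w'(2) coker_mult[OF pA(1), unfolded pA(2), OF w(1) w'(1)] N[OF Y w(1)] N[OF Y w'(1)] N[OF Y add_Hom[OF w(1) w'(1)]]
        using yoneda_map_add[OF m f \<tau>[OF Y w(1)] \<tau>[OF Y w'(1)]] by simp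
    qed
    moreover have "bij_betw (N Y) (carrier (FObj (coker_functor T p) Y)) (carrier (FObj (delta T \<kappa> G) Y))"
    proof (rule bij_betw_imageI)
      show "inj_on (N Y) (carrier (FObj (coker_functor T p) Y))"
      proof (rule inj_onI)
        fix x y assume "x \<in> carrier (FObj (coker_functor T p) Y)" "y \<in> carrier (FObj (coker_functor T p) Y)" and eq: "N Y x = N Y y"
        note xy = this(1,2)
        obtain w where w: "w \<in> Hom T (dual T C) Y" "x = coker_class p Y w" using xy(1) carr by blast
        obtain w' where w': "w' \<in> Hom T (dual T C) Y" "y = coker_class p Y w'" using xy(2) carr by blast
        have "yoneda_map f G m (\<tau> Y w) = yoneda_map f G m (\<tau> Y w')" using eq N[OF Y w(1)] N[OF Y w'(1)] w(2) w'(2) by simp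
        then have "\<tau> Y w = \<tau> Y w'" by (rule yoneda_map_inj[OF m f \<tau>[OF Y w(1)] \<tau>[OF Y w'(1)]])
        then show "x = y" using \<tau>_eq[OF Y w(1) w'(1)] wt[OF w(1) w'(1)] w(2) w'(2) by simp
      qed
      have "n \<in> N Y ` carrier (FObj (coker_functor T p) Y)" if n: "n \<in> carrier (FObj (delta T \<kappa> G) Y)" for n
      proof -
        obtain c where c: "c \<in> Hom T (dual T Y) (Dom T f)" "f \<cdot> c = Zero T (dual T Y) (Cod T f)" "n = yoneda_map f G m c"
          by (rule yoneda_map_surj[OF m f _ n[unfolded delta_carrier]]) (use rigid_obj[OF RY] in auto)
        \<comment> \<open>Exactness lifts \<open>c\<close> along \<open>t\<close>, and the lift is
          the flip of some \<open>w\<close>.\<close>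
        obtain d where d: "d \<in> Hom T (dual T Y) C" "t \<cdot> d = c"
          using Dist_exact[OF D, of c "dual T Y"] c by (auto simp: C_def)
        obtain w where w: "w \<in> Hom T (dual T C) Y" "dual_flip C Y w = d" by (rule dual_flip_surj[OF R(2) RY d(1)])
        have "N Y (coker_class p Y w) = n" unfolding N[OF Y w(1)] \<tau>_def w(2) d(2) c(3) ..
        then show ?thesis using w(1) carr by blast
      qed
      moreover have "N Y ` carrier (FObj (coker_functor T p) Y) \<subseteq> carrier (FObj (delta T \<kappa> G) Y)"
        using \<open>N Y \<in> hom (FObj (coker_functor T p) Y) (FObj (delta T \<kappa> G) Y)\<close> by (auto simp: hom_def)
      ultimately show "N Y ` carrier (FObj (coker_functor T p) Y) = carrier (FObj (delta T \<kappa> G) Y)" by blast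
    qed
    ultimately show ?thesis by (simp add: iso_def)
  qed
  have "N \<in> nat_trans T (compacts T \<kappa>) (coker_functor T p) (delta T \<kappa> G)"
    unfolding nat_trans_def
  proof (intro CollectI conjI ballI)
    show "N \<in> (\<Pi>\<^sub>E Y \<in> compacts T \<kappa>. hom (FObj (coker_functor T p) Y) (FObj (delta T \<kappa> G) Y) \<inter>
        extensional (carrier (FObj (coker_functor T p) Y)))"
    proof (rule PiE_I)
      fix Y assume Y: "Y \<in> compacts T \<kappa>"
      then show "N Y \<in> hom (FObj (coker_functor T p) Y) (FObj (delta T \<kappa> G) Y) \<inter> extensional (carrier (FObj (coker_functor T p) Y))"
        using iso[of Y] by (simp add: compacts_iff iso_def) (simp add: N_def compacts_iff)
    qed (simp add: N_def)
    fix Y Y' g x assume "Y \<in> compacts T \<kappa>" "Y' \<in> compacts T \<kappa>" and g: "g \<in> Hom T Y Y'" and x: "x \<in> carrier (FObj (coker_functor T p) Y)"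
    then have Y: "compact_object T \<kappa> Y" "compact_object T \<kappa> Y'" by (simp_all add: compacts_iff)
    obtain w where w: "w \<in> Hom T (dual T C) Y" "x = coker_class p Y w" using x carr by blast
    have "\<tau> Y' (g \<cdot> w) = \<tau> Y w \<cdot> dualM T g"
      unfolding \<tau>_def dual_flip_comp[OF R(2) compact_rigid[OF Y(1)] compact_rigid[OF Y(2)] w(1) g]
      by (rule Comp_assoc[OF _ dual_flip(1)[OF R(2) compact_rigid[OF Y(1)] w(1)] tH, of _ "dual T Y'"]) (use g in \<open>auto simp: Hom_def\<close>)
    then show "N Y' (FArr (coker_functor T p) g x) = FArr (delta T \<kappa> G) g (N Y x)"
      unfolding w(2) coker_FArr[OF pA(1), unfolded pA(2), OF w(1) g] N[OF Y(2) Comp_Hom[OF w(1) g]] N[OF Y(1) w(1)]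
      using yoneda_map_dual[OF m f \<tau>[OF Y(1) w(1)] g] by simp
  qed
  then have "nat_iso T (compacts T \<kappa>) (coker_functor T p) (delta T \<kappa> G)"
    unfolding nat_iso_def by (rule bexI[rotated]) (simp add: iso compacts_iff)
  then show ?thesis using p by (simp add: presents_def)
qed

text \<open>The presentation chosen inside \<open>extension\<close> may differ from
  \<open>f\<close>, but by \<open>hom_surj_independent\<close> vanishing at \<open>X\<close> is the
  same for both.\<close>

lemma extension_trivial_iff:
  assumes G: "presents T \<kappa> f G" and X: "X \<in> Obj T"
  shows "trivial_group (FObj (extension T \<kappa> G) X) \<longleftrightarrow> hom_surj f X"
proof -
  define f' where "f' = (SOME f. presents T \<kappa> f G)"
  have G': "presents T \<kappa> f' G" unfolding f'_def by (rule someI[of "\<lambda>f. presents T \<kappa> f G", OF G])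
  then have "f' \<in> Arr T" by (simp add: presents_def compact_arrows_iff)
  then have "trivial_group (FObj (extension T \<kappa> G) X) \<longleftrightarrow> hom_surj f' X"
    using coker_trivial_iff[OF _ X] by (simp add: extension_def f'_def)
  then show ?thesis using hom_surj_independent[OF G G' _ X] hom_surj_independent[OF G' G _ X] by blast
qed

lemma presents_coker: "f \<in> compact_arrows T \<kappa> \<Longrightarrow> presents T \<kappa> f (coker_functor T f)"
  unfolding presents_def
  using nat_iso_refl[OF coker_additive_functor[of f "compacts T \<kappa>"]] compact_obj
  by (simp add: compact_arrows_iff compacts_def Collect_mono_iff subset_iff)

lemma delta_extension_trivial_iff:
  assumes G: "presents T \<kappa> f G" and D: "(t, f, r) \<in> Dist T" and Y: "Y \<in> Obj T"
  shows "trivial_group (FObj (extension T \<kappa> (delta T \<kappa> G)) Y) \<longleftrightarrow> annihilates (dualM T t) Y"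
proof -
  have "dualM T t \<in> Arr T" using Dist_arr[OF D] by simp
  then obtain p s where E: "(dualM T t, p, s) \<in> Dist T" using Dist_cone by blast
  show ?thesis using extension_trivial_iff[OF delta_presents[OF G D E] Y] hom_surj_iff_annihilates[OF E] by simp
qed

text \<open>The class written \<open>I\<close> at the start of the proof.\<close>

definition common_annihilators :: "'o set \<Rightarrow> 'm set"
  where "common_annihilators D = {t \<in> compact_arrows T \<kappa>. \<forall>X \<in> D. annihilates t X}"

text \<open>Presentations \<open>f\<close> of functors vanishing on \<open>D\<close> and maps
  \<open>t\<close> annihilating \<open>D\<close> are exchanged by triangles: \<open>f\<close> is a
  cone map of \<open>t\<close>, and \<open>t\<close> is a fiber of \<open>f\<close>.\<close>

lemma dual_definable_eq:
  assumes D: "D \<subseteq> Obj T"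
  shows "dual_definable T \<kappa> D = {Y \<in> Obj T. \<forall>t \<in> common_annihilators D. annihilates (dualM T t) Y}"
proof -
  have "(\<forall>H \<in> delta T \<kappa> ` annihilator T \<kappa> D. trivial_group (FObj (extension T \<kappa> H) Y))
      \<longleftrightarrow> (\<forall>t \<in> common_annihilators D. annihilates (dualM T t) Y)" if Y: "Y \<in> Obj T" for Y
  proof (intro iffI ballI)
    fix t assume *: "\<forall>H \<in> delta T \<kappa> ` annihilator T \<kappa> D. trivial_group (FObj (extension T \<kappa> H) Y)" and t: "t \<in> common_annihilators D"
    have tc: "t \<in> compact_arrows T \<kappa>" "t \<in> Arr T" using t by (auto simp: common_annihilators_def compact_arrows_iff)
    obtain f r where F: "(t, f, r) \<in> Dist T" using Dist_cone[OF tc(2)] by blast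
    have f: "f \<in> compact_arrows T \<kappa>" by (rule compact_arrow_cone[OF F tc(1)])
    note G = presents_coker[OF f]
    have "coker_functor T f \<in> annihilator T \<kappa> D"
      unfolding annihilator_def finitely_presented_def
    proof (intro CollectI conjI ballI)
      show "additive_functor T (compacts T \<kappa>) (coker_functor T f)"
        by (rule coker_additive_functor) (use f compact_obj in \<open>auto simp: compact_arrows_iff compacts_iff\<close>)
      show "\<exists>f'. presents T \<kappa> f' (coker_functor T f)" using G by blast
      fix X assume X: "X \<in> D"
      then have "annihilates t X" using t by (simp add: common_annihilators_def)
      then show "trivial_group (FObj (extension T \<kappa> (coker_functor T f)) X)"
        using extension_trivial_iff[OF G] hom_surj_iff_annihilates[OF F] X D by blast
    qed
    then show "annihilates (dualM T t) Y" using * delta_extension_trivial_iff[OF G F Y] by blast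
  next
    fix H assume *: "\<forall>t \<in> common_annihilators D. annihilates (dualM T t) Y" and "H \<in> delta T \<kappa> ` annihilator T \<kappa> D"
    then obtain G where G: "G \<in> annihilator T \<kappa> D" "H = delta T \<kappa> G" by blast
    then obtain f where f: "presents T \<kappa> f G" by (auto simp: annihilator_def finitely_presented_def)
    have fc: "f \<in> compact_arrows T \<kappa>" "f \<in> Arr T" using f by (auto simp: presents_def compact_arrows_iff)
    obtain t r where F: "(t, f, r) \<in> Dist T" by (rule Dist_fiber[OF fc(2)])
    have "t \<in> common_annihilators D"
      unfolding common_annihilators_def
      using compact_arrow_fiber[OF F fc(1)] G(1) extension_trivial_iff[OF f] hom_surj_iff_annihilates[OF F] D
      by (auto simp: annihilator_def)
    then show "trivial_group (FObj (extension T \<kappa> H) Y)" using * delta_extension_trivial_iff[OF f F Y] G(2) by blast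
  qed
  then show ?thesis unfolding dual_definable_def by blast
qed

end

section \<open>Tensor ideals\<close>

context big_tt_category
begin

text \<open>The fibers of the maps that define \<open>D\<close> are common annihilators, and they
  already cut out \<open>D\<close>.\<close>

lemma definable_eq:
  assumes D: "definable T \<kappa> D"
  shows "D = {X \<in> Obj T. \<forall>t \<in> common_annihilators D. annihilates t X}"
proof -
  obtain \<Phi> where \<Phi>: "\<Phi> \<subseteq> compact_arrows T \<kappa>"
    "D = {X \<in> Obj T. \<forall>f \<in> \<Phi>. (\<lambda>h. h \<cdot> f) ` Hom T (Cod T f) X = Hom T (Dom T f) X}"
    using D by (auto simp: definable_def)
  have surj: "(\<lambda>h. h \<cdot> f) ` Hom T (Cod T f) X = Hom T (Dom T f) X \<longleftrightarrow> hom_surj f X" if f: "f \<in> Arr T" for f X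
    using f unfolding hom_surj_def by (auto simp: Hom_def)
  have D': "D = {X \<in> Obj T. \<forall>f \<in> \<Phi>. hom_surj f X}"
  proof -
    have "(\<lambda>h. h \<cdot> f) ` Hom T (Cod T f) X = Hom T (Dom T f) X \<longleftrightarrow> hom_surj f X" if "f \<in> \<Phi>" for f X
      by (rule surj) (use that \<Phi>(1) in \<open>auto simp: compact_arrows_iff\<close>)
    then show ?thesis unfolding \<Phi>(2) by (auto cong: ball_cong)
  qed
  show ?thesis
  proof (intro subset_antisym subsetI)
    fix X assume "X \<in> D"
    then show "X \<in> {X \<in> Obj T. \<forall>t \<in> common_annihilators D. annihilates t X}"
      using D' by (auto simp: common_annihilators_def)
  next
    fix X assume X: "X \<in> {X \<in> Obj T. \<forall>t \<in> common_annihilators D. annihilates t X}"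
    have "hom_surj f X" if f: "f \<in> \<Phi>" for f
    proof -
      have fc: "f \<in> compact_arrows T \<kappa>" "f \<in> Arr T" using f \<Phi>(1) by (auto simp: compact_arrows_iff)
      obtain t r where F: "(t, f, r) \<in> Dist T" by (rule Dist_fiber[OF fc(2)])
      have "t \<in> common_annihilators D"
        unfolding common_annihilators_def
        using compact_arrow_fiber[OF F fc(1)] hom_surj_iff_annihilates[OF F] D' f by blast
      then show ?thesis using X hom_surj_iff_annihilates[OF F] by blast
    qed
    then show "X \<in> D" using D' X by blast
  qed
qed

text \<open>Membership of \<open>X \<odot> A\<close> is tested by maps from the codomains of maps in
  \<open>S\<close>. These are compact, so \<open>compact_factors_ten\<close> applies to each test
  map.\<close>

lemma tensor_ideal_of_compacts:
  assumes S: "S \<subseteq> compact_arrows T \<kappa>" and D: "D = {X \<in> Obj T. \<forall>t \<in> S. annihilates t X}"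
    and K: "\<And>K A. compact_object T \<kappa> K \<Longrightarrow> A \<in> D \<Longrightarrow> K \<odot> A \<in> D"
  shows "tensor_ideal T D"
  unfolding tensor_ideal_def
proof (intro ballI)
  fix A X assume A: "A \<in> D" and X: "X \<in> Obj T"
  have AO: "A \<in> Obj T" using A D by blast
  have "annihilates t (X \<odot> A)" if t: "t \<in> S" for t
    unfolding annihilates_def
  proof
    fix x assume x: "x \<in> Hom T (Cod T t) (X \<odot> A)"
    have tc: "compact_object T \<kappa> (Cod T t)" "t \<in> Arr T" using t S by (auto simp: compact_arrows_iff)
    obtain C c y where C: "compact_object T \<kappa> C" "c \<in> Hom T C X" "y \<in> Hom T (Cod T t) (C \<odot> A)" "x = (c \<boxtimes> Idn T A) \<cdot> y"
      by (rule compact_factors_ten[OF X AO tc(1) x])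
    have "C \<odot> A \<in> D" by (rule K[OF C(1) A])
    then have "y \<cdot> t = Zero T (Dom T t) (C \<odot> A)" using t D C(3) by (auto simp: annihilates_def)
    moreover have "x \<cdot> t = (c \<boxtimes> Idn T A) \<cdot> (y \<cdot> t)" unfolding C(4) using C(2,3) AO tc by (auto simp: Hom_def comp_assoc)
    ultimately show "x \<cdot> t = Zero T (Dom T t) (X \<odot> A)" using C(2) AO tc X by (auto simp: Hom_def)
  qed
  then show "X \<odot> A \<in> D" using D X AO by simp
qed

text \<open>The adjunction for \<open>K\<close> transposes \<open>x\<close> to a map from
  \<open>Cod T t\<close> to \<open>dual T K \<odot> X\<close>, where the hypothesis applies.\<close>

lemma annihilates_ten:
  assumes K: "compact_object T \<kappa> K" and t: "t \<in> Arr T" and X: "X \<in> Obj T" and a: "annihilates t (dual T K \<odot> X)"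
  shows "annihilates (Idn T K \<boxtimes> t) X"
  unfolding annihilates_def
proof
  have o: "K \<in> Obj T" "dual T K \<in> Obj T" using compact_obj[OF K] by auto
  fix x assume "x \<in> Hom T (Cod T (Idn T K \<boxtimes> t)) X"
  then have x: "x \<in> Hom T (K \<odot> Cod T t) X" using t o by simp
  obtain h where h: "h \<in> Hom T (Cod T t) (dual T K \<odot> X)" "contract K X \<cdot> (Idn T K \<boxtimes> h) = x"
    by (rule rigid_exists[OF compact_rigid[OF K] x]) (use t in simp)
  have "x \<cdot> (Idn T K \<boxtimes> t) = contract K X \<cdot> (Idn T K \<boxtimes> (h \<cdot> t))"
    unfolding h(2)[symmetric] using h(1) t o X by (auto simp: Hom_def comp_assoc ten_comp)
  also have "h \<cdot> t = Zero T (Dom T t) (dual T K \<odot> X)" using a h(1) by (auto simp: annihilates_def)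
  finally show "x \<cdot> (Idn T K \<boxtimes> t) = Zero T (Dom T (Idn T K \<boxtimes> t)) X" using t o X by simp
qed

text \<open>The opposite adjunction transposes \<open>w\<close> to a map \<open>w'\<close> out of
  the product with the dual of \<open>K\<close>, where the hypothesis applies; the triangle identity
  \<open>expand'_contract'\<close> recovers \<open>w\<close>.\<close>

lemma annihilates_ten_dual:
  assumes K: "compact_object T \<kappa> K" and t: "t \<in> Arr T" and X: "X \<in> Obj T" and a: "annihilates (Idn T (dual T K) \<boxtimes> t) X"
  shows "annihilates t (K \<odot> X)"
  unfolding annihilates_def
proof
  note R = compact_rigid[OF K]
  let ?L = "dual T K"
  have o: "K \<in> Obj T" "?L \<in> Obj T" "Dom T t \<in> Obj T" "Cod T t \<in> Obj T" "K \<odot> X \<in> Obj T" using compact_obj[OF K] t X by auto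
  note e = expand'_arr[OF R o(3)] expand'_arr[OF R o(4)] expand'_arr[OF R o(5)]
  fix w assume w: "w \<in> Hom T (Cod T t) (K \<odot> X)"
  then have wa: "w \<in> Arr T" "Dom T w = Cod T t" "Cod T w = K \<odot> X" by (auto simp: Hom_def)
  have tH: "t \<in> Hom T (Dom T t) (Cod T t)" using t by (simp add: Hom_def)
  define w' where "w' = contract' K X \<cdot> (Idn T ?L \<boxtimes> w)"
  have w': "w' \<in> Hom T (?L \<odot> Cod T t) X" using wa o X by (auto simp: w'_def Hom_def)
  have "(Idn T K \<boxtimes> w') \<cdot> expand' K (Cod T t) = (Idn T K \<boxtimes> contract' K X) \<cdot> ((Idn T K \<boxtimes> (Idn T ?L \<boxtimes> w)) \<cdot> expand' K (Cod T t))"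
    unfolding w'_def using wa o X e by (simp add: ten_comp_tail)
  also have "\<dots> = ((Idn T K \<boxtimes> contract' K X) \<cdot> expand' K (K \<odot> X)) \<cdot> w"
    unfolding expand'_nat[OF R w, symmetric] using wa o X e by (simp add: comp_assoc)
  also have "\<dots> = w" unfolding expand'_contract'[OF R X] using wa o X by simp
  finally have ww: "(Idn T K \<boxtimes> w') \<cdot> expand' K (Cod T t) = w" .
  have w't: "w' \<cdot> (Idn T ?L \<boxtimes> t) = Zero T (?L \<odot> Dom T t) X" using a w' t o by (auto simp: annihilates_def)
  have "w \<cdot> t = (Idn T K \<boxtimes> w') \<cdot> (expand' K (Cod T t) \<cdot> t)"
    unfolding ww[symmetric] using w' o X e t by (auto simp: Hom_def comp_assoc)
  also have "\<dots> = (Idn T K \<boxtimes> (w' \<cdot> (Idn T ?L \<boxtimes> t))) \<cdot> expand' K (Dom T t)"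
    unfolding expand'_nat[OF R tH] using w' o X e t by (auto simp: Hom_def ten_comp_tail)
  also have "\<dots> = Zero T (Dom T t) (K \<odot> X)" unfolding w't using o X e by simp
  finally show "w \<cdot> t = Zero T (Dom T t) (K \<odot> X)" .
qed

text \<open>A swap moves \<open>K\<close> from the map to the object: up to the isomorphisms
  \<open>Assoc\<close> and \<open>swap\<close>, both conditions concern the same map.\<close>

lemma null_on_ten_iff:
  assumes K: "K \<in> Obj T" and t: "t \<in> Arr T" and Y: "Y \<in> Obj T"
  shows "null_on (Idn T K \<boxtimes> t) Y \<longleftrightarrow> null_on t (K \<odot> Y)"
proof -
  let ?I = "Unit T" and ?C = "Dom T t" and ?A = "Cod T t"
  have o: "?C \<in> Obj T" "?A \<in> Obj T" "K \<odot> Y \<in> Obj T" using K t Y by auto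
  have tH: "t \<in> Hom T ?C ?A" using t by (simp add: Hom_def)
  have main: "swap K ?A Y \<cdot> (Assoc T K ?A Y \<cdot> ((Idn T K \<boxtimes> t \<boxtimes> Idn T Y) \<cdot> z)) = (t \<boxtimes> Idn T (K \<odot> Y)) \<cdot> (swap K ?C Y \<cdot> (Assoc T K ?C Y \<cdot> z))"
    if z: "z \<in> Hom T ?I (K \<odot> ?C \<odot> Y)" for z
  proof -
    have za: "z \<in> Arr T" "Dom T z = ?I" "Cod T z = K \<odot> ?C \<odot> Y" using z by (auto simp: Hom_def)
    have "Assoc T K ?A Y \<cdot> ((Idn T K \<boxtimes> t \<boxtimes> Idn T Y) \<cdot> z) = ((Idn T K \<boxtimes> (t \<boxtimes> Idn T Y)) \<cdot> Assoc T K ?C Y) \<cdot> z"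
      by (rule comp_rewrite) (use assoc_nat[of "Idn T K" t "Idn T Y"] K t Y za in auto)
    then have "swap K ?A Y \<cdot> (Assoc T K ?A Y \<cdot> ((Idn T K \<boxtimes> t \<boxtimes> Idn T Y) \<cdot> z)) = swap K ?A Y \<cdot> ((Idn T K \<boxtimes> (t \<boxtimes> Idn T Y)) \<cdot> (Assoc T K ?C Y \<cdot> z))"
      using K t Y za by (simp add: comp_assoc)
    also have "\<dots> = ((t \<boxtimes> (Idn T K \<boxtimes> Idn T Y)) \<cdot> swap K ?C Y) \<cdot> (Assoc T K ?C Y \<cdot> z)"
      by (rule comp_rewrite[OF swap_nat[OF Idn_Hom[OF K] tH Idn_Hom[OF Y]]]) (use K t Y za in auto)
    finally show ?thesis using K t Y za by (simp add: comp_assoc)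
  qed
  have sw: "swap B B' Y \<cdot> u = Zero T ?I (B' \<odot> (B \<odot> Y)) \<longleftrightarrow> u = Zero T ?I (B \<odot> (B' \<odot> Y))"
    if B: "B \<in> Obj T" "B' \<in> Obj T" and u: "u \<in> Hom T ?I (B \<odot> (B' \<odot> Y))" for B B' u
  proof
    have ua: "u \<in> Arr T" "Dom T u = ?I" "Cod T u = B \<odot> (B' \<odot> Y)" using u by (auto simp: Hom_def)
    assume s: "swap B B' Y \<cdot> u = Zero T ?I (B' \<odot> (B \<odot> Y))"
    have "u = swap B' B Y \<cdot> (swap B B' Y \<cdot> u)" using comp_rewrite[OF swap_swap[OF B Y], of u] ua B Y by simp
    then show "u = Zero T ?I (B \<odot> (B' \<odot> Y))" unfolding s using B Y by simp
  qed (use B Y in simp)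
  show ?thesis
  proof
    assume n: "null_on (Idn T K \<boxtimes> t) Y"
    show "null_on t (K \<odot> Y)" unfolding null_on_def
    proof
      fix z assume z: "z \<in> Hom T ?I (?C \<odot> (K \<odot> Y))"
      then have za: "z \<in> Arr T" "Dom T z = ?I" "Cod T z = ?C \<odot> (K \<odot> Y)" by (auto simp: Hom_def)
      define z' where "z' = inv_arrow T (Assoc T K ?C Y) \<cdot> (swap ?C K Y \<cdot> z)"
      have z': "z' \<in> Hom T ?I (K \<odot> ?C \<odot> Y)" using za K o Y by (auto simp: z'_def Hom_def)
      have "swap K ?C Y \<cdot> (Assoc T K ?C Y \<cdot> z') = z"
        unfolding z'_def using za K o Y comp_rewrite[OF swap_swap[OF o(1) K Y], of z] by simp
      moreover have "(Idn T K \<boxtimes> t \<boxtimes> Idn T Y) \<cdot> z' = Zero T ?I (K \<odot> ?A \<odot> Y)" using n z' K t unfolding null_on_def by simp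
      ultimately show "(t \<boxtimes> Idn T (K \<odot> Y)) \<cdot> z = Zero T ?I (?A \<odot> (K \<odot> Y))" using main[OF z'] K o Y by simp
    qed
  next
    assume n: "null_on t (K \<odot> Y)"
    show "null_on (Idn T K \<boxtimes> t) Y" unfolding null_on_def
    proof
      fix z assume "z \<in> Hom T ?I (Dom T (Idn T K \<boxtimes> t) \<odot> Y)"
      then have z: "z \<in> Hom T ?I (K \<odot> ?C \<odot> Y)" using K t by simp
      then have za: "z \<in> Arr T" "Dom T z = ?I" "Cod T z = K \<odot> ?C \<odot> Y" by (auto simp: Hom_def)
      define v where "v = (Idn T K \<boxtimes> t \<boxtimes> Idn T Y) \<cdot> z"
      have v: "v \<in> Arr T" "Dom T v = ?I" "Cod T v = K \<odot> ?A \<odot> Y" using za K t Y by (auto simp: v_def)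
      have "swap K ?C Y \<cdot> (Assoc T K ?C Y \<cdot> z) \<in> Hom T ?I (?C \<odot> (K \<odot> Y))" using za K o Y by (auto simp: Hom_def)
      then have "swap K ?A Y \<cdot> (Assoc T K ?A Y \<cdot> v) = Zero T ?I (?A \<odot> (K \<odot> Y))"
        using main[OF z] n unfolding null_on_def v_def by simp
      then have "Assoc T K ?A Y \<cdot> v = Zero T ?I (K \<odot> (?A \<odot> Y))"
        by (subst (asm) sw) (use K o Y v in \<open>auto simp: Hom_def\<close>)
      then have "Assoc T K ?A Y \<cdot> v = Assoc T K ?A Y \<cdot> Zero T ?I (K \<odot> ?A \<odot> Y)" using K o Y by simp
      then have "v = Zero T ?I (K \<odot> ?A \<odot> Y)" by (rule iso_monic[rotated 3, where X="?I"]) (use v K o Y in \<open>auto simp: Hom_def\<close>)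
      then show "(Idn T K \<boxtimes> t \<boxtimes> Idn T Y) \<cdot> z = Zero T ?I (Cod T (Idn T K \<boxtimes> t) \<odot> Y)" using K t by (simp add: v_def)
    qed
  qed
qed

text \<open>Null maps are closed under composition on both sides. This lets a null map with compact
  source be replaced by null maps out of cells.\<close>

lemma null_on_comp:
  assumes "null_on u X" "u \<in> Hom T C A" "w \<in> Hom T A B" "r \<in> Hom T K C" "X \<in> Obj T"
  shows "null_on (w \<cdot> (u \<cdot> r)) X"
  unfolding null_on_def
proof
  have ar: "u \<in> Arr T" "Dom T u = C" "Cod T u = A" "w \<in> Arr T" "Dom T w = A" "Cod T w = B" "r \<in> Arr T" "Dom T r = K" "Cod T r = C"
    using assms by (auto simp: Hom_def)
  fix z assume "z \<in> Hom T (Unit T) (Dom T (w \<cdot> (u \<cdot> r)) \<odot> X)"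
  then have z: "z \<in> Arr T" "Dom T z = Unit T" "Cod T z = K \<odot> X" using ar by (auto simp: Hom_def)
  have "(r \<boxtimes> Idn T X) \<cdot> z \<in> Hom T (Unit T) (C \<odot> X)" using z ar assms(5) by (auto simp: Hom_def)
  then have "(u \<boxtimes> Idn T X) \<cdot> ((r \<boxtimes> Idn T X) \<cdot> z) = Zero T (Unit T) (A \<odot> X)" using assms(1) ar by (auto simp: null_on_def)
  moreover have "((w \<cdot> (u \<cdot> r)) \<boxtimes> Idn T X) \<cdot> z = (w \<boxtimes> Idn T X) \<cdot> ((u \<boxtimes> Idn T X) \<cdot> ((r \<boxtimes> Idn T X) \<cdot> z))"
    using z ar assms(5) by (simp add: ten_comp_tail)
  ultimately show "((w \<cdot> (u \<cdot> r)) \<boxtimes> Idn T X) \<cdot> z = Zero T (Unit T) (Cod T (w \<cdot> (u \<cdot> r)) \<odot> X)"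
    using ar assms(5) Hom_obj[OF assms(3)] by simp
qed

text \<open>Small object argument: the null maps out of cells are killed repeatedly.\<close>

lemma null_small_object:
  assumes A: "A \<in> Obj T" and D: "D \<subseteq> Obj T"
  obtains L a where "a \<in> Hom T A L"
    "\<And>s. s \<in> compact_arrows T \<kappa> \<Longrightarrow> (\<And>X. X \<in> D \<Longrightarrow> null_on s X) \<Longrightarrow> annihilates s L"
    "\<And>X z. X \<in> D \<Longrightarrow> z \<in> Hom T (Unit T) (A \<odot> X) \<Longrightarrow> (a \<boxtimes> Idn T X) \<cdot> z = Zero T (Unit T) (L \<odot> X) \<Longrightarrow> z = Zero T (Unit T) (A \<odot> X)"
proof -
  let ?I = "Unit T"
  define N where "N u \<longleftrightarrow> (\<forall>X \<in> D. null_on u X)" for u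
  obtain \<phi> :: "nat \<Rightarrow> 'm" where \<phi>: "Dom T (\<phi> 0) = A" "\<And>n. \<phi> n \<in> Arr T" "\<And>n. Dom T (\<phi> (Suc n)) = Cod T (\<phi> n)"
    "\<And>n. kill_step N (\<phi> n)" using kill_tower_exists[OF A] by metis
  obtain W \<iota> d \<pi> where t: "telescope \<phi> W \<iota> d \<pi>" by (rule telescope_exists[of \<phi>]) (use \<phi> in auto)
  note ta = telescope_arr[OF t]
  note tr = trans_map_arr[OF t]
  define a where "a = \<pi> \<cdot> \<iota> 0"
  have a: "a \<in> Hom T A (Cod T \<pi>)" using ta \<phi>(1) by (auto simp: a_def Hom_def)
  have 1: "annihilates s (Cod T \<pi>)" if s: "s \<in> compact_arrows T \<kappa>" and sN: "\<And>X. X \<in> D \<Longrightarrow> null_on s X" for s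
    unfolding annihilates_def
  proof
    fix w assume w: "w \<in> Hom T (Cod T s) (Cod T \<pi>)"
    have sa: "s \<in> Arr T" "compact_object T \<kappa> (Dom T s)" "compact_object T \<kappa> (Cod T s)" using s by (auto simp: compact_arrows_iff)
    obtain n v where v: "v \<in> Hom T (Cod T s) (Dom T (\<phi> n))" "w = \<pi> \<cdot> \<iota> n \<cdot> v" by (rule telescope_compact[OF t sa(3) w])
    have va: "v \<in> Arr T" "Dom T v = Cod T s" "Cod T v = Dom T (\<phi> n)" using v by (auto simp: Hom_def)
    \<comment> \<open>The tower kills null maps out of cells; since the source of \<open>s\<close>
      is a retract of a cell, \<open>s\<close> is first composed with the retraction.\<close>
    obtain K i r where K: "K \<in> cells" "i \<in> Hom T (Dom T s) K" "r \<in> Hom T K (Dom T s)" "r \<cdot> i = Idn T (Dom T s)"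
      by (rule compact_retract_of_cell[OF sa(2)])
    have ir: "i \<in> Arr T" "Dom T i = Dom T s" "Cod T i = K" "r \<in> Arr T" "Dom T r = K" "Cod T r = Dom T s" using K by (auto simp: Hom_def)
    have "N (v \<cdot> (s \<cdot> r))"
      unfolding N_def
    proof
      fix X assume X: "X \<in> D"
      show "null_on (v \<cdot> (s \<cdot> r)) X"
        by (rule null_on_comp[OF sN[OF X] _ v(1) K(3)]) (use sa X D in \<open>auto simp: Hom_def\<close>)
    qed
    moreover have u: "v \<cdot> (s \<cdot> r) \<in> Arr T" "Dom T (v \<cdot> (s \<cdot> r)) = K" "Cod T (v \<cdot> (s \<cdot> r)) = Dom T (\<phi> n)" using va sa ir by auto
    ultimately have "\<phi> n \<cdot> (v \<cdot> (s \<cdot> r)) = Zero T K (Cod T (\<phi> n))"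
      using \<phi>(4)[of n] K(1) unfolding kill_step_def by metis
    then have "(\<phi> n \<cdot> (v \<cdot> (s \<cdot> r))) \<cdot> i = Zero T (Dom T s) (Cod T (\<phi> n))" using ir ta by simp
    then have 0: "\<phi> n \<cdot> (v \<cdot> s) = Zero T (Dom T s) (Cod T (\<phi> n))" using va sa ir ta K(4) by (simp add: comp_assoc)
    have "w \<cdot> s = (\<pi> \<cdot> \<iota> (Suc n)) \<cdot> (\<phi> n \<cdot> (v \<cdot> s))"
      unfolding v(2) telescope_step[OF t, of n, symmetric] using ta va sa by (simp add: comp_assoc)
    then show "w \<cdot> s = Zero T (Dom T s) (Cod T \<pi>)" unfolding 0 using ta sa by simp
  qed
  have 2: "z = Zero T ?I (A \<odot> X)"
    if X: "X \<in> D" and z: "z \<in> Hom T ?I (A \<odot> X)" and az: "(a \<boxtimes> Idn T X) \<cdot> z = Zero T ?I (Cod T \<pi> \<odot> X)" for X z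
  proof -
    have XO: "X \<in> Obj T" using X D by blast
    have za: "z \<in> Arr T" "Dom T z = ?I" "Cod T z = A \<odot> X" using z by (auto simp: Hom_def)
    interpret H: homological_endofunctor T \<kappa> "\<lambda>Z. Z \<odot> X" "\<lambda>f. f \<boxtimes> Idn T X" by (rule homological_endofunctor_ten[OF XO])
    obtain n where n: "(trans_map \<phi> 0 n \<boxtimes> Idn T X) \<cdot> z = Zero T ?I (Dom T (\<phi> n) \<odot> X)"
      by (rule H.telescope_dies[OF t compact_unit, of z]) (use z az \<phi>(1) a_def in auto)
    \<comment> \<open>Descent along the tower: if the image of \<open>z\<close> at stage
      \<open>n + 1\<close> is zero, then its image at stage \<open>n\<close> lifts along
      \<open>\<gamma>\<close>, whose components are null on \<open>X\<close>, and so is zero as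
      well.\<close>
    then show ?thesis
    proof (induction n)
      case 0
      then show ?case using za \<phi>(1) A XO by simp
    next
      case (Suc n)
      define y where "y = (trans_map \<phi> 0 n \<boxtimes> Idn T X) \<cdot> z"
      have y: "y \<in> Arr T" "Dom T y = ?I" "Cod T y = Dom T (\<phi> n) \<odot> X" using tr[of 0 n] za \<phi>(1) XO by (auto simp: y_def)
      obtain B :: "'m set" and E G j \<gamma> \<delta> where G: "small \<kappa> B" "is_coproduct T B E G j" "(\<gamma>, \<phi> n, \<delta>) \<in> Dist T" "Dom T \<gamma> = G"
        "\<forall>b \<in> B. N (\<gamma> \<cdot> j b)" using \<phi>(4)[of n] unfolding kill_step_def by blast
      note ga = Dist_arr[OF G(3)] and ja = coproduct_arr[OF G(2)]
      have "(\<phi> n \<boxtimes> Idn T X) \<cdot> y = Zero T ?I (Cod T (\<phi> n) \<odot> X)"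
        using Suc.prems tr[of 0 n] za \<phi> XO by (simp add: y_def ten_comp_tail)
      then obtain v where v: "v \<in> Hom T ?I (G \<odot> X)" "(\<gamma> \<boxtimes> Idn T X) \<cdot> v = y"
        using H.F_exact[OF G(3), of y ?I] y G(4) by (auto simp: Hom_def)
      have va: "v \<in> Arr T" "Dom T v = ?I" "Cod T v = G \<odot> X" using v by (auto simp: Hom_def)
      obtain F e where F: "finite F" "F \<subseteq> B" "is_trunc B G j F e" "(e \<boxtimes> Idn T X) \<cdot> v = v"
        by (rule H.F_finitely_supported[OF G(1,2) compact_unit v(1)])
      \<comment> \<open>Finitely many summands carry \<open>v\<close>, and the component of
        \<open>\<gamma>\<close> at each of them kills its contribution.\<close>
      have "(\<gamma> \<boxtimes> Idn T X) \<cdot> ((e \<boxtimes> Idn T X) \<cdot> v) = Zero T ?I (Cod T \<gamma> \<odot> X)" using F(1-3)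
      proof (induction F arbitrary: e)
        case empty
        have "e = Zero T G G" by (rule coproduct_eqI[OF G(2), of _ G]) (use ja empty.prems in \<open>auto simp: is_trunc_def zero_Hom\<close>)
        then show ?case using va ga G(4) ja XO by simp
      next
        case (insert b F)
        obtain d where d: "is_trunc B G j F d" by (rule trunc_ex[OF G(2)])
        have b: "b \<in> B" "F \<subseteq> B" using insert.prems by auto
        obtain p where p: "\<forall>i \<in> B. p i \<in> Hom T G (E i)"
          "\<forall>i \<in> B. \<forall>k \<in> B. p i \<cdot> j k = (if k = i then Idn T (E i) else Zero T (E k) (E i))" by (rule coproduct_projs[OF G(2)])
        have e: "e = Add T (j b \<cdot> p b) d"
          by (rule trunc_insert[OF G(2) d insert.prems(2) b(1) insert.hyps(2)]) (use p b in auto)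
        note da = trunc_arr[OF d]
        have pa: "p b \<in> Arr T" "Dom T (p b) = G" "Cod T (p b) = E b" using p b by (auto simp: Hom_def)
        have "(p b \<boxtimes> Idn T X) \<cdot> v \<in> Hom T ?I (E b \<odot> X)" using pa va XO by (auto simp: Hom_def)
        then have 0: "((\<gamma> \<cdot> j b) \<boxtimes> Idn T X) \<cdot> ((p b \<boxtimes> Idn T X) \<cdot> v) = Zero T ?I (Cod T \<gamma> \<odot> X)"
          using G(4,5) b(1) X ga ja unfolding N_def null_on_def by simp
        have "(\<gamma> \<boxtimes> Idn T X) \<cdot> (((j b \<cdot> p b) \<boxtimes> Idn T X) \<cdot> v) = ((\<gamma> \<cdot> j b) \<boxtimes> Idn T X) \<cdot> ((p b \<boxtimes> Idn T X) \<cdot> v)"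
          using ga ja b pa va XO G(4) by (simp add: ten_comp_tail comp_assoc)
        moreover have "(e \<boxtimes> Idn T X) \<cdot> v = Add T (((j b \<cdot> p b) \<boxtimes> Idn T X) \<cdot> v) ((d \<boxtimes> Idn T X) \<cdot> v)"
          unfolding e using H.F_add[of "j b \<cdot> p b" d] ja b pa da va XO by (simp add: comp_add)
        ultimately show ?case
          using insert.IH[OF b(2) d] 0 ga ja b pa da va XO G(4) by (simp add: comp_add)
      qed
      then have "y = Zero T ?I (Dom T (\<phi> n) \<odot> X)" using F(4) v(2) ga by simp
      then show ?case using Suc.IH by (simp add: y_def)
    qed
  qed
  show thesis using that[OF a 1 2] by blast
qed

text \<open>The small object argument is applied to the dual of the source of \<open>g\<close>.
  Every \<open>dualM T t\<close> with \<open>t\<close> annihilating \<open>D\<close> is null on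
  \<open>D\<close>, so the resulting object \<open>L\<close> lies in the dual class. Hence
  \<open>dualM T g\<close> annihilates \<open>L\<close>, which gives that
  \<open>a \<cdot> dualM T g\<close> is zero. As \<open>a\<close> detects elements over
  \<open>D\<close>, the map \<open>dualM T g\<close> is null on \<open>D\<close>, and thus
  \<open>g\<close> annihilates \<open>D\<close>.\<close>

lemma null_on_dual_definable:
  assumes D: "D \<subseteq> Obj T" and g: "g \<in> compact_arrows T \<kappa>"
    and n: "\<And>Y. Y \<in> dual_definable T \<kappa> D \<Longrightarrow> null_on g Y"
  shows "g \<in> common_annihilators D"
proof -
  let ?C = "Dom T g" and ?A = "Cod T g"
  have gc: "g \<in> Arr T" "compact_object T \<kappa> ?C" "compact_object T \<kappa> ?A" using g by (auto simp: compact_arrows_iff)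
  note R = compact_rigid[OF gc(2)] compact_rigid[OF gc(3)]
  have gH: "g \<in> Hom T ?C ?A" using gc by (simp add: Hom_def)
  have dO: "dual T ?C \<in> Obj T" using gc by simp
  obtain L a where L: "a \<in> Hom T (dual T ?C) L"
    "\<And>s. s \<in> compact_arrows T \<kappa> \<Longrightarrow> (\<And>X. X \<in> D \<Longrightarrow> null_on s X) \<Longrightarrow> annihilates s L"
    "\<And>X z. X \<in> D \<Longrightarrow> z \<in> Hom T (Unit T) (dual T ?C \<odot> X) \<Longrightarrow> (a \<boxtimes> Idn T X) \<cdot> z = Zero T (Unit T) (L \<odot> X) \<Longrightarrow> z = Zero T (Unit T) (dual T ?C \<odot> X)"
    using null_small_object[OF dO D] by metis
  have LO: "L \<in> Obj T" using Hom_obj[OF L(1)] by simp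
  have "annihilates (dualM T t) L" if t: "t \<in> common_annihilators D" for t
  proof (rule L(2))
    have tc: "t \<in> Arr T" "compact_object T \<kappa> (Dom T t)" "compact_object T \<kappa> (Cod T t)" using t by (auto simp: common_annihilators_def compact_arrows_iff)
    then show "dualM T t \<in> compact_arrows T \<kappa>" using compact_dual by (simp add: compact_arrows_iff)
    fix X assume X: "X \<in> D"
    then show "null_on (dualM T t) X"
      using annihilates_iff_dual_null[OF compact_rigid[OF tc(2)] compact_rigid[OF tc(3)], of t X] tc t D
      by (auto simp: common_annihilators_def Hom_def)
  qed
  then have "L \<in> dual_definable T \<kappa> D" using LO by (simp add: dual_definable_eq[OF D])
  then have "annihilates (dualM T g) L" using n annihilates_dual_iff[OF R gH LO] by blast
  then have ag: "a \<cdot> dualM T g = Zero T (dual T ?A) L" using L(1) gc by (auto simp: annihilates_def)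
  have aa: "a \<in> Arr T" "Dom T a = dual T ?C" "Cod T a = L" using L by (auto simp: Hom_def)
  have "annihilates g X" if X: "X \<in> D" for X
  proof -
    have XO: "X \<in> Obj T" using X D by blast
    have "null_on (dualM T g) X" unfolding null_on_def
    proof
      fix z assume z: "z \<in> Hom T (Unit T) (Dom T (dualM T g) \<odot> X)"
      then have za: "z \<in> Arr T" "Dom T z = Unit T" "Cod T z = dual T ?A \<odot> X" using gc by (auto simp: Hom_def)
      have "(a \<boxtimes> Idn T X) \<cdot> ((dualM T g \<boxtimes> Idn T X) \<cdot> z) = ((a \<cdot> dualM T g) \<boxtimes> Idn T X) \<cdot> z"
        using za gc aa XO by (simp add: ten_comp_tail)
      also have "\<dots> = Zero T (Unit T) (L \<odot> X)" unfolding ag using za gc LO XO by simp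
      finally have "(dualM T g \<boxtimes> Idn T X) \<cdot> z = Zero T (Unit T) (dual T ?C \<odot> X)"
        by (intro L(3)[OF X]) (use za gc XO in \<open>auto simp: Hom_def\<close>)
      then show "(dualM T g \<boxtimes> Idn T X) \<cdot> z = Zero T (Unit T) (Cod T (dualM T g) \<odot> X)" using gc by simp
    qed
    then show ?thesis using annihilates_iff_dual_null[OF R gH XO] by blast
  qed
  then show ?thesis using g by (simp add: common_annihilators_def)
qed

lemma dual_definable_null:
  assumes D: "D \<subseteq> Obj T"
  shows "dual_definable T \<kappa> D = {Y \<in> Obj T. \<forall>t \<in> common_annihilators D. null_on t Y}"
proof -
  have "annihilates (dualM T t) Y \<longleftrightarrow> null_on t Y" if t: "t \<in> common_annihilators D" and Y: "Y \<in> Obj T" for t Y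
  proof -
    have tc: "t \<in> Arr T" "compact_object T \<kappa> (Dom T t)" "compact_object T \<kappa> (Cod T t)" using t by (auto simp: common_annihilators_def compact_arrows_iff)
    then show ?thesis using annihilates_dual_iff[OF compact_rigid[OF tc(2)] compact_rigid[OF tc(3)] _ Y] by (simp add: Hom_def)
  qed
  then show ?thesis unfolding dual_definable_eq[OF D] by blast
qed

lemma ten_compact_arrow:
  "\<lbrakk>compact_object T \<kappa> K; t \<in> compact_arrows T \<kappa>\<rbrakk> \<Longrightarrow> Idn T K \<boxtimes> t \<in> compact_arrows T \<kappa>"
  using compact_ten compact_obj[of K] by (auto simp: compact_arrows_iff)

text \<open>If \<open>t\<close> annihilates \<open>D\<close>, so does
  \<open>Idn T K \<boxtimes> t\<close>: on \<open>X\<close> it is governed by \<open>t\<close> on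
  \<open>dual T K \<odot> X\<close>, which stays in \<open>D\<close>. Its nullity on
  \<open>Y\<close> is that of \<open>t\<close> on \<open>K \<odot> Y\<close>.\<close>

lemma dual_definable_tensor_ideal:
  assumes D: "definable T \<kappa> D" and ideal: "tensor_ideal T D"
  shows "tensor_ideal T (dual_definable T \<kappa> D)"
proof (rule tensor_ideal_of_compacts)
  have DO: "D \<subseteq> Obj T" using definable_eq[OF D] by blast
  show "dual_definable T \<kappa> D = {Y \<in> Obj T. \<forall>s \<in> dualM T ` common_annihilators D. annihilates s Y}"
    unfolding dual_definable_eq[OF DO] by simp
  show "dualM T ` common_annihilators D \<subseteq> compact_arrows T \<kappa>"
    using compact_dual by (auto simp: common_annihilators_def compact_arrows_iff)
  fix K Y assume K: "compact_object T \<kappa> K" and Y: "Y \<in> dual_definable T \<kappa> D"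
  have o: "K \<in> Obj T" "Y \<in> Obj T" "dual T K \<in> Obj T" using compact_obj[OF K] Y dual_definable_null[OF DO] by auto
  have "null_on t (K \<odot> Y)" if t: "t \<in> common_annihilators D" for t
  proof -
    have tc: "t \<in> compact_arrows T \<kappa>" "t \<in> Arr T" using t by (auto simp: common_annihilators_def compact_arrows_iff)
    have "annihilates (Idn T K \<boxtimes> t) X" if X: "X \<in> D" for X
    proof (rule annihilates_ten[OF K tc(2)])
      show "X \<in> Obj T" using X DO by blast
      have "dual T K \<odot> X \<in> D" using ideal X o by (simp add: tensor_ideal_def)
      then show "annihilates t (dual T K \<odot> X)" using t by (simp add: common_annihilators_def)
    qed
    then have "Idn T K \<boxtimes> t \<in> common_annihilators D" using ten_compact_arrow[OF K tc(1)] by (simp add: common_annihilators_def)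
    then have "null_on (Idn T K \<boxtimes> t) Y" using Y dual_definable_null[OF DO] by blast
    then show ?thesis using null_on_ten_iff[OF o(1) tc(2) o(2)] by simp
  qed
  then show "K \<odot> Y \<in> dual_definable T \<kappa> D" using dual_definable_null[OF DO] o by simp
qed

text \<open>The relevant factor is the dual of \<open>K\<close>, because \<open>t\<close> on
  \<open>K \<odot> X\<close> is governed by \<open>Idn T (dual T K) \<boxtimes> t\<close> on
  \<open>X\<close>. On the dual class this map behaves like \<open>t\<close> on products with the
  dual of \<open>K\<close>, and \<open>null_on_dual_definable\<close> leads back to
  \<open>D\<close>.\<close>

lemma definable_tensor_ideal:
  assumes D: "definable T \<kappa> D" and ideal: "tensor_ideal T (dual_definable T \<kappa> D)"
  shows "tensor_ideal T D"
proof (rule tensor_ideal_of_compacts[OF _ definable_eq[OF D]])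
  have DO: "D \<subseteq> Obj T" using definable_eq[OF D] by blast
  show "common_annihilators D \<subseteq> compact_arrows T \<kappa>" by (auto simp: common_annihilators_def)
  fix K X assume K: "compact_object T \<kappa> K" and X: "X \<in> D"
  have o: "K \<in> Obj T" "X \<in> Obj T" "dual T K \<in> Obj T" using compact_obj[OF K] X DO by auto
  have "annihilates t (K \<odot> X)" if t: "t \<in> common_annihilators D" for t
  proof -
    have tc: "t \<in> compact_arrows T \<kappa>" "t \<in> Arr T" using t by (auto simp: common_annihilators_def compact_arrows_iff)
    have "Idn T (dual T K) \<boxtimes> t \<in> common_annihilators D"
    proof (rule null_on_dual_definable[OF DO ten_compact_arrow[OF compact_dual[OF K] tc(1)]])
      fix Y assume Y: "Y \<in> dual_definable T \<kappa> D"
      then have YO: "Y \<in> Obj T" using dual_definable_null[OF DO] by blast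
      have "dual T K \<odot> Y \<in> dual_definable T \<kappa> D" using ideal Y o by (simp add: tensor_ideal_def)
      then have "null_on t (dual T K \<odot> Y)" using t dual_definable_null[OF DO] by blast
      then show "null_on (Idn T (dual T K) \<boxtimes> t) Y" using null_on_ten_iff[OF o(3) tc(2) YO] by simp
    qed
    then have "annihilates (Idn T (dual T K) \<boxtimes> t) X" using X by (simp add: common_annihilators_def)
    then show ?thesis by (rule annihilates_ten_dual[OF K tc(2) o(2)])
  qed
  moreover have "K \<odot> X \<in> Obj T" using o by simp
  ultimately show "K \<odot> X \<in> D" using definable_eq[OF D] by blast
qed

end

theorem proposition8p1:
  fixes T :: "('o, 'm, 'z) tt_category_scheme"
    and \<kappa> :: "'u rel"
    and D :: "'o set"
  assumes "big_tt_category T \<kappa>"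
    and "definable T \<kappa> D"
  shows "tensor_ideal T D \<longleftrightarrow> tensor_ideal T (dual_definable T \<kappa> D)"
proof -
  interpret big_tt_category T \<kappa> by (rule assms(1))
  show ?thesis using dual_definable_tensor_ideal[OF assms(2)] definable_tensor_ideal[OF assms(2)] by blast
qed

end
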